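(* Suppose that there is an $i\in E$ such that $a(i)>0$. Then one can find an exponent $\kappa>0$ and a constant $L>0$ such that the stationary distribution $\nu$ of the process $Y$ satisfies $$t^\kappa\,\nu\big((t,+\infty)\big)\underset{t\to+\infty}{\longrightarrow}L,\qquad t^\kappa\,\nu\big((-\infty,-t)\big)\underset{t\to+\infty}{\longrightarrow}L .$$
   Context: Let $E=\{1,\dots,N\}$ with $N>1$. Let $X=(X_t)_{t\ge 0}$ be a Markov jump process with state space $E$, defined on a probability space $(\Omega,\mathcal{A},Q)$, with positive intensity function $\lambda:E\to(0,\infty)$ and jump kernel $q$ (a stochastic matrix on $E$) which is irreducible and satisfies $q(i,i)=0$ for every $i\in E$: in state $i$ the process waits an exponential time with parameter $\lambda(i)$ and then jumps to $j$ with probability $q(i,j)$. $X$ is ergodic with invariant probability measure $\mu$, and is taken stationary. Let $W=(W_t)_{t\ge 0}$ be a standard Brownian motion on a probability space $(\Theta,\mathcal{B},Q')$ with filtration $(\mathcal{F}_t)$, and work on the product space with $\mathbb{P}=Q\otimes Q'$ (so $X$ and $W$ are independent). Let $a,\sigma:E\to\mathbb{R}$. The diffusion with Markov switching $Y=(Y_t)_{t\ge0}$ is, for each $\omega\in\Omega$, the real-valued solution of the linear SDE $$dY_t=a(X_t)Y_t\,dt+\sigma(X_t)\,dW_t,\quad t\ge 0,$$ where $Y_0$ is an $\mathcal{F}_0$-measurable random variable on $(\Theta,\mathcal{B},Q')$. Standing assumption: $\alpha=\sum_{i\in E}a(i)\mu(i)<0$. Under this assumption $Y$ is ergodic: there is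 a probability measure $\nu$ on $\mathbb{R}$ such that the law of $Y_t$ converges weakly to $\nu$ as $t\to\infty$, independently of the initial condition $Y_0$. This $\nu$ is called the stationary (or limit) distribution of $Y$.
   Formalization: It is additionally assumed that σ(i) ≠ 0 for some i in E: if σ vanishes on all of E then Y_t tends to 0, the limit distribution ν is the point mass at 0, and the claim with L > 0 fails. *)

theory Defs
  imports "HOL-Probability.Probability"
begin

section \<open>Jump kernels and Markov jump processes\<close>

definition stochastic_kernel :: "nat set \<Rightarrow> (nat \<Rightarrow> nat \<Rightarrow> real) \<Rightarrow> bool" where
  "stochastic_kernel E q \<longleftrightarrow>
     (\<forall>i\<in>E. (\<forall>j\<in>E. 0 \<le> q i j) \<and> (\<Sum>j\<in>E. q i j) = 1)"

fun kernel_power :: "nat set \<Rightarrow> (nat \<Rightarrow> nat \<Rightarrow> real) \<Rightarrow> nat \<Rightarrow> nat \<Rightarrow> nat \<Rightarrow> real" where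
  "kernel_power E q 0 i j = (if i = j then 1 else 0)"
| "kernel_power E q (Suc n) i j = (\<Sum>k\<in>E. q i k * kernel_power E q n k j)"

definition irreducible_kernel :: "nat set \<Rightarrow> (nat \<Rightarrow> nat \<Rightarrow> real) \<Rightarrow> bool" where
  "irreducible_kernel E q \<longleftrightarrow> (\<forall>i\<in>E. \<forall>j\<in>E. \<exists>n. 0 < kernel_power E q n i j)"

text \<open>
  The states visited are \<open>Z 0, Z 1, \<dots>\<close> and the corresponding holding times are
  \<open>T 0, T 1, \<dots>\<close>; all paths are right-continuous step functions with finitely many jumps
  on bounded intervals. The last clause gives the joint law of \<open>(Z, T)\<close>: in state \<open>i\<close>
  the process waits an exponential time of parameter \<open>lam i\<close> and then moves to \<open>j\<close> with
  probability \<open>q i j\<close>, independently of the past. The initial law is left free.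
\<close>

definition markov_jump_process ::
  "'a measure \<Rightarrow> nat set \<Rightarrow> (nat \<Rightarrow> real) \<Rightarrow> (nat \<Rightarrow> nat \<Rightarrow> real) \<Rightarrow> (real \<Rightarrow> 'a \<Rightarrow> nat) \<Rightarrow> bool"
where
  "markov_jump_process M E lam q X \<longleftrightarrow>
     (\<exists>(Z :: nat \<Rightarrow> 'a \<Rightarrow> nat) (T :: nat \<Rightarrow> 'a \<Rightarrow> real).
        (\<forall>n. Z n \<in> measurable M (count_space E)) \<and>
        (\<forall>n. T n \<in> borel_measurable M) \<and>
        (\<forall>\<omega>\<in>space M.
           (\<forall>n. 0 < T n \<omega>) \<and>
           filterlim (\<lambda>n. \<Sum>k<n. T k \<omega>) at_top sequentially \<and>
           (\<forall>n t. (\<Sum>k<n. T k \<omega>) \<le> t \<and> t < (\<Sum>k<Suc n. T k \<omega>) \<longrightarrow> X t \<omega> = Z n \<omega>)) \<and>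
        (\<forall>n (z :: nat \<Rightarrow> nat) (s :: nat \<Rightarrow> real).
           (\<forall>k\<le>n. z k \<in> E \<and> 0 \<le> s k) \<longrightarrow>
           measure M {\<omega>\<in>space M. \<forall>k\<le>n. Z k \<omega> = z k \<and> s k < T k \<omega>} =
             measure M {\<omega>\<in>space M. Z 0 \<omega> = z 0} *
             (\<Prod>k<n. q (z k) (z (Suc k))) * (\<Prod>k\<le>n. exp (- lam (z k) * s k))))"

definition generator :: "(nat \<Rightarrow> real) \<Rightarrow> (nat \<Rightarrow> nat \<Rightarrow> real) \<Rightarrow> nat \<Rightarrow> nat \<Rightarrow> real" where
  "generator lam q i j = lam i * (q i j - (if i = j then 1 else 0))"

definition invariant_probability ::
  "nat set \<Rightarrow> (nat \<Rightarrow> real) \<Rightarrow> (nat \<Rightarrow> nat \<Rightarrow> real) \<Rightarrow> (nat \<Rightarrow> real) \<Rightarrow> bool"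
where
  "invariant_probability E lam q \<mu> \<longleftrightarrow>
     (\<forall>i\<in>E. 0 \<le> \<mu> i) \<and> (\<Sum>i\<in>E. \<mu> i) = 1 \<and>
     (\<forall>j\<in>E. (\<Sum>i\<in>E. \<mu> i * generator lam q i j) = 0)"

text \<open>Finite-dimensional laws are invariant under time shifts, and every marginal law is \<open>\<mu>\<close>.\<close>

definition stationary_with_law ::
  "'a measure \<Rightarrow> nat set \<Rightarrow> (real \<Rightarrow> 'a \<Rightarrow> nat) \<Rightarrow> (nat \<Rightarrow> real) \<Rightarrow> bool"
where
  "stationary_with_law M E X \<mu> \<longleftrightarrow>
     (\<forall>t\<ge>0. \<forall>i\<in>E. measure M {\<omega>\<in>space M. X t \<omega> = i} = \<mu> i) \<and>
     (\<forall>h\<ge>0. \<forall>n (t :: nat \<Rightarrow> real) (x :: nat \<Rightarrow> nat). (\<forall>k<n. 0 \<le> t k) \<longrightarrow>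
        measure M {\<omega>\<in>space M. \<forall>k<n. X (t k + h) \<omega> = x k} =
        measure M {\<omega>\<in>space M. \<forall>k<n. X (t k) \<omega> = x k})"


section \<open>Brownian motion relative to a filtration\<close>

text \<open>Only the times \<open>t \<ge> 0\<close> are meaningful here and below.\<close>

definition filtration_on :: "'b measure \<Rightarrow> (real \<Rightarrow> 'b measure) \<Rightarrow> bool" where
  "filtration_on M F \<longleftrightarrow>
     (\<forall>t\<ge>0. subalgebra M (F t)) \<and>
     (\<forall>s t. 0 \<le> s \<and> s \<le> t \<longrightarrow> subalgebra (F t) (F s))"

definition standard_brownian_motion ::
  "'b measure \<Rightarrow> (real \<Rightarrow> 'b measure) \<Rightarrow> (real \<Rightarrow> 'b \<Rightarrow> real) \<Rightarrow> bool"
where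
  "standard_brownian_motion M F W \<longleftrightarrow>
     (\<forall>t\<ge>0. W t \<in> borel_measurable (F t)) \<and>
     (\<forall>\<theta>\<in>space M. W 0 \<theta> = 0 \<and> continuous_on {0..} (\<lambda>t. W t \<theta>)) \<and>
     (\<forall>s t. 0 \<le> s \<and> s < t \<longrightarrow>
        distributed M lborel (\<lambda>\<theta>. W t \<theta> - W s \<theta>) (normal_density 0 (sqrt (t - s))) \<and>
        prob_space.indep_set M (sets (F s))
          (sets (vimage_algebra (space M) (\<lambda>\<theta>. W t \<theta> - W s \<theta>) borel)))"


section \<open>The diffusion with Markov switching\<close>

text \<open>
  For a fixed \<open>\<omega>\<close> the integrand \<open>s \<mapsto> \<sigma> (X s \<omega>)\<close> is a deterministic step function, so its
  stochastic integral with respect to \<open>W\<close> is the integral of an elementary integrand: a finite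
  sum of increments of \<open>W\<close> weighted by the values of the integrand on a partition of \<open>[0, t]\<close>.
  Its value does not depend on the partition chosen.
\<close>

definition has_step_integral ::
  "(real \<Rightarrow> real) \<Rightarrow> (real \<Rightarrow> real) \<Rightarrow> real \<Rightarrow> real \<Rightarrow> bool"
where
  "has_step_integral f w t I \<longleftrightarrow>
     (\<exists>n (s :: nat \<Rightarrow> real).
        s 0 = 0 \<and> s n = t \<and> (\<forall>k<n. s k \<le> s (Suc k)) \<and>
        (\<forall>k<n. \<forall>u. s k \<le> u \<and> u < s (Suc k) \<longrightarrow> f u = f (s k)) \<and>
        I = (\<Sum>k<n. f (s k) * (w (s (Suc k)) - w (s k))))"

text \<open>
  For each \<open>\<omega>\<close>, the process \<open>Y\<close> is an adapted continuous solution of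
  \<open>dY = a(X) Y dt + \<sigma>(X) dW\<close>, \<open>Y 0 = Y0\<close>, on the space carrying \<open>W\<close>. Measurability on the
  product space is required so that the law of \<open>Y t\<close> is defined.
\<close>

definition switching_diffusion ::
  "'a measure \<Rightarrow> 'b measure \<Rightarrow> (real \<Rightarrow> 'b measure) \<Rightarrow> (real \<Rightarrow> 'a \<Rightarrow> nat) \<Rightarrow> (real \<Rightarrow> 'b \<Rightarrow> real) \<Rightarrow>
   (nat \<Rightarrow> real) \<Rightarrow> (nat \<Rightarrow> real) \<Rightarrow> ('b \<Rightarrow> real) \<Rightarrow> (real \<Rightarrow> 'a \<times> 'b \<Rightarrow> real) \<Rightarrow> bool"
where
  "switching_diffusion Q Q' F X W a \<sigma> Y0 Y \<longleftrightarrow>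
     (\<forall>t\<ge>0. Y t \<in> borel_measurable (Q \<Otimes>\<^sub>M Q')) \<and>
     (\<forall>\<omega>\<in>space Q.
        (\<forall>t\<ge>0. (\<lambda>\<theta>. Y t (\<omega>, \<theta>)) \<in> borel_measurable (F t)) \<and>
        (AE \<theta> in Q'.
           continuous_on {0..} (\<lambda>t. Y t (\<omega>, \<theta>)) \<and>
           Y 0 (\<omega>, \<theta>) = Y0 \<theta> \<and>
           (\<forall>t\<ge>0.
              set_integrable lborel {0..t} (\<lambda>s. a (X s \<omega>) * Y s (\<omega>, \<theta>)) \<and>
              has_step_integral (\<lambda>s. \<sigma> (X s \<omega>)) (\<lambda>s. W s \<theta>) t
                (Y t (\<omega>, \<theta>) - Y0 \<theta> - (LINT s:{0..t}|lborel. a (X s \<omega>) * Y s (\<omega>, \<theta>))))))"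

text \<open>
  Weak convergence as \<open>t \<rightarrow> \<infinity>\<close> over the reals, expressed through sequences of times since
  \<^const>\<open>weak_conv_m\<close> is about sequences of measures.
\<close>

definition limit_distribution ::
  "'c measure \<Rightarrow> (real \<Rightarrow> 'c \<Rightarrow> real) \<Rightarrow> real measure \<Rightarrow> bool"
where
  "limit_distribution P Y \<nu> \<longleftrightarrow>
     real_distribution \<nu> \<and>
     (\<forall>s :: nat \<Rightarrow> real. (\<forall>n. 0 \<le> s n) \<and> filterlim s at_top sequentially \<longrightarrow>
        weak_conv_m (\<lambda>n. distr P borel (Y (s n))) \<nu>)"

end

theory Submission
  imports Defs
begin

text \<open>
  Conditionally on the path of the switching process \<open>X\<close>, the diffusion is linear with additive
  noise. So, given \<open>X\<close>, \<open>Y t\<close> is the sum of \<open>exp (A t) * Y0\<close>, where \<open>A\<close> integrates \<open>a (X)\<close>, and of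
  an independent centred Gaussian variable of variance \<open>V t\<close>, where \<open>V\<close> solves
  \<open>V' = 2 a (X) V + (\<sigma> (X))\<^sup>2\<close>, \<open>V 0 = 0\<close> (\<open>conditional_char\<close>). Negative drift makes \<open>exp (A t)\<close>
  vanish in probability (\<open>contracted_initial_value_vanishes\<close>). Hence \<open>\<nu>\<close> is the law of
  \<open>sqrt V * G\<close> with \<open>G\<close> standard Gaussian and independent of the limit variance \<open>V\<close>
  (\<open>gaussian_mixture_tails\<close>). In particular \<open>\<nu>\<close> is symmetric, which explains the common
  constant \<open>L\<close>, and both tails at \<open>t\<close> equal the average of the smooth function
  \<open>gaussian_kernel (v / t\<^sup>2)\<close> under the law of \<open>V\<close>.

  The pair \<open>(X, V)\<close> is a piecewise deterministic Markov process. Dynkin's formula, proved from the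
  law of the jump chain, shows that time averages are tight and that their limits \<open>M i\<close> (the laws
  of \<open>V\<close> in state \<open>i\<close>) satisfy a stationary balance equation (\<open>stationary_law_exists\<close>).

  The exponent comes from linear algebra. For small \<open>p > 0\<close> the generator tilted by \<open>p * b\<close>, with
  \<open>b = 2 a\<close>, admits a strict positive supersolution, since the drift is negative; for large \<open>p\<close> it
  admits none, since some \<open>b i\<close> is positive. At the critical \<open>\<kappa>\<close> the tilted generator is singular
  with positive null vectors (\<open>critical_exponent\<close>).

  The averages \<open>avg f i s\<close> compare \<open>v\<close> with \<open>exp s\<close>. A maximum principle bounds them by a multiple of
  \<open>exp (- \<kappa> * s)\<close>. Normalised by this rate and by the left null vector \<open>l\<close>, they are functions \<open>H i\<close>
  for which the balance equation becomes a linear system with a positive source, coming from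
  the noise. Pairing \<open>H\<close> with the right null vector \<open>r\<close> gives an increasing bounded function of
  \<open>s\<close> that vanishes at \<open>- \<infinity>\<close>, so it has a positive limit; a quadratic functional of \<open>H\<close>
  dissipates the differences \<open>H i - H j\<close>, so all \<open>H i\<close> have the same limit behaviour and
  converge to a positive constant (\<open>gaussian_average_tail\<close>). No renewal theorem is involved.
\<close>

section \<open>Irreducible matrices with nonnegative off-diagonal entries\<close>

lemma bilinear_sum_swap:
  fixes A :: "'i \<Rightarrow> 'j \<Rightarrow> real"
  shows "(\<Sum>j\<in>J. (\<Sum>i\<in>I. u i * A i j) * w j) = (\<Sum>i\<in>I. u i * (\<Sum>j\<in>J. A i j * w j))"
proof -
  have "(\<Sum>j\<in>J. (\<Sum>i\<in>I. u i * A i j) * w j) = (\<Sum>j\<in>J. \<Sum>i\<in>I. u i * (A i j * w j))"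
    by (simp add: sum_distrib_right mult.assoc)
  also have "\<dots> = (\<Sum>i\<in>I. \<Sum>j\<in>J. u i * (A i j * w j))" by (rule sum.swap)
  finally show ?thesis by (simp add: sum_distrib_left)
qed

lemma underdetermined_system_has_nontrivial_solution:
  fixes A :: "'i \<Rightarrow> 'j \<Rightarrow> real"
  assumes "finite I" "finite J" "card I < card J"
  shows "\<exists>x. (\<exists>j\<in>J. x j \<noteq> 0) \<and> (\<forall>i\<in>I. (\<Sum>j\<in>J. A i j * x j) = 0)"
  using assms
proof (induction I arbitrary: J A rule: finite_induct)
  case empty
  then obtain j where "j \<in> J" by (metis card.empty card_gt_0_iff ex_in_conv)
  then show ?case by (intro exI[of _ "\<lambda>_. 1"]) auto
next
  case (insert i0 I)
  show ?case
  proof (cases "\<forall>j\<in>J. A i0 j = 0")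
    case True
    have "card I < card J" using insert by simp
    then obtain x where "\<exists>j\<in>J. x j \<noteq> 0" "\<forall>i\<in>I. (\<Sum>j\<in>J. A i j * x j) = 0"
      using insert.IH[of J A] insert.prems by blast
    with True show ?thesis by (intro exI[of _ x]) auto
  next
    case False
    then obtain j0 where j0: "j0 \<in> J" "A i0 j0 \<noteq> 0" by blast
    define J' where "J' = J - {j0}"
    have "card J = Suc (card J')" using j0 insert.prems unfolding J'_def
      by (metis card_Suc_Diff1)
    then have c: "finite J'" "card I < card J'" using insert by (auto simp: J'_def)
    then obtain x where x: "\<exists>j\<in>J'. x j \<noteq> 0"
      "\<forall>i\<in>I. (\<Sum>j\<in>J'. (A i j - A i j0 * A i0 j / A i0 j0) * x j) = 0"
      using insert.IH[OF c, of "\<lambda>i j. A i j - A i j0 * A i0 j / A i0 j0"] by blast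
    define c where "c = - (\<Sum>j\<in>J'. A i0 j * x j) / A i0 j0"
    define y where "y = x(j0 := c)"
    have S: "(\<Sum>j\<in>J. A i j * y j) = A i j0 * c + (\<Sum>j\<in>J'. A i j * x j)" for i
      using j0 insert.prems(1) unfolding J'_def y_def
      by (subst sum.remove[of J j0]) (auto intro!: sum.cong)
    have "(\<Sum>j\<in>J. A i j * y j) = 0" if "i \<in> insert i0 I" for i
    proof (cases "i = i0")
      case True then show ?thesis using j0 unfolding S c_def by simp
    next
      case False
      then have "(\<Sum>j\<in>J'. (A i j - A i j0 * A i0 j / A i0 j0) * x j) = 0" using x that by auto
      also have "(\<Sum>j\<in>J'. (A i j - A i j0 * A i0 j / A i0 j0) * x j)
          = (\<Sum>j\<in>J'. A i j * x j) - A i j0 * (\<Sum>j\<in>J'. A i0 j * x j) / A i0 j0"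
        by (simp add: left_diff_distrib sum_subtractf sum_distrib_left sum_divide_distrib mult.assoc)
      finally show ?thesis unfolding S c_def by simp
    qed
    moreover have "\<exists>j\<in>J. y j \<noteq> 0" using x(1) unfolding y_def J'_def by auto
    ultimately show ?thesis by blast
  qed
qed

lemma injective_square_system_is_surjective:
  fixes A :: "'i \<Rightarrow> 'i \<Rightarrow> real"
  assumes fin: "finite E"
    and inj: "\<And>x. (\<forall>i\<in>E. (\<Sum>j\<in>E. A i j * x j) = 0) \<Longrightarrow> \<forall>j\<in>E. x j = 0"
  shows "\<exists>x. \<forall>i\<in>E. (\<Sum>j\<in>E. A i j * x j) = y i"
proof -
  define B where "B i jo = (case jo of None \<Rightarrow> - y i | Some j \<Rightarrow> A i j)" for i jo
  define J where "J = insert None (Some ` E)"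
  have J: "finite J" "card E < card J" using fin
    by (auto simp: J_def card_insert_if card_image)
  obtain z where z: "\<exists>j\<in>J. z j \<noteq> 0" "\<forall>i\<in>E. (\<Sum>j\<in>J. B i j * z j) = 0"
    using underdetermined_system_has_nontrivial_solution[OF fin J, of B] by blast
  have S: "(\<Sum>j\<in>J. B i j * z j) = - y i * z None + (\<Sum>j\<in>E. A i j * z (Some j))" for i
    unfolding J_def using fin by (subst sum.insert) (auto simp: B_def sum.reindex)
  have "z None \<noteq> 0"
  proof
    assume n: "z None = 0"
    have "\<forall>j\<in>E. z (Some j) = 0" by (rule inj) (use z(2) S n in auto)
    then show False using z(1) n by (auto simp: J_def)
  qed
  have "(\<Sum>j\<in>E. A i j * (z (Some j) / z None)) = y i" if "i \<in> E" for i
  proof -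
    have "(\<Sum>j\<in>E. A i j * (z (Some j) / z None)) = (\<Sum>j\<in>E. A i j * z (Some j)) / z None"
      by (simp add: sum_divide_distrib)
    also have "(\<Sum>j\<in>E. A i j * z (Some j)) = y i * z None" using z(2) that unfolding S by simp
    finally show ?thesis using \<open>z None \<noteq> 0\<close> by simp
  qed
  then show ?thesis by (intro exI[of _ "\<lambda>j. z (Some j) / z None"] ballI)
qed

lemma singular_system_has_left_null_vector:
  fixes A :: "'i \<Rightarrow> 'i \<Rightarrow> real"
  assumes fin: "finite E"
    and x: "\<forall>i\<in>E. (\<Sum>j\<in>E. A i j * x j) = 0" "k \<in> E" "x k \<noteq> 0"
  shows "\<exists>y. (\<exists>i\<in>E. y i \<noteq> 0) \<and> (\<forall>j\<in>E. (\<Sum>i\<in>E. y i * A i j) = 0)"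
proof (rule ccontr)
  assume no: "\<not> ?thesis"
  have "\<exists>y. \<forall>j\<in>E. (\<Sum>i\<in>E. A i j * y i) = (if j = k then 1 else 0)"
    by (rule injective_square_system_is_surjective[OF fin, where A = "\<lambda>j i. A i j"])
       (use no in \<open>auto simp: mult.commute\<close>)
  then obtain y where y: "\<forall>j\<in>E. (\<Sum>i\<in>E. A i j * y i) = (if j = k then 1 else 0)" by blast
  have "x k = (\<Sum>j\<in>E. x j * (\<Sum>i\<in>E. A i j * y i))"
    using y x fin by (auto simp: if_distrib[of "\<lambda>u. _ * u"] sum.delta cong: if_cong)
  also have "\<dots> = (\<Sum>i\<in>E. y i * (\<Sum>j\<in>E. A i j * x j))"
    unfolding sum_distrib_left by (subst sum.swap) (simp add: mult_ac)
  also have "\<dots> = 0" using x by simp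
  finally show False using x by simp
qed

definition irreducible_metzler :: "'i set \<Rightarrow> ('i \<Rightarrow> 'i \<Rightarrow> real) \<Rightarrow> bool" where
  "irreducible_metzler E A \<longleftrightarrow> finite E \<and> E \<noteq> {} \<and> (\<forall>i\<in>E. \<forall>j\<in>E. i \<noteq> j \<longrightarrow> 0 \<le> A i j) \<and>
     (\<forall>I\<subseteq>E. I \<noteq> {} \<longrightarrow> (\<forall>i\<in>I. \<forall>j\<in>E - I. A i j = 0) \<longrightarrow> I = E)"

lemma irreducible_metzlerD:
  assumes "irreducible_metzler E A"
  shows "finite E" "E \<noteq> {}" "\<And>i j. i \<in> E \<Longrightarrow> j \<in> E \<Longrightarrow> i \<noteq> j \<Longrightarrow> 0 \<le> A i j"
    "\<And>I. I \<subseteq> E \<Longrightarrow> I \<noteq> {} \<Longrightarrow> (\<And>i j. i \<in> I \<Longrightarrow> j \<in> E - I \<Longrightarrow> A i j = 0) \<Longrightarrow> I = E"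
  using assms unfolding irreducible_metzler_def by simp_all

lemma irreducible_metzler_transpose:
  assumes "irreducible_metzler E A"
  shows "irreducible_metzler E (\<lambda>i j. A j i)"
  unfolding irreducible_metzler_def
proof (intro conjI allI impI ballI)
  fix I assume I: "I \<subseteq> E" "I \<noteq> {}" "\<forall>i\<in>I. \<forall>j\<in>E - I. A j i = 0"
  show "I = E"
  proof (rule ccontr)
    assume "I \<noteq> E"
    then have "E - I \<noteq> {}" using I by blast
    then have "E - I = E"
      using I by (intro irreducible_metzlerD(4)[OF assms]) auto
    then show False using I by blast
  qed
qed (use irreducible_metzlerD[OF assms] in auto)

lemma irreducible_metzler_change_diagonal:
  assumes "irreducible_metzler E A" "\<And>i j. i \<in> E \<Longrightarrow> j \<in> E \<Longrightarrow> i \<noteq> j \<Longrightarrow> B i j = A i j"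
  shows "irreducible_metzler E B"
  unfolding irreducible_metzler_def
proof (intro conjI allI impI ballI)
  fix I assume I: "I \<subseteq> E" "I \<noteq> {}" "\<forall>i\<in>I. \<forall>j\<in>E - I. B i j = 0"
  show "I = E"
    by (rule irreducible_metzlerD(4)[OF assms(1) I(1,2)]) (use I assms(2) in \<open>metis DiffD1 DiffD2 subsetD\<close>)
qed (use irreducible_metzlerD[OF assms(1)] assms(2) in auto)

text \<open>The zeros of a nonnegative supersolution propagate along the edges.\<close>

lemma nonneg_supersolution_positive:
  assumes A: "irreducible_metzler E A"
    and x: "\<And>i. i \<in> E \<Longrightarrow> 0 \<le> x i" "\<And>i. i \<in> E \<Longrightarrow> x i = 0 \<Longrightarrow> (\<Sum>j\<in>E. A i j * x j) \<le> 0"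
    and nz: "k \<in> E" "x k \<noteq> 0"
    and i: "i \<in> E"
  shows "0 < x i"
proof (rule ccontr)
  note D = irreducible_metzlerD[OF A]
  assume "\<not> 0 < x i"
  then have xi: "x i = 0" using x(1)[OF i] by simp
  have "{i\<in>E. x i = 0} = E"
  proof (rule D(4))
    fix i j assume ij: "i \<in> {i\<in>E. x i = 0}" "j \<in> E - {i\<in>E. x i = 0}"
    have "A i j * x j = 0"
    proof (rule sum_nonneg_0[where f = "\<lambda>j. A i j * x j"])
      show "0 \<le> A i j * x j" if "j \<in> E" for j
        using that ij x(1) D(3) by (cases "i = j") auto
      then show "(\<Sum>j\<in>E. A i j * x j) = 0"
        using x(2)[of i] ij by (intro antisym sum_nonneg) auto
    qed (use D(1) ij in auto)
    then show "A i j = 0" using ij by auto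
  qed (use xi i in auto)
  then show False using nz by auto
qed

lemma positive_kernel_one_dimensional:
  assumes A: "irreducible_metzler E A"
    and r: "\<And>i. i \<in> E \<Longrightarrow> 0 < r i" "\<And>i. i \<in> E \<Longrightarrow> (\<Sum>j\<in>E. A i j * r j) \<le> 0"
    and x: "\<And>i. i \<in> E \<Longrightarrow> (\<Sum>j\<in>E. A i j * x j) = 0"
  shows "\<exists>c. (\<forall>i\<in>E. x i = c * r i)"
proof -
  note D = irreducible_metzlerD[OF A]
  \<comment> \<open>the largest multiple of \<open>r\<close> below \<open>y\<close> touches \<open>y\<close>\<close>
  have touch: "\<exists>c. (\<forall>i\<in>E. y i = c * r i)"
    if y: "\<And>i. i \<in> E \<Longrightarrow> (\<Sum>j\<in>E. A i j * y j) = 0" and neg: "\<exists>i\<in>E. y i \<le> 0" for y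
  proof -
    define c where "c = Min ((\<lambda>i. y i / r i) ` E)"
    have "c \<in> (\<lambda>i. y i / r i) ` E" unfolding c_def using D by (intro Min_in) auto
    then obtain i0 where i0: "i0 \<in> E" "c = y i0 / r i0" by blast
    have cle: "c \<le> y i / r i" if "i \<in> E" for i
      unfolding c_def using D that by (intro Min_le) auto
    obtain i1 where "i1 \<in> E" "y i1 \<le> 0" using neg by blast
    then have c0: "c \<le> 0" using cle[of i1] r(1)[of i1] by (meson divide_le_0_iff less_imp_le order_trans)
    define u where "u i = y i - c * r i" for i
    have u: "0 \<le> u i" if "i \<in> E" for i
      using cle[OF that] r(1)[OF that] by (simp add: u_def field_simps)
    have u0: "u i0 = 0" using i0 r(1)[OF i0(1)] by (simp add: u_def)
    have Au: "(\<Sum>j\<in>E. A i j * u j) \<le> 0" if "i \<in> E" for i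
    proof -
      have "(\<Sum>j\<in>E. A i j * u j) = (\<Sum>j\<in>E. A i j * y j) - c * (\<Sum>j\<in>E. A i j * r j)"
        by (simp add: u_def algebra_simps sum_subtractf sum_distrib_left)
      then show ?thesis using y[OF that] r(2)[OF that] c0 by (simp add: mult_nonpos_nonpos)
    qed
    have "\<forall>i\<in>E. u i = 0"
      using nonneg_supersolution_positive[OF A u Au _ _ i0(1)] u0 by force
    then show ?thesis by (intro exI[of _ c]) (simp add: u_def)
  qed
  show ?thesis
  proof (cases "\<exists>i\<in>E. x i \<le> 0")
    case True then show ?thesis using touch x by blast
  next
    case False
    have "\<exists>c. \<forall>i\<in>E. - x i = c * r i"
      by (rule touch) (use False D(2) x in \<open>auto simp: sum_negf not_le intro: less_imp_le\<close>)
    then obtain c where "\<forall>i\<in>E. - x i = c * r i" by blast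
    then show ?thesis by (intro exI[of _ "-c"]) (auto simp: minus_equation_iff)
  qed
qed

text \<open>Solvability of \<open>A x = y\<close> under the one orthogonality condition: adding the rank-one matrix
  \<open>r l\<close> to \<open>A\<close> makes it injective, and the solution of the perturbed system solves the original one.\<close>

lemma fredholm_alternative:
  assumes A: "irreducible_metzler E A"
    and r: "\<And>i. i \<in> E \<Longrightarrow> 0 < r i" "\<And>i. i \<in> E \<Longrightarrow> (\<Sum>j\<in>E. A i j * r j) = 0"
    and l: "\<And>i. i \<in> E \<Longrightarrow> 0 < l i" "\<And>j. j \<in> E \<Longrightarrow> (\<Sum>i\<in>E. l i * A i j) = 0"
    and y: "(\<Sum>i\<in>E. l i * y i) = 0"
  shows "\<exists>x. \<forall>i\<in>E. (\<Sum>j\<in>E. A i j * x j) = y i"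
proof -
  note D = irreducible_metzlerD[OF A]
  define B where "B i j = A i j - r i * l j" for i j
  have pos: "0 < (\<Sum>i\<in>E. l i * r i)" using D l r by (intro sum_pos) auto
  have B: "(\<Sum>j\<in>E. B i j * x j) = (\<Sum>j\<in>E. A i j * x j) - r i * (\<Sum>j\<in>E. l j * x j)" for i x
    by (simp add: B_def left_diff_distrib sum_subtractf sum_distrib_left mult.assoc)
  have orth: "(\<Sum>i\<in>E. l i * (\<Sum>j\<in>E. B i j * x j)) = - (\<Sum>i\<in>E. l i * r i) * (\<Sum>j\<in>E. l j * x j)" for x
  proof -
    have "(\<Sum>i\<in>E. l i * (\<Sum>j\<in>E. A i j * x j)) = (\<Sum>j\<in>E. (\<Sum>i\<in>E. l i * A i j) * x j)"
      by (rule bilinear_sum_swap[symmetric])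
    also have "\<dots> = 0" using l by simp
    finally have *: "(\<Sum>i\<in>E. l i * (\<Sum>j\<in>E. A i j * x j)) = 0" .
    show ?thesis unfolding B right_diff_distrib sum_subtractf *
      by (simp add: sum_distrib_right mult.assoc)
  qed
  have "\<exists>x. \<forall>i\<in>E. (\<Sum>j\<in>E. B i j * x j) = y i"
  proof (rule injective_square_system_is_surjective[OF D(1)])
    fix x assume x: "\<forall>i\<in>E. (\<Sum>j\<in>E. B i j * x j) = 0"
    then have 0: "(\<Sum>j\<in>E. l j * x j) = 0" using orth[of x] pos by simp
    then have "\<And>i. i \<in> E \<Longrightarrow> (\<Sum>j\<in>E. A i j * x j) = 0" using x B by simp
    then obtain c where c: "\<forall>i\<in>E. x i = c * r i"
      using positive_kernel_one_dimensional[OF A r(1)] r(2) by force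
    have "(\<Sum>j\<in>E. l j * x j) = c * (\<Sum>j\<in>E. l j * r j)" using c by (simp add: sum_distrib_left mult_ac)
    then show "\<forall>j\<in>E. x j = 0" using 0 pos c by auto
  qed
  then obtain x where x: "\<forall>i\<in>E. (\<Sum>j\<in>E. B i j * x j) = y i" by blast
  then have "(\<Sum>j\<in>E. l j * x j) = 0" using orth[of x] y pos by simp
  then show ?thesis using x B by auto
qed

text \<open>Either a positive supersolution can be made strict everywhere, or it is a null vector. If \<open>A\<close> is
  injective, the solution of \<open>A x = -1\<close> is positive by comparison with \<open>r\<close>; otherwise a null vector
  is compared with \<open>r\<close>.\<close>

lemma supersolution_dichotomy:
  assumes A: "irreducible_metzler E A"
    and r: "\<And>i. i \<in> E \<Longrightarrow> 0 < r i" "\<And>i. i \<in> E \<Longrightarrow> (\<Sum>j\<in>E. A i j * r j) \<le> 0"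
  shows "(\<exists>x. (\<forall>i\<in>E. 0 < x i) \<and> (\<forall>i\<in>E. (\<Sum>j\<in>E. A i j * x j) < 0)) \<or>
         (\<forall>i\<in>E. (\<Sum>j\<in>E. A i j * r j) = 0)"
proof (cases "\<forall>x. (\<forall>i\<in>E. (\<Sum>j\<in>E. A i j * x j) = 0) \<longrightarrow> (\<forall>j\<in>E. x j = 0)")
  case True
  note D = irreducible_metzlerD[OF A]
  obtain x where x: "\<forall>i\<in>E. (\<Sum>j\<in>E. A i j * x j) = - 1"
    using injective_square_system_is_surjective[OF D(1), of A "\<lambda>_. - 1"] True by blast
  define c where "c = Min ((\<lambda>i. x i / r i) ` E)"
  have "c \<in> (\<lambda>i. x i / r i) ` E" unfolding c_def using D by (intro Min_in) auto
  then obtain i0 where i0: "i0 \<in> E" "c = x i0 / r i0" by blast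
  have cle: "c \<le> x i / r i" if "i \<in> E" for i
    unfolding c_def using D that by (intro Min_le) auto
  have "0 < c"
  proof (rule ccontr)
    assume "\<not> 0 < c"
    then have c0: "c \<le> 0" by simp
    define u where "u i = x i - c * r i" for i
    have u: "0 \<le> u i" if "i \<in> E" for i
      using cle[OF that] r(1)[OF that] by (simp add: u_def field_simps)
    have u0: "u i0 = 0" using i0 r(1)[OF i0(1)] by (simp add: u_def)
    have "(\<Sum>j\<in>E. A i0 j * u j) = (\<Sum>j\<in>E. A i0 j * x j) - c * (\<Sum>j\<in>E. A i0 j * r j)"
      by (simp add: u_def algebra_simps sum_subtractf sum_distrib_left)
    also have "\<dots> \<le> - 1" using x[rule_format, OF i0(1)] mult_nonpos_nonpos[OF c0 r(2)[OF i0(1)]] by linarith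
    finally have "(\<Sum>j\<in>E. A i0 j * u j) \<le> - 1" .
    moreover have "0 \<le> A i0 j * u j" if "j \<in> E" for j
      using D(3)[OF i0(1) that] u[OF that] u0 by (cases "j = i0") auto
    then have "0 \<le> (\<Sum>j\<in>E. A i0 j * u j)" by (rule sum_nonneg)
    ultimately show False by linarith
  qed
  then have "0 < x i" if "i \<in> E" for i
    using cle[OF that] r(1)[OF that] by (metis less_le_trans zero_less_divide_iff order.asym)
  then show ?thesis using x by (intro disjI1 exI[of _ x]) auto
next
  case False
  then obtain x k where x: "\<forall>i\<in>E. (\<Sum>j\<in>E. A i j * x j) = 0" "k \<in> E" "x k \<noteq> 0" by blast
  obtain c where c: "\<forall>i\<in>E. x i = c * r i" using positive_kernel_one_dimensional[OF A r] x(1) by blast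
  then have "c \<noteq> 0" using x by auto
  have "c * (\<Sum>j\<in>E. A i j * r j) = (\<Sum>j\<in>E. A i j * x j)" for i
    using c by (simp add: sum_distrib_left mult_ac)
  then show ?thesis using x(1) \<open>c \<noteq> 0\<close> by (metis mult_eq_0_iff)
qed

lemma left_null_vector_positive:
  assumes A: "irreducible_metzler E A"
    and r: "\<And>i. i \<in> E \<Longrightarrow> 0 < r i" "\<And>i. i \<in> E \<Longrightarrow> (\<Sum>j\<in>E. A i j * r j) = 0"
  shows "\<exists>l. (\<forall>i\<in>E. 0 < l i) \<and> (\<forall>j\<in>E. (\<Sum>i\<in>E. l i * A i j) = 0)"
proof -
  note D = irreducible_metzlerD[OF A]
  obtain k where k: "k \<in> E" using D by blast
  have "r k \<noteq> 0" using r(1)[OF k] by simp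
  then obtain y where y: "\<exists>i\<in>E. y i \<noteq> 0" "\<forall>j\<in>E. (\<Sum>i\<in>E. y i * A i j) = 0"
    using singular_system_has_left_null_vector[OF D(1) _ k, of A r] r(2) by blast
  define z where "z j = (\<Sum>i\<in>E. \<bar>y i\<bar> * A i j)" for j
  have rest: "(\<Sum>i\<in>E. f i) = f j + (\<Sum>i\<in>E - {j}. f i)" if "j \<in> E" for f :: "_ \<Rightarrow> real" and j
    using that D(1) by (simp add: sum.remove)
  have Aneg: "A j j \<le> 0" if "j \<in> E" for j
  proof -
    have "0 \<le> (\<Sum>i\<in>E - {j}. A j i * r i)" using D(3) r(1) that
      by (intro sum_nonneg mult_nonneg_nonneg) (auto intro: less_imp_le)
    then have "A j j * r j \<le> 0" using r(2)[OF that] rest[OF that, of "\<lambda>i. A j i * r i"] by simp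
    then show ?thesis using r(1)[OF that] by (simp add: mult_le_0_iff)
  qed
  have z: "0 \<le> z j" if "j \<in> E" for j
  proof -
    have "y j * A j j = - (\<Sum>i\<in>E - {j}. y i * A i j)" using y that rest[OF that, of "\<lambda>i. y i * A i j"] by simp
    then have "\<bar>y j * A j j\<bar> = \<bar>\<Sum>i\<in>E - {j}. y i * A i j\<bar>" by simp
    then have "\<bar>y j\<bar> * - A j j = \<bar>\<Sum>i\<in>E - {j}. y i * A i j\<bar>"
      using Aneg[OF that] by (simp add: abs_mult)
    also have "\<dots> \<le> (\<Sum>i\<in>E - {j}. \<bar>y i\<bar> * A i j)"
      by (rule order.trans[OF sum_abs]) (use D(3) that in \<open>auto simp: abs_mult intro!: sum_mono\<close>)
    finally show ?thesis unfolding z_def rest[OF that, of "\<lambda>i. \<bar>y i\<bar> * A i j"] by linarith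
  qed
  have "(\<Sum>j\<in>E. z j * r j) = (\<Sum>i\<in>E. \<bar>y i\<bar> * (\<Sum>j\<in>E. A i j * r j))"
    unfolding z_def by (rule bilinear_sum_swap)
  also have "\<dots> = 0" by (intro sum.neutral ballI) (simp only: r(2) mult_zero_right)
  finally have S: "(\<Sum>j\<in>E. z j * r j) = 0" .
  have z0: "z j = 0" if "j \<in> E" for j
  proof -
    have "z j * r j = 0"
      by (rule sum_nonneg_0[OF D(1) _ S that]) (use z r(1) in \<open>simp add: less_imp_le\<close>)
    then show ?thesis using r(1)[OF that] by simp
  qed
  obtain i1 where "i1 \<in> E" "\<bar>y i1\<bar> \<noteq> 0" using y(1) by auto
  then have "0 < \<bar>y i\<bar>" if "i \<in> E" for i
    using nonneg_supersolution_positive[OF irreducible_metzler_transpose[OF A], of "\<lambda>i. \<bar>y i\<bar>" i1 i] that z0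
    by (simp add: z_def mult.commute)
  then show ?thesis using z0 by (intro exI[of _ "\<lambda>i. \<bar>y i\<bar>"]) (auto simp: z_def)
qed

lemma invariant_weights_positive:
  assumes A: "irreducible_metzler E A"
    and m: "\<And>i. i \<in> E \<Longrightarrow> 0 \<le> m i" "(\<Sum>i\<in>E. m i) = 1" "\<And>j. j \<in> E \<Longrightarrow> (\<Sum>i\<in>E. m i * A i j) = (0::real)"
    and i: "i \<in> E"
  shows "0 < m i"
proof -
  obtain k where "k \<in> E" "m k \<noteq> 0" using m(2) by (metis sum.neutral zero_neq_one)
  then show ?thesis
    using nonneg_supersolution_positive[OF irreducible_metzler_transpose[OF A], of m k i] m i
    by (simp add: mult.commute)
qed

section \<open>The critical exponent\<close>

text \<open>Extraction of a common subsequence for finitely many hereditary properties.\<close>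

lemma common_subsequence:
  fixes P :: "'i \<Rightarrow> (nat \<Rightarrow> nat) \<Rightarrow> bool"
  assumes "finite I"
    and ext: "\<And>i s. i \<in> I \<Longrightarrow> strict_mono s \<Longrightarrow> \<exists>r::nat \<Rightarrow> nat. strict_mono r \<and> P i (s \<circ> r)"
    and her: "\<And>i s (r::nat \<Rightarrow> nat). i \<in> I \<Longrightarrow> P i s \<Longrightarrow> strict_mono r \<Longrightarrow> P i (s \<circ> r)"
  shows "\<exists>s. strict_mono s \<and> (\<forall>i\<in>I. P i s)"
  using assms(1) ext her
proof (induction I rule: finite_induct)
  case empty
  then show ?case by (intro exI[of _ id]) (auto simp: strict_mono_def)
next
  case (insert i I)
  then obtain s where s: "strict_mono s" "\<forall>j\<in>I. P j s" by auto
  obtain r :: "nat \<Rightarrow> nat" where r: "strict_mono r" "P i (s \<circ> r)"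
    using insert.prems(1)[of i s] s by blast
  have "P j (s \<circ> r)" if "j \<in> insert i I" for j
    using s r insert.prems(2)[of j s r] that by blast
  moreover have "strict_mono (s \<circ> r)" using s r strict_mono_o by blast
  ultimately show ?case by blast
qed

lemma convergent_coordinates_subsequence:
  fixes x :: "nat \<Rightarrow> 'i \<Rightarrow> real"
  assumes "finite E" and bd: "\<And>n i. i \<in> E \<Longrightarrow> \<bar>x n i\<bar> \<le> B"
  shows "\<exists>s. strict_mono s \<and> (\<forall>i\<in>E. convergent (\<lambda>n. x (s n) i))"
proof -
  have "\<exists>s. strict_mono s \<and> (\<forall>i\<in>E. convergent ((\<lambda>n. x n i) \<circ> s))"
  proof (rule common_subsequence[OF assms(1)])
    fix i and s :: "nat \<Rightarrow> nat" assume i: "i \<in> E"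
    have "\<exists>l\<in>{-B..B}. \<exists>r. strict_mono r \<and> (((\<lambda>n. x (s n) i) \<circ> r) \<longlonglongrightarrow> l)"
      using compact_Icc[of "-B" B] bd[OF i] unfolding compact_def
      by (auto simp: abs_le_iff minus_le_iff)
    then show "\<exists>r. strict_mono r \<and> convergent ((\<lambda>n. x n i) \<circ> (s \<circ> r))"
      by (auto simp: convergent_def o_def)
  next
    fix i and s r :: "nat \<Rightarrow> nat" assume "convergent ((\<lambda>n. x n i) \<circ> s)" "strict_mono r"
    then show "convergent ((\<lambda>n. x n i) \<circ> (s \<circ> r))"
      using convergent_subseq_convergent[of "(\<lambda>n. x n i) \<circ> s" r] by (simp add: o_assoc)
  qed
  then show ?thesis by (simp add: o_def)
qed

text \<open>
  A matrix \<open>G\<close> with zero row sums generates a Markov jump process, and \<open>G + p diag(b)\<close> is its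
  Feynman-Kac perturbation; \<open>tilted\<close> is that matrix.
\<close>

definition tilted :: "('i \<Rightarrow> 'i \<Rightarrow> real) \<Rightarrow> ('i \<Rightarrow> real) \<Rightarrow> real \<Rightarrow> 'i \<Rightarrow> 'i \<Rightarrow> real" where
  "tilted G b p i j = G i j + (if i = j then p * b i else 0)"

lemma sum_tilted_right:
  assumes "finite E" "i \<in> E"
  shows "(\<Sum>j\<in>E. tilted G b p i j * r j) = (\<Sum>j\<in>E. G i j * r j) + p * b i * r i"
proof -
  have "(\<Sum>j\<in>E. (if i = j then p * b i else 0) * r j) = (\<Sum>j\<in>E. if i = j then p * b i * r j else 0)"
    by (intro sum.cong) auto
  then show ?thesis using assms by (simp add: tilted_def distrib_right sum.distrib)
qed

lemma sum_tilted_left: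
  assumes "finite E" "j \<in> E"
  shows "(\<Sum>i\<in>E. l i * tilted G b p i j) = (\<Sum>i\<in>E. l i * G i j) + p * b j * l j"
proof -
  have "(\<Sum>i\<in>E. l i * (if i = j then p * b i else 0)) = (\<Sum>i\<in>E. if i = j then p * b i * l i else 0)"
    by (intro sum.cong) auto
  then show ?thesis using assms by (simp add: tilted_def distrib_left sum.distrib)
qed

lemma irreducible_metzler_tilted:
  "irreducible_metzler E G \<Longrightarrow> irreducible_metzler E (tilted G b p)"
  by (erule irreducible_metzler_change_diagonal) (simp add: tilted_def)

locale tilted_generator =
  fixes E :: "'i set" and G :: "'i \<Rightarrow> 'i \<Rightarrow> real" and b m :: "'i \<Rightarrow> real"
  assumes irr: "irreducible_metzler E G"
    and row_sum: "\<And>i. i \<in> E \<Longrightarrow> (\<Sum>j\<in>E. G i j) = 0"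
    and m_nonneg: "\<And>i. i \<in> E \<Longrightarrow> 0 \<le> m i" and m_sum: "(\<Sum>i\<in>E. m i) = 1"
    and m_inv: "\<And>j. j \<in> E \<Longrightarrow> (\<Sum>i\<in>E. m i * G i j) = 0"
    and drift_neg: "(\<Sum>i\<in>E. b i * m i) < 0"
begin

lemmas finE = irreducible_metzlerD(1)[OF irr]
  and neE = irreducible_metzlerD(2)[OF irr]
  and offdiag = irreducible_metzlerD(3)[OF irr]

lemma m_pos: "i \<in> E \<Longrightarrow> 0 < m i"
  using invariant_weights_positive[OF irr m_nonneg m_sum m_inv] .

text \<open>For small \<open>p\<close> the first-order perturbation \<open>1 + p w\<close> of the constant vector works, where \<open>w\<close>
  solves the Poisson equation \<open>G w = \<beta> - b\<close> with \<open>\<beta>\<close> the mean of \<open>b\<close>.\<close>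

lemma small_exponent_contracts:
  assumes p1: "0 < p1"
  shows "\<exists>p r. 0 < p \<and> p \<le> p1 \<and> (\<forall>i\<in>E. 0 < r i) \<and> (\<forall>i\<in>E. (\<Sum>j\<in>E. G i j * r j) + p * b i * r i < 0)"
proof -
  define \<beta> where "\<beta> = (\<Sum>i\<in>E. b i * m i)"
  have "(\<Sum>i\<in>E. m i * (\<beta> - b i)) = 0"
    using m_sum by (simp add: right_diff_distrib sum_subtractf mult.commute[of _ \<beta>] sum_distrib_left[symmetric])
       (simp add: \<beta>_def mult.commute)
  then obtain w where w: "\<forall>i\<in>E. (\<Sum>j\<in>E. G i j * w j) = \<beta> - b i"
    using fredholm_alternative[OF irr, of "\<lambda>_. 1" m "\<lambda>i. \<beta> - b i"] row_sum m_pos m_inv by auto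
  define D where "D = 1 + (\<Sum>i\<in>E. \<bar>w i\<bar> + \<bar>b i * w i\<bar>)"
  have D1: "1 \<le> D" unfolding D_def by (simp add: sum_nonneg)
  have D: "\<bar>w i\<bar> + \<bar>b i * w i\<bar> < D" if "i \<in> E" for i
    using member_le_sum[OF that, of "\<lambda>i. \<bar>w i\<bar> + \<bar>b i * w i\<bar>"] finE unfolding D_def by simp
  define p where "p = min p1 (min (1 / D) (- \<beta> / D))"
  have \<beta>: "\<beta> < 0" using drift_neg unfolding \<beta>_def .
  then have p0: "0 < p" unfolding p_def using D1 p1 by (simp add: divide_neg_pos)
  have pD: "p * D \<le> 1" "p * D \<le> - \<beta>" "p \<le> p1" unfolding p_def using D1
    by (auto simp: min_def field_simps)
  have "0 < 1 + p * w i" if "i \<in> E" for i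
  proof -
    have "p * \<bar>w i\<bar> < p * D" using D[OF that] p0 by (intro mult_strict_left_mono) auto
    moreover have "- (p * w i) \<le> p * \<bar>w i\<bar>" using p0 by (metis abs_ge_minus_self abs_mult abs_of_pos)
    ultimately show ?thesis using pD by linarith
  qed
  moreover have "(\<Sum>j\<in>E. G i j * (1 + p * w j)) + p * b i * (1 + p * w i) < 0" if "i \<in> E" for i
  proof -
    have "(\<Sum>j\<in>E. G i j * (1 + p * w j)) = p * (\<Sum>j\<in>E. G i j * w j)"
      using row_sum[OF that] by (simp add: distrib_left sum.distrib sum_distrib_left mult_ac)
    then have "(\<Sum>j\<in>E. G i j * (1 + p * w j)) + p * b i * (1 + p * w i) = p * (\<beta> + p * (b i * w i))"
      using w that by (simp add: distrib_left mult.assoc) (simp add: algebra_simps)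
    moreover have "p * (b i * w i) < p * D" using D[OF that] p0 by (intro mult_strict_left_mono) auto
    ultimately have "\<beta> + p * (b i * w i) < 0" using pD(2) by linarith
    then show ?thesis using p0 \<open>(\<Sum>j\<in>E. G i j * (1 + p * w j)) + _ = _\<close> by (simp add: mult_pos_neg)
  qed
  ultimately show ?thesis using p0 pD by (intro exI[of _ p] exI[of _ "\<lambda>i. 1 + p * w i"]) auto
qed

definition contractive :: "real \<Rightarrow> bool" where
  "contractive p \<longleftrightarrow> (\<exists>r. (\<forall>i\<in>E. 0 < r i) \<and> (\<forall>i\<in>E. (\<Sum>j\<in>E. G i j * r j) + p * b i * r i \<le> 0))"

lemma contractive_bounded:
  assumes "i \<in> E" "0 < b i" "contractive p"
  shows "p \<le> - G i i / b i"
proof -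
  obtain r where r: "\<forall>i\<in>E. 0 < r i" "\<forall>i\<in>E. (\<Sum>j\<in>E. G i j * r j) + p * b i * r i \<le> 0"
    using assms(3) unfolding contractive_def by blast
  have "0 \<le> (\<Sum>j\<in>E - {i}. G i j * r j)"
    using offdiag assms(1) r(1) by (intro sum_nonneg mult_nonneg_nonneg) (auto simp: less_imp_le)
  then have "G i i * r i \<le> (\<Sum>j\<in>E. G i j * r j)" using finE assms(1) by (subst sum.remove) auto
  then have "(G i i + p * b i) * r i \<le> 0" using r(2) assms(1) by (auto simp: distrib_right)
  then have "G i i + p * b i \<le> 0" using r(1) assms(1) by (auto simp: mult_le_0_iff)
  then show ?thesis using assms(2) by (simp add: field_simps)
qed

lemma contractive_closed:
  assumes pn: "\<And>n. contractive (pn n)" "pn \<longlonglongrightarrow> p"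
  shows "contractive p"
proof -
  obtain rn where rn: "\<And>n. (\<forall>i\<in>E. 0 < rn n i) \<and> (\<forall>i\<in>E. (\<Sum>j\<in>E. G i j * rn n j) + pn n * b i * rn n i \<le> 0)"
    using pn(1) unfolding contractive_def by metis
  define S where "S n = (\<Sum>i\<in>E. rn n i)" for n
  have S: "0 < S n" for n unfolding S_def using rn finE neE by (intro sum_pos) auto
  define xn where "xn n i = rn n i / S n" for n i
  have xn: "0 < xn n i" "xn n i \<le> 1" if "i \<in> E" for n i
    using rn[of n] S[of n] that member_le_sum[of i E "rn n"] finE
    by (auto simp: xn_def S_def less_imp_le)
  have xsum: "(\<Sum>i\<in>E. xn n i) = 1" for n
    using S[of n] by (simp add: xn_def S_def sum_divide_distrib[symmetric])
  have xle: "(\<Sum>j\<in>E. G i j * xn n j) + pn n * b i * xn n i \<le> 0" if "i \<in> E" for n i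
  proof -
    have "(\<Sum>j\<in>E. G i j * xn n j) + pn n * b i * xn n i
        = ((\<Sum>j\<in>E. G i j * rn n j) + pn n * b i * rn n i) / S n"
      by (simp add: xn_def sum_divide_distrib add_divide_distrib)
    then show ?thesis using rn[of n] S[of n] that by (simp add: divide_le_0_iff)
  qed
  obtain s where s: "strict_mono s" "\<forall>i\<in>E. convergent (\<lambda>n. xn (s n) i)"
    using convergent_coordinates_subsequence[OF finE, of xn 1] xn by (force simp: abs_le_iff less_imp_le)
  then obtain x where x: "\<And>i. i \<in> E \<Longrightarrow> (\<lambda>n. xn (s n) i) \<longlonglongrightarrow> x i"
    unfolding convergent_def by metis
  have ps: "(\<lambda>n. pn (s n)) \<longlonglongrightarrow> p" using LIMSEQ_subseq_LIMSEQ[OF pn(2) s(1)] by (simp add: o_def)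
  have x0: "0 \<le> x i" if "i \<in> E" for i
    using x[OF that] by (rule LIMSEQ_le_const) (use xn that in \<open>auto simp: less_imp_le\<close>)
  have "(\<lambda>n. \<Sum>i\<in>E. xn (s n) i) \<longlonglongrightarrow> (\<Sum>i\<in>E. x i)" by (intro tendsto_sum x)
  then have x1: "(\<Sum>i\<in>E. x i) = 1" unfolding xsum by (simp add: LIMSEQ_const_iff)
  have xle': "(\<Sum>j\<in>E. G i j * x j) + p * b i * x i \<le> 0" if "i \<in> E" for i
  proof (rule LIMSEQ_le_const2)
    show "(\<lambda>n. (\<Sum>j\<in>E. G i j * xn (s n) j) + pn (s n) * b i * xn (s n) i)
        \<longlonglongrightarrow> (\<Sum>j\<in>E. G i j * x j) + p * b i * x i"
      using that by (intro tendsto_intros x ps)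
  qed (use xle[OF that] in auto)
  obtain k where k: "k \<in> E" "x k \<noteq> 0" using x1 by (metis sum.neutral zero_neq_one)
  have "(\<Sum>j\<in>E. tilted G b p i j * x j) \<le> 0" if "i \<in> E" for i
    using xle'[OF that] by (simp add: sum_tilted_right finE that)
  then have "0 < x i" if "i \<in> E" for i
    using nonneg_supersolution_positive[OF irreducible_metzler_tilted[OF irr, of b p], of x k i] x0 k that
    by blast
  then show ?thesis using xle' unfolding contractive_def by blast
qed

text \<open>The sign of the mean drift under the tilted chain: \<open>\<kappa> \<Sum> l b r\<close> is the relative entropy of the
  tilted chain with respect to the original one.\<close>

lemma tilted_drift_positive:
  assumes k: "0 < \<kappa>" and bpos: "\<exists>i\<in>E. b i \<noteq> 0"
    and r: "\<And>i. i \<in> E \<Longrightarrow> 0 < r i" "\<And>i. i \<in> E \<Longrightarrow> (\<Sum>j\<in>E. G i j * r j) + \<kappa> * b i * r i = 0"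
    and l: "\<And>i. i \<in> E \<Longrightarrow> 0 < l i" "\<And>j. j \<in> E \<Longrightarrow> (\<Sum>i\<in>E. l i * G i j) + \<kappa> * b j * l j = 0"
  shows "0 < (\<Sum>i\<in>E. l i * b i * r i)"
proof -
  define f where "f i j = G i j * (r j * (ln (r j) - ln (r i)) - (r j - r i))" for i j
  have swap: "(\<Sum>j\<in>E. (\<Sum>i\<in>E. l i * G i j) * (r j * ln (r j))) = (\<Sum>i\<in>E. l i * (\<Sum>j\<in>E. G i j * (r j * ln (r j))))"
    by (rule bilinear_sum_swap)
  have l2: "(\<Sum>i\<in>E. l i * G i j) = - (\<kappa> * b j * l j)" if "j \<in> E" for j using l(2)[OF that] by linarith
  have r2: "(\<Sum>j\<in>E. G i j * r j) = - (\<kappa> * b i * r i)" if "i \<in> E" for i using r(2)[OF that] by linarith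
  have a1: "(\<Sum>j\<in>E. (\<Sum>i\<in>E. l i * G i j) * (r j * ln (r j))) = (\<Sum>i\<in>E. - \<kappa> * (l i * b i * r i) * ln (r i))"
    by (intro sum.cong refl) (simp add: l2)
  have a2: "(\<Sum>i\<in>E. l i * ln (r i) * (\<Sum>j\<in>E. G i j * r j)) = (\<Sum>i\<in>E. - \<kappa> * (l i * b i * r i) * ln (r i))"
    by (intro sum.cong refl) (simp add: r2)
  have a3: "(\<Sum>i\<in>E. l i * (\<Sum>j\<in>E. G i j * (r j - r i))) = (\<Sum>i\<in>E. - \<kappa> * (l i * b i * r i))"
  proof (intro sum.cong refl)
    fix i assume i: "i \<in> E"
    have "(\<Sum>j\<in>E. G i j * (r j - r i)) = (\<Sum>j\<in>E. G i j * r j) - r i * (\<Sum>j\<in>E. G i j)"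
      by (simp add: right_diff_distrib sum_subtractf sum_distrib_left mult.commute)
    then have "(\<Sum>j\<in>E. G i j * (r j - r i)) = - (\<kappa> * b i * r i)" using row_sum[OF i] r(2)[OF i] by simp
    then show "l i * (\<Sum>j\<in>E. G i j * (r j - r i)) = - \<kappa> * (l i * b i * r i)" by simp
  qed
  have f: "(\<Sum>j\<in>E. f i j) = (\<Sum>j\<in>E. G i j * (r j * ln (r j))) - ln (r i) * (\<Sum>j\<in>E. G i j * r j)
      - (\<Sum>j\<in>E. G i j * (r j - r i))" for i
    unfolding f_def sum_distrib_left sum_subtractf[symmetric] by (intro sum.cong) (auto simp: algebra_simps)
  have "(\<Sum>i\<in>E. l i * (\<Sum>j\<in>E. f i j)) = (\<Sum>i\<in>E. l i * (\<Sum>j\<in>E. G i j * (r j * ln (r j))))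
      - (\<Sum>i\<in>E. l i * ln (r i) * (\<Sum>j\<in>E. G i j * r j)) - (\<Sum>i\<in>E. l i * (\<Sum>j\<in>E. G i j * (r j - r i)))"
    unfolding f right_diff_distrib sum_subtractf by (simp add: mult.assoc)
  then have main: "(\<Sum>i\<in>E. l i * (\<Sum>j\<in>E. f i j)) = \<kappa> * (\<Sum>i\<in>E. l i * b i * r i)"
    unfolding swap[symmetric] a1 a2 a3 by (simp add: sum_negf sum_distrib_left)
  have entropy: "0 \<le> x * (ln x - ln y) - (x - y)" "x \<noteq> y \<Longrightarrow> 0 < x * (ln x - ln y) - (x - y)"
    if "0 < x" "0 < y" for x y :: real
  proof -
    have eq: "x * (ln x - ln y) - (x - y) = x * ((y / x - 1) - ln (y / x))"
      using that by (simp add: ln_div field_simps)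
    have "ln (y / x) \<le> y / x - 1" using that by (intro ln_le_minus_one) auto
    then show "0 \<le> x * (ln x - ln y) - (x - y)" unfolding eq using that by simp
    assume "x \<noteq> y"
    then have "ln (y / x) \<noteq> y / x - 1" using that ln_eq_minus_one[of "y / x"] by auto
    then have "ln (y / x) < y / x - 1" using \<open>ln (y / x) \<le> y / x - 1\<close> by simp
    then show "0 < x * (ln x - ln y) - (x - y)" unfolding eq using that by simp
  qed
  have f0: "0 \<le> f i j" if "i \<in> E" "j \<in> E" for i j
    using offdiag[OF that] entropy(1)[of "r j" "r i"] r(1) that by (cases "i = j") (auto simp: f_def)
  have lf0: "0 \<le> l i * (\<Sum>j\<in>E. f i j)" if "i \<in> E" for i
    using l(1)[OF that] f0 that by (intro mult_nonneg_nonneg sum_nonneg) auto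
  have "(\<Sum>i\<in>E. l i * (\<Sum>j\<in>E. f i j)) \<noteq> 0"
  proof
    assume 0: "(\<Sum>i\<in>E. l i * (\<Sum>j\<in>E. f i j)) = 0"
    have fz: "f i j = 0" if "i \<in> E" "j \<in> E" for i j
    proof -
      have "l i * (\<Sum>j\<in>E. f i j) = 0" by (rule sum_nonneg_0[OF finE lf0 0 that(1)])
      then have "(\<Sum>j\<in>E. f i j) = 0" using l(1)[OF that(1)] by simp
      from sum_nonneg_0[OF finE f0[OF that(1)] this that(2)] show ?thesis by simp
    qed
    obtain k where kE: "k \<in> E" using neE by blast
    have "{i\<in>E. r i = r k} = E"
    proof (rule irreducible_metzlerD(4)[OF irr])
      fix i j assume ij: "i \<in> {i\<in>E. r i = r k}" "j \<in> E - {i\<in>E. r i = r k}"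
      then have "0 < r j * (ln (r j) - ln (r i)) - (r j - r i)" using r(1) by (intro entropy(2)) (blast, blast, force)
      then show "G i j = 0" using fz[of i j] ij by (auto simp: f_def)
    qed (use kE in auto)
    then have rk: "r i = r k" if "i \<in> E" for i using that by blast
    have "b i = 0" if "i \<in> E" for i
    proof -
      have "(\<Sum>j\<in>E. G i j * r j) = (\<Sum>j\<in>E. G i j) * r k" unfolding sum_distrib_right
        by (intro sum.cong refl) (metis rk)
      then show ?thesis using row_sum[OF that] r(2)[OF that] r(1)[OF that] k by simp
    qed
    then show False using bpos by blast
  qed
  then have "0 < (\<Sum>i\<in>E. l i * (\<Sum>j\<in>E. f i j))" using sum_nonneg[of E, OF lf0] by force
  then show ?thesis unfolding main using k by (simp add: zero_less_mult_iff)
qed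

theorem critical_exponent:
  assumes bpos: "\<exists>i\<in>E. 0 < b i"
  obtains \<kappa> r l where "0 < \<kappa>"
    "\<And>i. i \<in> E \<Longrightarrow> 0 < r i" "\<And>i. i \<in> E \<Longrightarrow> (\<Sum>j\<in>E. G i j * r j) + \<kappa> * b i * r i = 0"
    "\<And>i. i \<in> E \<Longrightarrow> 0 < l i" "\<And>j. j \<in> E \<Longrightarrow> (\<Sum>i\<in>E. l i * G i j) + \<kappa> * b j * l j = 0"
    "0 < (\<Sum>i\<in>E. l i * b i * r i)"
proof -
  define S where "S = {p. contractive p}"
  define \<kappa> where "\<kappa> = Sup S"
  obtain p0 r0 where p0: "0 < p0" and r0: "\<forall>i\<in>E. 0 < r0 i"
      "\<forall>i\<in>E. (\<Sum>j\<in>E. G i j * r0 j) + p0 * b i * r0 i < 0"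
    using small_exponent_contracts[of 1] by auto
  have "contractive p0" unfolding contractive_def
    by (rule exI[of _ r0]) (use r0 in \<open>simp add: less_imp_le\<close>)
  then have p0S: "p0 \<in> S" unfolding S_def by simp
  obtain i0 where "i0 \<in> E" "0 < b i0" using bpos by blast
  then have bdd: "bdd_above S" using contractive_bounded unfolding S_def
    by (intro bdd_aboveI[of _ "- G i0 i0 / b i0"]) blast
  have k: "0 < \<kappa>" using cSup_upper[OF p0S bdd] p0 unfolding \<kappa>_def by simp
  have "\<exists>p\<in>S. \<kappa> - inverse (real (Suc n)) < p" for n
  proof -
    have "\<kappa> - inverse (real (Suc n)) < Sup S" unfolding \<kappa>_def by simp
    then show ?thesis using less_cSup_iff[OF _ bdd] p0S by blast
  qed
  then obtain pn where pn: "\<And>n. pn n \<in> S" "\<And>n. \<kappa> - inverse (real (Suc n)) < pn n" by metis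
  have "pn \<longlonglongrightarrow> \<kappa>"
  proof (rule tendsto_sandwich[where f = "\<lambda>n. \<kappa> - inverse (real (Suc n))" and h = "\<lambda>_. \<kappa>"])
    show "(\<lambda>n. \<kappa> - inverse (real (Suc n))) \<longlonglongrightarrow> \<kappa>"
      by (rule tendsto_eq_rhs[OF tendsto_diff[OF tendsto_const LIMSEQ_inverse_real_of_nat]]) simp
    show "\<forall>\<^sub>F n in sequentially. pn n \<le> \<kappa>"
      using cSup_upper[OF pn(1) bdd] unfolding \<kappa>_def by simp
    show "\<forall>\<^sub>F n in sequentially. \<kappa> - inverse (real (Suc n)) \<le> pn n"
      by (rule always_eventually) (blast intro: less_imp_le pn(2))
  qed simp
  then have "contractive \<kappa>" using contractive_closed[of pn \<kappa>] pn(1) by (simp add: S_def)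
  then obtain r where r: "\<forall>i\<in>E. 0 < r i" "\<forall>i\<in>E. (\<Sum>j\<in>E. G i j * r j) + \<kappa> * b i * r i \<le> 0"
    unfolding contractive_def by blast
  have no: False if x: "\<forall>i\<in>E. 0 < x i" "\<forall>i\<in>E. (\<Sum>j\<in>E. tilted G b \<kappa> i j * x j) < 0" for x
  proof -
    define e where "e = Min ((\<lambda>i. - (\<Sum>j\<in>E. tilted G b \<kappa> i j * x j) / (1 + \<bar>b i * x i\<bar>)) ` E)"
    have "0 < - (\<Sum>j\<in>E. tilted G b \<kappa> i j * x j) / (1 + \<bar>b i * x i\<bar>)" if "i \<in> E" for i
      using x(2) that by (intro divide_pos_pos) auto
    then have e: "0 < e" unfolding e_def using finE neE by (subst Min_gr_iff) auto
    have "(\<Sum>j\<in>E. G i j * x j) + (\<kappa> + e) * b i * x i \<le> 0" if "i \<in> E" for i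
    proof -
      have "e \<le> - (\<Sum>j\<in>E. tilted G b \<kappa> i j * x j) / (1 + \<bar>b i * x i\<bar>)"
        unfolding e_def using finE that by (intro Min_le) auto
      then have "e * (1 + \<bar>b i * x i\<bar>) \<le> - (\<Sum>j\<in>E. tilted G b \<kappa> i j * x j)"
        by (subst (asm) pos_le_divide_eq) (auto simp: add_pos_nonneg)
      moreover have "e * (b i * x i) \<le> e * (1 + \<bar>b i * x i\<bar>)" using e by (intro mult_left_mono) auto
      ultimately show ?thesis using sum_tilted_right[OF finE that, of G b \<kappa> x] by (simp add: algebra_simps)
    qed
    then have "\<kappa> + e \<in> S" using x(1) unfolding S_def contractive_def by auto
    then show False using cSup_upper[OF _ bdd, of "\<kappa> + e"] e unfolding \<kappa>_def by simp
  qed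
  note irrk = irreducible_metzler_tilted[OF irr, of b \<kappa>]
  have "(\<Sum>j\<in>E. tilted G b \<kappa> i j * r j) \<le> 0" if "i \<in> E" for i
    using r(2) that by (simp add: sum_tilted_right finE)
  from supersolution_dichotomy[OF irrk r(1)[rule_format] this]
  have "\<forall>i\<in>E. (\<Sum>j\<in>E. tilted G b \<kappa> i j * r j) = 0"
  proof
    assume "\<exists>x. (\<forall>i\<in>E. 0 < x i) \<and> (\<forall>i\<in>E. (\<Sum>j\<in>E. tilted G b \<kappa> i j * x j) < 0)"
    then obtain x where "\<forall>i\<in>E. 0 < x i" "\<forall>i\<in>E. (\<Sum>j\<in>E. tilted G b \<kappa> i j * x j) < 0" by (elim exE conjE)
    then show ?thesis using no[of x] by simp
  qed
  then have req: "(\<Sum>j\<in>E. tilted G b \<kappa> i j * r j) = 0" if "i \<in> E" for i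
    using that by simp
  have "\<exists>l. (\<forall>i\<in>E. 0 < l i) \<and> (\<forall>j\<in>E. (\<Sum>i\<in>E. l i * tilted G b \<kappa> i j) = 0)"
    by (rule left_null_vector_positive[OF irrk, of r]) (use r(1) req in auto)
  then obtain l where l: "\<forall>i\<in>E. 0 < l i" "\<forall>j\<in>E. (\<Sum>i\<in>E. l i * tilted G b \<kappa> i j) = 0"
    by (elim exE conjE)
  have r2: "(\<Sum>j\<in>E. G i j * r j) + \<kappa> * b i * r i = 0" if "i \<in> E" for i
    using req[OF that] that by (simp add: sum_tilted_right finE)
  have l2: "(\<Sum>i\<in>E. l i * G i j) + \<kappa> * b j * l j = 0" if "j \<in> E" for j
    using l(2) that by (simp add: sum_tilted_left finE)
  have "\<exists>i\<in>E. b i \<noteq> 0" using bpos by (metis less_irrefl)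
  then have "0 < (\<Sum>i\<in>E. l i * b i * r i)"
    using r(1) l(1) r2 l2 by (intro tilted_drift_positive[OF k]) auto
  then show thesis using r(1) l(1) k r2 l2 by (intro that[of \<kappa> r l]) auto
qed


text \<open>Just above the critical exponent there is a strict left subsolution, again by first-order
  perturbation, now of the left null vector.\<close>

lemma supercritical_left_vector:
  assumes r: "\<And>i. i \<in> E \<Longrightarrow> 0 < r i" "\<And>i. i \<in> E \<Longrightarrow> (\<Sum>j\<in>E. G i j * r j) + \<kappa> * b i * r i = 0"
    and l: "\<And>i. i \<in> E \<Longrightarrow> 0 < l i" "\<And>j. j \<in> E \<Longrightarrow> (\<Sum>i\<in>E. l i * G i j) + \<kappa> * b j * l j = 0"
    and pos: "0 < (\<Sum>i\<in>E. l i * b i * r i)"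
  obtains \<delta> u where "0 < \<delta>" "\<delta> < 1" "\<And>i. i \<in> E \<Longrightarrow> 0 < u i"
    "\<And>j. j \<in> E \<Longrightarrow> 0 < (\<Sum>i\<in>E. u i * G i j) + (\<kappa> + \<delta>) * b j * u j"
proof -
  define R where "R = (\<Sum>i\<in>E. r i)"
  have R: "0 < R" unfolding R_def using r(1) finE neE by (intro sum_pos) auto
  define t where "t = (\<Sum>i\<in>E. l i * b i * r i) / R"
  have t: "0 < t" unfolding t_def using pos R by simp
  have "(\<Sum>i\<in>E. r i * (t - l i * b i)) = (\<Sum>i\<in>E. t * r i - l i * b i * r i)"
    by (intro sum.cong) (simp_all add: algebra_simps)
  also have "\<dots> = t * R - (\<Sum>i\<in>E. l i * b i * r i)"
    by (simp add: R_def sum_subtractf sum_distrib_left)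
  also have "\<dots> = 0" using R by (simp add: t_def)
  finally have orth: "(\<Sum>i\<in>E. r i * (t - l i * b i)) = 0" .
  note irrT = irreducible_metzler_transpose[OF irreducible_metzler_tilted[OF irr, of b \<kappa>]]
  have "\<exists>w. \<forall>i\<in>E. (\<Sum>j\<in>E. tilted G b \<kappa> j i * w j) = t - l i * b i"
  proof (rule fredholm_alternative[OF irrT l(1) _ r(1) _ orth])
    show "(\<Sum>j\<in>E. tilted G b \<kappa> j i * l j) = 0" if "i \<in> E" for i
      using l(2)[OF that] sum_tilted_left[OF finE that, of l G b \<kappa>] by (simp add: mult.commute)
    show "(\<Sum>i\<in>E. r i * tilted G b \<kappa> j i) = 0" if "j \<in> E" for j
      using r(2)[OF that] sum_tilted_right[OF finE that, of G b \<kappa> r] by (simp add: mult.commute)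
  qed auto
  then obtain w where "\<forall>i\<in>E. (\<Sum>j\<in>E. tilted G b \<kappa> j i * w j) = t - l i * b i" ..
  then have w: "\<forall>i\<in>E. (\<Sum>j\<in>E. w j * tilted G b \<kappa> j i) = t - l i * b i"
    by (simp add: mult.commute)
  define D where "D = 1 + (\<Sum>i\<in>E. \<bar>w i\<bar> / l i + \<bar>b i * w i\<bar>)"
  have nn: "0 \<le> \<bar>w i\<bar> / l i + \<bar>b i * w i\<bar>" if "i \<in> E" for i
    using l(1)[OF that] by (intro add_nonneg_nonneg divide_nonneg_pos) auto
  have D1: "1 \<le> D" unfolding D_def using sum_nonneg[of E, OF nn] by simp
  have D: "\<bar>w i\<bar> / l i + \<bar>b i * w i\<bar> < D" if "i \<in> E" for i
    using member_le_sum[OF that, of "\<lambda>i. \<bar>w i\<bar> / l i + \<bar>b i * w i\<bar>"] nn finE unfolding D_def by simp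
  define d where "d = min (1/2) (min (1 / D) (t / D))"
  have d: "0 < d" "d < 1" "d \<le> 1 / D" "d \<le> t / D" unfolding d_def using D1 t by auto
  have dD: "d * D \<le> 1" "d * D \<le> t" using d(3,4) D1 by (simp_all add: pos_le_divide_eq)
  define u where "u i = l i + d * w i" for i
  have "0 < u i" if "i \<in> E" for i
  proof -
    have "\<bar>w i\<bar> / l i < D" using D[OF that] abs_ge_zero[of "b i * w i"] by linarith
    then have "\<bar>w i\<bar> < D * l i" using l(1)[OF that] by (simp add: pos_divide_less_eq)
    then have "d * \<bar>w i\<bar> < d * (D * l i)" using d(1) by (rule mult_strict_left_mono)
    also have "\<dots> \<le> 1 * l i" unfolding mult.assoc[symmetric] using dD(1) l(1)[OF that] by (intro mult_right_mono) auto
    finally have "d * \<bar>w i\<bar> < l i" by simp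
    moreover have "\<bar>d * w i\<bar> = d * \<bar>w i\<bar>" using d(1) by (simp add: abs_mult)
    ultimately show ?thesis unfolding u_def by linarith
  qed
  moreover have "0 < (\<Sum>i\<in>E. u i * G i j) + (\<kappa> + d) * b j * u j" if "j \<in> E" for j
  proof -
    have e1: "(\<Sum>i\<in>E. u i * G i j) = (\<Sum>i\<in>E. l i * G i j) + d * (\<Sum>i\<in>E. w i * G i j)"
      by (simp add: u_def distrib_right sum.distrib sum_distrib_left mult.assoc)
    have e2: "(\<Sum>i\<in>E. w i * G i j) = t - l j * b j - \<kappa> * b j * w j"
      using w[rule_format, OF that] sum_tilted_left[OF finE that, of w G b \<kappa>] by linarith
    have e3: "(\<Sum>i\<in>E. l i * G i j) = - (\<kappa> * b j * l j)" using l(2)[OF that] by linarith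
    have "(\<Sum>i\<in>E. u i * G i j) + (\<kappa> + d) * b j * u j = d * (t + d * (b j * w j))"
      unfolding e1 e2 e3 u_def[of j] by (simp add: algebra_simps)
    moreover have "0 < t + d * (b j * w j)"
    proof -
      have "0 \<le> \<bar>w j\<bar> / l j" using l(1)[OF that] by (intro divide_nonneg_pos) auto
      then have "\<bar>b j * w j\<bar> < D" using D[OF that] by linarith
      then have "d * \<bar>b j * w j\<bar> < d * D" using d(1) by (rule mult_strict_left_mono)
      moreover have "\<bar>d * (b j * w j)\<bar> = d * \<bar>b j * w j\<bar>" using d(1) by (simp add: abs_mult)
      ultimately show ?thesis using dD(2) by linarith
    qed
    ultimately show ?thesis using d(1) by simp
  qed
  ultimately show thesis using that[of d u] d(1,2) by blast
qed

end

section \<open>The jump chain and its holding times\<close>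

abbreviation exponential_law :: "real \<Rightarrow> real measure" where
  "exponential_law l \<equiv> density lborel (exponential_density l)"

lemma measure_exponential_law_greaterThan:
  assumes "0 < l"
  shows "measure (exponential_law l) {t<..} = exp (- l * max t 0)"
proof -
  interpret prob_space "exponential_law l" by (rule prob_space_exponential_density[OF assms])
  have D: "distributed (exponential_law l) lborel (\<lambda>x. x) (exponential_density l)"
    unfolding distributed_def by (intro conjI) (simp_all add: distr_id2)
  have "measure (exponential_law l) {x \<in> space (exponential_law l). max t 0 < x} = exp (- l * max t 0)"
    using exponential_distributedD_gt[OF D, of "max t 0"] assms by (simp add: mult.commute)
  moreover have "measure (exponential_law l) {t<..} = measure (exponential_law l) {x \<in> space (exponential_law l). max t 0 < x}"
  proof (rule finite_measure_eq_AE)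
    have "AE x in lborel. x \<noteq> 0" by (rule AE_lborel_singleton)
    then show "AE x in exponential_law l. (x \<in> {t<..}) = (x \<in> {x \<in> space (exponential_law l). max t 0 < x})"
      by (subst AE_density) (auto simp: exponential_density_def elim!: eventually_mono)
  qed auto
  ultimately show ?thesis by simp
qed

locale jump_chain = prob_space Q for Q :: "'a measure" +
  fixes E :: "nat set" and lam :: "nat \<Rightarrow> real" and q :: "nat \<Rightarrow> nat \<Rightarrow> real"
    and Z :: "nat \<Rightarrow> 'a \<Rightarrow> nat" and T :: "nat \<Rightarrow> 'a \<Rightarrow> real"
  assumes finE: "finite E"
    and lam_pos: "\<And>i. i \<in> E \<Longrightarrow> 0 < lam i"
    and q_nonneg: "\<And>i j. i \<in> E \<Longrightarrow> j \<in> E \<Longrightarrow> 0 \<le> q i j"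
    and q_sum: "\<And>i. i \<in> E \<Longrightarrow> (\<Sum>j\<in>E. q i j) = 1"
    and Z_measurable: "\<And>n. Z n \<in> measurable Q (count_space E)"
    and T_measurable[measurable]: "\<And>n. T n \<in> borel_measurable Q"
    and T_pos: "\<And>n \<omega>. \<omega> \<in> space Q \<Longrightarrow> 0 < T n \<omega>"
    and T_diverges: "\<And>\<omega>. \<omega> \<in> space Q \<Longrightarrow> filterlim (\<lambda>n. \<Sum>k<n. T k \<omega>) at_top sequentially"
    and joint_law: "\<And>n z s. (\<forall>k\<le>n. z k \<in> E \<and> 0 \<le> s k) \<Longrightarrow>
      prob {\<omega>\<in>space Q. \<forall>k\<le>n. Z k \<omega> = z k \<and> s k < T k \<omega>} =
      prob {\<omega>\<in>space Q. Z 0 \<omega> = z 0} * (\<Prod>k<n. q (z k) (z (Suc k))) * (\<Prod>k\<le>n. exp (- lam (z k) * s k))"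
begin

lemma Z_in_E: "\<omega> \<in> space Q \<Longrightarrow> Z n \<omega> \<in> E"
  using measurable_space[OF Z_measurable] by auto

lemma Z_measurable_UNIV[measurable]: "Z n \<in> measurable Q (count_space UNIV)"
proof (rule measurableI)
  fix A :: "nat set"
  have "Z n -` A \<inter> space Q = Z n -` (A \<inter> E) \<inter> space Q" using Z_in_E by auto
  also have "\<dots> \<in> sets Q" by (rule measurable_sets[OF Z_measurable]) auto
  finally show "Z n -` A \<inter> space Q \<in> sets Q" .
qed auto

text \<open>The events determined by the first \<open>n + 1\<close> states and the first \<open>n\<close> holding times.\<close>

definition cylinder :: "nat \<Rightarrow> (nat \<Rightarrow> nat) \<Rightarrow> (nat \<Rightarrow> real) \<Rightarrow> 'a set" where
  "cylinder n z s = {\<omega>\<in>space Q. (\<forall>k\<le>n. Z k \<omega> = z k) \<and> (\<forall>k<n. s k < T k \<omega>)}"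

definition cylinders :: "nat \<Rightarrow> 'a set set" where
  "cylinders n = insert {} {cylinder n z s |z s. (\<forall>k. z k \<in> E) \<and> (\<forall>k. 0 \<le> s k)}"

definition past :: "nat \<Rightarrow> 'a measure" where
  "past n = sigma (space Q) (cylinders n)"

lemma cylinder_sets[measurable]: "cylinder n z s \<in> sets Q"
  unfolding cylinder_def by measurable

lemma cylinders_sets: "cylinders n \<subseteq> sets Q"
  unfolding cylinders_def by auto

lemma cylinders_Pow: "cylinders n \<subseteq> Pow (space Q)"
  unfolding cylinders_def cylinder_def by auto

lemma sets_past: "sets (past n) = sigma_sets (space Q) (cylinders n)" and space_past: "space (past n) = space Q"
  unfolding past_def using cylinders_Pow[of n] by (auto simp: sets_measure_of space_measure_of)

lemma past_sets_subset: "sets (past n) \<subseteq> sets Q"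
  unfolding sets_past by (rule sets.sigma_sets_subset[OF cylinders_sets])

lemma Int_stable_cylinders: "Int_stable (cylinders n)"
proof (rule Int_stableI)
  fix A B assume A: "A \<in> cylinders n" and B: "B \<in> cylinders n"
  show "A \<inter> B \<in> cylinders n"
  proof (cases "A = {} \<or> B = {}")
    case True then show ?thesis by (auto simp: cylinders_def)
  next
    case False
    then obtain z s z' s' where *: "A = cylinder n z s" "B = cylinder n z' s'"
      "\<forall>k. z k \<in> E" "\<forall>k. 0 \<le> s k" "\<forall>k. z' k \<in> E" "\<forall>k. 0 \<le> s' k"
      using A B unfolding cylinders_def by blast
    show ?thesis
    proof (cases "\<forall>k\<le>n. z k = z' k")
      case True
      then have "A \<inter> B = cylinder n z (\<lambda>k. max (s k) (s' k))"
        unfolding * cylinder_def by auto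
      moreover have "\<forall>k. 0 \<le> max (s k) (s' k)" using * by (simp add: le_max_iff_disj)
      ultimately show ?thesis using *(3) unfolding cylinders_def by blast
    next
      case False
      then have "A \<inter> B = {}" unfolding * cylinder_def by auto
      then show ?thesis by (simp add: cylinders_def)
    qed
  qed
qed

definition words :: "nat \<Rightarrow> (nat \<Rightarrow> nat) set" where
  "words n = PiE_dflt {..n} (SOME i. i \<in> E) (\<lambda>_. E)"

lemma finite_words: "finite (words n)"
  unfolding words_def by (intro finite_PiE_dflt finE) auto

lemma E_nonempty: "E \<noteq> {}"
  using Z_in_E not_empty by blast

lemma words_in_E: "z \<in> words n \<Longrightarrow> z k \<in> E"
  using some_in_eq[of E] E_nonempty unfolding words_def PiE_dflt_def
  by (cases "k \<le> n") auto

lemma word_of: 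
  assumes "\<omega> \<in> space Q"
  shows "\<exists>z\<in>words n. \<forall>k\<le>n. Z k \<omega> = z k"
  unfolding words_def using Z_in_E[OF assms]
  by (intro bexI[of _ "\<lambda>k. if k \<le> n then Z k \<omega> else (SOME i. i \<in> E)"]) (auto simp: PiE_dflt_def)

lemma words_eqI:
  assumes "z \<in> words n" "z' \<in> words n" "\<forall>k\<le>n. z k = z' k"
  shows "z = z'"
proof
  fix k show "z k = z' k" using assms unfolding words_def PiE_dflt_def by (cases "k \<le> n") auto
qed

lemma cylinder_in_past: "z \<in> words n \<Longrightarrow> (\<And>k. 0 \<le> s k) \<Longrightarrow> cylinder n z s \<in> sets (past n)"
  unfolding sets_past by (rule sigma_sets.Basic) (auto simp: cylinders_def intro: words_in_E)

lemma past_Z[measurable]: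
  assumes "k \<le> n"
  shows "Z k \<in> measurable (past n) (count_space UNIV)"
proof (rule measurableI)
  fix A :: "nat set"
  have "Z k -` A \<inter> space (past n) = (\<Union>z\<in>{z\<in>words n. z k \<in> A}. cylinder n z (\<lambda>_. 0))"
    using assms word_of[of _ n] T_pos by (fastforce simp: space_past cylinder_def)
  also have "\<dots> \<in> sets (past n)"
    by (intro sets.finite_UN) (auto intro: cylinder_in_past finite_subset[OF _ finite_words])
  finally show "Z k -` A \<inter> space (past n) \<in> sets (past n)" .
qed auto

lemma past_T[measurable]:
  assumes "k < n"
  shows "T k \<in> borel_measurable (past n)"
  unfolding borel_measurable_iff_greater
proof
  fix a :: real
  have "{w \<in> space (past n). a < T k w} = (\<Union>z\<in>words n. cylinder n z (\<lambda>m. if m = k then max a 0 else 0))"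
  proof (intro equalityI subsetI)
    fix w assume w: "w \<in> {w \<in> space (past n). a < T k w}"
    then obtain z where "z \<in> words n" "\<forall>k\<le>n. Z k w = z k" using word_of[of w n] by (auto simp: space_past)
    then show "w \<in> (\<Union>z\<in>words n. cylinder n z (\<lambda>m. if m = k then max a 0 else 0))"
      using w T_pos by (intro UN_I[of z]) (auto simp: space_past cylinder_def)
  next
    fix w assume "w \<in> (\<Union>z\<in>words n. cylinder n z (\<lambda>m. if m = k then max a 0 else 0))"
    then have "w \<in> space Q" "(if k = k then max a 0 else 0) < T k w"
      using assms unfolding cylinder_def by blast+
    then show "w \<in> {w \<in> space (past n). a < T k w}" by (simp add: space_past)
  qed
  also have "\<dots> \<in> sets (past n)"
    by (intro sets.finite_UN cylinder_in_past finite_words) auto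
  finally show "{w \<in> space (past n). a < T k w} \<in> sets (past n)" .
qed

definition next_event :: "nat \<Rightarrow> nat \<Rightarrow> nat \<Rightarrow> real \<Rightarrow> 'a set" where
  "next_event n i j t = {\<omega>\<in>space Q. Z n \<omega> = i \<and> Z (Suc n) \<omega> = j \<and> t < T n \<omega>}"

lemma next_event_sets[measurable]: "next_event n i j t \<in> sets Q"
  unfolding next_event_def by measurable

lemma prob_cylinder:
  assumes "\<forall>k. z k \<in> E" "\<forall>k. 0 \<le> s k"
  shows "prob (cylinder n z s) = prob {\<omega>\<in>space Q. Z 0 \<omega> = z 0} * (\<Prod>k<n. q (z k) (z (Suc k)))
      * (\<Prod>k<n. exp (- lam (z k) * s k))"
proof -
  have "cylinder n z s = {\<omega>\<in>space Q. \<forall>k\<le>n. Z k \<omega> = z k \<and> (s(n := 0)) k < T k \<omega>}"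
    unfolding cylinder_def using T_pos by (auto simp: le_less)
  moreover have "(\<Prod>k\<le>n. exp (- lam (z k) * (s(n := 0)) k)) = (\<Prod>k<n. exp (- lam (z k) * s k))"
    unfolding lessThan_Suc_atMost[symmetric] by (simp add: prod.lessThan_Suc)
  ultimately show ?thesis using joint_law[of n z "s(n := 0)"] assms by auto
qed

lemma prob_cylinder_next:
  assumes z: "\<forall>k. z k \<in> E" "\<forall>k. 0 \<le> s k" and ij: "i \<in> E" "j \<in> E" "0 \<le> t"
  shows "prob (cylinder n z s \<inter> next_event n i j t) =
    q i j * exp (- lam i * t) * prob (cylinder n z s \<inter> {\<omega>\<in>space Q. Z n \<omega> = i})"
proof (cases "z n = i")
  case False
  then have "cylinder n z s \<inter> next_event n i j t = {}" "cylinder n z s \<inter> {\<omega>\<in>space Q. Z n \<omega> = i} = {}"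
    unfolding cylinder_def next_event_def by auto
  then show ?thesis by simp
next
  case True
  define z' where "z' = z(Suc n := j)"
  define s' where "s' = s(n := t)"
  have e1: "cylinder n z s \<inter> next_event n i j t = cylinder (Suc n) z' s'"
    unfolding cylinder_def next_event_def z'_def s'_def
    by (auto simp: True le_Suc_eq less_Suc_eq)
  have e2: "cylinder n z s \<inter> {\<omega>\<in>space Q. Z n \<omega> = i} = cylinder n z s"
    unfolding cylinder_def using True by auto
  have "(\<Prod>k<Suc n. q (z' k) (z' (Suc k))) = (\<Prod>k<n. q (z k) (z (Suc k))) * q i j"
    unfolding prod.lessThan_Suc by (auto simp: z'_def True intro!: prod.cong)
  moreover have "(\<Prod>k<Suc n. exp (- lam (z' k) * s' k)) = (\<Prod>k<n. exp (- lam (z k) * s k)) * exp (- lam i * t)"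
    unfolding prod.lessThan_Suc by (auto simp: z'_def s'_def True intro!: prod.cong)
  moreover have "z' 0 = z 0" by (simp add: z'_def)
  moreover have "\<forall>k. z' k \<in> E" "\<forall>k. 0 \<le> s' k" using z ij by (auto simp: z'_def s'_def)
  ultimately show ?thesis unfolding e1 e2 prob_cylinder[OF z] by (simp add: prob_cylinder)
qed

text \<open>Given the past, the holding time in state \<open>i\<close> is exponential and the next state is drawn from
  \<open>q i\<close>: both sides are measures in \<open>A\<close> that agree on the cylinders, which generate the past.\<close>

lemma markov_step_event:
  assumes A: "A \<in> sets (past n)" and ij: "i \<in> E" "j \<in> E" "0 \<le> t"
  shows "prob (A \<inter> next_event n i j t) =
    q i j * exp (- lam i * t) * prob (A \<inter> {\<omega>\<in>space Q. Z n \<omega> = i})"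
proof -
  define N where "N = next_event n i j t"
  define I where "I = {\<omega>\<in>space Q. Z n \<omega> = i}"
  define c where "c = q i j * exp (- lam i * t)"
  have [measurable]: "N \<in> sets Q" "I \<in> sets Q" unfolding N_def I_def by measurable
  have sub: "B \<in> sets Q" if "B \<in> sigma_sets (space Q) (cylinders n)" for B
    using that past_sets_subset[of n] unfolding sets_past by blast
  have cyl: "prob (cylinder n z s \<inter> N) = c * prob (cylinder n z s \<inter> I)"
    if "\<forall>k. z k \<in> E" "\<forall>k. 0 \<le> s k" for z s
    unfolding N_def I_def c_def using prob_cylinder_next[OF that ij] .
  have whole: "prob N = c * prob I"
  proof -
    have disj: "disjoint_family_on (\<lambda>z. cylinder n z (\<lambda>_. 0) \<inter> S) (words n)" for S
      unfolding disjoint_family_on_def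
    proof (intro ballI impI)
      fix z z' assume z: "z \<in> words n" "z' \<in> words n" "z \<noteq> z'"
      then obtain k where "k \<le> n" "z k \<noteq> z' k" using words_eqI by blast
      then show "(cylinder n z (\<lambda>_. 0) \<inter> S) \<inter> (cylinder n z' (\<lambda>_. 0) \<inter> S) = {}"
        unfolding cylinder_def by auto
    qed
    have split: "prob S = (\<Sum>z\<in>words n. prob (cylinder n z (\<lambda>_. 0) \<inter> S))" if S: "S \<in> sets Q" for S
    proof -
      have "S = (\<Union>z\<in>words n. cylinder n z (\<lambda>_. 0) \<inter> S)"
      proof (intro equalityI subsetI)
        fix w assume w: "w \<in> S"
        then have "w \<in> space Q" using sets.sets_into_space[OF S] by blast
        then obtain z where "z \<in> words n" "\<forall>k\<le>n. Z k w = z k" using word_of[of w n] by blast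
        then show "w \<in> (\<Union>z\<in>words n. cylinder n z (\<lambda>_. 0) \<inter> S)"
          using w \<open>w \<in> space Q\<close> T_pos by (intro UN_I[of z]) (auto simp: cylinder_def)
      qed auto
      then have "prob S = prob (\<Union>z\<in>words n. cylinder n z (\<lambda>_. 0) \<inter> S)" by simp
      also have "\<dots> = (\<Sum>z\<in>words n. prob (cylinder n z (\<lambda>_. 0) \<inter> S))"
        by (rule finite_measure_finite_Union[OF finite_words _ disj]) (use S in auto)
      finally show ?thesis .
    qed
    have "prob N = (\<Sum>z\<in>words n. prob (cylinder n z (\<lambda>_. 0) \<inter> N))" by (rule split) measurable
    also have "\<dots> = (\<Sum>z\<in>words n. c * prob (cylinder n z (\<lambda>_. 0) \<inter> I))"
      by (intro sum.cong refl cyl) (auto intro: words_in_E)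
    also have "\<dots> = c * prob I" unfolding sum_distrib_left[symmetric]
      by (subst split[symmetric]) auto
    finally show ?thesis .
  qed
  have "A \<in> sigma_sets (space Q) (cylinders n)" using A unfolding sets_past .
  with Int_stable_cylinders cylinders_Pow have "prob (A \<inter> N) = c * prob (A \<inter> I)"
  proof (induct rule: sigma_sets_induct_disjoint)
    case (basic A)
    then show ?case using cyl unfolding cylinders_def by auto
  next
    case empty
    then show ?case by simp
  next
    case (compl A)
    have [measurable]: "A \<in> sets Q" using compl(1) by (rule sub)
    have d: "prob ((space Q - A) \<inter> S) = prob S - prob (A \<inter> S)" if S[measurable]: "S \<in> sets Q" for S
    proof -
      have "(space Q - A) \<inter> S = S - (A \<inter> S)" using sets.sets_into_space[OF S] by auto
      then show ?thesis using finite_measure_Diff[of S "A \<inter> S"] by simp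
    qed
    show ?case using compl(2) whole by (simp add: d right_diff_distrib)
  next
    case (union A)
    have s: "(\<lambda>k. prob (A k \<inter> S)) sums prob ((\<Union>k. A k) \<inter> S)" if S: "S \<in> sets Q" for S
    proof -
      have "(\<lambda>k. prob (A k \<inter> S)) sums prob (\<Union>k. A k \<inter> S)"
        using union S sub by (intro finite_measure_UNION) (auto simp: disjoint_family_on_def)
      then show ?thesis by (simp add: Int_UN_distrib2)
    qed
    have "(\<lambda>k. prob (A k \<inter> N)) sums (c * prob ((\<Union>k. A k) \<inter> I))"
      using sums_mult[OF s[of I], of c] union(3) by simp
    then show ?case using s[of N] sums_unique2 by auto
  qed
  then show ?thesis unfolding N_def I_def c_def .
qed

end

context jump_chain
begin

lemma markov_step_law:
  assumes U[measurable]: "U \<in> measurable (past n) S" and ij: "i \<in> E" "j \<in> E"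
  defines "I \<equiv> {\<omega>\<in>space Q. Z n \<omega> = i}" and "J \<equiv> {\<omega>\<in>space Q. Z n \<omega> = i \<and> Z (Suc n) \<omega> = j}"
  shows "distr (density Q (\<lambda>\<omega>. ennreal (q i j) * indicator I \<omega>)) S U \<Otimes>\<^sub>M exponential_law (lam i) =
    distr (density Q (indicator J)) (S \<Otimes>\<^sub>M borel) (\<lambda>\<omega>. (U \<omega>, T n \<omega>))" (is "?M1 \<Otimes>\<^sub>M ?X = ?D")
proof -
  have UQ[measurable]: "U \<in> measurable Q S"
    using measurable_sets[OF U] measurable_space[OF U] past_sets_subset[of n]
    by (intro measurableI) (auto simp: space_past)
  have [measurable]: "I \<in> sets Q" "J \<in> sets Q" unfolding I_def J_def by measurable
  have q0: "0 \<le> q i j" using q_nonneg ij by simp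
  interpret X: prob_space ?X by (rule prob_space_exponential_density[OF lam_pos[OF ij(1)]])
  have M1: "emeasure ?M1 A = ennreal (q i j * prob (U -` A \<inter> I))" if A[measurable]: "A \<in> sets S" for A
  proof -
    have "emeasure ?M1 A = (\<integral>\<^sup>+\<omega>. ennreal (q i j) * indicator I \<omega> * indicator (U -` A \<inter> space Q) \<omega> \<partial>Q)"
      using A by (subst emeasure_distr) (auto simp: emeasure_density)
    also have "\<dots> = (\<integral>\<^sup>+\<omega>. ennreal (q i j) * indicator (U -` A \<inter> I) \<omega> \<partial>Q)"
      by (intro nn_integral_cong) (auto simp: indicator_def I_def)
    also have "\<dots> = ennreal (q i j) * emeasure Q (U -` A \<inter> I)"
    proof -
      have "U -` A \<inter> I = (U -` A \<inter> space Q) \<inter> I" by (auto simp: I_def)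
      then have "U -` A \<inter> I \<in> sets Q" using measurable_sets[OF UQ A] by auto
      then show ?thesis by (rule nn_integral_cmult_indicator)
    qed
    finally show ?thesis using q0 by (simp add: emeasure_eq_measure ennreal_mult)
  qed
  show ?thesis
  proof (rule pair_measure_eqI)
    show "sigma_finite_measure ?X" by unfold_locales
    have "finite_measure ?M1"
      by (rule finite_measureI) (use M1[of "space S"] in simp)
    then show "sigma_finite_measure ?M1" unfolding finite_measure_def by simp
    show "sets (?M1 \<Otimes>\<^sub>M ?X) = sets ?D" by (simp cong: sets_pair_measure_cong)
    fix A B assume "A \<in> sets ?M1" and B: "B \<in> sets ?X"
    then have A[measurable]: "A \<in> sets S" by simp
    define A' where "A' = U -` A \<inter> space Q"
    have A'[measurable]: "A' \<in> sets Q" "A' \<in> sets (past n)"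
      unfolding A'_def using measurable_sets[OF UQ A] measurable_sets[OF U A] by (simp_all add: space_past)
    define N1 where "N1 = distr (density Q (indicator (A' \<inter> J))) borel (T n)"
    define N2 where "N2 = density ?X (\<lambda>_. ennreal (q i j * prob (A' \<inter> I)))"
    have N1e: "emeasure N1 C = emeasure Q (T n -` C \<inter> (A' \<inter> J))" if C[measurable]: "C \<in> sets borel" for C
    proof -
      have TC[measurable]: "T n -` C \<inter> space Q \<in> sets Q" by (rule measurable_sets[OF T_measurable C])
      have "emeasure N1 C = (\<integral>\<^sup>+\<omega>. indicator (A' \<inter> J) \<omega> * indicator (T n -` C \<inter> space Q) \<omega> \<partial>Q)"
        unfolding N1_def by (subst emeasure_distr) (auto simp: emeasure_density)
      also have "\<dots> = (\<integral>\<^sup>+\<omega>. indicator ((T n -` C \<inter> space Q) \<inter> (A' \<inter> J)) \<omega> \<partial>Q)"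
        by (intro nn_integral_cong) (auto simp: indicator_def)
      also have "\<dots> = emeasure Q ((T n -` C \<inter> space Q) \<inter> (A' \<inter> J))" by (rule nn_integral_indicator) auto
      also have "(T n -` C \<inter> space Q) \<inter> (A' \<inter> J) = T n -` C \<inter> (A' \<inter> J)" by (auto simp: J_def)
      finally show ?thesis .
    qed
    have "N1 = N2"
    proof (rule measure_eqI_lessThan)
      show "sets N1 = sets borel" "sets N2 = sets borel" by (simp_all add: N1_def N2_def)
      fix x
      show "emeasure N1 {x<..} < \<infinity>" by (simp add: N1e emeasure_eq_measure)
      have "T n -` {x<..} \<inter> (A' \<inter> J) = A' \<inter> next_event n i j (max x 0)"
        using T_pos by (auto simp: J_def next_event_def)
      then have "emeasure N1 {x<..} = ennreal (q i j * exp (- lam i * max x 0) * prob (A' \<inter> I))"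
        using markov_step_event[OF A'(2) ij, of "max x 0"] by (simp add: N1e emeasure_eq_measure I_def)
      also have "\<dots> = ennreal (q i j * prob (A' \<inter> I)) * ennreal (measure ?X {x<..})"
        using q0 measure_exponential_law_greaterThan[OF lam_pos[OF ij(1)], of x]
        by (simp add: ennreal_mult[symmetric] mult_ac)
      also have "\<dots> = emeasure N2 {x<..}"
        unfolding N2_def by (simp add: emeasure_density_const X.emeasure_eq_measure)
      finally show "emeasure N1 {x<..} = emeasure N2 {x<..}" .
    qed
    have "emeasure ?M1 A * emeasure ?X B = emeasure N2 B"
    proof -
      have "U -` A \<inter> I = A' \<inter> I" by (auto simp: A'_def I_def)
      then show ?thesis unfolding N2_def using B by (simp add: emeasure_density_const M1[OF A])
    qed
    also have "\<dots> = emeasure Q (T n -` B \<inter> (A' \<inter> J))" using B N1e \<open>N1 = N2\<close> by simp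
    also have "\<dots> = emeasure ?D (A \<times> B)"
    proof -
      have B': "B \<in> sets borel" using B by simp
      have s: "(\<lambda>\<omega>. (U \<omega>, T n \<omega>)) -` (A \<times> B) \<inter> space Q \<in> sets Q"
        using A B' by (intro measurable_sets[of _ _ "S \<Otimes>\<^sub>M borel"]) auto
      have "emeasure ?D (A \<times> B) = (\<integral>\<^sup>+\<omega>. indicator J \<omega> * indicator ((\<lambda>\<omega>. (U \<omega>, T n \<omega>)) -` (A \<times> B) \<inter> space Q) \<omega> \<partial>Q)"
        using s A B' by (subst emeasure_distr) (auto simp: emeasure_density)
      also have "\<dots> = (\<integral>\<^sup>+\<omega>. indicator (J \<inter> ((\<lambda>\<omega>. (U \<omega>, T n \<omega>)) -` (A \<times> B) \<inter> space Q)) \<omega> \<partial>Q)"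
        by (intro nn_integral_cong) (auto simp: indicator_def)
      also have "\<dots> = emeasure Q (J \<inter> ((\<lambda>\<omega>. (U \<omega>, T n \<omega>)) -` (A \<times> B) \<inter> space Q))"
        using s by (intro nn_integral_indicator) auto
      also have "J \<inter> ((\<lambda>\<omega>. (U \<omega>, T n \<omega>)) -` (A \<times> B) \<inter> space Q) = T n -` B \<inter> (A' \<inter> J)"
        by (auto simp: A'_def J_def)
      finally show ?thesis by simp
    qed
    finally show "emeasure ?M1 A * emeasure ?X B = emeasure ?D (A \<times> B)" .
  qed
qed

lemma markov_step_integral:
  fixes g :: "'s \<Rightarrow> real \<Rightarrow> real"
  assumes U[measurable]: "U \<in> measurable (past n) S" and ij: "i \<in> E" "j \<in> E"
    and g[measurable]: "(\<lambda>(u, s). g u s) \<in> borel_measurable (S \<Otimes>\<^sub>M borel)"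
    and B: "\<And>u s. \<bar>g u s\<bar> \<le> B"
  defines "I \<equiv> {\<omega>\<in>space Q. Z n \<omega> = i}" and "J \<equiv> {\<omega>\<in>space Q. Z n \<omega> = i \<and> Z (Suc n) \<omega> = j}"
  shows "(\<integral>\<omega>. indicator J \<omega> * g (U \<omega>) (T n \<omega>) \<partial>Q) =
    q i j * (\<integral>\<omega>. indicator I \<omega> * (\<integral>s. g (U \<omega>) s \<partial>exponential_law (lam i)) \<partial>Q)"
proof -
  have UQ[measurable]: "U \<in> measurable Q S"
    using measurable_sets[OF U] measurable_space[OF U] past_sets_subset[of n]
    by (intro measurableI) (auto simp: space_past)
  have [measurable]: "I \<in> sets Q" "J \<in> sets Q" unfolding I_def J_def by measurable
  have q0: "0 \<le> q i j" using q_nonneg ij by simp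
  let ?X = "exponential_law (lam i)"
  let ?M1 = "distr (density Q (\<lambda>\<omega>. ennreal (q i j * indicator I \<omega>))) S U"
  let ?D = "distr (density Q (\<lambda>\<omega>. ennreal (indicator J \<omega>))) (S \<Otimes>\<^sub>M borel) (\<lambda>\<omega>. (U \<omega>, T n \<omega>))"
  interpret X: prob_space ?X by (rule prob_space_exponential_density[OF lam_pos[OF ij(1)]])
  have eq: "?M1 \<Otimes>\<^sub>M ?X = ?D"
    using markov_step_law[OF U ij] q0 unfolding I_def J_def
    by (simp add: ennreal_mult' ennreal_indicator)
  have fin: "finite_measure ?M1"
  proof (rule finite_measureI)
    have "emeasure ?M1 (space ?M1) = (\<integral>\<^sup>+\<omega>. ennreal (q i j * indicator I \<omega>) \<partial>Q)"
      using measurable_space[OF UQ]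
      by (subst emeasure_distr) (auto simp: emeasure_density intro!: nn_integral_cong simp: indicator_def)
    also have "\<dots> \<le> (\<integral>\<^sup>+\<omega>. ennreal (q i j) \<partial>Q)"
      by (intro nn_integral_mono ennreal_leI) (auto simp: indicator_def q0)
    also have "\<dots> < \<infinity>" by (simp add: emeasure_space_1)
    finally show "emeasure ?M1 (space ?M1) \<noteq> \<infinity>" by simp
  qed
  then interpret M1: finite_measure ?M1 .
  interpret P: pair_sigma_finite ?M1 ?X ..
  have finP: "finite_measure (?M1 \<Otimes>\<^sub>M ?X)"
    using finite_measure_pair_measure[OF X.finite_measure_axioms fin] X.finite_measure_axioms fin
    by (simp add: finite_measure_pair_measure)
  have gint: "integrable (?M1 \<Otimes>\<^sub>M ?X) (\<lambda>(u, s). g u s)"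
    by (rule finite_measure.integrable_const_bound[OF finP, of _ B]) (auto simp: B)
  have "(\<integral>\<omega>. indicator J \<omega> * g (U \<omega>) (T n \<omega>) \<partial>Q) = (\<integral>x. (case x of (u, s) \<Rightarrow> g u s) \<partial>?D)"
    by (subst integral_distr) (auto simp: integral_real_density)
  also have "\<dots> = (\<integral>u. (\<integral>s. g u s \<partial>?X) \<partial>?M1)"
    using P.integral_fst'[OF gint] unfolding eq by simp
  also have "\<dots> = (\<integral>\<omega>. q i j * indicator I \<omega> * (\<integral>s. g (U \<omega>) s \<partial>?X) \<partial>Q)"
  proof -
    have [measurable]: "(\<lambda>u. \<integral>s. g u s \<partial>?X) \<in> borel_measurable S"
      by (rule X.borel_measurable_lebesgue_integral) simp
    show ?thesis by (subst integral_distr) (auto simp: integral_real_density q0)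
  qed
  finally show ?thesis by (simp add: mult.assoc)
qed

lemma markov_step_expectation:
  fixes g :: "nat \<Rightarrow> nat \<Rightarrow> 's \<Rightarrow> real \<Rightarrow> real"
  assumes U[measurable]: "U \<in> measurable (past n) S"
    and g: "\<And>i j. i \<in> E \<Longrightarrow> j \<in> E \<Longrightarrow> (\<lambda>(u, s). g i j u s) \<in> borel_measurable (S \<Otimes>\<^sub>M borel)"
    and B: "\<And>i j u s. i \<in> E \<Longrightarrow> j \<in> E \<Longrightarrow> \<bar>g i j u s\<bar> \<le> B"
  shows "(\<integral>\<omega>. g (Z n \<omega>) (Z (Suc n) \<omega>) (U \<omega>) (T n \<omega>) \<partial>Q) =
    (\<integral>\<omega>. (\<Sum>i\<in>E. indicator {\<omega>\<in>space Q. Z n \<omega> = i} \<omega> *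
        (\<Sum>j\<in>E. q i j * (\<integral>s. g i j (U \<omega>) s \<partial>exponential_law (lam i)))) \<partial>Q)"
proof -
  have UQ[measurable]: "U \<in> measurable Q S"
    using measurable_sets[OF U] measurable_space[OF U] past_sets_subset[of n]
    by (intro measurableI) (auto simp: space_past)
  let ?I = "\<lambda>i. {\<omega>\<in>space Q. Z n \<omega> = i}" and ?J = "\<lambda>i j. {\<omega>\<in>space Q. Z n \<omega> = i \<and> Z (Suc n) \<omega> = j}"
  let ?G = "\<lambda>i j \<omega>. \<integral>s. g i j (U \<omega>) s \<partial>exponential_law (lam i)"
  have gm: "(\<lambda>\<omega>. g i j (U \<omega>) (T n \<omega>)) \<in> borel_measurable Q" if "i \<in> E" "j \<in> E" for i j
    using measurable_compose[OF measurable_Pair[OF UQ T_measurable] g[OF that]] by simp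
  have int1: "integrable Q (\<lambda>\<omega>. indicator (?J i j) \<omega> * g i j (U \<omega>) (T n \<omega>))" if "i \<in> E" "j \<in> E" for i j
    using gm[OF that] B[OF that] order_trans[OF abs_ge_zero B[OF that]]
    by (intro integrable_const_bound[of _ B]) (auto simp: indicator_def)
  have int2: "integrable Q (\<lambda>\<omega>. indicator (?I i) \<omega> * ?G i j \<omega>)" if ij: "i \<in> E" "j \<in> E" for i j
  proof -
    interpret X: prob_space "exponential_law (lam i)" by (rule prob_space_exponential_density[OF lam_pos[OF ij(1)]])
    have [measurable]: "(\<lambda>(u, s). g i j u s) \<in> borel_measurable (S \<Otimes>\<^sub>M borel)" using g ij by simp
    have "(\<lambda>u. \<integral>s. g i j u s \<partial>exponential_law (lam i)) \<in> borel_measurable S"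
      by (rule X.borel_measurable_lebesgue_integral) simp
    then have [measurable]: "?G i j \<in> borel_measurable Q" by simp
    have Bnn: "0 \<le> B" using order_trans[OF abs_ge_zero B[OF ij]] .
    have "\<bar>?G i j \<omega>\<bar> \<le> B" for \<omega>
    proof -
      have "\<bar>?G i j \<omega>\<bar> \<le> (\<integral>s. \<bar>g i j (U \<omega>) s\<bar> \<partial>exponential_law (lam i))" by (rule integral_abs_bound)
      also have "\<dots> \<le> (\<integral>s. B \<partial>exponential_law (lam i))" using B[OF ij] Bnn
        by (intro integral_mono') auto
      finally show ?thesis using X.prob_space by simp
    qed
    then show ?thesis using Bnn by (intro integrable_const_bound[of _ B]) (auto simp: indicator_def)
  qed
  have "(\<integral>\<omega>. g (Z n \<omega>) (Z (Suc n) \<omega>) (U \<omega>) (T n \<omega>) \<partial>Q) =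
      (\<integral>\<omega>. (\<Sum>i\<in>E. \<Sum>j\<in>E. indicator (?J i j) \<omega> * g i j (U \<omega>) (T n \<omega>)) \<partial>Q)"
  proof (rule Bochner_Integration.integral_cong[OF refl])
    fix \<omega> assume w: "\<omega> \<in> space Q"
    have "(\<Sum>i\<in>E. \<Sum>j\<in>E. indicator (?J i j) \<omega> * g i j (U \<omega>) (T n \<omega>)) =
      (\<Sum>i\<in>E. if i = Z n \<omega> then (\<Sum>j\<in>E. if j = Z (Suc n) \<omega> then g i j (U \<omega>) (T n \<omega>) else 0) else 0)"
      using w by (intro sum.cong refl) (auto simp: indicator_def intro!: sum.cong)
    also have "\<dots> = g (Z n \<omega>) (Z (Suc n) \<omega>) (U \<omega>) (T n \<omega>)"
      using w finE Z_in_E by simp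
    finally show "g (Z n \<omega>) (Z (Suc n) \<omega>) (U \<omega>) (T n \<omega>) =
      (\<Sum>i\<in>E. \<Sum>j\<in>E. indicator (?J i j) \<omega> * g i j (U \<omega>) (T n \<omega>))" by simp
  qed
  also have "\<dots> = (\<Sum>i\<in>E. \<Sum>j\<in>E. (\<integral>\<omega>. indicator (?J i j) \<omega> * g i j (U \<omega>) (T n \<omega>) \<partial>Q))"
    using int1 by (simp add: Bochner_Integration.integral_sum)
  also have "\<dots> = (\<Sum>i\<in>E. \<Sum>j\<in>E. q i j * (\<integral>\<omega>. indicator (?I i) \<omega> * ?G i j \<omega> \<partial>Q))"
    using g B by (intro sum.cong refl markov_step_integral[OF U])
  also have "\<dots> = (\<Sum>i\<in>E. \<integral>\<omega>. (\<Sum>j\<in>E. q i j * (indicator (?I i) \<omega> * ?G i j \<omega>)) \<partial>Q)"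
    using int2 by (intro sum.cong refl) (simp add: Bochner_Integration.integral_sum)
  also have "\<dots> = (\<integral>\<omega>. (\<Sum>i\<in>E. \<Sum>j\<in>E. q i j * (indicator (?I i) \<omega> * ?G i j \<omega>)) \<partial>Q)"
    using int2 by (subst Bochner_Integration.integral_sum) auto
  finally show ?thesis by (simp add: sum_distrib_left mult_ac)
qed

end

section \<open>Linear flows\<close>

text \<open>The solution at time \<open>s\<close> of \<open>v' = b v + c\<close> started at \<open>v\<close>.\<close>

definition linear_flow :: "real \<Rightarrow> real \<Rightarrow> real \<Rightarrow> real \<Rightarrow> real" where
  "linear_flow b c s v = v * exp (b * s) + c * (if b = 0 then s else (exp (b * s) - 1) / b)"

lemma linear_flow_0[simp]: "linear_flow b c 0 v = v"
  by (simp add: linear_flow_def)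

lemma linear_flow_deriv:
  "((\<lambda>s. linear_flow b c s v) has_real_derivative b * linear_flow b c s v + c) (at s)"
  unfolding linear_flow_def by (cases "b = 0") (auto intro!: derivative_eq_intros simp: field_simps)

lemma linear_flow_measurable[measurable]: 
  "(\<lambda>x. linear_flow b c (fst x) (snd x)) \<in> borel_measurable (borel \<Otimes>\<^sub>M borel)"
  unfolding linear_flow_def by (cases "b = 0") simp_all

lemma linear_flow_measurable'[measurable (raw)]:
  assumes [measurable]: "f \<in> borel_measurable M" "g \<in> borel_measurable M"
  shows "(\<lambda>x. linear_flow b c (f x) (g x)) \<in> borel_measurable M"
  unfolding linear_flow_def by (cases "b = 0") simp_all

lemma linear_flow_isCont: "isCont (\<lambda>s. linear_flow b c s v) s"
  using linear_flow_deriv by (rule DERIV_isCont)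

lemma linear_flow_nonneg:
  assumes "0 \<le> c" "0 \<le> s" "0 \<le> v"
  shows "0 \<le> linear_flow b c s v"
proof -
  have "0 \<le> (exp (b * s) - 1) / b" if "b \<noteq> 0"
    using that assms(2) by (cases "0 < b") (auto intro!: divide_nonneg_pos divide_nonpos_neg simp: mult_le_0_iff)
  then show ?thesis unfolding linear_flow_def using assms by (auto intro!: add_nonneg_nonneg)
qed

lemma linear_flow_bound:
  assumes "\<bar>b\<bar> \<le> \<beta>" "\<bar>c\<bar> \<le> \<gamma>" "0 \<le> s"
  shows "\<bar>linear_flow b c s v\<bar> \<le> exp (\<beta> * s) * (\<bar>v\<bar> + \<gamma> * s)"
proof -
  have bs: "b * s \<le> \<beta> * s" using assms by (intro mult_right_mono) auto
  have "\<bar>if b = 0 then s else (exp (b * s) - 1) / b\<bar> \<le> s * exp (\<beta> * s)"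
  proof (cases "b = 0")
    case True
    have "1 \<le> exp (\<beta> * s)" using assms by simp
    then show ?thesis using True assms by (simp add: mult_le_cancel_left1)
  next
    case False
    have "\<bar>exp (b * s) - 1\<bar> \<le> \<bar>b\<bar> * (s * exp (\<beta> * s))"
    proof (cases "0 < b")
      case True
      have "1 - b * s \<le> exp (- (b * s))" using exp_ge_add_one_self[of "- (b * s)"] by simp
      then have "(1 - b * s) * exp (b * s) \<le> exp (- (b * s)) * exp (b * s)" by (intro mult_right_mono) auto
      then have "exp (b * s) - 1 \<le> b * s * exp (b * s)" by (simp add: exp_minus algebra_simps)
      also have "\<dots> \<le> b * s * exp (\<beta> * s)" using bs True assms by (intro mult_left_mono) auto
      finally show ?thesis using True assms by (simp add: mult.assoc)
    next
      case b: False
      have "1 + b * s \<le> exp (b * s)" by (rule exp_ge_add_one_self)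
      moreover have "exp (b * s) \<le> 1" using b assms by (simp add: mult_nonpos_nonneg)
      moreover have "\<bar>b\<bar> * s * 1 \<le> \<bar>b\<bar> * s * exp (\<beta> * s)" using assms by (intro mult_left_mono) auto
      moreover have "\<bar>b\<bar> * s = - (b * s)" using b by simp
      moreover have "\<bar>exp (b * s) - 1\<bar> = 1 - exp (b * s)" using calculation(2) by simp
      ultimately show ?thesis unfolding mult.assoc[symmetric] by linarith
    qed
    then show ?thesis using False by (simp add: abs_divide divide_le_eq mult.commute mult.left_commute)
  qed
  then have 1: "\<bar>c * (if b = 0 then s else (exp (b * s) - 1) / b)\<bar> \<le> \<gamma> * (s * exp (\<beta> * s))"
    unfolding abs_mult using assms by (intro mult_mono) auto
  have "\<bar>v * exp (b * s)\<bar> \<le> \<bar>v\<bar> * exp (\<beta> * s)" using bs by (simp add: abs_mult mult_left_mono)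
  with 1 have "\<bar>linear_flow b c s v\<bar> \<le> \<bar>v\<bar> * exp (\<beta> * s) + \<gamma> * (s * exp (\<beta> * s))"
    unfolding linear_flow_def by (rule order.trans[OF abs_triangle_ineq add_mono, rotated])
  then show ?thesis by (simp add: algebra_simps)
qed

section \<open>Dynkin's formula across one exponential holding time\<close>

lemma integral_exponential_law_stopped:
  fixes f :: "real \<Rightarrow> real"
  assumes l: "0 < l" and R: "0 \<le> R" and f: "\<And>s. isCont f s"
  shows "integrable (exponential_law l) (\<lambda>s. if s \<le> R then f s else k)"
    and "(\<integral>s. (if s \<le> R then f s else k) \<partial>exponential_law l) =
      (\<integral>s. l * exp (- l * s) * f s * indicator {0..R} s \<partial>lborel) + k * exp (- l * R)"
proof -
  interpret X: prob_space "exponential_law l" by (rule prob_space_exponential_density[OF l])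
  have fm[measurable]: "f \<in> borel_measurable borel"
    using f by (intro borel_measurable_continuous_onI continuous_at_imp_continuous_on) auto
  have i1: "integrable lborel (\<lambda>s. l * exp (- l * s) * f s * indicator {0..R} s)"
    using f by (intro borel_integrable_atLeastAtMost) auto
  have m2: "(\<integral>s. indicator {R<..} s \<partial>exponential_law l) = exp (- l * R)"
    using measure_exponential_law_greaterThan[OF l, of R] R by (simp add: max_def)
  have i2': "integrable (exponential_law l) (indicator {R<..} :: real \<Rightarrow> real)"
    by (rule integrable_real_indicator) (simp_all add: X.emeasure_eq_measure)
  have i2: "integrable lborel (\<lambda>s. exponential_density l s * indicator {R<..} s)"
    using i2' exponential_density_nonneg[OF l] by (subst (asm) integrable_real_density) auto
  have m2': "(\<integral>s. exponential_density l s * indicator {R<..} s \<partial>lborel) = exp (- l * R)"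
    using m2 exponential_density_nonneg[OF l] by (subst (asm) integral_real_density) auto
  have eq: "exponential_density l s * (if s \<le> R then f s else k) =
     l * exp (- l * s) * f s * indicator {0..R} s + k * (exponential_density l s * indicator {R<..} s)" for s
    using R by (auto simp: exponential_density_def indicator_def mult.commute)
  show "integrable (exponential_law l) (\<lambda>s. if s \<le> R then f s else k)"
    using exponential_density_nonneg[OF l] i1 i2 by (subst integrable_real_density) (auto simp: eq)
  show "(\<integral>s. (if s \<le> R then f s else k) \<partial>exponential_law l) =
      (\<integral>s. l * exp (- l * s) * f s * indicator {0..R} s \<partial>lborel) + k * exp (- l * R)"
    using exponential_density_nonneg[OF l] i1 i2 m2' by (subst integral_real_density) (auto simp: eq)
qed

lemma exponential_dynkin:
  fixes y yd w :: "real \<Rightarrow> real"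
  assumes l: "0 < l" and R: "0 \<le> R"
    and y: "\<And>s. (y has_real_derivative yd s) (at s)" "\<And>s. isCont yd s" and w: "\<And>s. isCont w s"
  shows "(\<integral>s. (if s \<le> R then w s else y R) \<partial>exponential_law l) - y 0 =
    (\<integral>s. (\<integral>r. (yd r + l * (w r - y r)) * indicator {0..min s R} r \<partial>lborel) \<partial>exponential_law l)"
proof -
  define \<psi> where "\<psi> r = yd r + l * (w r - y r)" for r
  have yc: "isCont y s" for s using y(1) by (rule DERIV_isCont)
  have \<psi>: "isCont \<psi> r" for r unfolding \<psi>_def by (intro continuous_intros y w yc)
  obtain F0 where F0: "\<And>x. (F0 has_real_derivative \<psi> x) (at x)"
    using einterval_antiderivative[of "-\<infinity>" "\<infinity>" \<psi>] \<psi> by (auto simp: has_real_derivative_iff_has_vector_derivative)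
  define F where "F x = F0 x - F0 0" for x
  have F: "(F has_real_derivative \<psi> x) (at x)" for x
    unfolding F_def using DERIV_diff[OF F0 DERIV_const] by simp
  have Fc: "isCont F s" for s using F by (rule DERIV_isCont)
  have inner: "(\<integral>r. \<psi> r * indicator {0..x} r \<partial>lborel) = F x" if "0 \<le> x" for x
    using integral_FTC_Icc_real[OF that F \<psi>] by (simp add: F_def)
  have "(\<integral>s. (\<integral>r. \<psi> r * indicator {0..min s R} r \<partial>lborel) \<partial>exponential_law l)
      = (\<integral>s. (if s \<le> R then F s else F R) \<partial>exponential_law l)"
  proof (rule integral_cong_AE)
    have "AE s in lborel. exponential_density l s > 0 \<longrightarrow> 0 \<le> s"
      by (auto simp: exponential_density_def)
    then show "AE s in exponential_law l. (\<integral>r. \<psi> r * indicator {0..min s R} r \<partial>lborel) = (if s \<le> R then F s else F R)"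
      using inner R by (subst AE_density) (auto simp: min_def exponential_density_def elim!: eventually_mono)
    have [measurable]: "\<psi> \<in> borel_measurable borel" "F \<in> borel_measurable borel"
      using \<psi> Fc by (auto intro!: borel_measurable_continuous_onI continuous_at_imp_continuous_on)
    have "(\<lambda>s. \<integral>r. \<psi> r * (if 0 \<le> r \<and> r \<le> min s R then 1 else 0) \<partial>lborel) \<in> borel_measurable borel"
      by measurable
    then show "(\<lambda>s. \<integral>r. \<psi> r * indicator {0..min s R} r \<partial>lborel) \<in> borel_measurable (exponential_law l)"
      by (simp add: indicator_def)
    show "(\<lambda>s. if s \<le> R then F s else F R) \<in> borel_measurable (exponential_law l)" by simp
  qed
  moreover have "(\<integral>s. (if s \<le> R then F s else F R) \<partial>exponential_law l) -
      (\<integral>s. (if s \<le> R then w s else y R) \<partial>exponential_law l) = - y 0"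
  proof -
    have i: "integrable lborel (\<lambda>s. l * exp (- l * s) * f s * indicator {0..R} s)" if "\<And>s. isCont f s" for f :: "real \<Rightarrow> real"
      using that by (intro borel_integrable_atLeastAtMost) auto
    have "(\<integral>s. l * exp (- l * s) * F s * indicator {0..R} s \<partial>lborel) - (\<integral>s. l * exp (- l * s) * w s * indicator {0..R} s \<partial>lborel)
      = (\<integral>s. l * exp (- l * s) * (F s - w s) * indicator {0..R} s \<partial>lborel)"
      using i[of F] i[of w] Fc w
      by (subst Bochner_Integration.integral_diff[symmetric]) (auto simp: algebra_simps)
    also have "\<dots> = (- exp (- l * R) * (F R - y R)) - (- exp (- l * 0) * (F 0 - y 0))"
    proof (rule integral_FTC_Icc_real[OF R])
      fix s
      show "((\<lambda>s. - exp (- l * s) * (F s - y s)) has_real_derivative l * exp (- l * s) * (F s - w s)) (at s)"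
        by (rule derivative_eq_intros refl F y(1))+ (simp add: \<psi>_def algebra_simps)
      show "isCont (\<lambda>s. l * exp (- l * s) * (F s - w s)) s" by (intro continuous_intros Fc w)
    qed
    finally show ?thesis
      using integral_exponential_law_stopped(2)[OF l R Fc, of "F R"] integral_exponential_law_stopped(2)[OF l R w, of "y R"]
      by (simp add: F_def algebra_simps)
  qed
  ultimately show ?thesis unfolding \<psi>_def by simp
qed

section \<open>Piecewise linear processes driven by the jump chain\<close>

context jump_chain
begin

definition jump_time :: "nat \<Rightarrow> 'a \<Rightarrow> real" where
  "jump_time n \<omega> = (\<Sum>k<n. T k \<omega>)"

primrec jump_value :: "(nat \<Rightarrow> real) \<Rightarrow> (nat \<Rightarrow> real) \<Rightarrow> real \<Rightarrow> nat \<Rightarrow> 'a \<Rightarrow> real" where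
  "jump_value b c u 0 \<omega> = u"
| "jump_value b c u (Suc n) \<omega> = linear_flow (b (Z n \<omega>)) (c (Z n \<omega>)) (T n \<omega>) (jump_value b c u n \<omega>)"

definition jump_count :: "real \<Rightarrow> 'a \<Rightarrow> nat" where
  "jump_count t \<omega> = (LEAST n. t < jump_time (Suc n) \<omega>)"

definition state :: "real \<Rightarrow> 'a \<Rightarrow> nat" where
  "state t \<omega> = Z (jump_count t \<omega>) \<omega>"

definition pdmp :: "(nat \<Rightarrow> real) \<Rightarrow> (nat \<Rightarrow> real) \<Rightarrow> real \<Rightarrow> real \<Rightarrow> 'a \<Rightarrow> real" where
  "pdmp b c u t \<omega> = linear_flow (b (state t \<omega>)) (c (state t \<omega>)) (t - jump_time (jump_count t \<omega>) \<omega>)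
     (jump_value b c u (jump_count t \<omega>) \<omega>)"

lemma jump_time_0[simp]: "jump_time 0 \<omega> = 0" and jump_time_Suc: "jump_time (Suc n) \<omega> = jump_time n \<omega> + T n \<omega>"
  by (simp_all add: jump_time_def)

lemma jump_time_mono:
  assumes "\<omega> \<in> space Q" "m \<le> n"
  shows "jump_time m \<omega> \<le> jump_time n \<omega>"
  unfolding jump_time_def using assms T_pos[OF assms(1)]
  by (intro sum_mono2) (auto intro: less_imp_le)

lemma jump_time_nonneg: "\<omega> \<in> space Q \<Longrightarrow> 0 \<le> jump_time n \<omega>"
  using jump_time_mono[of \<omega> 0 n] by simp

lemma jump_time_less_Suc: "\<omega> \<in> space Q \<Longrightarrow> jump_time n \<omega> < jump_time (Suc n) \<omega>"
  using T_pos by (simp add: jump_time_Suc)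

lemma jump_time_unbounded:
  assumes "\<omega> \<in> space Q"
  shows "\<exists>n. t < jump_time n \<omega>"
  using T_diverges[OF assms] unfolding filterlim_at_top_dense jump_time_def[symmetric]
  by (meson eventually_happens trivial_limit_sequentially)

lemma jump_count_eq:
  assumes w: "\<omega> \<in> space Q" and n: "jump_time n \<omega> \<le> t" "t < jump_time (Suc n) \<omega>"
  shows "jump_count t \<omega> = n"
  unfolding jump_count_def
proof (rule Least_equality)
  show "t < jump_time (Suc n) \<omega>" by fact
  fix m assume "t < jump_time (Suc m) \<omega>"
  then show "n \<le> m" using jump_time_mono[OF w, of "Suc m" n] n by (meson Suc_leI leD leI order_less_le_trans)
qed

lemma jump_count_bounds:
  assumes w: "\<omega> \<in> space Q" and t: "0 \<le> t"
  shows "jump_time (jump_count t \<omega>) \<omega> \<le> t" "t < jump_time (Suc (jump_count t \<omega>)) \<omega>"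
proof -
  obtain n where n: "t < jump_time n \<omega>" using jump_time_unbounded[OF w] by blast
  then have "n \<noteq> 0" using t by (metis jump_time_0 not_le)
  then have "t < jump_time (Suc (n - 1)) \<omega>" using n by simp
  then show "t < jump_time (Suc (jump_count t \<omega>)) \<omega>"
    unfolding jump_count_def by (rule LeastI)
  show "jump_time (jump_count t \<omega>) \<omega> \<le> t"
  proof (cases "jump_count t \<omega>")
    case 0 then show ?thesis using t by simp
  next
    case (Suc m)
    then have "\<not> t < jump_time (Suc m) \<omega>"
      unfolding jump_count_def by (intro not_less_Least) simp
    then show ?thesis using Suc by simp
  qed
qed

lemma jump_time_measurable[measurable]: "jump_time n \<in> borel_measurable Q"
  unfolding jump_time_def by measurable

lemma jump_count_measurable[measurable]:
  "(\<lambda>x. jump_count (fst x) (snd x)) \<in> measurable (borel \<Otimes>\<^sub>M Q) (count_space UNIV)"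
  unfolding jump_count_def by measurable

lemma measurable_flow_step:
  fixes b c :: "nat \<Rightarrow> real"
  assumes i: "i \<in> measurable M (count_space UNIV)" and [measurable]: "f \<in> borel_measurable M" "g \<in> borel_measurable M"
  shows "(\<lambda>\<omega>. linear_flow (b (i \<omega>)) (c (i \<omega>)) (f \<omega>) (g \<omega>)) \<in> borel_measurable M"
  by (rule measurable_compose_countable[where f = "\<lambda>i \<omega>. linear_flow (b i) (c i) (f \<omega>) (g \<omega>)" and g = i, OF _ i]) measurable

lemma jump_value_measurable[measurable]: "jump_value b c u n \<in> borel_measurable Q"
proof (induction n)
  case 0
  have "jump_value b c u 0 = (\<lambda>_. u)" by (rule ext) simp
  then show ?case by simp
next
  case (Suc n)
  have e: "jump_value b c u (Suc n) = (\<lambda>\<omega>. linear_flow (b (Z n \<omega>)) (c (Z n \<omega>)) (T n \<omega>) (jump_value b c u n \<omega>))"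
    by (rule ext) simp
  show ?case unfolding e by (intro measurable_flow_step Suc) measurable
qed

lemma past_jump_time: "m \<le> n \<Longrightarrow> jump_time m \<in> borel_measurable (past n)"
  unfolding jump_time_def by (intro borel_measurable_sum past_T) auto

lemma past_jump_value: "m \<le> n \<Longrightarrow> jump_value b c u m \<in> borel_measurable (past n)"
proof (induction m)
  case 0
  have "jump_value b c u 0 = (\<lambda>_. u)" by (rule ext) simp
  then show ?case by simp
next
  case (Suc m)
  have e: "jump_value b c u (Suc m) = (\<lambda>\<omega>. linear_flow (b (Z m \<omega>)) (c (Z m \<omega>)) (T m \<omega>) (jump_value b c u m \<omega>))"
    by (rule ext) simp
  show ?case unfolding e using Suc by (intro measurable_flow_step past_Z past_T) auto
qed

lemma state_measurable[measurable]:
  "(\<lambda>x. state (fst x) (snd x)) \<in> measurable (borel \<Otimes>\<^sub>M Q) (count_space UNIV)"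
  unfolding state_def
  by (rule measurable_compose_countable[where f = "\<lambda>n x. Z n (snd x)", OF _ jump_count_measurable]) measurable

lemma pdmp_measurable[measurable]:
  "(\<lambda>x. pdmp b c u (fst x) (snd x)) \<in> borel_measurable (borel \<Otimes>\<^sub>M Q)"
  unfolding pdmp_def
proof (rule measurable_flow_step)
  show "(\<lambda>x. fst x - jump_time (jump_count (fst x) (snd x)) (snd x)) \<in> borel_measurable (borel \<Otimes>\<^sub>M Q)"
    by (rule measurable_compose_countable[where f = "\<lambda>n x. fst x - jump_time n (snd x)", OF _ jump_count_measurable]) measurable
  show "(\<lambda>x. jump_value b c u (jump_count (fst x) (snd x)) (snd x)) \<in> borel_measurable (borel \<Otimes>\<^sub>M Q)"
    by (rule measurable_compose_countable[where f = "\<lambda>n x. jump_value b c u n (snd x)", OF _ jump_count_measurable]) measurable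
qed measurable

lemma measurable_section:
  assumes "f \<in> measurable (borel \<Otimes>\<^sub>M Q) N"
  shows "(\<lambda>\<omega>. f (t, \<omega>)) \<in> measurable Q N"
  using measurable_compose[OF _ assms, of "\<lambda>\<omega>. (t, \<omega>)" Q] by simp

lemma state_measurable'[measurable]: "state t \<in> measurable Q (count_space UNIV)"
  using measurable_section[OF state_measurable, of t] by simp

lemma pdmp_measurable'[measurable]: "pdmp b c u t \<in> borel_measurable Q"
  using measurable_section[OF pdmp_measurable, of b c u t] by simp

lemma state_in_E: "\<omega> \<in> space Q \<Longrightarrow> state t \<omega> \<in> E"
  unfolding state_def by (rule Z_in_E)

lemma state_eq: "\<omega> \<in> space Q \<Longrightarrow> jump_time n \<omega> \<le> t \<Longrightarrow> t < jump_time (Suc n) \<omega> \<Longrightarrow> state t \<omega> = Z n \<omega>"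
  unfolding state_def by (simp add: jump_count_eq)

lemma pdmp_eq: "\<omega> \<in> space Q \<Longrightarrow> jump_time n \<omega> \<le> t \<Longrightarrow> t < jump_time (Suc n) \<omega> \<Longrightarrow>
   pdmp b c u t \<omega> = linear_flow (b (Z n \<omega>)) (c (Z n \<omega>)) (t - jump_time n \<omega>) (jump_value b c u n \<omega>)"
  unfolding pdmp_def state_def by (simp add: jump_count_eq)

lemma jump_value_bound:
  assumes w: "\<omega> \<in> space Q"
  shows "\<bar>jump_value b c u n \<omega>\<bar> \<le> exp ((\<Sum>i\<in>E. \<bar>b i\<bar>) * jump_time n \<omega>) * (\<bar>u\<bar> + (\<Sum>i\<in>E. \<bar>c i\<bar>) * jump_time n \<omega>)"
    (is "_ \<le> exp (?\<beta> * _) * (_ + ?\<gamma> * _)")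
proof (induction n)
  case 0 then show ?case by simp
next
  case (Suc n)
  define s where "s = T n \<omega>"
  define t where "t = jump_time n \<omega>"
  have st: "0 < s" "0 \<le> t" using T_pos[OF w] jump_time_nonneg[OF w] by (simp_all add: s_def t_def)
  have bg: "\<bar>b i\<bar> \<le> ?\<beta>" "\<bar>c i\<bar> \<le> ?\<gamma>" if "i \<in> E" for i
    using finE that by (auto intro: member_le_sum[of i E "\<lambda>i. \<bar>b i\<bar>"] member_le_sum[of i E "\<lambda>i. \<bar>c i\<bar>"])
  have g0: "0 \<le> ?\<beta>" "0 \<le> ?\<gamma>" by (auto intro: sum_nonneg)
  have "\<bar>jump_value b c u (Suc n) \<omega>\<bar> \<le> exp (?\<beta> * s) * (\<bar>jump_value b c u n \<omega>\<bar> + ?\<gamma> * s)"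
    using bg[OF Z_in_E[OF w]] st unfolding jump_value.simps s_def[symmetric]
    by (intro linear_flow_bound) auto
  also have "\<dots> \<le> exp (?\<beta> * s) * (exp (?\<beta> * t) * (\<bar>u\<bar> + ?\<gamma> * t) + exp (?\<beta> * t) * (?\<gamma> * s))"
  proof (intro mult_left_mono add_mono)
    show "\<bar>jump_value b c u n \<omega>\<bar> \<le> exp (?\<beta> * t) * (\<bar>u\<bar> + ?\<gamma> * t)" using Suc unfolding t_def .
    have "1 \<le> exp (?\<beta> * t)" using g0 st by simp
    from mult_right_mono[OF this, of "?\<gamma> * s"] show "?\<gamma> * s \<le> exp (?\<beta> * t) * (?\<gamma> * s)" using g0 st by simp
  qed simp
  also have "\<dots> = exp (?\<beta> * (t + s)) * (\<bar>u\<bar> + ?\<gamma> * (t + s))"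
    by (simp add: exp_add algebra_simps)
  finally show ?case unfolding jump_time_Suc s_def t_def .
qed

definition value_bound :: "(nat \<Rightarrow> real) \<Rightarrow> (nat \<Rightarrow> real) \<Rightarrow> real \<Rightarrow> real \<Rightarrow> real" where
  "value_bound b c u t = exp ((\<Sum>i\<in>E. \<bar>b i\<bar>) * t) * (\<bar>u\<bar> + (\<Sum>i\<in>E. \<bar>c i\<bar>) * t)"

lemma value_bound_mono: "0 \<le> s \<Longrightarrow> s \<le> t \<Longrightarrow> value_bound b c u s \<le> value_bound b c u t"
  unfolding value_bound_def
  by (intro mult_mono add_mono mult_left_mono exp_le_cancel_iff[THEN iffD2])
     (auto intro!: sum_nonneg add_nonneg_nonneg mult_nonneg_nonneg)

lemma flow_value_bound:
  assumes "i \<in> E" "0 \<le> s"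
  shows "\<bar>linear_flow (b i) (c i) s v\<bar> \<le> value_bound b c v s"
  unfolding value_bound_def using assms finE
  by (intro linear_flow_bound) (auto intro: member_le_sum[of i E "\<lambda>i. \<bar>b i\<bar>"] member_le_sum[of i E "\<lambda>i. \<bar>c i\<bar>"])

lemma jump_value_bound':
  assumes w: "\<omega> \<in> space Q" and t: "jump_time n \<omega> \<le> t"
  shows "\<bar>jump_value b c u n \<omega>\<bar> \<le> value_bound b c u t"
  using jump_value_bound[OF w, of b c u n] value_bound_mono[OF jump_time_nonneg[OF w] t, of b c u]
  unfolding value_bound_def by linarith

lemma pdmp_bound:
  assumes w: "\<omega> \<in> space Q" and t: "0 \<le> s" "s \<le> t"
  shows "\<bar>pdmp b c u s \<omega>\<bar> \<le> value_bound b c (value_bound b c u t) t"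
proof -
  let ?n = "jump_count s \<omega>"
  note n = jump_count_bounds[OF w t(1)]
  have v: "\<bar>jump_value b c u ?n \<omega>\<bar> \<le> value_bound b c u t"
    using n t by (intro jump_value_bound'[OF w]) auto
  have "\<bar>pdmp b c u s \<omega>\<bar> \<le> value_bound b c (jump_value b c u ?n \<omega>) (s - jump_time ?n \<omega>)"
    unfolding pdmp_def using n by (intro flow_value_bound state_in_E w) auto
  also have "\<dots> \<le> value_bound b c (jump_value b c u ?n \<omega>) t"
    using n t jump_time_nonneg[OF w, of ?n] by (intro value_bound_mono) auto
  also have "\<dots> \<le> value_bound b c (value_bound b c u t) t"
    unfolding value_bound_def using v unfolding value_bound_def by (intro mult_left_mono add_right_mono) auto
  finally show ?thesis .
qed

lemma pdmp_0: "\<omega> \<in> space Q \<Longrightarrow> pdmp b c u 0 \<omega> = u" and state_0: "\<omega> \<in> space Q \<Longrightarrow> state 0 \<omega> = Z 0 \<omega>"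
  using pdmp_eq[of \<omega> 0 0 b c u] state_eq[of \<omega> 0 0] jump_time_less_Suc[of \<omega> 0] by auto

lemma pdmp_nonneg:
  assumes w: "\<omega> \<in> space Q" and "\<And>i. i \<in> E \<Longrightarrow> 0 \<le> c i" "0 \<le> u" "0 \<le> t"
  shows "0 \<le> pdmp b c u t \<omega>"
proof -
  have "0 \<le> jump_value b c u n \<omega>" for n
  proof (induction n)
    case (Suc n)
    have "0 \<le> c (Z n \<omega>)" "0 \<le> T n \<omega>" using assms Z_in_E[OF w] T_pos[OF w, of n] by (auto simp: less_imp_le)
    then show ?case using Suc by (simp add: linear_flow_nonneg)
  qed (use assms in simp)
  then show ?thesis unfolding pdmp_def
    using assms jump_count_bounds[OF w, of t] state_in_E[OF w] by (intro linear_flow_nonneg) auto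
qed

section \<open>Dynkin's formula\<close>

definition pd_generator :: "(nat \<Rightarrow> real) \<Rightarrow> (nat \<Rightarrow> real) \<Rightarrow> (nat \<Rightarrow> real \<Rightarrow> real) \<Rightarrow> (nat \<Rightarrow> real \<Rightarrow> real) \<Rightarrow> nat \<Rightarrow> real \<Rightarrow> real" where
  "pd_generator b c h h' i v = (b i * v + c i) * h' i v + lam i * (\<Sum>j\<in>E. q i j * (h j v - h i v))"

lemma pd_generator_isCont:
  assumes h: "\<And>i v. i \<in> E \<Longrightarrow> (h i has_real_derivative h' i v) (at v)" "\<And>i v. i \<in> E \<Longrightarrow> isCont (h' i) v"
    and i: "i \<in> E"
  shows "isCont (pd_generator b c h h' i) v"
  unfolding pd_generator_def using DERIV_isCont[OF h(1)] h(2) i by (intro continuous_intros) auto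

lemma dynkin_one_step:
  fixes b c :: "nat \<Rightarrow> real" and v :: real
  assumes h: "\<And>i v. i \<in> E \<Longrightarrow> (h i has_real_derivative h' i v) (at v)" "\<And>i v. i \<in> E \<Longrightarrow> isCont (h' i) v"
    and i: "i \<in> E" and R: "0 \<le> R"
  defines "f \<equiv> \<lambda>s. linear_flow (b i) (c i) s v"
  shows "(\<Sum>j\<in>E. q i j * (\<integral>s. (if s \<le> R then h j (f s) else h i (f R)) - h i v \<partial>exponential_law (lam i))) =
    (\<integral>s. (\<integral>r. pd_generator b c h h' i (f r) * indicator {0..min s R} r \<partial>lborel) \<partial>exponential_law (lam i))"
proof -
  let ?X = "exponential_law (lam i)"
  note l = lam_pos[OF i]
  interpret X: prob_space ?X by (rule prob_space_exponential_density[OF l])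
  have fc: "isCont f s" for s unfolding f_def by (rule linear_flow_isCont)
  have hf: "isCont (\<lambda>s. h j (f s)) s" if "j \<in> E" for j s
    using DERIV_isCont[OF h(1)[OF that]] fc by (rule isCont_o2[rotated])
  have f0: "f 0 = v" by (simp add: f_def)
  have yd: "((\<lambda>s. h i (f s)) has_real_derivative h' i (f s) * (b i * f s + c i)) (at s)" for s
    unfolding f_def by (rule DERIV_chain2[OF h(1)[OF i] linear_flow_deriv])
  have ydc: "isCont (\<lambda>s. h' i (f s) * (b i * f s + c i)) s" for s
    using isCont_o2[OF fc h(2)[OF i]] fc by (intro continuous_intros)
  have wc: "isCont (\<lambda>s. \<Sum>j\<in>E. q i j * h j (f s)) s" for s
    using hf by (intro continuous_intros)
  have int: "integrable ?X (\<lambda>s. if s \<le> R then h j (f s) else h i (f R))" if "j \<in> E" for j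
    by (rule integral_exponential_law_stopped(1)[OF l R hf[OF that]])
  have "(\<Sum>j\<in>E. q i j * (\<integral>s. (if s \<le> R then h j (f s) else h i (f R)) - h i v \<partial>?X))
    = (\<integral>s. (\<Sum>j\<in>E. q i j * ((if s \<le> R then h j (f s) else h i (f R)) - h i v)) \<partial>?X)"
    using int by (subst Bochner_Integration.integral_sum) auto
  also have "\<dots> = (\<integral>s. (if s \<le> R then (\<Sum>j\<in>E. q i j * h j (f s)) else h i (f R)) - h i (f 0) \<partial>?X)"
    using q_sum[OF i] by (intro Bochner_Integration.integral_cong refl)
      (auto simp: right_diff_distrib sum_subtractf f0 sum_distrib_right[symmetric])
  also have "\<dots> = (\<integral>s. (if s \<le> R then (\<Sum>j\<in>E. q i j * h j (f s)) else h i (f R)) \<partial>?X) - h i (f 0)"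
    using integral_exponential_law_stopped(1)[OF l R wc, of "h i (f R)"] X.prob_space
    by (subst Bochner_Integration.integral_diff) auto
  also have "\<dots> = (\<integral>s. (\<integral>r. (h' i (f r) * (b i * f r + c i) + lam i * ((\<Sum>j\<in>E. q i j * h j (f r)) - h i (f r)))
      * indicator {0..min s R} r \<partial>lborel) \<partial>?X)"
    by (rule exponential_dynkin[OF l R yd ydc wc])
  also have "(\<lambda>r. h' i (f r) * (b i * f r + c i) + lam i * ((\<Sum>j\<in>E. q i j * h j (f r)) - h i (f r)))
      = (\<lambda>r. pd_generator b c h h' i (f r))"
    using q_sum[OF i] by (auto simp: pd_generator_def fun_eq_iff right_diff_distrib sum_subtractf sum_distrib_right[symmetric])
  finally show ?thesis .
qed

lemma measurable_switch:
  fixes f :: "nat \<Rightarrow> real \<Rightarrow> real"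
  assumes f: "\<And>i. i \<in> E \<Longrightarrow> f i \<in> borel_measurable borel"
    and I: "I \<in> measurable M (count_space UNIV)" "\<And>x. x \<in> space M \<Longrightarrow> I x \<in> E"
    and g: "g \<in> borel_measurable M"
  shows "(\<lambda>x. f (I x) (g x)) \<in> borel_measurable M"
proof -
  have "(\<lambda>x. (if i \<in> E then f i else (\<lambda>_. 0)) (g x)) \<in> borel_measurable M" for i
    using measurable_compose[OF g f, of i] by (cases "i \<in> E") auto
  from measurable_compose_countable[where f = "\<lambda>i x. (if i \<in> E then f i else (\<lambda>_. 0)) (g x)", OF this I(1)]
  have "(\<lambda>x. (if I x \<in> E then f (I x) else (\<lambda>_. 0)) (g x)) \<in> borel_measurable M" .
  then show ?thesis by (rule measurable_cong[THEN iffD1, rotated]) (simp add: I(2))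
qed

lemma isCont_borel_measurable: "(\<And>v. isCont f v) \<Longrightarrow> f \<in> borel_measurable borel" for f :: "real \<Rightarrow> real"
  by (intro borel_measurable_continuous_onI continuous_at_imp_continuous_on) auto

lemma finite_family_bounded_on_Icc:
  fixes f :: "nat \<Rightarrow> real \<Rightarrow> real"
  assumes "\<And>i v. i \<in> E \<Longrightarrow> isCont (f i) v"
  shows "\<exists>B. \<forall>i\<in>E. \<forall>v. \<bar>v\<bar> \<le> C \<longrightarrow> \<bar>f i v\<bar> \<le> B"
proof -
  have "\<exists>M. \<forall>v. \<bar>v\<bar> \<le> C \<longrightarrow> \<bar>f i v\<bar> \<le> M" if "i \<in> E" for i
  proof -
    have "compact (f i ` {- C..C})"
      using assms[OF that] by (intro compact_continuous_image continuous_at_imp_continuous_on) auto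
    then obtain M where "\<forall>x\<in>f i ` {- C..C}. norm x \<le> M" using compact_imp_bounded bounded_iff by metis
    then show ?thesis by (intro exI[of _ M]) (auto simp: abs_le_iff minus_le_iff)
  qed
  then obtain M where M: "\<And>i v. i \<in> E \<Longrightarrow> \<bar>v\<bar> \<le> C \<Longrightarrow> \<bar>f i v\<bar> \<le> M i" by metis
  have "\<bar>f i v\<bar> \<le> (\<Sum>i\<in>E. \<bar>M i\<bar>)" if "i \<in> E" "\<bar>v\<bar> \<le> C" for i v
    using M[OF that] member_le_sum[OF that(1), of "\<lambda>i. \<bar>M i\<bar>"] finE by force
  then show ?thesis by blast
qed

lemma AE_exponential_law_nonneg: "AE s in exponential_law l. 0 \<le> s"
  by (subst AE_density) (auto simp: exponential_density_def intro!: AE_I2)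

text \<open>
  Summing the formula for a single holding time over the jumps before \<open>t\<close>. Test functions may be
  unbounded, because the value stays in a fixed bounded set up to time \<open>t\<close>.
\<close>

theorem dynkin_formula:
  fixes b c :: "nat \<Rightarrow> real" and u :: real
  assumes h: "\<And>i v. i \<in> E \<Longrightarrow> (h i has_real_derivative h' i v) (at v)" "\<And>i v. i \<in> E \<Longrightarrow> isCont (h' i) v"
    and t: "0 \<le> t"
  defines "L \<equiv> pd_generator b c h h'"
  shows "integrable Q (\<lambda>\<omega>. h (state t \<omega>) (pdmp b c u t \<omega>))" (is ?int)
    and "integrable (lborel \<Otimes>\<^sub>M Q) (\<lambda>(s, \<omega>). L (state s \<omega>) (pdmp b c u s \<omega>) * indicator {0..t} s)" (is ?int2)
    and "(\<integral>\<omega>. h (state t \<omega>) (pdmp b c u t \<omega>) \<partial>Q) = (\<integral>\<omega>. h (Z 0 \<omega>) u \<partial>Q) +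
      (\<integral>s. (\<integral>\<omega>. L (state s \<omega>) (pdmp b c u s \<omega>) \<partial>Q) * indicator {0..t} s \<partial>lborel)" (is ?eq)
proof -
  define C where "C = value_bound b c u t"
  define C2 where "C2 = value_bound b c C t"
  have hc: "isCont (h i) v" if "i \<in> E" for i v using DERIV_isCont[OF h(1)[OF that]] .
  have Lc: "isCont (L i) v" if "i \<in> E" for i v unfolding L_def by (rule pd_generator_isCont[OF h that])
  have hm: "h i \<in> borel_measurable borel" and Lm: "L i \<in> borel_measurable borel" if "i \<in> E" for i
    using isCont_borel_measurable hc Lc that by auto
  obtain B1 B2 where B12: "\<forall>i\<in>E. \<forall>v. \<bar>v\<bar> \<le> C2 \<longrightarrow> \<bar>h i v\<bar> \<le> B1" "\<forall>i\<in>E. \<forall>v. \<bar>v\<bar> \<le> C2 \<longrightarrow> \<bar>L i v\<bar> \<le> B2"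
    using finite_family_bounded_on_Icc[of h C2, OF hc] finite_family_bounded_on_Icc[of L C2, OF Lc] by auto
  define B where "B = max 0 (max B1 B2)"
  have B: "\<bar>h i v\<bar> \<le> B" "\<bar>L i v\<bar> \<le> B" if "i \<in> E" "\<bar>v\<bar> \<le> C2" for i v
    using B12 that unfolding B_def by (simp_all add: le_max_iff_disj)
  have B0: "0 \<le> B" unfolding B_def by simp
  have flowC2: "\<bar>linear_flow (b i) (c i) r v\<bar> \<le> C2" if "i \<in> E" "0 \<le> r" "r \<le> t" "\<bar>v\<bar> \<le> C" for i r v
  proof -
    have "\<bar>linear_flow (b i) (c i) r v\<bar> \<le> value_bound b c v r" using that by (intro flow_value_bound)
    also have "\<dots> \<le> value_bound b c v t" using that by (intro value_bound_mono)
    also have "\<dots> \<le> C2" unfolding C2_def value_bound_def using that by (intro mult_left_mono add_right_mono) auto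
    finally show ?thesis .
  qed
  have CC2: "\<bar>v\<bar> \<le> C2" if "\<bar>v\<bar> \<le> C" for v
    using flowC2[of _ 0 v] that t E_nonempty by auto
  have pC2: "\<bar>pdmp b c u s \<omega>\<bar> \<le> C2" if "\<omega> \<in> space Q" "0 \<le> s" "s \<le> t" for s \<omega>
    unfolding C2_def C_def by (rule pdmp_bound[OF that])
  have jC: "\<bar>jump_value b c u n \<omega>\<bar> \<le> C" if "\<omega> \<in> space Q" "jump_time n \<omega> \<le> t" for n \<omega>
    unfolding C_def by (rule jump_value_bound'[OF that])
  define f where "f i r v = linear_flow (b i) (c i) r v" for i r v
  define R where "R x = L (state (fst x) (snd x)) (pdmp b c u (fst x) (snd x))" for x
  have R[measurable]: "R \<in> borel_measurable (borel \<Otimes>\<^sub>M Q)"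
    unfolding R_def by (rule measurable_switch[OF Lm]) (auto simp: space_pair_measure state_in_E)
  have RB: "\<bar>R (s, \<omega>)\<bar> \<le> B" if "\<omega> \<in> space Q" "0 \<le> s" "s \<le> t" for s \<omega>
    unfolding R_def using B(2) state_in_E pC2 that by simp
  have ht[measurable]: "(\<lambda>\<omega>. h (state t \<omega>) (pdmp b c u t \<omega>)) \<in> borel_measurable Q"
    by (rule measurable_switch[OF hm]) (auto simp: state_in_E)
  have hZ[measurable]: "(\<lambda>\<omega>. h (Z n \<omega>) (jump_value b c u n \<omega>)) \<in> borel_measurable Q" for n
    by (rule measurable_switch[OF hm]) (auto simp: Z_in_E)
  show ?int
    by (rule integrable_const_bound[of _ B]) (auto intro!: AE_I2 B(1) state_in_E pC2 t)
  \<comment> \<open>\<open>S n\<close> is the observable stopped at the \<open>n\<close>-th jump, \<open>P n\<close> the integral of its generator up to then\<close>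
  define S where "S n \<omega> = (if jump_time n \<omega> \<le> t then h (Z n \<omega>) (jump_value b c u n \<omega>)
      else h (state t \<omega>) (pdmp b c u t \<omega>))" for n \<omega>
  define P where "P n \<omega> = (\<integral>s. R (s, \<omega>) * (if 0 \<le> s \<and> s \<le> t \<and> s < jump_time n \<omega> then 1 else 0) \<partial>lborel)" for n \<omega>
  have Sm[measurable]: "S n \<in> borel_measurable Q" for n unfolding S_def by measurable
  have SB: "\<bar>S n \<omega>\<bar> \<le> B" if "\<omega> \<in> space Q" for n \<omega>
    unfolding S_def using B(1) Z_in_E state_in_E CC2 jC pC2 t that by auto
  have Pm[measurable]: "P n \<in> borel_measurable Q" for n
    unfolding P_def by measurable
  have ind: "integrable lborel (indicator {0..t} :: real \<Rightarrow> real)"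
    using t by (intro integrable_real_indicator) auto
  have bnd: "\<bar>\<integral>s. G s \<partial>lborel\<bar> \<le> B * t" if "\<And>s. \<bar>G s\<bar> \<le> B * indicator {0..t} s" for G :: "real \<Rightarrow> real"
  proof -
    have "\<bar>\<integral>s. G s \<partial>lborel\<bar> \<le> (\<integral>s. \<bar>G s\<bar> \<partial>lborel)" by (rule integral_abs_bound)
    also have "\<dots> \<le> (\<integral>s. B * indicator {0..t} s \<partial>lborel)" using that
      using ind B0 by (intro integral_mono') auto
    finally show ?thesis using t by simp
  qed
  have PB: "\<bar>P n \<omega>\<bar> \<le> B * t" if "\<omega> \<in> space Q" for n \<omega>
    unfolding P_def using RB[OF that] B0 by (intro bnd) (auto simp: indicator_def)
  have Rint: "integrable lborel (\<lambda>s. R (s, \<omega>) * (if 0 \<le> s \<and> s \<le> t \<and> s < a then 1 else 0))" 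
      "integrable lborel (\<lambda>s. R (s, \<omega>) * (if 0 \<le> s \<and> s \<le> t then 1 else 0))" if w: "\<omega> \<in> space Q" for \<omega> a
  proof -
    have [measurable]: "(\<lambda>s. R (s, \<omega>)) \<in> borel_measurable borel"
      using measurable_compose[OF _ R, of "\<lambda>s. (s, \<omega>)" borel] w by simp
    have i: "integrable lborel (\<lambda>s. B * indicator {0..t} s)" using ind by simp
    show "integrable lborel (\<lambda>s. R (s, \<omega>) * (if 0 \<le> s \<and> s \<le> t \<and> s < a then 1 else 0))"
      by (rule Bochner_Integration.integrable_bound[OF i]) (use RB[OF w] B0 in \<open>auto simp: indicator_def intro!: AE_I2\<close>)
    show "integrable lborel (\<lambda>s. R (s, \<omega>) * (if 0 \<le> s \<and> s \<le> t then 1 else 0))"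
      by (rule Bochner_Integration.integrable_bound[OF i]) (use RB[OF w] B0 in \<open>auto simp: indicator_def intro!: AE_I2\<close>)
  qed
  define ok where "ok x s \<longleftrightarrow> 0 \<le> s \<and> 0 \<le> fst x \<and> fst x \<le> t \<and> \<bar>snd x\<bar> \<le> C" for x :: "real \<times> real" and s :: real
  define g where "g i j x s = (if ok x s then (if fst x + s \<le> t then h j (f i s (snd x)) else h i (f i (t - fst x) (snd x)))
      - h i (snd x) else 0)" for i j x s
  define g2 where "g2 i x s = (if ok x s then \<integral>r. L i (f i r (snd x)) * (if 0 \<le> r \<and> r \<le> min s (t - fst x) then 1 else 0) \<partial>lborel else 0)" for i x s
  have gm: "(\<lambda>(x, s). g i j x s) \<in> borel_measurable ((borel \<Otimes>\<^sub>M borel) \<Otimes>\<^sub>M borel)" if "i \<in> E" "j \<in> E" for i j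
  proof -
    have [measurable]: "h i \<in> borel_measurable borel" "h j \<in> borel_measurable borel" using hm that by auto
    show ?thesis unfolding g_def ok_def f_def split_beta' by measurable
  qed
  have g2m: "(\<lambda>(x, s). g2 i x s) \<in> borel_measurable ((borel \<Otimes>\<^sub>M borel) \<Otimes>\<^sub>M borel)" if "i \<in> E" for i
  proof -
    have [measurable]: "L i \<in> borel_measurable borel" using Lm that by auto
    show ?thesis unfolding g2_def ok_def f_def split_beta' by measurable
  qed
  have gB: "\<bar>g i j x s\<bar> \<le> 2 * B" if "i \<in> E" "j \<in> E" for i j x s
  proof (cases "ok x s")
    case True
    then have "\<bar>h i (snd x)\<bar> \<le> B" using B(1) CC2 that unfolding ok_def by auto
    moreover have "fst x + s \<le> t \<Longrightarrow> \<bar>h j (f i s (snd x))\<bar> \<le> B"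
      using True that unfolding f_def ok_def by (intro B(1) flowC2) auto
    moreover have "\<bar>h i (f i (t - fst x) (snd x))\<bar> \<le> B"
      using True that unfolding f_def ok_def by (intro B(1) flowC2) auto
    ultimately show ?thesis unfolding g_def using True by (auto simp: abs_le_iff)
  qed (simp add: g_def B0)
  have g2B: "\<bar>g2 i x s\<bar> \<le> B * t" if "i \<in> E" for i x s
  proof (cases "ok x s")
    case True
    have "\<bar>\<integral>r. L i (f i r (snd x)) * (if 0 \<le> r \<and> r \<le> min s (t - fst x) then 1 else 0) \<partial>lborel\<bar> \<le> B * t"
    proof (rule bnd)
      fix r
      show "\<bar>L i (f i r (snd x)) * (if 0 \<le> r \<and> r \<le> min s (t - fst x) then 1 else 0)\<bar> \<le> B * indicator {0..t} r"
      proof (cases "0 \<le> r \<and> r \<le> min s (t - fst x)")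
        case r: True
        then have "\<bar>L i (f i r (snd x))\<bar> \<le> B"
          using True that unfolding f_def ok_def by (intro B(2) flowC2) auto
        then show ?thesis using r True by (auto simp: ok_def)
      qed (auto simp: B0)
    qed
    then show ?thesis using True by (simp add: g2_def)
  qed (simp add: g2_def B0 t)
  have step: "(\<Sum>j\<in>E. q i j * (\<integral>s. g i j x s \<partial>exponential_law (lam i))) = (\<integral>s. g2 i x s \<partial>exponential_law (lam i))"
    if i: "i \<in> E" for i x
  proof (cases "0 \<le> fst x \<and> fst x \<le> t \<and> \<bar>snd x\<bar> \<le> C")
    case False
    then have "\<And>j s. g i j x s = 0" "\<And>s. g2 i x s = 0" unfolding g_def g2_def ok_def by auto
    then show ?thesis by simp
  next
    case True
    have fc: "isCont (\<lambda>s. f i s v) s" for v s unfolding f_def by (rule linear_flow_isCont)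
    have "(\<integral>s. g i j x s \<partial>exponential_law (lam i)) =
      (\<integral>s. (if s \<le> t - fst x then h j (f i s (snd x)) else h i (f i (t - fst x) (snd x))) - h i (snd x) \<partial>exponential_law (lam i))"
      if j: "j \<in> E" for j
    proof (rule integral_cong_AE)
      show "AE s in exponential_law (lam i). g i j x s = (if s \<le> t - fst x then h j (f i s (snd x)) else h i (f i (t - fst x) (snd x))) - h i (snd x)"
        using AE_exponential_law_nonneg by eventually_elim (use True in \<open>auto simp: g_def ok_def\<close>)
      show "g i j x \<in> borel_measurable (exponential_law (lam i))"
        using measurable_compose[OF _ gm[OF i j], of "\<lambda>s. (x, s)" borel] by (simp add: space_pair_measure)
      have "isCont (\<lambda>s. h j (f i s (snd x))) s" for s using isCont_o2[OF fc hc[OF j]] .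
      then have [measurable]: "(\<lambda>s. h j (f i s (snd x))) \<in> borel_measurable borel" by (rule isCont_borel_measurable)
      show "(\<lambda>s. (if s \<le> t - fst x then h j (f i s (snd x)) else h i (f i (t - fst x) (snd x))) - h i (snd x)) \<in> borel_measurable (exponential_law (lam i))"
        by simp
    qed
    then have "(\<Sum>j\<in>E. q i j * (\<integral>s. g i j x s \<partial>exponential_law (lam i))) =
       (\<Sum>j\<in>E. q i j * (\<integral>s. (if s \<le> t - fst x then h j (f i s (snd x)) else h i (f i (t - fst x) (snd x))) - h i (snd x) \<partial>exponential_law (lam i)))"
      by simp
    also have "\<dots> = (\<integral>s. (\<integral>r. L i (f i r (snd x)) * indicator {0..min s (t - fst x)} r \<partial>lborel) \<partial>exponential_law (lam i))"
      unfolding f_def L_def using True by (intro dynkin_one_step[OF h i]) auto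
    also have "\<dots> = (\<integral>s. g2 i x s \<partial>exponential_law (lam i))"
    proof (rule integral_cong_AE)
      show "AE s in exponential_law (lam i). (\<integral>r. L i (f i r (snd x)) * indicator {0..min s (t - fst x)} r \<partial>lborel) = g2 i x s"
        using AE_exponential_law_nonneg
        by eventually_elim (use True in \<open>auto simp: g2_def ok_def indicator_def intro!: Bochner_Integration.integral_cong\<close>)
      show "g2 i x \<in> borel_measurable (exponential_law (lam i))"
        using measurable_compose[OF _ g2m[OF i], of "\<lambda>s. (x, s)" borel] by (simp add: space_pair_measure)
      have [measurable]: "(\<lambda>r. L i (f i r (snd x))) \<in> borel_measurable borel"
        using isCont_o2[OF fc Lc[OF i]] by (rule isCont_borel_measurable)
      have "(\<lambda>s. \<integral>r. L i (f i r (snd x)) * (if 0 \<le> r \<and> r \<le> min s (t - fst x) then 1 else 0) \<partial>lborel) \<in> borel_measurable borel"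
        by measurable
      then show "(\<lambda>s. \<integral>r. L i (f i r (snd x)) * indicator {0..min s (t - fst x)} r \<partial>lborel) \<in> borel_measurable (exponential_law (lam i))"
        by (simp add: indicator_def)
    qed
    finally show ?thesis .
  qed
  define U where "U n \<omega> = (jump_time n \<omega>, jump_value b c u n \<omega>)" for n \<omega>
  have U: "U n \<in> measurable (past n) (borel \<Otimes>\<^sub>M borel)" for n
    unfolding U_def using past_jump_time past_jump_value by (intro measurable_Pair) auto
  have Eg: "(\<integral>\<omega>. g (Z n \<omega>) (Z (Suc n) \<omega>) (U n \<omega>) (T n \<omega>) \<partial>Q) = (\<integral>\<omega>. g2 (Z n \<omega>) (U n \<omega>) (T n \<omega>) \<partial>Q)" for n
  proof -
    have "(\<integral>\<omega>. g2 (Z n \<omega>) (U n \<omega>) (T n \<omega>) \<partial>Q) =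
      (\<integral>\<omega>. (\<Sum>i\<in>E. indicator {\<omega>\<in>space Q. Z n \<omega> = i} \<omega> *
        (\<Sum>j\<in>E. q i j * (\<integral>s. g2 i (U n \<omega>) s \<partial>exponential_law (lam i)))) \<partial>Q)"
      using markov_step_expectation[OF U, where g = "\<lambda>i j. g2 i" and B = "B * t" and n = n] g2m g2B by simp
    also have "\<dots> = (\<integral>\<omega>. (\<Sum>i\<in>E. indicator {\<omega>\<in>space Q. Z n \<omega> = i} \<omega> *
        (\<Sum>j\<in>E. q i j * (\<integral>s. g i j (U n \<omega>) s \<partial>exponential_law (lam i)))) \<partial>Q)"
      by (intro Bochner_Integration.integral_cong refl sum.cong)
         (simp add: step sum_distrib_right[symmetric] q_sum)
    also have "\<dots> = (\<integral>\<omega>. g (Z n \<omega>) (Z (Suc n) \<omega>) (U n \<omega>) (T n \<omega>) \<partial>Q)"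
      using markov_step_expectation[OF U, where g = g and B = "2 * B" and n = n] gm gB by simp
    finally show ?thesis by simp
  qed
  have gS: "g (Z n \<omega>) (Z (Suc n) \<omega>) (U n \<omega>) (T n \<omega>) = S (Suc n) \<omega> - S n \<omega>" if w: "\<omega> \<in> space Q" for n \<omega>
  proof (cases "jump_time n \<omega> \<le> t")
    case False
    then have "\<not> jump_time (Suc n) \<omega> \<le> t" using jump_time_less_Suc[OF w, of n] by simp
    then show ?thesis using False by (simp add: S_def g_def ok_def U_def)
  next
    case True
    have ok: "ok (U n \<omega>) (T n \<omega>)" unfolding ok_def U_def
      using True jC[OF w True] T_pos[OF w, of n] jump_time_nonneg[OF w, of n] by simp
    show ?thesis
    proof (cases "jump_time (Suc n) \<omega> \<le> t")
      case 2: True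
      then show ?thesis using ok True by (simp add: g_def S_def U_def f_def jump_time_Suc)
    next
      case 2: False
      then have "state t \<omega> = Z n \<omega>" "pdmp b c u t \<omega> = f (Z n \<omega>) (t - jump_time n \<omega>) (jump_value b c u n \<omega>)"
        using state_eq[OF w True] pdmp_eq[OF w True] by (simp_all add: f_def)
      then show ?thesis using ok True 2 by (simp add: g_def S_def U_def jump_time_Suc)
    qed
  qed
  have g2P: "g2 (Z n \<omega>) (U n \<omega>) (T n \<omega>) = P (Suc n) \<omega> - P n \<omega>" if w: "\<omega> \<in> space Q" for n \<omega>
  proof -
    let ?\<tau> = "jump_time n \<omega>" and ?v = "jump_value b c u n \<omega>"
    have [measurable]: "(\<lambda>s. R (s, \<omega>)) \<in> borel_measurable borel"
      using measurable_compose[OF _ R, of "\<lambda>s. (s, \<omega>)" borel] w by simp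
    have "P (Suc n) \<omega> - P n \<omega> = (\<integral>s. R (s, \<omega>) * (if 0 \<le> s \<and> s \<le> t \<and> s < jump_time (Suc n) \<omega> then 1 else 0)
        - R (s, \<omega>) * (if 0 \<le> s \<and> s \<le> t \<and> s < ?\<tau> then 1 else 0) \<partial>lborel)"
      unfolding P_def using Rint(1)[OF w] by (subst Bochner_Integration.integral_diff) auto
    also have "\<dots> = (\<integral>s. R (s, \<omega>) * (if ?\<tau> \<le> s \<and> s \<le> t \<and> s < jump_time (Suc n) \<omega> then 1 else 0) \<partial>lborel)"
      using jump_time_nonneg[OF w, of n] jump_time_less_Suc[OF w, of n]
      by (intro Bochner_Integration.integral_cong refl) auto
    also have "\<dots> = (\<integral>r. R (?\<tau> + r, \<omega>) * (if ?\<tau> \<le> ?\<tau> + r \<and> ?\<tau> + r \<le> t \<and> ?\<tau> + r < jump_time (Suc n) \<omega> then 1 else 0) \<partial>lborel)"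
      by (subst lborel_integral_real_affine[where c = 1 and t = ?\<tau>]) simp_all
    also have "\<dots> = (\<integral>r. L (Z n \<omega>) (f (Z n \<omega>) r ?v) * (if 0 \<le> r \<and> r \<le> min (T n \<omega>) (t - ?\<tau>) then 1 else 0) \<partial>lborel)"
    proof (rule integral_cong_AE)
      have [measurable]: "(\<lambda>r. L (Z n \<omega>) (f (Z n \<omega>) r ?v)) \<in> borel_measurable borel"
        using isCont_o2[OF linear_flow_isCont Lc[OF Z_in_E[OF w]]] unfolding f_def by (rule isCont_borel_measurable)
      show "(\<lambda>r. L (Z n \<omega>) (f (Z n \<omega>) r ?v) * (if 0 \<le> r \<and> r \<le> min (T n \<omega>) (t - ?\<tau>) then 1 else 0)) \<in> borel_measurable lborel"
        by simp
      show "(\<lambda>r. R (?\<tau> + r, \<omega>) * (if ?\<tau> \<le> ?\<tau> + r \<and> ?\<tau> + r \<le> t \<and> ?\<tau> + r < jump_time (Suc n) \<omega> then 1 else 0)) \<in> borel_measurable lborel"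
        by measurable
      have "AE r in lborel. r \<noteq> T n \<omega>" by (rule AE_lborel_singleton)
      then show "AE r in lborel. R (?\<tau> + r, \<omega>) * (if ?\<tau> \<le> ?\<tau> + r \<and> ?\<tau> + r \<le> t \<and> ?\<tau> + r < jump_time (Suc n) \<omega> then 1 else 0)
          = L (Z n \<omega>) (f (Z n \<omega>) r ?v) * (if 0 \<le> r \<and> r \<le> min (T n \<omega>) (t - ?\<tau>) then 1 else 0)"
      proof eventually_elim
        fix r assume "r \<noteq> T n \<omega>"
        have "R (?\<tau> + r, \<omega>) = L (Z n \<omega>) (f (Z n \<omega>) r ?v)" if "0 \<le> r" "r < T n \<omega>"
          using state_eq[OF w, of n "?\<tau> + r"] pdmp_eq[OF w, of n "?\<tau> + r" b c u] that
          by (simp add: R_def f_def jump_time_Suc)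
        then show "R (?\<tau> + r, \<omega>) * (if ?\<tau> \<le> ?\<tau> + r \<and> ?\<tau> + r \<le> t \<and> ?\<tau> + r < jump_time (Suc n) \<omega> then 1 else 0)
          = L (Z n \<omega>) (f (Z n \<omega>) r ?v) * (if 0 \<le> r \<and> r \<le> min (T n \<omega>) (t - ?\<tau>) then 1 else 0)"
          using \<open>r \<noteq> T n \<omega>\<close> by (auto simp: jump_time_Suc)
      qed
    qed
    also have "\<dots> = g2 (Z n \<omega>) (U n \<omega>) (T n \<omega>)"
    proof (cases "?\<tau> \<le> t")
      case True
      then have "ok (U n \<omega>) (T n \<omega>)" unfolding ok_def U_def
        using jC[OF w True] T_pos[OF w, of n] jump_time_nonneg[OF w, of n] by simp
      then show ?thesis by (simp add: g2_def U_def)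
    next
      case False
      then have "(if 0 \<le> r \<and> r \<le> min (T n \<omega>) (t - ?\<tau>) then 1 else 0) = (0::real)" for r by auto
      then show ?thesis using False by (simp add: g2_def ok_def U_def)
    qed
    finally show ?thesis by simp
  qed
  have iS: "integrable Q (S n)" for n by (rule integrable_const_bound[of _ B]) (auto intro!: AE_I2 SB)
  have iP: "integrable Q (P n)" for n by (rule integrable_const_bound[of _ "B * t"]) (auto intro!: AE_I2 PB)
  have SP: "(\<integral>\<omega>. S n \<omega> \<partial>Q) = (\<integral>\<omega>. S 0 \<omega> \<partial>Q) + (\<integral>\<omega>. P n \<omega> \<partial>Q)" for n
  proof (induction n)
    case 0
    have "(\<integral>\<omega>. P 0 \<omega> \<partial>Q) = 0" unfolding P_def
      by (intro integral_eq_zero_AE AE_I2) (auto intro!: integral_eq_zero_AE AE_I2)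
    then show ?case by simp
  next
    case (Suc n)
    have "(\<integral>\<omega>. S (Suc n) \<omega> \<partial>Q) - (\<integral>\<omega>. S n \<omega> \<partial>Q) = (\<integral>\<omega>. S (Suc n) \<omega> - S n \<omega> \<partial>Q)"
      by (rule Bochner_Integration.integral_diff[OF iS iS, symmetric])
    also have "\<dots> = (\<integral>\<omega>. g (Z n \<omega>) (Z (Suc n) \<omega>) (U n \<omega>) (T n \<omega>) \<partial>Q)"
      by (rule Bochner_Integration.integral_cong) (simp_all add: gS)
    also have "\<dots> = (\<integral>\<omega>. P (Suc n) \<omega> - P n \<omega> \<partial>Q)" unfolding Eg
      by (rule Bochner_Integration.integral_cong) (simp_all add: g2P)
    also have "\<dots> = (\<integral>\<omega>. P (Suc n) \<omega> \<partial>Q) - (\<integral>\<omega>. P n \<omega> \<partial>Q)"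
      by (rule Bochner_Integration.integral_diff[OF iP iP])
    finally show ?case using Suc by simp
  qed
  have ev: "\<forall>\<^sub>F n in sequentially. t < jump_time n \<omega>" if "\<omega> \<in> space Q" for \<omega>
    using T_diverges[OF that] unfolding filterlim_at_top_dense jump_time_def[symmetric] by blast
  have limS: "(\<lambda>n. \<integral>\<omega>. S n \<omega> \<partial>Q) \<longlonglongrightarrow> (\<integral>\<omega>. h (state t \<omega>) (pdmp b c u t \<omega>) \<partial>Q)"
  proof (rule integral_dominated_convergence[where w = "\<lambda>_. B"])
    show "AE \<omega> in Q. (\<lambda>n. S n \<omega>) \<longlonglongrightarrow> h (state t \<omega>) (pdmp b c u t \<omega>)"
    proof (rule AE_I2)
      fix \<omega> assume "\<omega> \<in> space Q"
      from ev[OF this] show "(\<lambda>n. S n \<omega>) \<longlonglongrightarrow> h (state t \<omega>) (pdmp b c u t \<omega>)"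
        by (intro tendsto_eventually) (auto simp: S_def elim!: eventually_mono)
    qed
  qed (auto intro!: AE_I2 SB)
  define P' where "P' \<omega> = (\<integral>s. R (s, \<omega>) * (if 0 \<le> s \<and> s \<le> t then 1 else 0) \<partial>lborel)" for \<omega>
  have limP: "(\<lambda>n. \<integral>\<omega>. P n \<omega> \<partial>Q) \<longlonglongrightarrow> (\<integral>\<omega>. P' \<omega> \<partial>Q)"
  proof (rule integral_dominated_convergence[where w = "\<lambda>_. B * t"])
    show "AE \<omega> in Q. (\<lambda>n. P n \<omega>) \<longlonglongrightarrow> P' \<omega>"
    proof (rule AE_I2)
      fix \<omega> assume "\<omega> \<in> space Q"
      from ev[OF this] have "\<forall>\<^sub>F n in sequentially. P n \<omega> = P' \<omega>"
        by eventually_elim (auto simp: P_def P'_def intro!: Bochner_Integration.integral_cong)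
      then show "(\<lambda>n. P n \<omega>) \<longlonglongrightarrow> P' \<omega>" by (rule tendsto_eventually)
    qed
    show "P' \<in> borel_measurable Q" unfolding P'_def by measurable
  qed (auto intro!: AE_I2 PB)
  have "(\<lambda>n. (\<integral>\<omega>. S 0 \<omega> \<partial>Q) + (\<integral>\<omega>. P n \<omega> \<partial>Q)) \<longlonglongrightarrow> (\<integral>\<omega>. S 0 \<omega> \<partial>Q) + (\<integral>\<omega>. P' \<omega> \<partial>Q)"
    by (intro tendsto_intros limP)
  then have main: "(\<integral>\<omega>. h (state t \<omega>) (pdmp b c u t \<omega>) \<partial>Q) = (\<integral>\<omega>. S 0 \<omega> \<partial>Q) + (\<integral>\<omega>. P' \<omega> \<partial>Q)"
    unfolding SP[symmetric] using limS LIMSEQ_unique by blast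
  interpret LQ: pair_sigma_finite lborel Q ..
  have int2: "integrable (lborel \<Otimes>\<^sub>M Q) (\<lambda>x. R x * indicator {0..t} (fst x))"
  proof (rule Bochner_Integration.integrable_bound[where f = "\<lambda>x. B * indicator ({0..t} \<times> space Q) x"])
    have "emeasure (lborel \<Otimes>\<^sub>M Q) ({0..t} \<times> space Q) < \<infinity>"
      using t by (subst emeasure_pair_measure_Times) (auto simp: emeasure_space_1)
    then show "integrable (lborel \<Otimes>\<^sub>M Q) (\<lambda>x. B * indicator ({0..t} \<times> space Q) x)"
      by (intro integrable_mult_right integrable_real_indicator) auto
    show "AE x in lborel \<Otimes>\<^sub>M Q. norm (R x * indicator {0..t} (fst x)) \<le> norm (B * indicator ({0..t} \<times> space Q) x)"
      using RB B0 by (intro AE_I2) (auto simp: space_pair_measure indicator_def)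
    have [measurable]: "R \<in> borel_measurable (lborel \<Otimes>\<^sub>M Q)" using R by (simp cong: measurable_cong_sets)
    show "(\<lambda>x. R x * indicator {0..t} (fst x)) \<in> borel_measurable (lborel \<Otimes>\<^sub>M Q)" by measurable
  qed
  then show ?int2 by (simp add: R_def split_beta')
  have "(\<integral>\<omega>. P' \<omega> \<partial>Q) = (\<integral>\<omega>. (\<integral>s. R (s, \<omega>) * indicator {0..t} s \<partial>lborel) \<partial>Q)"
    by (simp add: P'_def indicator_def of_bool_def)
  also have "\<dots> = (\<integral>s. (\<integral>\<omega>. R (s, \<omega>) * indicator {0..t} s \<partial>Q) \<partial>lborel)"
    by (rule LQ.Fubini_integral) (use int2 in \<open>simp add: split_beta'\<close>)
  also have "\<dots> = (\<integral>s. (\<integral>\<omega>. L (state s \<omega>) (pdmp b c u s \<omega>) \<partial>Q) * indicator {0..t} s \<partial>lborel)"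
    by (simp add: R_def)
  finally have P'eq: "(\<integral>\<omega>. P' \<omega> \<partial>Q) = (\<integral>s. (\<integral>\<omega>. L (state s \<omega>) (pdmp b c u s \<omega>) \<partial>Q) * indicator {0..t} s \<partial>lborel)" .
  have "S 0 = (\<lambda>\<omega>. h (Z 0 \<omega>) u)" using t by (simp add: S_def fun_eq_iff)
  then show ?eq unfolding main P'eq by simp
qed

end

section \<open>The Gaussian kernel\<close>

definition gaussian_tail :: "real \<Rightarrow> real" where
  "gaussian_tail z = measure std_normal_distribution {z<..}"

text \<open>\<open>gaussian_kernel v\<close> is the probability that \<open>sqrt v * N\<close> exceeds \<open>1\<close>, for \<open>N\<close> standard normal.\<close>

definition gaussian_kernel :: "real \<Rightarrow> real" where
  "gaussian_kernel v = (if v \<le> 0 then 0 else gaussian_tail (1 / sqrt v))"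

definition gaussian_kernel' :: "real \<Rightarrow> real" where
  "gaussian_kernel' v = (if v \<le> 0 then 0 else std_normal_density (1 / sqrt v) / (2 * (v * sqrt v)))"

lemma prob_space_std_normal: "prob_space std_normal_distribution"
  by (rule prob_space_normal_density) simp

lemma gaussian_tail_deriv: "(gaussian_tail has_real_derivative - std_normal_density z) (at z)"
proof -
  interpret N: prob_space std_normal_distribution by (rule prob_space_std_normal)
  have c: "isCont std_normal_density x" for x unfolding std_normal_density_def by (intro continuous_intros) auto
  obtain F where F: "\<And>x. (F has_real_derivative std_normal_density x) (at x)"
    using einterval_antiderivative[of "-\<infinity>" "\<infinity>" std_normal_density] c
    by (auto simp: has_real_derivative_iff_has_vector_derivative)
  have diff: "gaussian_tail w - gaussian_tail z = F z - F w" if "w \<le> z" for w z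
  proof -
    have "gaussian_tail w = measure std_normal_distribution ({w<..z} \<union> {z<..})"
      unfolding gaussian_tail_def using that by (simp add: ivl_disj_un)
    also have "\<dots> = measure std_normal_distribution {w<..z} + gaussian_tail z"
      unfolding gaussian_tail_def by (rule N.finite_measure_Union) auto
    finally have "gaussian_tail w - gaussian_tail z = measure std_normal_distribution {w<..z}" by simp
    also have "\<dots> = (\<integral>x. indicator {w<..z} x \<partial>std_normal_distribution)" by simp
    also have "\<dots> = (\<integral>x. std_normal_density x * indicator {w<..z} x \<partial>lborel)"
      by (subst integral_real_density) auto
    also have "\<dots> = (\<integral>x. std_normal_density x * indicator {w..z} x \<partial>lborel)"
    proof (rule integral_cong_AE)
      have "AE x in lborel. x \<noteq> w" by (rule AE_lborel_singleton)
      then show "AE x in lborel. std_normal_density x * indicator {w<..z} x = std_normal_density x * indicator {w..z} x"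
        by eventually_elim (auto simp: indicator_def)
    qed auto
    also have "\<dots> = F z - F w" using integral_FTC_Icc_real[OF that F c] .
    finally show ?thesis .
  qed
  have "gaussian_tail x = gaussian_tail 0 + F 0 - F x" for x
    using diff[of 0 x] diff[of x 0] by (cases "0 \<le> x") auto
  then have "gaussian_tail = (\<lambda>x. gaussian_tail 0 + F 0 - F x)" by blast
  then show ?thesis using DERIV_diff[OF DERIV_const F, of "gaussian_tail 0 + F 0"] by simp
qed

lemma gaussian_tail_nonneg: "0 \<le> gaussian_tail z" and gaussian_tail_le_1: "gaussian_tail z \<le> 1"
  unfolding gaussian_tail_def using prob_space.prob_le_1[OF prob_space_std_normal] by auto

lemma gaussian_tail_le_fourth_power:
  assumes "0 < z"
  shows "gaussian_tail z \<le> 3 / z ^ 4"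
proof -
  interpret N: prob_space std_normal_distribution by (rule prob_space_std_normal)
  have m: "has_bochner_integral lborel (\<lambda>x. std_normal_density x * x ^ 4) 3"
    using std_normal_moment_even[of 2] by (simp add: fact_numeral)
  have i: "integrable std_normal_distribution (\<lambda>x. x ^ 4)" 
    using m by (subst integrable_real_density) (auto simp: has_bochner_integral_iff)
  have e: "(\<integral>x. x ^ 4 \<partial>std_normal_distribution) = 3" 
    using m by (subst integral_real_density) (auto simp: has_bochner_integral_iff)
  have "z ^ 4 * gaussian_tail z = (\<integral>x. z ^ 4 * indicator {z<..} x \<partial>std_normal_distribution)"
    unfolding gaussian_tail_def by simp
  also have "\<dots> \<le> (\<integral>x. x ^ 4 \<partial>std_normal_distribution)"
  proof (rule integral_mono)
    show "integrable std_normal_distribution (\<lambda>x. z ^ 4 * indicator {z<..} x)"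
      by (intro integrable_mult_right integrable_real_indicator) (auto simp: N.emeasure_eq_measure)
    fix x show "z ^ 4 * indicator {z<..} x \<le> x ^ 4"
      using assms by (auto simp: indicator_def intro!: power_mono)
  qed (rule i)
  finally show ?thesis using assms e by (simp add: field_simps)
qed

lemma std_normal_density_le_1: "std_normal_density z \<le> 1"
proof -
  have "1 \<le> sqrt (2 * pi)" using pi_ge_two by (intro real_le_rsqrt) auto
  then have "1 / sqrt (2 * pi) * exp (- z\<^sup>2 / 2) \<le> 1 * 1" by (intro mult_mono) auto
  then show ?thesis by (simp add: std_normal_density_def)
qed

lemma std_normal_density_sixth_power: "z ^ 6 * std_normal_density z \<le> 216"
proof -
  have "z\<^sup>2 / 6 \<le> exp (z\<^sup>2 / 6)" using exp_ge_add_one_self[of "z\<^sup>2 / 6"] by linarith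
  then have "(z\<^sup>2 / 6) ^ 3 \<le> exp (z\<^sup>2 / 6) ^ 3" by (rule power_mono) simp
  also have "exp (z\<^sup>2 / 6) ^ 3 = exp (z\<^sup>2 / 2)" by (simp flip: exp_of_nat_mult)
  finally have "z ^ 6 \<le> 216 * exp (z\<^sup>2 / 2)" by (simp add: power_divide flip: power_mult)
  then have "z ^ 6 * exp (- z\<^sup>2 / 2) \<le> 216" by (simp add: exp_minus field_simps)
  moreover have "std_normal_density z \<le> exp (- z\<^sup>2 / 2)"
  proof -
    have "1 \<le> sqrt (2 * pi)" using pi_ge_two by (intro real_le_rsqrt) auto
    then have "1 / sqrt (2 * pi) * exp (- z\<^sup>2 / 2) \<le> 1 * exp (- z\<^sup>2 / 2)" by (intro mult_right_mono) auto
    then show ?thesis by (simp add: std_normal_density_def)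
  qed
  then have "z ^ 6 * std_normal_density z \<le> z ^ 6 * exp (- z\<^sup>2 / 2)"
    by (intro mult_left_mono) (simp_all add: zero_le_even_power)
  ultimately show ?thesis by linarith
qed

lemma std_normal_density_antimono:
  assumes "0 \<le> x" "x \<le> z"
  shows "std_normal_density z \<le> std_normal_density x"
  unfolding std_normal_density_def using assms power_mono[OF assms(2,1), of 2] by (intro mult_left_mono) auto

lemma DERIV_zero_of_quadratic_bound:
  fixes f :: "real \<Rightarrow> real"
  assumes "\<And>v. \<bar>f v - f p\<bar> \<le> C * (v - p)\<^sup>2"
  shows "(f has_real_derivative 0) (at p)"
proof -
  have "((\<lambda>v. (f v - f p) / (v - p)) \<longlongrightarrow> 0) (at p)"
  proof (rule Lim_null_comparison)
    show "\<forall>\<^sub>F v in at p. norm ((f v - f p) / (v - p)) \<le> C * \<bar>v - p\<bar>"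
    proof (rule eventually_at_filter[THEN iffD2], intro always_eventually allI impI)
      fix v assume "v \<noteq> p"
      then have "\<bar>f v - f p\<bar> / \<bar>v - p\<bar> \<le> C * (v - p)\<^sup>2 / \<bar>v - p\<bar>" using assms by (intro divide_right_mono) auto
      also have "\<dots> = C * \<bar>v - p\<bar>" using \<open>v \<noteq> p\<close>
        by (simp add: power2_eq_square abs_mult_self_eq[of "v - p", symmetric] del: abs_mult_self_eq)
      finally show "norm ((f v - f p) / (v - p)) \<le> C * \<bar>v - p\<bar>" by (simp add: abs_divide)
    qed
    have "((\<lambda>v. C * \<bar>v - p\<bar>) \<longlongrightarrow> C * \<bar>p - p\<bar>) (at p)" by (intro tendsto_intros)
    then show "((\<lambda>v. C * \<bar>v - p\<bar>) \<longlongrightarrow> 0) (at p)" by simp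
  qed
  then show ?thesis by (simp add: has_field_derivative_iff)
qed

lemma gaussian_kernel_bounds: "0 \<le> gaussian_kernel v" "gaussian_kernel v \<le> 1"
  unfolding gaussian_kernel_def using gaussian_tail_nonneg gaussian_tail_le_1 by auto

lemma gaussian_kernel_le_square: "gaussian_kernel v \<le> 3 * v\<^sup>2"
proof (cases "v \<le> 0")
  case False
  then have "gaussian_tail (1 / sqrt v) \<le> 3 / (1 / sqrt v) ^ 4" by (intro gaussian_tail_le_fourth_power) auto
  also have "(1 / sqrt v) ^ 4 = 1 / v\<^sup>2"
  proof -
    have "sqrt v ^ 4 = ((sqrt v)\<^sup>2)\<^sup>2" by (simp flip: power_mult)
    then show ?thesis using False by (simp add: power_divide)
  qed
  finally show ?thesis using False by (simp add: gaussian_kernel_def)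
qed (simp add: gaussian_kernel_def)

lemma gaussian_kernel'_nonneg: "0 \<le> gaussian_kernel' v" and gaussian_kernel'_pos: "0 < v \<Longrightarrow> 0 < gaussian_kernel' v"
  unfolding gaussian_kernel'_def by (auto simp: normal_density_pos intro!: divide_nonneg_nonneg divide_pos_pos)

lemma gaussian_kernel'_le_near_0: "gaussian_kernel' v \<le> 108 * (\<bar>v\<bar> * sqrt \<bar>v\<bar>)"
proof (cases "v \<le> 0")
  case False
  then have v: "0 < v" by simp
  have s6: "sqrt v ^ 6 = v ^ 3"
  proof -
    have "sqrt v ^ 6 = ((sqrt v)\<^sup>2) ^ 3" by (simp flip: power_mult)
    then show ?thesis using v by simp
  qed
  have "std_normal_density (1 / sqrt v) \<le> 216 * v ^ 3"
    using std_normal_density_sixth_power[of "1 / sqrt v"] v by (simp add: power_divide s6 field_simps)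
  then have "gaussian_kernel' v \<le> 216 * v ^ 3 / (2 * (v * sqrt v))"
    unfolding gaussian_kernel'_def if_not_P[OF False] using v by (intro divide_right_mono) auto
  also have "v ^ 3 = (v * sqrt v) * (v * sqrt v)" using v by (simp add: power3_eq_cube)
  also have "216 * ((v * sqrt v) * (v * sqrt v)) / (2 * (v * sqrt v)) = 108 * (v * sqrt v)" using v by (simp add: field_simps)
  finally show ?thesis using v by simp
next
  case True
  have "0 \<le> \<bar>v\<bar> * sqrt \<bar>v\<bar>" by (intro mult_nonneg_nonneg) auto
  then show ?thesis using True by (simp only: gaussian_kernel'_def if_True)
qed

lemma gaussian_kernel_deriv: "(gaussian_kernel has_real_derivative gaussian_kernel' v) (at v)"
proof -
  consider "v < 0" | "v = 0" | "0 < v" by linarith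
  then show ?thesis
  proof cases
    case 1
    have "((\<lambda>_. 0) has_real_derivative 0) (at v)" by simp
    then have "(gaussian_kernel has_real_derivative 0) (at v)"
      by (rule has_field_derivative_transform_within_open[of _ _ _ "{..<0}"]) (use 1 in \<open>auto simp: gaussian_kernel_def\<close>)
    then show ?thesis using 1 by (simp add: gaussian_kernel'_def)
  next
    case 2
    have "(gaussian_kernel has_real_derivative 0) (at 0)"
      using gaussian_kernel_le_square gaussian_kernel_bounds(1)
      by (intro DERIV_zero_of_quadratic_bound[of _ _ 3]) (simp add: gaussian_kernel_def[of 0])
    then show ?thesis using 2 by (simp add: gaussian_kernel'_def)
  next
    case 3
    have d: "((\<lambda>v. 1 / sqrt v) has_real_derivative - 1 / (2 * (v * sqrt v))) (at v)"
      using 3 by (auto intro!: derivative_eq_intros simp: divide_simps power2_eq_square)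
    have "((\<lambda>v. gaussian_tail (1 / sqrt v)) has_real_derivative
        - std_normal_density (1 / sqrt v) * (- 1 / (2 * (v * sqrt v)))) (at v)"
      by (rule DERIV_chain2[OF gaussian_tail_deriv d])
    then have "(gaussian_kernel has_real_derivative - std_normal_density (1 / sqrt v) * (- 1 / (2 * (v * sqrt v)))) (at v)"
      by (rule has_field_derivative_transform_within_open[of _ _ _ "{0<..}"]) (use 3 in \<open>auto simp: gaussian_kernel_def\<close>)
    then show ?thesis using 3 by (simp add: gaussian_kernel'_def)
  qed
qed

lemma gaussian_kernel'_isCont: "isCont gaussian_kernel' v"
proof -
  consider "v < 0" | "v = 0" | "0 < v" by linarith
  then show ?thesis
  proof cases
    case 1
    have "\<forall>\<^sub>F x in nhds v. gaussian_kernel' x = 0"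
      using eventually_nhds_in_open[of "{..<0}" v] 1 by (auto simp: gaussian_kernel'_def elim!: eventually_mono)
    then show ?thesis using isCont_cong[of gaussian_kernel' "\<lambda>_. 0" v] by simp
  next
    case 2
    have "(gaussian_kernel' \<longlongrightarrow> 0) (at 0)"
    proof (rule Lim_null_comparison)
      show "\<forall>\<^sub>F x in at 0. norm (gaussian_kernel' x) \<le> 108 * (\<bar>x\<bar> * sqrt \<bar>x\<bar>)"
        using gaussian_kernel'_le_near_0 gaussian_kernel'_nonneg by (auto intro!: always_eventually)
      have "((\<lambda>x. 108 * (\<bar>x\<bar> * sqrt \<bar>x\<bar>)) \<longlongrightarrow> 108 * (\<bar>0::real\<bar> * sqrt \<bar>0\<bar>)) (at 0)" by (intro tendsto_intros)
      then show "((\<lambda>x::real. 108 * (\<bar>x\<bar> * sqrt \<bar>x\<bar>)) \<longlongrightarrow> 0) (at 0)" by simp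
    qed
    then show ?thesis using 2 by (simp add: isCont_def gaussian_kernel'_def)
  next
    case 3
    have "\<forall>\<^sub>F x in nhds v. gaussian_kernel' x = std_normal_density (1 / sqrt x) / (2 * (x * sqrt x))"
      using eventually_nhds_in_open[of "{0<..}" v] 3 by (auto simp: gaussian_kernel'_def elim!: eventually_mono)
    moreover have "isCont (\<lambda>x. std_normal_density (1 / sqrt x) / (2 * (x * sqrt x))) v"
      unfolding std_normal_density_def using 3 by (intro continuous_intros) auto
    ultimately show ?thesis by (simp only: isCont_cong)
  qed
qed

lemma gaussian_kernel'_bound: "(1 + \<bar>v\<bar>) * \<bar>gaussian_kernel' v\<bar> \<le> 216"
proof -
  consider "v \<le> 0" | "0 < v" "v \<le> 1" | "1 \<le> v" by linarith
  then show ?thesis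
  proof cases
    case 1 then show ?thesis by (simp add: gaussian_kernel'_def)
  next
    case 2
    then have "\<bar>v\<bar> * sqrt \<bar>v\<bar> \<le> 1 * 1" by (intro mult_mono) auto
    then have "gaussian_kernel' v \<le> 108" using gaussian_kernel'_le_near_0[of v] by linarith
    then have "(1 + \<bar>v\<bar>) * \<bar>gaussian_kernel' v\<bar> \<le> 2 * 108"
      using 2 gaussian_kernel'_nonneg[of v] by (intro mult_mono) auto
    then show ?thesis by simp
  next
    case 3
    have "gaussian_kernel' v \<le> 1 / (2 * (v * sqrt v))"
      unfolding gaussian_kernel'_def using 3 std_normal_density_le_1 by (auto intro!: divide_right_mono)
    also have "\<dots> \<le> 1 / (2 * (v * 1))" using 3 by (intro divide_left_mono mult_left_mono) auto
    finally have "(1 + \<bar>v\<bar>) * \<bar>gaussian_kernel' v\<bar> \<le> (2 * v) * (1 / (2 * (v * 1)))"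
      using 3 gaussian_kernel'_nonneg[of v] by (intro mult_mono) auto
    then show ?thesis using 3 by simp
  qed
qed

lemma gaussian_kernel'_le_kernel: "v * gaussian_kernel' v \<le> gaussian_kernel (4 * v)"
proof (cases "v \<le> 0")
  case True then show ?thesis using gaussian_kernel_bounds by (simp add: gaussian_kernel'_def)
next
  case False
  define z where "z = 1 / sqrt v"
  have z: "0 < z" using False by (simp add: z_def)
  obtain y where y: "z / 2 < y" "y < z" "gaussian_tail z - gaussian_tail (z / 2) = (z - z / 2) * (- std_normal_density y)"
    using MVT2[of "z / 2" z gaussian_tail "\<lambda>x. - std_normal_density x"] gaussian_tail_deriv z by auto
  have "z / 2 * std_normal_density z \<le> z / 2 * std_normal_density y"
    using std_normal_density_antimono[of y z] y z by (intro mult_left_mono) auto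
  then have "z / 2 * std_normal_density z \<le> gaussian_tail (z / 2)"
    using y(3) gaussian_tail_nonneg[of z] by (simp add: field_simps)
  moreover have "v * gaussian_kernel' v = z / 2 * std_normal_density z"
    using False by (simp add: gaussian_kernel'_def z_def)
  moreover have "gaussian_kernel (4 * v) = gaussian_tail (z / 2)"
    using False by (simp add: gaussian_kernel_def z_def real_sqrt_mult mult.commute)
  ultimately show ?thesis by simp
qed

lemma gaussian_kernel_measurable[measurable]: "gaussian_kernel \<in> borel_measurable borel"
  and gaussian_kernel'_measurable[measurable]: "gaussian_kernel' \<in> borel_measurable borel"
  using DERIV_isCont[OF gaussian_kernel_deriv] gaussian_kernel'_isCont
  by (auto intro!: borel_measurable_continuous_onI continuous_at_imp_continuous_on)

text \<open>Averaging the kernel against a law with a power tail keeps the power: condition on the Gaussian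
  variable and use that it has all moments.\<close>

lemma gaussian_kernel_average_bound:
  assumes M: "real_distribution M" and \<kappa>: "0 < \<kappa>"
    and tail: "\<And>s. measure M {exp s<..} \<le> C * exp (- \<kappa> * s)"
  shows "\<exists>C'. \<forall>s. (\<integral>v. gaussian_kernel (v * exp (- s)) \<partial>M) \<le> C' * exp (- \<kappa> * s)"
proof -
  interpret M: real_distribution M by fact
  let ?N = std_normal_distribution
  interpret N: prob_space ?N by (rule prob_space_std_normal)
  interpret P: pair_prob_space M ?N ..
  obtain n :: nat where n: "\<kappa> \<le> real n" using real_arch_simple by blast
  have C0: "0 \<le> C" using order_trans[OF measure_nonneg tail[of 0]] by simp
  define m where "m = (\<integral>z. 1 + z ^ (2 * n) \<partial>?N)"
  have mi: "integrable ?N (\<lambda>z. z ^ (2 * n))"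
    using integrable_std_normal_moment[of "2 * n"] by (subst integrable_real_density) auto
  have "(\<integral>v. gaussian_kernel (v * exp (- s)) \<partial>M) \<le> (C * m) * exp (- \<kappa> * s)" for s
  proof -
    define A where "A = {x :: real \<times> real. 0 < snd x \<and> exp s < fst x * (snd x)\<^sup>2}"
    have "{x \<in> space (borel \<Otimes>\<^sub>M borel). 0 < snd x \<and> exp s < fst x * (snd x)\<^sup>2} \<in> sets (borel \<Otimes>\<^sub>M (borel :: real measure))"
      by measurable
    then have Am: "A \<in> sets (borel \<Otimes>\<^sub>M borel)" unfolding A_def by (simp add: space_pair_measure)
    have "sets (M \<Otimes>\<^sub>M ?N) = sets (borel \<Otimes>\<^sub>M borel)" by (rule sets_pair_measure_cong) simp_all
    then have Am'[measurable]: "A \<in> sets (M \<Otimes>\<^sub>M ?N)" using Am by blast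
    have k: "gaussian_kernel (v * exp (- s)) = (\<integral>z. indicator A (v, z) \<partial>?N)" for v
    proof (cases "v \<le> 0")
      case True
      then have "\<not> exp s < v * z\<^sup>2" for z :: real
        using mult_nonpos_nonneg[OF True zero_le_power2[of z]] exp_gt_zero[of s] by linarith
      then have "indicator A (v, z) = (0::real)" for z by (simp add: A_def)
      then show ?thesis using True by (simp add: gaussian_kernel_def mult_le_0_iff)
    next
      case False
      define w where "w = v * exp (- s)"
      have w: "0 < w" using False by (simp add: w_def)
      have "(0 < z \<and> exp s < v * z\<^sup>2) \<longleftrightarrow> 1 / sqrt w < z" for z
      proof -
        define r where "r = 1 / sqrt w"
        have r: "0 < r" "r\<^sup>2 = 1 / w" using w by (simp_all add: r_def power_divide)
        have "exp s < v * z\<^sup>2 \<longleftrightarrow> r\<^sup>2 < z\<^sup>2" unfolding r(2) using False w by (simp add: w_def exp_minus field_simps)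
        moreover have "r < z \<Longrightarrow> 0 < z \<and> r\<^sup>2 < z\<^sup>2" using r(1) by (auto intro!: power_strict_mono)
        moreover have "0 < z \<Longrightarrow> r\<^sup>2 < z\<^sup>2 \<Longrightarrow> r < z" by (rule power2_less_imp_less) auto
        ultimately show ?thesis unfolding r_def by argo
      qed
      then have "indicator A (v, z) = (indicator {1 / sqrt w<..} z :: real)" for z by (simp add: A_def indicator_def)
      then show ?thesis using w by (simp add: gaussian_kernel_def gaussian_tail_def w_def[symmetric])
    qed
    have int: "integrable (M \<Otimes>\<^sub>M ?N) (indicator A :: _ \<Rightarrow> real)"
      by (rule integrable_real_indicator) (use Am in \<open>auto simp: P.emeasure_eq_measure\<close>)
    have sec: "(\<integral>v. indicator A (v, z) \<partial>M) \<le> C * exp (- \<kappa> * s) * (1 + z ^ (2 * n))" for z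
    proof (cases "0 < z")
      case False
      then show ?thesis using C0 by (simp add: A_def zero_le_even_power add_nonneg_nonneg)
    next
      case True
      have "exp (s - 2 * ln z) = exp s / z\<^sup>2" using True by (simp add: exp_diff exp_double)
      then have "indicator A (v, z) = (indicator {exp (s - 2 * ln z)<..} v :: real)" for v
        using True by (simp add: A_def indicator_def pos_divide_less_eq)
      then have "(\<integral>v. indicator A (v, z) \<partial>M) \<le> C * exp (- \<kappa> * (s - 2 * ln z))" using tail[of "s - 2 * ln z"] by simp
      also have "\<dots> = C * exp (- \<kappa> * s) * exp (2 * \<kappa> * ln z)" by (simp add: algebra_simps flip: exp_add)
      also have "\<dots> \<le> C * exp (- \<kappa> * s) * (1 + z ^ (2 * n))"
      proof (rule mult_left_mono)
        show "exp (2 * \<kappa> * ln z) \<le> 1 + z ^ (2 * n)"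
        proof (cases "1 \<le> z")
          case z: True
          then have "exp (2 * \<kappa> * ln z) \<le> exp (real (2 * n) * ln z)" using n by (simp add: mult_right_mono)
          also have "\<dots> = z ^ (2 * n)" using True by (simp add: exp_of_nat_mult del: of_nat_mult)
          finally show ?thesis by simp
        next
          case z: False
          then have "exp (2 * \<kappa> * ln z) \<le> 1" using \<kappa> True by (simp add: mult_nonneg_nonpos)
          then show ?thesis by (simp add: add_increasing2 zero_le_even_power)
        qed
      qed (simp add: C0)
      finally show ?thesis .
    qed
    have "(\<integral>v. gaussian_kernel (v * exp (- s)) \<partial>M) = (\<integral>v. (\<integral>z. indicator A (v, z) \<partial>?N) \<partial>M)" by (simp add: k)
    also have "\<dots> = (\<integral>z. (\<integral>v. indicator A (v, z) \<partial>M) \<partial>?N)"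
      using P.Fubini_integral[of "\<lambda>v z. indicator A (v, z) :: real"] int by simp
    also have "\<dots> \<le> (\<integral>z. C * exp (- \<kappa> * s) * (1 + z ^ (2 * n)) \<partial>?N)"
      using mi sec C0 by (intro integral_mono') (auto simp: zero_le_even_power add_nonneg_nonneg)
    also have "\<dots> = (C * m) * exp (- \<kappa> * s)" by (simp add: m_def)
    finally show ?thesis .
  qed
  then show ?thesis by (intro exI[of _ "C * m"] allI)
qed

section \<open>Two facts on real functions\<close>

lemma scaled_integral_deriv:
  fixes f f' :: "real \<Rightarrow> real"
  assumes M: "real_distribution M"
    and f: "\<And>v. (f has_real_derivative f' v) (at v)" "\<And>v. isCont f' v"
    and B: "\<And>v. \<bar>f v\<bar> \<le> B" "\<And>v. \<bar>v * f' v\<bar> \<le> B"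
  shows "((\<lambda>s. \<integral>v. f (v * exp (- s)) \<partial>M) has_real_derivative - (\<integral>v. v * exp (- s) * f' (v * exp (- s)) \<partial>M)) (at s)"
proof -
  interpret M: real_distribution M by fact
  have fm[measurable]: "f \<in> borel_measurable borel" "f' \<in> borel_measurable borel"
    using DERIV_isCont[OF f(1)] f(2) by (auto intro!: borel_measurable_continuous_onI continuous_at_imp_continuous_on)
  have d: "((\<lambda>s. f (v * exp (- s))) has_real_derivative - (v * exp (- s) * f' (v * exp (- s)))) (at s)" for v s
    by (rule DERIV_cong[OF DERIV_chain2[OF f(1)]], (rule derivative_eq_intros refl)+) simp
  have lip: "\<bar>f (v * exp (- x)) - f (v * exp (- y))\<bar> \<le> B * \<bar>x - y\<bar>" for v x y
    using field_differentiable_bound[of UNIV "\<lambda>s. f (v * exp (- s))" "\<lambda>s. - (v * exp (- s) * f' (v * exp (- s)))" B x y] d B(2)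
    by auto
  have int: "integrable M (\<lambda>v. f (v * exp (- x)))" for x
    by (rule M.integrable_const_bound[of _ B]) (auto simp: B)
  show ?thesis
    unfolding DERIV_def LIMSEQ_SEQ_conv[symmetric]
  proof (intro allI impI)
    fix h :: "nat \<Rightarrow> real" assume h: "(\<forall>n. h n \<noteq> 0) \<and> h \<longlonglongrightarrow> 0"
    have "(\<lambda>n. \<integral>v. (f (v * exp (- (s + h n))) - f (v * exp (- s))) / h n \<partial>M) \<longlonglongrightarrow> (\<integral>v. - (v * exp (- s) * f' (v * exp (- s))) \<partial>M)"
    proof (rule integral_dominated_convergence[where w = "\<lambda>_. B"])
      show "AE v in M. (\<lambda>n. (f (v * exp (- (s + h n))) - f (v * exp (- s))) / h n) \<longlonglongrightarrow> - (v * exp (- s) * f' (v * exp (- s)))"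
      proof (rule AE_I2)
        fix v
        have "\<forall>S. (\<forall>n. S n \<noteq> 0) \<and> S \<longlonglongrightarrow> 0 \<longrightarrow> (\<lambda>n. (f (v * exp (- (s + S n))) - f (v * exp (- s))) / S n)
            \<longlonglongrightarrow> - (v * exp (- s) * f' (v * exp (- s)))"
          using d[of v s] unfolding DERIV_def LIMSEQ_SEQ_conv[symmetric] .
        then show "(\<lambda>n. (f (v * exp (- (s + h n))) - f (v * exp (- s))) / h n) \<longlonglongrightarrow> - (v * exp (- s) * f' (v * exp (- s)))"
          using h by (elim allE[of _ h]) (rule mp)
      qed
      show "AE v in M. norm ((f (v * exp (- (s + h n))) - f (v * exp (- s))) / h n) \<le> B" for n
        using lip[of _ "s + h n" s] h by (intro AE_I2) (auto simp: abs_divide divide_le_eq)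
    qed auto
    moreover have eq: "(\<integral>v. (f (v * exp (- (s + h n))) - f (v * exp (- s))) / h n \<partial>M)
        = ((\<integral>v. f (v * exp (- (s + h n))) \<partial>M) - (\<integral>v. f (v * exp (- s)) \<partial>M)) / h n" for n
      unfolding Bochner_Integration.integral_diff[OF int[of "s + h n"] int[of s], symmetric] by (rule integral_divide_zero)
    ultimately show "(\<lambda>n. ((\<integral>v. f (v * exp (- (s + h n))) \<partial>M) - (\<integral>v. f (v * exp (- s)) \<partial>M)) / h n)
        \<longlonglongrightarrow> - (\<integral>v. v * exp (- s) * f' (v * exp (- s)) \<partial>M)"
      unfolding eq integral_minus by blast
  qed
qed

lemma bounded_nondecreasing_tendsto:
  fixes f :: "real \<Rightarrow> real"
  assumes mono: "\<And>s t. s \<le> t \<Longrightarrow> f s \<le> f t" and bd: "\<And>s. f s \<le> B"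
  shows "\<exists>l. (f \<longlongrightarrow> l) at_top \<and> (\<forall>s. f s \<le> l)"
proof -
  have bdd: "bdd_above (range f)" using bd by (intro bdd_aboveI[of _ B]) auto
  define l where "l = Sup (range f)"
  have le: "f s \<le> l" for s unfolding l_def by (rule cSup_upper[OF _ bdd]) simp
  have "(f \<longlongrightarrow> l) at_top"
  proof (rule increasing_tendsto)
    show "\<forall>\<^sub>F n in at_top. f n \<le> l" using le by simp
    fix x assume "x < l"
    then obtain s where "x < f s" unfolding l_def using less_cSup_iff[OF _ bdd] by auto
    then show "\<forall>\<^sub>F n in at_top. x < f n"
      using mono by (intro eventually_at_top_linorderI[of s]) (meson order_less_le_trans)
  qed
  then show ?thesis using le by blast
qed

text \<open>Barbalat's lemma: a Lipschitz function whose primitive stays bounded tends to zero.\<close>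

lemma barbalat:
  fixes R R' D :: "real \<Rightarrow> real"
  assumes R: "\<And>s. (R has_real_derivative R' s) (at s)" and le: "\<And>s. D s \<le> R' s"
    and D0: "\<And>s. 0 \<le> D s" and lip: "\<And>s t. \<bar>D s - D t\<bar> \<le> K * \<bar>s - t\<bar>" and K: "0 < K"
    and bd: "\<And>s. R s \<le> B"
  shows "(D \<longlongrightarrow> 0) at_top"
proof (rule tendstoI)
  fix e :: real assume e: "0 < e"
  have mono: "R s \<le> R t" if "s \<le> t" for s t
  proof (rule DERIV_nonneg_imp_nondecreasing[OF that])
    fix x show "\<exists>y. (R has_real_derivative y) (at x) \<and> 0 \<le> y"
      by (intro exI[of _ "R' x"] conjI R order_trans[OF D0 le])
  qed
  obtain l where l: "(R \<longlongrightarrow> l) at_top" "\<And>s. R s \<le> l" using bounded_nondecreasing_tendsto[of R B] mono bd by blast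
  define d where "d = e / (2 * K)"
  have d: "0 < d" using e K by (simp add: d_def)
  have "\<forall>\<^sub>F s in at_top. l - d * (e / 2) < R s"
    using order_tendstoD(1)[OF l(1)] d e by simp
  then show "\<forall>\<^sub>F s in at_top. dist (D s) 0 < e"
  proof eventually_elim
    fix s assume s: "l - d * (e / 2) < R s"
    show "dist (D s) 0 < e"
    proof (rule ccontr)
      assume "\<not> dist (D s) 0 < e"
      then have De: "e \<le> D s" using D0[of s] by (simp add: dist_real_def)
      obtain x where x: "s < x" "x < s + d" "R (s + d) - R s = (s + d - s) * R' x"
        using MVT2[of s "s + d" R R'] d R by auto
      have "K * \<bar>s - x\<bar> \<le> K * d" using x K by (intro mult_left_mono) auto
      also have "K * d = e / 2" using K by (simp add: d_def)
      finally have "e / 2 \<le> D x" using lip[of s x] De by linarith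
      then have "d * (e / 2) \<le> d * R' x" using le[of x] d by (intro mult_left_mono) auto
      then show False using x(3) s l(2)[of "s + d"] by simp
    qed
  qed
qed

section \<open>Tails of stationary laws\<close>

text \<open>
  The stationary law of the pair (state, value) of a piecewise linear process with coefficients
  \<open>b\<close>, \<open>c\<close>: \<open>m i\<close> is the weight of the state \<open>i\<close> and \<open>M i\<close> the conditional law of the value.
\<close>

locale stationary_law = tilted_generator E G b m
  for E :: "nat set" and G :: "nat \<Rightarrow> nat \<Rightarrow> real" and b m :: "nat \<Rightarrow> real" +
  fixes c :: "nat \<Rightarrow> real" and M :: "nat \<Rightarrow> real measure"
  assumes c_nonneg: "\<And>i. i \<in> E \<Longrightarrow> 0 \<le> c i"
    and M_dist: "\<And>i. i \<in> E \<Longrightarrow> real_distribution (M i)"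
    and M_nonneg: "\<And>i. i \<in> E \<Longrightarrow> AE v in M i. 0 \<le> v"
    and M_stationary: "\<And>f f' B i. i \<in> E \<Longrightarrow> (\<And>v. (f has_real_derivative f' v) (at v)) \<Longrightarrow> (\<And>v. isCont f' v) \<Longrightarrow>
       (\<And>v. \<bar>f v\<bar> \<le> B) \<Longrightarrow> (\<And>v. (1 + \<bar>v\<bar>) * \<bar>f' v\<bar> \<le> B) \<Longrightarrow>
       m i * (\<integral>v. (b i * v + c i) * f' v \<partial>M i) + (\<Sum>j\<in>E. m j * G j i * (\<integral>v. f v \<partial>M j)) = 0"
    and b_pos: "\<exists>i\<in>E. 0 < b i" and c_pos: "\<exists>i\<in>E. 0 < c i"
begin

text \<open>The average of \<open>f\<close> at scale \<open>exp s\<close>.\<close>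

definition avg :: "(real \<Rightarrow> real) \<Rightarrow> nat \<Rightarrow> real \<Rightarrow> real" where
  "avg f i s = m i * (\<integral>v. f (v * exp (- s)) \<partial>M i)"

definition admissible :: "(real \<Rightarrow> real) \<Rightarrow> (real \<Rightarrow> real) \<Rightarrow> bool" where
  "admissible f f' \<longleftrightarrow> (\<forall>v. (f has_real_derivative f' v) (at v)) \<and> (\<forall>v. isCont f' v) \<and>
     (\<exists>B. \<forall>v. \<bar>f v\<bar> \<le> B \<and> (1 + \<bar>v\<bar>) * \<bar>f' v\<bar> \<le> B)"

lemma admissibleE:
  assumes "admissible f f'"
  obtains B where "\<And>v. (f has_real_derivative f' v) (at v)" "\<And>v. isCont f' v" "0 \<le> B"
    "\<And>v. \<bar>f v\<bar> \<le> B" "\<And>v. \<bar>f' v\<bar> \<le> B" "\<And>v. \<bar>v * f' v\<bar> \<le> B" "\<And>v. (1 + \<bar>v\<bar>) * \<bar>f' v\<bar> \<le> B"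
    "f \<in> borel_measurable borel" "f' \<in> borel_measurable borel"
proof -
  obtain B where B: "\<And>v. (f has_real_derivative f' v) (at v)" "\<And>v. isCont f' v"
    "\<And>v. \<bar>f v\<bar> \<le> B" "\<And>v. (1 + \<bar>v\<bar>) * \<bar>f' v\<bar> \<le> B"
    using assms unfolding admissible_def by blast
  have "\<bar>f' v\<bar> \<le> (1 + \<bar>v\<bar>) * \<bar>f' v\<bar>" "\<bar>v * f' v\<bar> \<le> (1 + \<bar>v\<bar>) * \<bar>f' v\<bar>" for v
    by (simp_all add: distrib_right abs_mult)
  moreover have "f \<in> borel_measurable borel" "f' \<in> borel_measurable borel"
    using DERIV_isCont[OF B(1)] B(2) by (auto intro!: borel_measurable_continuous_onI continuous_at_imp_continuous_on)
  moreover have "0 \<le> B" using order_trans[OF abs_ge_zero B(3)[of 0]] .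
  moreover have "\<bar>f' v\<bar> \<le> B" "\<bar>v * f' v\<bar> \<le> B" for v
    using order_trans[OF calculation(1) B(4)] order_trans[OF calculation(2) B(4)] .
  ultimately show thesis using B by (intro that[of B]) auto
qed

lemma admissible_gaussian: "admissible gaussian_kernel gaussian_kernel'"
  unfolding admissible_def using gaussian_kernel_deriv gaussian_kernel'_isCont gaussian_kernel_bounds gaussian_kernel'_bound
  by (auto intro!: exI[of _ 216] simp: abs_le_iff intro: order_trans[of _ 1] order_trans[of _ 0])

lemma avg_integrable:
  assumes "admissible f f'" "i \<in> E"
  shows "integrable (M i) (\<lambda>v. f (v * exp (- s)))" "integrable (M i) (\<lambda>v. f' (v * exp (- s)))"
    "integrable (M i) (\<lambda>v. v * exp (- s) * f' (v * exp (- s)))"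
proof -
  interpret Mi: real_distribution "M i" by (rule M_dist[OF assms(2)])
  from assms(1) obtain B where B: "0 \<le> B" "\<And>v. \<bar>f v\<bar> \<le> B" "\<And>v. \<bar>f' v\<bar> \<le> B" "\<And>v. \<bar>v * f' v\<bar> \<le> B"
    and [measurable]: "f \<in> borel_measurable borel" "f' \<in> borel_measurable borel" by (rule admissibleE) blast
  show "integrable (M i) (\<lambda>v. f (v * exp (- s)))" by (rule Mi.integrable_const_bound[of _ B]) (auto simp: B)
  show "integrable (M i) (\<lambda>v. f' (v * exp (- s)))" by (rule Mi.integrable_const_bound[of _ B]) (auto simp: B)
  show "integrable (M i) (\<lambda>v. v * exp (- s) * f' (v * exp (- s)))"
    by (rule Mi.integrable_const_bound[of _ B]) (use B(4) in auto)
qed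

lemma avg_deriv:
  assumes f: "admissible f f'" and i: "i \<in> E"
  shows "(avg f i has_real_derivative - avg (\<lambda>v. v * f' v) i s) (at s)"
proof -
  from f obtain B where B: "\<And>v. (f has_real_derivative f' v) (at v)" "\<And>v. isCont f' v" "\<And>v. \<bar>f v\<bar> \<le> B" "\<And>v. \<bar>v * f' v\<bar> \<le> B"
    by (rule admissibleE) blast
  have "((\<lambda>s. m i * (\<integral>v. f (v * exp (- s)) \<partial>M i)) has_real_derivative m i * - (\<integral>v. v * exp (- s) * f' (v * exp (- s)) \<partial>M i)) (at s)"
    by (rule DERIV_cmult[OF scaled_integral_deriv[OF M_dist[OF i] B]])
  then show ?thesis unfolding avg_def[abs_def] by simp
qed

text \<open>The stationarity relation tested against \<open>f\<close> at scale \<open>exp s\<close>.\<close>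

lemma avg_balance:
  assumes f: "admissible f f'" and i: "i \<in> E"
  shows "b i * avg (\<lambda>v. v * f' v) i s + c i * exp (- s) * avg f' i s + (\<Sum>j\<in>E. G j i * avg f j s) = 0"
proof -
  from f obtain B where B: "\<And>v. (f has_real_derivative f' v) (at v)" "\<And>v. isCont f' v" "0 \<le> B" "\<And>v. \<bar>f v\<bar> \<le> B" 
     "\<And>v. \<bar>f' v\<bar> \<le> B" "\<And>v. \<bar>v * f' v\<bar> \<le> B"
    by (rule admissibleE) blast
  define g where "g v = f (v * exp (- s))" for v
  define g' where "g' v = exp (- s) * f' (v * exp (- s))" for v
  have 1: "(g has_real_derivative g' v) (at v)" for v
    unfolding g_def g'_def by (rule DERIV_cong[OF DERIV_chain2[OF B(1)]], (rule derivative_eq_intros refl)+) simp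
  have 2: "isCont g' v" for v
    unfolding g'_def by (intro continuous_intros isCont_o2[OF _ B(2)])
  have 3: "\<bar>g v\<bar> \<le> (2 + exp (- s)) * B" for v
  proof -
    have "1 * B \<le> (2 + exp (- s)) * B" using B(3) by (intro mult_right_mono) (auto simp: add_increasing2)
    then show ?thesis using B(4)[of "v * exp (- s)"] unfolding g_def by linarith
  qed
  have 4: "(1 + \<bar>v\<bar>) * \<bar>g' v\<bar> \<le> (2 + exp (- s)) * B" for v
  proof -
    have "(1 + \<bar>v\<bar>) * \<bar>g' v\<bar> = exp (- s) * \<bar>f' (v * exp (- s))\<bar> + \<bar>v * exp (- s) * f' (v * exp (- s))\<bar>"
      by (simp add: g'_def distrib_right abs_mult mult.assoc)
    also have "\<dots> \<le> exp (- s) * B + B" by (intro add_mono mult_left_mono B) auto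
    finally show ?thesis using B(3) by (simp add: algebra_simps)
  qed
  have "(b i * v + c i) * g' v = b i * (v * exp (- s) * f' (v * exp (- s))) + c i * exp (- s) * f' (v * exp (- s))" for v
    by (simp add: g'_def algebra_simps)
  then have "(\<integral>v. (b i * v + c i) * g' v \<partial>M i) =
      (\<integral>v. b i * (v * exp (- s) * f' (v * exp (- s))) + c i * exp (- s) * f' (v * exp (- s)) \<partial>M i)" by simp
  also have "\<dots> = b i * (\<integral>v. v * exp (- s) * f' (v * exp (- s)) \<partial>M i) + c i * exp (- s) * (\<integral>v. f' (v * exp (- s)) \<partial>M i)"
    using avg_integrable(2,3)[OF f i, of s] by (simp only: Bochner_Integration.integral_add integrable_mult_right integral_mult_right_zero)
  finally have "m i * (\<integral>v. (b i * v + c i) * g' v \<partial>M i) = b i * avg (\<lambda>v. v * f' v) i s + c i * exp (- s) * avg f' i s"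
    by (simp only: avg_def distrib_left mult_ac)
  moreover have "(\<Sum>j\<in>E. m j * G j i * (\<integral>v. g v \<partial>M j)) = (\<Sum>j\<in>E. G j i * avg f j s)"
    by (intro sum.cong) (auto simp: avg_def g_def)
  ultimately show ?thesis using M_stationary[OF i 1 2 3 4] by simp
qed

lemma avg_mono:
  assumes "i \<in> E" "integrable (M i) (\<lambda>v. f (v * exp (- s)))" "integrable (M i) (\<lambda>v. g (v * exp (- s)))" "\<And>v. f v \<le> g v"
  shows "avg f i s \<le> avg g i s"
  unfolding avg_def using assms m_pos by (intro mult_left_mono integral_mono) (auto simp: less_imp_le)

lemma avg_nonneg: "i \<in> E \<Longrightarrow> (\<And>v. 0 \<le> f v) \<Longrightarrow> 0 \<le> avg f i s"
  unfolding avg_def using m_nonneg by (intro mult_nonneg_nonneg integral_nonneg_AE AE_I2) auto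

lemma avg_le_weight:
  assumes "i \<in> E" "integrable (M i) (\<lambda>v. f (v * exp (- s)))" "\<And>v. f v \<le> 1"
  shows "avg f i s \<le> m i"
proof -
  interpret Mi: real_distribution "M i" by (rule M_dist[OF assms(1)])
  have "(\<integral>v. f (v * exp (- s)) \<partial>M i) \<le> 1" by (rule Mi.integral_le_const[OF assms(2)]) (auto simp: assms)
  then show ?thesis unfolding avg_def using m_nonneg[OF assms(1)] by (simp add: mult_left_le)
qed

lemma avg_tendsto_0:
  assumes f: "admissible f f'" and i: "i \<in> E" and 0: "f 0 = 0"
  shows "(avg f i \<longlongrightarrow> 0) at_top"
proof -
  interpret Mi: real_distribution "M i" by (rule M_dist[OF i])
  from f obtain B where B: "\<And>v. (f has_real_derivative f' v) (at v)" "\<And>v. \<bar>f v\<bar> \<le> B" 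
    and [measurable]: "f \<in> borel_measurable borel" by (rule admissibleE) blast
  have "((\<lambda>s. \<integral>v. f (v * exp (- s)) \<partial>M i) \<longlongrightarrow> (\<integral>v. 0 \<partial>M i)) at_top"
  proof (rule integral_dominated_convergence_at_top[where w = "\<lambda>_. B"])
    show "AE v in M i. ((\<lambda>s. f (v * exp (- s))) \<longlongrightarrow> 0) at_top"
    proof (rule AE_I2)
      fix v :: real
      have "((\<lambda>s::real. exp (- s)) \<longlongrightarrow> 0) at_top"
        by (rule filterlim_compose[OF exp_at_bot filterlim_uminus_at_bot_at_top])
      then have "((\<lambda>s. v * exp (- s)) \<longlongrightarrow> v * 0) at_top" by (rule tendsto_mult_left)
      then have "((\<lambda>s. f (v * exp (- s))) \<longlongrightarrow> f 0) at_top"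
        using isCont_tendsto_compose[OF DERIV_isCont[OF B(1)]] by simp
      then show "((\<lambda>s. f (v * exp (- s))) \<longlongrightarrow> 0) at_top" by (simp add: 0)
    qed
  qed (auto simp: B)
  from tendsto_mult_left[OF this, of "m i"] show ?thesis unfolding avg_def[abs_def] by simp
qed

subsection \<open>The upper bound\<close>

text \<open>A smooth cutoff vanishing on \<open>v \<le> 1\<close>; there \<open>f' v \<le> v f' v\<close>, so that the lower-order
  term of the stationarity relation is controlled by the derivative of the average itself.\<close>

definition cutoff :: "real \<Rightarrow> real" where
  "cutoff v = (if v \<le> 1 then 0 else (1 - 1 / v)\<^sup>2)"

definition cutoff' :: "real \<Rightarrow> real" where
  "cutoff' v = (if v \<le> 1 then 0 else 2 * (1 - 1 / v) / v\<^sup>2)"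

lemma cutoff_bounds: "0 \<le> cutoff v" "cutoff v \<le> 1"
  unfolding cutoff_def by (auto intro!: power_le_one)

lemma cutoff'_bounds: "0 \<le> cutoff' v" "cutoff' v \<le> v * cutoff' v" "(1 + \<bar>v\<bar>) * \<bar>cutoff' v\<bar> \<le> 4"
proof -
  have 1: "0 \<le> cutoff' v" for v
  proof (cases "v \<le> 1")
    case False
    then have "0 \<le> 1 - 1 / v" by simp
    then show ?thesis unfolding cutoff'_def if_not_P[OF False] by (intro divide_nonneg_nonneg mult_nonneg_nonneg) simp_all
  qed (simp add: cutoff'_def)
  show "0 \<le> cutoff' v" by (rule 1)
  show "cutoff' v \<le> v * cutoff' v"
    using mult_right_mono[of 1 v, OF _ 1[of v]] by (cases "v \<le> 1") (auto simp: cutoff'_def)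
  show "(1 + \<bar>v\<bar>) * \<bar>cutoff' v\<bar> \<le> 4"
  proof (cases "v \<le> 1")
    case True then show ?thesis by (simp add: cutoff'_def)
  next
    case False
    have "cutoff' v \<le> 2 * 1 / v\<^sup>2" unfolding cutoff'_def if_not_P[OF False]
      by (rule divide_right_mono) (use False in auto)
    also have "\<dots> = 2 / v * (1 / v)" by (simp add: power2_eq_square)
    also have "\<dots> \<le> 2 / v * 1" by (rule mult_left_mono) (use False in auto)
    finally have "cutoff' v \<le> 2 / v" by simp
    then have "(1 + \<bar>v\<bar>) * \<bar>cutoff' v\<bar> \<le> (2 * v) * (2 / v)" using False 1[of v] by (intro mult_mono) auto
    then show ?thesis using False by simp
  qed
qed

lemma admissible_cutoff: "admissible cutoff cutoff'"
proof -
  have "(cutoff has_real_derivative cutoff' v) (at v)" for v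
  proof -
    consider "v < 1" | "v = 1" | "1 < v" by linarith
    then show ?thesis
    proof cases
      case 1
      have "(cutoff has_real_derivative 0) (at v)"
        by (rule has_field_derivative_transform_within_open[of "\<lambda>_. 0" _ _ "{..<1}"]) (use 1 in \<open>auto simp: cutoff_def\<close>)
      then show ?thesis using 1 by (simp add: cutoff'_def)
    next
      case 2
      have "(cutoff has_real_derivative 0) (at 1)"
      proof (rule DERIV_zero_of_quadratic_bound[of _ _ 1])
        fix v :: real
        show "\<bar>cutoff v - cutoff 1\<bar> \<le> 1 * (v - 1)\<^sup>2"
        proof (cases "v \<le> 1")
          case False
          have "1 - 1 / v = (v - 1) / v" using False by (simp add: field_simps)
          also have "\<dots> \<le> v - 1" using False by (simp add: divide_le_eq)
          finally have "(1 - 1 / v)\<^sup>2 \<le> (v - 1)\<^sup>2" using False by (intro power_mono) auto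
          then show ?thesis using False by (simp add: cutoff_def)
        qed (simp add: cutoff_def)
      qed
      then show ?thesis using 2 by (simp add: cutoff'_def)
    next
      case 3
      have "((\<lambda>v. (1 - 1 / v)\<^sup>2) has_real_derivative 2 * (1 - 1 / v) / v\<^sup>2) (at v)"
      proof -
        have "((\<lambda>v. 1 - 1 / v) has_real_derivative 1 / v\<^sup>2) (at v)"
          using 3 by (auto intro!: derivative_eq_intros simp: power2_eq_square)
        from DERIV_power[OF this, of 2] show ?thesis by (simp add: mult_ac)
      qed
      then have "(cutoff has_real_derivative 2 * (1 - 1 / v) / v\<^sup>2) (at v)"
        by (rule has_field_derivative_transform_within_open[of _ _ _ "{1<..}"]) (use 3 in \<open>auto simp: cutoff_def\<close>)
      then show ?thesis using 3 by (simp add: cutoff'_def)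
    qed
  qed
  moreover have "isCont cutoff' v" for v
  proof -
    have "cutoff' = (\<lambda>v. 2 * (1 - 1 / max v 1) / (max v 1)\<^sup>2)"
      by (auto simp: cutoff'_def fun_eq_iff max_def)
    moreover have "isCont (\<lambda>v. 2 * (1 - 1 / max v 1) / (max v (1::real))\<^sup>2) v"
      by (intro continuous_intros) auto
    ultimately show ?thesis by simp
  qed
  moreover have "\<bar>cutoff v\<bar> \<le> 4 \<and> (1 + \<bar>v\<bar>) * \<bar>cutoff' v\<bar> \<le> 4" for v
    using cutoff_bounds[of v] cutoff'_bounds(3)[of v] by auto
  ultimately show ?thesis unfolding admissible_def by blast
qed

text \<open>
  The maximum principle. The supersolution is \<open>l exp (- \<kappa> s)\<close>, corrected by a faster decaying term
  built on a strict left subsolution for the exponent \<open>\<kappa> + \<delta>\<close>; the correction beats the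
  lower-order coefficient \<open>c\<close> as \<open>\<delta> < 1\<close>.
\<close>

lemma cutoff_avg_bound:
  assumes k: "0 < \<kappa>"
    and l: "\<And>i. i \<in> E \<Longrightarrow> 0 < l i" "\<And>j. j \<in> E \<Longrightarrow> (\<Sum>i\<in>E. l i * G i j) + \<kappa> * b j * l j = 0"
    and d: "0 < \<delta>" "\<delta> < 1"
    and w: "\<And>i. i \<in> E \<Longrightarrow> 0 < w i" "\<And>j. j \<in> E \<Longrightarrow> 0 < (\<Sum>i\<in>E. w i * G i j) + (\<kappa> + \<delta>) * b j * w j"
  shows "\<exists>C. \<forall>i\<in>E. \<forall>s. avg cutoff i s \<le> C * exp (- \<kappa> * s)"
proof -
  define K where "K = avg cutoff"
  define K1 where "K1 = avg (\<lambda>v. v * cutoff' v)"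
  define \<tau> where "\<tau> j = (\<Sum>i\<in>E. w i * G i j) + (\<kappa> + \<delta>) * b j * w j" for j
  define S where "S i s = l i * exp (- \<kappa> * s) - w i * exp (- (\<kappa> + \<delta>) * s)" for i s
  define S' where "S' i s = - \<kappa> * l i * exp (- \<kappa> * s) + (\<kappa> + \<delta>) * w i * exp (- (\<kappa> + \<delta>) * s)" for i s
  have K: "(K i has_real_derivative - K1 i s) (at s)" if "i \<in> E" for i s
    unfolding K_def K1_def by (rule avg_deriv[OF admissible_cutoff that])
  have S: "(S i has_real_derivative S' i s) (at s)" for i s
    unfolding S_def S'_def by (rule derivative_eq_intros refl)+ (simp add: algebra_simps)
  have K1le: "avg cutoff' i s \<le> K1 i s" "0 \<le> avg cutoff' i s" if "i \<in> E" for i s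
    unfolding K1_def using avg_integrable[OF admissible_cutoff that] cutoff'_bounds
    by (auto intro!: avg_mono avg_nonneg that)
  have K_le: "0 \<le> K i s" "K i s \<le> m i" if "i \<in> E" for i s
    unfolding K_def using avg_integrable(1)[OF admissible_cutoff that] cutoff_bounds
    by (auto intro!: avg_le_weight avg_nonneg that)
  have K_lim: "(K i \<longlongrightarrow> 0) at_top" if "i \<in> E" for i
    unfolding K_def by (rule avg_tendsto_0[OF admissible_cutoff that]) (simp add: cutoff_def)
  have balance: "(\<Sum>j\<in>E. G j i * S j s) = b i * S' i s - \<tau> i * exp (- (\<kappa> + \<delta>) * s)" if "i \<in> E" for i s
  proof -
    have "(\<Sum>j\<in>E. G j i * S j s) = exp (- \<kappa> * s) * (\<Sum>j\<in>E. l j * G j i) - exp (- (\<kappa> + \<delta>) * s) * (\<Sum>j\<in>E. w j * G j i)"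
      unfolding S_def sum_distrib_left sum_subtractf[symmetric] by (intro sum.cong) (auto simp: algebra_simps)
    moreover have "(\<Sum>j\<in>E. l j * G j i) = - (\<kappa> * b i * l i)" using l(2)[OF that] by linarith
    moreover have "(\<Sum>j\<in>E. w j * G j i) = \<tau> i - (\<kappa> + \<delta>) * b i * w i" by (simp add: \<tau>_def)
    ultimately show ?thesis by (simp add: S'_def algebra_simps)
  qed
  have ev0: "\<forall>\<^sub>F s in at_top. x * exp (- e * s) < y" if "0 < y" "0 < e" for x y e :: real
  proof -
    have "filterlim (\<lambda>s. e * s) at_top at_top" by (rule filterlim_tendsto_pos_mult_at_top[OF tendsto_const that(2) filterlim_ident])
    then have "filterlim (\<lambda>s. - e * s) at_bot at_top" by (simp add: filterlim_uminus_at_bot)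
    then have "((\<lambda>s. x * exp (- e * s)) \<longlongrightarrow> x * 0) at_top"
      by (intro tendsto_intros filterlim_compose[OF exp_at_bot])
    then show ?thesis using order_tendstoD(2)[of _ "x * 0" at_top y] that by simp
  qed
  have "\<forall>\<^sub>F s in at_top. \<forall>i\<in>E. w i * exp (- \<delta> * s) < l i \<and> \<kappa> * c i * l i * exp (- (1 - \<delta>) * s) < \<tau> i"
    using l(1) w(2) d by (intro eventually_ball_finite[OF finE] ballI eventually_conj ev0) (auto simp: \<tau>_def)
  then obtain s0 where s0: "\<And>s i. s0 \<le> s \<Longrightarrow> i \<in> E \<Longrightarrow> w i * exp (- \<delta> * s) < l i"
      "\<And>s i. s0 \<le> s \<Longrightarrow> i \<in> E \<Longrightarrow> \<kappa> * c i * l i * exp (- (1 - \<delta>) * s) < \<tau> i"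
    unfolding eventually_at_top_linorder by blast
  have Spos: "0 < S i s" if "s0 \<le> s" "i \<in> E" for i s
  proof -
    have "S i s = exp (- \<kappa> * s) * (l i - w i * exp (- \<delta> * s))"
      by (simp add: S_def algebra_simps flip: exp_add)
    then show ?thesis using s0(1)[OF that] by simp
  qed
  define C where "C = 1 + (\<Sum>i\<in>E. m i / S i s0)"
  have C0: "0 < C" unfolding C_def using Spos[of s0] m_nonneg
    by (intro add_pos_nonneg sum_nonneg divide_nonneg_pos) auto
  have KS0: "K i s0 \<le> C * S i s0" if "i \<in> E" for i
  proof -
    have "m i / S i s0 \<le> (\<Sum>i\<in>E. m i / S i s0)"
      by (rule member_le_sum[OF that _ finE]) (use Spos[of s0] m_nonneg in \<open>auto intro!: divide_nonneg_pos\<close>)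
    then have "m i / S i s0 \<le> C" unfolding C_def by simp
    then show ?thesis using K_le(2)[OF that, of s0] Spos[of s0 i] that by (simp add: pos_divide_le_eq)
  qed
  define D where "D i s = (K i s - C * S i s) / m i" for i s
  have Dd: "(D i has_real_derivative (- K1 i s - C * S' i s) / m i) (at s)" if "i \<in> E" for i s
    unfolding D_def using DERIV_cdivide[OF DERIV_diff[OF K[OF that] DERIV_cmult[OF S]]] .
  have Dle: "D i s \<le> 0" if "i \<in> E" "s0 \<le> s" for i s
  proof (rule ccontr)
    assume "\<not> D i s \<le> 0"
    define \<epsilon> where "\<epsilon> = D i s"
    have \<epsilon>: "0 < \<epsilon>" using \<open>\<not> D i s \<le> 0\<close> by (simp add: \<epsilon>_def)
    have "\<forall>\<^sub>F t in at_top. \<forall>j\<in>E. D j t < \<epsilon>"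
    proof (intro eventually_ball_finite[OF finE] ballI)
      fix j assume j: "j \<in> E"
      have "\<forall>\<^sub>F t in at_top. K j t < \<epsilon> * m j" using order_tendstoD(2)[OF K_lim[OF j]] \<epsilon> m_pos[OF j] by simp
      moreover have "\<forall>\<^sub>F t in at_top. s0 \<le> t" by (rule eventually_ge_at_top)
      ultimately show "\<forall>\<^sub>F t in at_top. D j t < \<epsilon>"
      proof eventually_elim
        fix t assume "K j t < \<epsilon> * m j" "s0 \<le> t"
        then have "K j t - C * S j t < \<epsilon> * m j" using Spos[of t j] j C0 by (smt (verit) mult_pos_pos)
        then show "D j t < \<epsilon>" using m_pos[OF j] by (simp add: D_def pos_divide_less_eq)
      qed
    qed
    then obtain s1 where s1: "\<And>t j. s1 \<le> t \<Longrightarrow> j \<in> E \<Longrightarrow> D j t < \<epsilon>" unfolding eventually_at_top_linorder by blast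
    have ss1: "s < s1" using s1[of s i] that by (force simp: \<epsilon>_def)
    have "\<exists>t. s0 \<le> t \<and> t \<le> s1 \<and> (\<forall>u. s0 \<le> u \<and> u \<le> s1 \<longrightarrow> D j u \<le> D j t)" if j: "j \<in> E" for j
    proof -
      have "continuous_on {s0..s1} (D j)"
        using DERIV_isCont[OF Dd[OF j]] by (intro continuous_at_imp_continuous_on) auto
      from continuous_attains_sup[OF compact_Icc _ this]
      obtain x where "x \<in> {s0..s1}" "\<forall>y\<in>{s0..s1}. D j y \<le> D j x" using ss1 \<open>s0 \<le> s\<close> by auto
      then show ?thesis by (intro exI[of _ x]) auto
    qed
    then obtain t where t: "\<And>j. j \<in> E \<Longrightarrow> s0 \<le> t j \<and> t j \<le> s1 \<and> (\<forall>u. s0 \<le> u \<and> u \<le> s1 \<longrightarrow> D j u \<le> D j (t j))" by metis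
    define V where "V = Max ((\<lambda>j. D j (t j)) ` E)"
    have "V \<in> (\<lambda>j. D j (t j)) ` E" unfolding V_def using finE neE by (intro Max_in) auto
    then obtain j where j: "j \<in> E" "V = D j (t j)" by blast
    have Vge: "D n u \<le> V" if "n \<in> E" "s0 \<le> u" "u \<le> s1" for n u
    proof -
      have "D n u \<le> D n (t n)" using t[OF that(1)] that by blast
      also have "\<dots> \<le> V" unfolding V_def using finE that by (intro Max_ge) auto
      finally show ?thesis .
    qed
    have V\<epsilon>: "\<epsilon> \<le> V" using Vge[OF that(1,2)] ss1 by (simp add: \<epsilon>_def)
    have tj: "s0 < t j" "t j < s1"
    proof -
      have "D j s0 \<le> 0" using KS0[OF j(1)] m_pos[OF j(1)] by (simp add: D_def divide_le_0_iff)
      then have "t j \<noteq> s0" using V\<epsilon> \<epsilon> j(2) by auto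
      then show "s0 < t j" using t[OF j(1)] by auto
      have "t j \<noteq> s1" using s1[of s1 j] V\<epsilon> j by auto
      then show "t j < s1" using t[OF j(1)] by auto
    qed
    \<comment> \<open>at an interior maximum the derivative vanishes, and the jump part of the generator is nonpositive\<close>
    have "(- K1 j (t j) - C * S' j (t j)) / m j = 0"
    proof (rule DERIV_local_max[OF Dd[OF j(1), of "t j"]])
      show "0 < min (t j - s0) (s1 - t j)" using tj by simp
      show "\<forall>y. \<bar>t j - y\<bar> < min (t j - s0) (s1 - t j) \<longrightarrow> D j y \<le> D j (t j)"
        using Vge[OF j(1)] unfolding j(2) by (auto simp: abs_less_iff)
    qed
    then have K1S: "K1 j (t j) = - C * S' j (t j)" using m_pos[OF j(1)] by simp
    have KD: "K n u - C * S n u = m n * D n u" if "n \<in> E" for n u using m_pos[OF that] by (simp add: D_def)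
    have "(\<Sum>n\<in>E. G n j * (K n (t j) - C * S n (t j))) = (\<Sum>n\<in>E. m n * G n j * (D n (t j) - D j (t j))) + D j (t j) * (\<Sum>n\<in>E. m n * G n j)"
      unfolding sum_distrib_left sum.distrib[symmetric] by (intro sum.cong) (auto simp: KD algebra_simps)
    also have "\<dots> = (\<Sum>n\<in>E. m n * G n j * (D n (t j) - D j (t j)))" using m_inv[OF j(1)] by simp
    also have "\<dots> \<le> 0"
    proof (rule sum_nonpos)
      fix n assume n: "n \<in> E"
      show "m n * G n j * (D n (t j) - D j (t j)) \<le> 0"
      proof (cases "n = j")
        case False
        have "D n (t j) \<le> D j (t j)" using Vge[OF n, of "t j"] tj j(2) by simp
        then show ?thesis using offdiag[OF n j(1) False] m_nonneg[OF n] by (intro mult_nonneg_nonpos) auto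
      qed simp
    qed
    finally have "(\<Sum>n\<in>E. G n j * K n (t j)) \<le> C * (\<Sum>n\<in>E. G n j * S n (t j))"
      by (simp add: right_diff_distrib sum_subtractf sum_distrib_left mult_ac)
    moreover have "(\<Sum>n\<in>E. G n j * K n (t j)) = - b j * K1 j (t j) - c j * exp (- t j) * avg cutoff' j (t j)"
      using avg_balance[OF admissible_cutoff j(1), of "t j"] unfolding K_def K1_def by simp
    moreover have "(\<Sum>n\<in>E. G n j * S n (t j)) = b j * S' j (t j) - \<tau> j * exp (- (\<kappa> + \<delta>) * t j)" by (rule balance[OF j(1)])
    ultimately have "C * (\<tau> j * exp (- (\<kappa> + \<delta>) * t j)) \<le> c j * exp (- t j) * avg cutoff' j (t j)"
      unfolding K1S by (simp add: algebra_simps)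
    also have "\<dots> \<le> c j * exp (- t j) * (- C * S' j (t j))"
      using K1le(1)[OF j(1), of "t j"] c_nonneg[OF j(1)] unfolding K1S by (intro mult_left_mono) auto
    also have "\<dots> \<le> c j * exp (- t j) * (C * (\<kappa> * l j * exp (- \<kappa> * t j)))"
    proof (intro mult_left_mono)
      have "0 \<le> (\<kappa> + \<delta>) * w j * exp (- (\<kappa> + \<delta>) * t j)" using k d w(1)[OF j(1)] by simp
      then have "- S' j (t j) \<le> \<kappa> * l j * exp (- \<kappa> * t j)" unfolding S'_def by simp
      from mult_left_mono[OF this, of C] C0 show "- C * S' j (t j) \<le> C * (\<kappa> * l j * exp (- \<kappa> * t j))" by simp
    qed (use c_nonneg[OF j(1)] in auto)
    also have "\<dots> = C * exp (- (\<kappa> + \<delta>) * t j) * (\<kappa> * c j * l j * exp (- (1 - \<delta>) * t j))"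
    proof -
      have "exp (- t j) * exp (- \<kappa> * t j) = exp (- (\<kappa> + \<delta>) * t j) * exp (- (1 - \<delta>) * t j)"
        by (simp add: algebra_simps flip: exp_add)
      then show ?thesis by (simp add: mult_ac)
    qed
    also have "\<dots> < C * exp (- (\<kappa> + \<delta>) * t j) * \<tau> j"
      using s0(2)[of "t j" j] tj j(1) C0 by (intro mult_strict_left_mono) auto
    finally show False by (simp add: mult_ac)
  qed
  define C1 where "C1 = (\<Sum>i\<in>E. C * l i) + exp (\<kappa> * s0)"
  have "avg cutoff i s \<le> C1 * exp (- \<kappa> * s)" if i: "i \<in> E" for i s
  proof (cases "s0 \<le> s")
    case True
    have "K i s \<le> C * S i s" using Dle[OF i True] m_pos[OF i] by (simp add: D_def divide_le_0_iff)
    also have "\<dots> \<le> C * (l i * exp (- \<kappa> * s))" unfolding S_def using C0 w(1)[OF i] by (intro mult_left_mono) auto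
    also have "\<dots> = (C * l i) * exp (- \<kappa> * s)" by simp
    also have "\<dots> \<le> C1 * exp (- \<kappa> * s)"
    proof (rule mult_right_mono)
      have "C * l i \<le> (\<Sum>i\<in>E. C * l i)"
        by (rule member_le_sum[OF i _ finE]) (use C0 l(1) in \<open>auto intro!: mult_nonneg_nonneg simp: less_imp_le\<close>)
      then show "C * l i \<le> C1" unfolding C1_def by (simp add: add_increasing2)
    qed simp
    finally show ?thesis unfolding K_def .
  next
    case False
    have "m i \<le> (\<Sum>j\<in>E. m j)" by (rule member_le_sum[OF i _ finE]) (simp add: m_nonneg)
    then have "K i s \<le> 1" using K_le(2)[OF i, of s] m_sum by simp
    also have "1 \<le> exp (\<kappa> * s0) * exp (- \<kappa> * s)" using False k by (simp flip: exp_add)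
    also have "\<dots> \<le> C1 * exp (- \<kappa> * s)"
    proof (rule mult_right_mono)
      have "0 \<le> (\<Sum>i\<in>E. C * l i)" using C0 l(1) by (intro sum_nonneg mult_nonneg_nonneg) (auto simp: less_imp_le)
      then show "exp (\<kappa> * s0) \<le> C1" unfolding C1_def by simp
    qed simp
    finally show ?thesis unfolding K_def .
  qed
  then show ?thesis by (intro exI[of _ C1]) auto
qed

subsection \<open>Convergence\<close>

lemma tail_bound_of_cutoff:
  assumes C: "\<And>i s. i \<in> E \<Longrightarrow> avg cutoff i s \<le> C * exp (- \<kappa> * s)" and i: "i \<in> E"
  shows "measure (M i) {exp s<..} \<le> (4 / m i * C * exp (\<kappa> * ln 2)) * exp (- \<kappa> * s)"
proof -
  interpret Mi: real_distribution "M i" by (rule M_dist[OF i])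
  define t where "t = s - ln 2"
  have "indicator {exp s<..} v \<le> 4 * cutoff (v * exp (- t))" for v :: real
  proof (cases "exp s < v")
    case True
    have "exp s = 2 * exp t" by (simp add: t_def exp_diff)
    then have "2 < v * exp (- t)" using True by (simp add: exp_minus field_simps)
    then have "1 / 2 \<le> 1 - 1 / (v * exp (- t))" by (simp add: field_simps)
    then have "(1 / 2)\<^sup>2 \<le> (1 - 1 / (v * exp (- t)))\<^sup>2" by (intro power_mono) auto
    then have "1 / 4 \<le> cutoff (v * exp (- t))" using \<open>2 < v * exp (- t)\<close> by (simp add: cutoff_def power2_eq_square)
    then show ?thesis using True by simp
  qed (simp add: cutoff_bounds)
  then have "(\<integral>v. indicator {exp s<..} v \<partial>M i) \<le> (\<integral>v. 4 * cutoff (v * exp (- t)) \<partial>M i)"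
    using avg_integrable(1)[OF admissible_cutoff i, of t]
    by (intro integral_mono integrable_real_indicator) (auto simp: Mi.emeasure_eq_measure)
  then have "measure (M i) {exp s<..} \<le> 4 / m i * avg cutoff i t"
    using m_pos[OF i] by (simp add: avg_def)
  also have "\<dots> \<le> 4 / m i * (C * exp (- \<kappa> * t))"
    using C[OF i, of t] m_pos[OF i] by (intro mult_left_mono) auto
  also have "exp (- \<kappa> * t) = exp (\<kappa> * ln 2) * exp (- \<kappa> * s)" by (simp add: t_def algebra_simps flip: exp_add)
  finally show ?thesis by (simp add: mult_ac)
qed

lemma gaussian_avg_bound:
  assumes k: "0 < \<kappa>" and C: "\<And>i s. i \<in> E \<Longrightarrow> avg cutoff i s \<le> C * exp (- \<kappa> * s)"
  shows "\<exists>C'\<ge>0. \<forall>i\<in>E. \<forall>s. avg gaussian_kernel i s \<le> C' * exp (- \<kappa> * s)"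
proof -
  have "\<exists>C'. \<forall>s. (\<integral>v. gaussian_kernel (v * exp (- s)) \<partial>M i) \<le> C' * exp (- \<kappa> * s)" if i: "i \<in> E" for i
    by (rule gaussian_kernel_average_bound[OF M_dist[OF i] k tail_bound_of_cutoff[OF C i]])
  then obtain C' where C': "\<And>i s. i \<in> E \<Longrightarrow> (\<integral>v. gaussian_kernel (v * exp (- s)) \<partial>M i) \<le> C' i * exp (- \<kappa> * s)" by metis
  have "avg gaussian_kernel i s \<le> (\<Sum>i\<in>E. \<bar>m i * C' i\<bar>) * exp (- \<kappa> * s)" if i: "i \<in> E" for i s
  proof -
    have "avg gaussian_kernel i s \<le> m i * (C' i * exp (- \<kappa> * s))"
      unfolding avg_def using C'[OF i] m_nonneg[OF i] by (intro mult_left_mono) auto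
    also have "\<dots> = (m i * C' i) * exp (- \<kappa> * s)" by simp
    also have "\<dots> \<le> (\<Sum>i\<in>E. \<bar>m i * C' i\<bar>) * exp (- \<kappa> * s)"
      using member_le_sum[OF i, of "\<lambda>i. \<bar>m i * C' i\<bar>"] finE by (intro mult_right_mono) force+
    finally show ?thesis .
  qed
  then show ?thesis by (intro exI[of _ "\<Sum>i\<in>E. \<bar>m i * C' i\<bar>"]) (auto intro: sum_nonneg)
qed

text \<open>Where the value is fed at a positive rate, it is not identically zero.\<close>

lemma M_positive:
  assumes i: "i \<in> E" "0 < c i"
  shows "\<not> (AE v in M i. v \<le> 0)"
proof
  assume "AE v in M i. v \<le> 0"
  with M_nonneg[OF i(1)] have 0: "AE v in M i. v = 0" by eventually_elim simp
  interpret Mi: real_distribution "M i" by (rule M_dist[OF i(1)])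
  have b1: "\<bar>arctan v\<bar> \<le> 2" for v using arctan_ubound[of v] arctan_lbound[of v] pi_less_4 by linarith
  have b2: "(1 + \<bar>v\<bar>) * \<bar>inverse (1 + v\<^sup>2)\<bar> \<le> 2" for v :: real
  proof -
    have "0 \<le> (\<bar>v\<bar> - 1)\<^sup>2" by simp
    then have "2 * \<bar>v\<bar> \<le> v\<^sup>2 + 1" by (simp add: power2_diff)
    define x y where "x = \<bar>v\<bar>" and "y = v\<^sup>2"
    have "0 \<le> y" "2 * x \<le> y + 1" using \<open>2 * \<bar>v\<bar> \<le> v\<^sup>2 + 1\<close> by (simp_all add: x_def y_def)
    then have "1 + x \<le> 2 * (1 + y)" by argo
    then have "1 + \<bar>v\<bar> \<le> 2 * (1 + v\<^sup>2)" by (simp only: x_def y_def)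
    moreover have "0 < 1 + v\<^sup>2" by (simp add: add_pos_nonneg)
    ultimately show ?thesis by (simp add: field_simps abs_of_pos)
  qed
  have stat: "m i * (\<integral>v. (b i * v + c i) * inverse (1 + v\<^sup>2) \<partial>M i) + (\<Sum>j\<in>E. m j * G j i * (\<integral>v. arctan v \<partial>M j)) = 0"
  proof (rule M_stationary[OF i(1) _ _ b1 b2])
    show "isCont (\<lambda>v::real. inverse (1 + v\<^sup>2)) v" for v
      using sum_power2_eq_zero_iff[of 1 v] by (intro continuous_intros) (simp add: add_nonneg_eq_0_iff)
  qed (rule DERIV_arctan)
  have e1: "(\<integral>v. (b i * v + c i) * inverse (1 + v\<^sup>2) \<partial>M i) = (\<integral>v. c i \<partial>M i)"
    by (rule integral_cong_AE) (use 0 in \<open>auto elim!: eventually_mono\<close>)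
  have e2: "(\<integral>v. arctan v \<partial>M i) = (\<integral>v. 0 \<partial>M i)"
    by (rule integral_cong_AE) (use 0 in \<open>auto elim!: eventually_mono\<close>)
  have "0 \<le> m j * G j i * (\<integral>v. arctan v \<partial>M j)" if j: "j \<in> E" for j
  proof (cases "j = i")
    case False
    have "0 \<le> (\<integral>v. arctan v \<partial>M j)" using M_nonneg[OF j] by (intro integral_nonneg_AE) (auto elim!: eventually_mono)
    then show ?thesis using offdiag[OF j i(1) False] m_nonneg[OF j] by (intro mult_nonneg_nonneg) auto
  qed (simp add: e2)
  then have "0 \<le> (\<Sum>j\<in>E. m j * G j i * (\<integral>v. arctan v \<partial>M j))" by (rule sum_nonneg)
  moreover have "0 < m i * (\<integral>v. c i \<partial>M i)" using i m_pos Mi.prob_space by simp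
  ultimately show False using stat unfolding e1 by linarith
qed

lemma avg_gaussian'_pos:
  assumes i: "i \<in> E" "0 < c i"
  shows "0 < avg gaussian_kernel' i s"
proof -
  interpret Mi: real_distribution "M i" by (rule M_dist[OF i(1)])
  note int = avg_integrable(2)[OF admissible_gaussian i(1), of s]
  have "(\<integral>v. gaussian_kernel' (v * exp (- s)) \<partial>M i) \<noteq> 0"
  proof
    assume "(\<integral>v. gaussian_kernel' (v * exp (- s)) \<partial>M i) = 0"
    then have "AE v in M i. gaussian_kernel' (v * exp (- s)) = 0"
      using integral_nonneg_eq_0_iff_AE[OF int] gaussian_kernel'_nonneg by simp
    then have "AE v in M i. v \<le> 0"
    proof eventually_elim
      fix v assume "gaussian_kernel' (v * exp (- s)) = 0"
      then show "v \<le> 0" using gaussian_kernel'_pos[of "v * exp (- s)"] by (force simp: zero_less_mult_iff not_less)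
    qed
    then show False using M_positive[OF i] by blast
  qed
  moreover have "0 \<le> (\<integral>v. gaussian_kernel' (v * exp (- s)) \<partial>M i)"
    by (intro integral_nonneg_AE AE_I2 gaussian_kernel'_nonneg)
  ultimately show ?thesis unfolding avg_def using m_pos[OF i(1)] by (intro mult_pos_pos) auto
qed

text \<open>
  The normalised averages \<open>H i\<close> relax to a common limit. With \<open>w\<close> the balanced weights of the
  tilted chain, \<open>\<Sum> r l b H\<close> is nondecreasing, and the quadratic functional
  \<open>1/2 \<Sum> r l b H\<^sup>2\<close> dissipates the Dirichlet form \<open>1/2 \<Sum> w (H i - H j)\<^sup>2\<close>. Both are bounded, so
  the Dirichlet form tends to zero by Barbalat's lemma.
\<close>

theorem gaussian_average_tail:
  "\<exists>\<kappa> L. 0 < \<kappa> \<and> 0 < L \<and> ((\<lambda>s. exp (\<kappa> * s) * (\<Sum>i\<in>E. avg gaussian_kernel i s)) \<longlongrightarrow> L) at_top"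
proof (rule critical_exponent[OF b_pos])
  fix \<kappa> and r l :: "nat \<Rightarrow> real"
  assume k: "0 < \<kappa>"
    and r: "\<And>i. i \<in> E \<Longrightarrow> 0 < r i" "\<And>i. i \<in> E \<Longrightarrow> (\<Sum>j\<in>E. G i j * r j) + \<kappa> * b i * r i = 0"
    and l: "\<And>i. i \<in> E \<Longrightarrow> 0 < l i" "\<And>j. j \<in> E \<Longrightarrow> (\<Sum>i\<in>E. l i * G i j) + \<kappa> * b j * l j = 0"
    and pos: "0 < (\<Sum>i\<in>E. l i * b i * r i)"
  have "\<exists>C. \<forall>i\<in>E. \<forall>s. avg cutoff i s \<le> C * exp (- \<kappa> * s)"
  proof (rule supercritical_left_vector[OF r l pos])
    fix \<delta> and w :: "nat \<Rightarrow> real"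
    assume d: "0 < \<delta>" "\<delta> < 1" and w: "\<And>i. i \<in> E \<Longrightarrow> 0 < w i"
      "\<And>j. j \<in> E \<Longrightarrow> 0 < (\<Sum>i\<in>E. w i * G i j) + (\<kappa> + \<delta>) * b j * w j"
    show "\<exists>C. \<forall>i\<in>E. \<forall>s. avg cutoff i s \<le> C * exp (- \<kappa> * s)"
      by (rule cutoff_avg_bound[OF k l d w])
  qed assumption+
  then obtain C0 where C0: "\<forall>i\<in>E. \<forall>s. avg cutoff i s \<le> C0 * exp (- \<kappa> * s)" ..
  have "\<exists>C'\<ge>0. \<forall>i\<in>E. \<forall>s. avg gaussian_kernel i s \<le> C' * exp (- \<kappa> * s)"
    by (rule gaussian_avg_bound[OF k, of C0]) (use C0 in simp)
  then obtain C where C: "0 \<le> C" "\<forall>i\<in>E. \<forall>s. avg gaussian_kernel i s \<le> C * exp (- \<kappa> * s)"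
    by (elim exE conjE)
  have C: "0 \<le> C" "\<And>i s. i \<in> E \<Longrightarrow> avg gaussian_kernel i s \<le> C * exp (- \<kappa> * s)"
    using C by simp_all
  define D where "D = avg (\<lambda>v. v * gaussian_kernel' v)"
  define H where "H i s = exp (\<kappa> * s) * avg gaussian_kernel i s / l i" for i s
  define H' where "H' i s = \<kappa> * H i s - exp (\<kappa> * s) * D i s / l i" for i s
  define e where "e i s = exp (\<kappa> * s) * (c i * exp (- s) * avg gaussian_kernel' i s)" for i s
  have H_deriv: "(H i has_real_derivative H' i s) (at s)" if "i \<in> E" for i s
  proof -
    have "((\<lambda>s. exp (\<kappa> * s) * avg gaussian_kernel i s / l i) has_real_derivative
       (exp (\<kappa> * s) * \<kappa> * avg gaussian_kernel i s + (- D i s) * exp (\<kappa> * s)) / l i) (at s)"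
      unfolding D_def
      by (rule DERIV_cdivide[OF DERIV_mult[OF _ avg_deriv[OF admissible_gaussian that]]])
         (auto intro!: derivative_eq_intros)
    then show ?thesis unfolding H_def[abs_def] H'_def using l(1)[OF that]
      by (simp add: diff_divide_distrib mult_ac)
  qed
  have H0: "0 \<le> H i s" if "i \<in> E" for i s
    unfolding H_def using l(1)[OF that] gaussian_kernel_bounds avg_nonneg[OF that] by (auto simp: less_imp_le)
  define B where "B = 1 + (\<Sum>i\<in>E. C * exp (\<kappa> * ln 4) / l i)"
  have lsum: "C * exp (\<kappa> * ln 4) / l i \<le> B" if "i \<in> E" for i
  proof -
    have "C * exp (\<kappa> * ln 4) / l i \<le> (\<Sum>i\<in>E. C * exp (\<kappa> * ln 4) / l i)"
      by (rule member_le_sum[OF that _ finE]) (use C l(1) in \<open>auto intro!: divide_nonneg_pos\<close>)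
    then show ?thesis unfolding B_def by simp
  qed
  have B1: "1 \<le> B" unfolding B_def using C l(1) by (auto intro!: sum_nonneg divide_nonneg_pos)
  have HB: "H i s \<le> B" if "i \<in> E" for i s
  proof -
    have "exp (\<kappa> * s) * avg gaussian_kernel i s \<le> exp (\<kappa> * s) * (C * exp (- \<kappa> * s))"
      using C(2)[OF that, of s] by (intro mult_left_mono) auto
    also have "\<dots> = C * 1" by (simp flip: exp_add)
    also have "\<dots> \<le> C * exp (\<kappa> * ln 4)" using C(1) k by (intro mult_left_mono) auto
    finally have "H i s \<le> C * exp (\<kappa> * ln 4) / l i" unfolding H_def using l(1)[OF that] by (intro divide_right_mono) auto
    then show ?thesis using lsum[OF that] by linarith
  qed
  have DB: "0 \<le> exp (\<kappa> * s) * D i s / l i" "exp (\<kappa> * s) * D i s / l i \<le> B" if i: "i \<in> E" for i s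
  proof -
    have nn: "0 \<le> v * gaussian_kernel' v" for v
      using gaussian_kernel'_nonneg[of v] by (cases "v \<le> 0") (auto simp: gaussian_kernel'_def)
    then have "0 \<le> D i s" unfolding D_def by (intro avg_nonneg[OF i])
    then show "0 \<le> exp (\<kappa> * s) * D i s / l i" using l(1)[OF i] by simp
    have sc: "4 * (v * exp (- s)) = v * exp (- (s - ln 4))" for v by (simp add: exp_diff exp_minus field_simps)
    have "(\<integral>v. v * exp (- s) * gaussian_kernel' (v * exp (- s)) \<partial>M i) \<le> (\<integral>v. gaussian_kernel (v * exp (- (s - ln 4))) \<partial>M i)"
    proof (rule integral_mono)
      show "v * exp (- s) * gaussian_kernel' (v * exp (- s)) \<le> gaussian_kernel (v * exp (- (s - ln 4)))" for v
        using gaussian_kernel'_le_kernel[of "v * exp (- s)"] unfolding sc .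
    qed (rule avg_integrable[OF admissible_gaussian i])+
    then have "D i s \<le> avg gaussian_kernel i (s - ln 4)"
      unfolding D_def avg_def using m_nonneg[OF i] by (intro mult_left_mono) auto
    then have "exp (\<kappa> * s) * D i s \<le> exp (\<kappa> * s) * (C * exp (- \<kappa> * (s - ln 4)))"
      using C(2)[OF i, of "s - ln 4"] by (intro mult_left_mono) auto
    also have "\<dots> = C * exp (\<kappa> * ln 4)" by (simp add: algebra_simps flip: exp_add)
    finally have "exp (\<kappa> * s) * D i s / l i \<le> C * exp (\<kappa> * ln 4) / l i" using l(1)[OF i] by (intro divide_right_mono) auto
    then show "exp (\<kappa> * s) * D i s / l i \<le> B" using lsum[OF i] by linarith
  qed
  have H'B: "\<bar>H' i s\<bar> \<le> (1 + \<kappa>) * B" if "i \<in> E" for i s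
  proof -
    have "0 \<le> \<kappa> * H i s" "\<kappa> * H i s \<le> \<kappa> * B" using H0[OF that] HB[OF that] k by auto
    moreover have "(1 + \<kappa>) * B = B + \<kappa> * B" by (simp add: distrib_right)
    ultimately show ?thesis using DB[OF that, of s] B1 unfolding H'_def by (intro abs_leI) linarith+
  qed
  have e0: "0 \<le> e i s" if "i \<in> E" for i s
    unfolding e_def using c_nonneg[OF that] avg_nonneg[OF that, of gaussian_kernel'] gaussian_kernel'_nonneg by simp
  have bal: "b i * l i * H' i s = (\<Sum>j\<in>E. G j i * l j * (H j s - H i s)) + e i s" if i: "i \<in> E" for i s
  proof -
    have lH: "l j * H j s = exp (\<kappa> * s) * avg gaussian_kernel j s" if "j \<in> E" for j
      using l(1)[OF that] by (simp add: H_def)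
    have "b i * D i s = - (c i * exp (- s) * avg gaussian_kernel' i s) - (\<Sum>j\<in>E. G j i * avg gaussian_kernel j s)"
      using avg_balance[OF admissible_gaussian i, of s] unfolding D_def by linarith
    then have "exp (\<kappa> * s) * (b i * D i s) = - e i s - exp (\<kappa> * s) * (\<Sum>j\<in>E. G j i * avg gaussian_kernel j s)"
      by (simp add: e_def right_diff_distrib)
    moreover have "exp (\<kappa> * s) * (\<Sum>j\<in>E. G j i * avg gaussian_kernel j s) = (\<Sum>j\<in>E. G j i * l j * H j s)"
      unfolding sum_distrib_left by (intro sum.cong refl) (simp add: mult.assoc lH)
    moreover have "b i * l i * H' i s = \<kappa> * b i * l i * H i s - exp (\<kappa> * s) * (b i * D i s)"
      using l(1)[OF i] by (simp add: H'_def right_diff_distrib mult_ac)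
    moreover have "\<kappa> * b i * l i * H i s = - (\<Sum>j\<in>E. G j i * l j) * H i s"
    proof -
      have "(\<Sum>j\<in>E. G j i * l j) = - (\<kappa> * b i * l i)" using l(2)[OF i] by (simp add: mult.commute add_eq_0_iff)
      then show ?thesis by simp
    qed
    ultimately show ?thesis
      by (simp add: right_diff_distrib sum_subtractf sum_distrib_right)
  qed
  define W where "W i j = r i * G j i * l j" for i j
  have Wrow: "(\<Sum>j\<in>E. W i j) = - (\<kappa> * b i * l i * r i)" if "i \<in> E" for i
  proof -
    have "(\<Sum>j\<in>E. W i j) = r i * (\<Sum>j\<in>E. l j * G j i)" by (simp add: W_def sum_distrib_left mult_ac)
    then show ?thesis using l(2)[OF that] by (simp add: add_eq_0_iff)
  qed
  have Wcol: "(\<Sum>i\<in>E. W i j) = - (\<kappa> * b j * l j * r j)" if "j \<in> E" for j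
  proof -
    have "(\<Sum>i\<in>E. W i j) = l j * (\<Sum>i\<in>E. G j i * r i)" by (simp add: W_def sum_distrib_left mult_ac)
    moreover have "(\<Sum>i\<in>E. G j i * r i) = - (\<kappa> * b j * r j)" using r(2)[OF that] by linarith
    ultimately show ?thesis by simp
  qed
  have Wbal: "(\<Sum>i\<in>E. \<Sum>j\<in>E. W i j * (f j - f i)) = 0" for f :: "nat \<Rightarrow> real"
  proof -
    have "(\<Sum>i\<in>E. \<Sum>j\<in>E. W i j * f j) = (\<Sum>j\<in>E. (\<Sum>i\<in>E. W i j) * f j)"
      by (subst sum.swap) (simp add: sum_distrib_right)
    also have "\<dots> = (\<Sum>i\<in>E. (\<Sum>j\<in>E. W i j) * f i)" by (intro sum.cong refl) (simp add: Wrow Wcol)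
    finally show ?thesis by (simp add: right_diff_distrib sum_subtractf sum_distrib_right)
  qed
  have W0: "0 \<le> W i j" if "i \<in> E" "j \<in> E" "i \<noteq> j" for i j
    unfolding W_def using offdiag[of j i] r(1) l(1) that by (simp add: less_imp_le)
  define \<psi> where "\<psi> s = (\<Sum>i\<in>E. r i * (b i * l i) * H i s)" for s
  define P where "P s = (\<Sum>i\<in>E. r i * (b i * l i) * (H i s)\<^sup>2 / 2)" for s
  define \<DD> where "\<DD> s = (\<Sum>i\<in>E. \<Sum>j\<in>E. W i j * (H j s - H i s)\<^sup>2) / 2" for s
  have rb: "r i * (b i * l i * H' i s) = (\<Sum>j\<in>E. W i j * (H j s - H i s)) + r i * e i s" if "i \<in> E" for i s
    unfolding bal[OF that] distrib_left sum_distrib_left by (simp add: W_def mult_ac)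
  have \<psi>_deriv: "(\<psi> has_real_derivative (\<Sum>i\<in>E. r i * e i s)) (at s)" for s
  proof -
    have "(\<psi> has_real_derivative (\<Sum>i\<in>E. r i * (b i * l i) * H' i s)) (at s)"
      unfolding \<psi>_def[abs_def] using H_deriv by (intro DERIV_sum DERIV_cmult) auto
    also have "(\<Sum>i\<in>E. r i * (b i * l i) * H' i s) = (\<Sum>i\<in>E. (\<Sum>j\<in>E. W i j * (H j s - H i s)) + r i * e i s)"
      by (intro sum.cong refl) (simp add: mult.assoc rb[unfolded mult.assoc])
    also have "\<dots> = (\<Sum>i\<in>E. r i * e i s)" by (simp add: sum.distrib Wbal)
    finally show ?thesis .
  qed
  have square_split: "x * (y - x) = (y\<^sup>2 - x\<^sup>2) / 2 - (y - x)\<^sup>2 / 2" for x y :: real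
    by (simp add: power2_eq_square field_simps)
  have P_deriv: "(P has_real_derivative (\<Sum>i\<in>E. r i * H i s * e i s) - \<DD> s) (at s)" for s
  proof -
    have "((\<lambda>s. r i * (b i * l i) * (H i s)\<^sup>2 / 2) has_real_derivative H i s * (r i * (b i * l i * H' i s))) (at s)" if "i \<in> E" for i
      using H_deriv[OF that] by (auto intro!: derivative_eq_intros)
    then have "(P has_real_derivative (\<Sum>i\<in>E. H i s * (r i * (b i * l i * H' i s)))) (at s)"
      unfolding P_def[abs_def] by (intro DERIV_sum) auto
    also have "(\<Sum>i\<in>E. H i s * (r i * (b i * l i * H' i s)))
        = (\<Sum>i\<in>E. \<Sum>j\<in>E. W i j * (H i s * (H j s - H i s))) + (\<Sum>i\<in>E. r i * H i s * e i s)"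
      unfolding sum.distrib[symmetric]
      by (intro sum.cong refl) (simp only: rb distrib_left, simp add: sum_distrib_left mult_ac)
    also have "(\<Sum>i\<in>E. \<Sum>j\<in>E. W i j * (H i s * (H j s - H i s)))
        = (\<Sum>i\<in>E. \<Sum>j\<in>E. W i j * ((H j s)\<^sup>2 - (H i s)\<^sup>2) / 2 - W i j * (H j s - H i s)\<^sup>2 / 2)"
      by (intro sum.cong refl) (simp only: square_split right_diff_distrib times_divide_eq_right)
    also have "\<dots> = (\<Sum>i\<in>E. \<Sum>j\<in>E. W i j * ((H j s)\<^sup>2 - (H i s)\<^sup>2)) / 2 - \<DD> s"
      by (simp add: sum_subtractf \<DD>_def sum_divide_distrib)
    also have "\<dots> = - \<DD> s" by (simp add: Wbal[of "\<lambda>i. (H i s)\<^sup>2"])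
    finally show ?thesis by (simp add: add.commute)
  qed
  have term0: "0 \<le> W i j * (H j s - H i s)\<^sup>2" if "i \<in> E" "j \<in> E" for i j s
    using W0[OF that] by (cases "i = j") auto
  have \<DD>0: "0 \<le> \<DD> s" for s unfolding \<DD>_def using term0 by (auto intro!: sum_nonneg)
  have re0: "0 \<le> r i * e i s" if "i \<in> E" for i s using r(1)[OF that] e0[OF that] by simp
  define a where "a = (\<Sum>i\<in>E. \<bar>r i * (b i * l i)\<bar>)"
  have \<psi>B: "\<bar>\<psi> s\<bar> \<le> a * B" for s
  proof -
    have "\<bar>\<psi> s\<bar> \<le> (\<Sum>i\<in>E. \<bar>r i * (b i * l i) * H i s\<bar>)" unfolding \<psi>_def by (rule sum_abs)
    also have "\<dots> \<le> (\<Sum>i\<in>E. \<bar>r i * (b i * l i)\<bar> * B)"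
      using H0 HB by (intro sum_mono) (auto simp: abs_mult intro!: mult_left_mono)
    finally show ?thesis by (simp add: a_def sum_distrib_right)
  qed
  have PB: "\<bar>P s\<bar> \<le> a * B\<^sup>2" for s
  proof -
    have "\<bar>P s\<bar> \<le> (\<Sum>i\<in>E. \<bar>r i * (b i * l i) * (H i s)\<^sup>2 / 2\<bar>)" unfolding P_def by (rule sum_abs)
    also have "\<dots> \<le> (\<Sum>i\<in>E. \<bar>r i * (b i * l i)\<bar> * B\<^sup>2)"
    proof (intro sum_mono)
      fix i assume i: "i \<in> E"
      have "(H i s)\<^sup>2 \<le> B\<^sup>2" using H0[OF i] HB[OF i] by (intro power_mono) auto
      moreover have "\<bar>(H i s)\<^sup>2 / 2\<bar> = (H i s)\<^sup>2 / 2" by simp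
      ultimately have "\<bar>(H i s)\<^sup>2 / 2\<bar> \<le> B\<^sup>2" using zero_le_power2[of "H i s"] by linarith
      then have "\<bar>r i * (b i * l i)\<bar> * \<bar>(H i s)\<^sup>2 / 2\<bar> \<le> \<bar>r i * (b i * l i)\<bar> * B\<^sup>2" by (intro mult_left_mono) auto
      then show "\<bar>r i * (b i * l i) * (H i s)\<^sup>2 / 2\<bar> \<le> \<bar>r i * (b i * l i)\<bar> * B\<^sup>2"
        by (simp only: abs_mult[symmetric] times_divide_eq_right)
    qed
    finally show ?thesis by (simp add: a_def sum_distrib_right)
  qed
  have H_lip: "\<bar>H i s - H i t\<bar> \<le> (1 + \<kappa>) * B * \<bar>s - t\<bar>" if "i \<in> E" for i s t
    using field_differentiable_bound[of UNIV "H i" "H' i" "(1 + \<kappa>) * B" s t] H_deriv[OF that] H'B[OF that] by simp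
  define K where "K = 1 + (\<Sum>i\<in>E. \<Sum>j\<in>E. \<bar>W i j\<bar> * (4 * B * ((1 + \<kappa>) * B)))"
  have K: "0 < K" unfolding K_def using B1 k by (intro add_pos_nonneg sum_nonneg mult_nonneg_nonneg) auto
  have \<DD>_lip: "\<bar>\<DD> s - \<DD> t\<bar> \<le> K * \<bar>s - t\<bar>" for s t
  proof -
    have one: "\<bar>W i j * (H j s - H i s)\<^sup>2 - W i j * (H j t - H i t)\<^sup>2\<bar> \<le> \<bar>W i j\<bar> * (4 * B * ((1 + \<kappa>) * B)) * \<bar>s - t\<bar>"
      if ij: "i \<in> E" "j \<in> E" for i j
    proof -
      define x y where "x = H j s - H i s" and "y = H j t - H i t"
      have "\<bar>x - y\<bar> \<le> 2 * ((1 + \<kappa>) * B * \<bar>s - t\<bar>)"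
        using H_lip[OF ij(1), of s t] H_lip[OF ij(2), of s t] unfolding x_def y_def by linarith
      moreover have "\<bar>x + y\<bar> \<le> 2 * B"
        using H0[OF ij(1), of s] H0[OF ij(2), of s] H0[OF ij(1), of t] H0[OF ij(2), of t]
          HB[OF ij(1), of s] HB[OF ij(2), of s] HB[OF ij(1), of t] HB[OF ij(2), of t]
        unfolding x_def y_def by linarith
      ultimately have "\<bar>x + y\<bar> * \<bar>x - y\<bar> \<le> (2 * B) * (2 * ((1 + \<kappa>) * B * \<bar>s - t\<bar>))"
        using B1 by (intro mult_mono) auto
      also have "\<bar>x + y\<bar> * \<bar>x - y\<bar> = \<bar>x\<^sup>2 - y\<^sup>2\<bar>" by (simp add: abs_mult[symmetric] power2_eq_square algebra_simps)
      finally have "\<bar>W i j\<bar> * \<bar>x\<^sup>2 - y\<^sup>2\<bar> \<le> \<bar>W i j\<bar> * ((2 * B) * (2 * ((1 + \<kappa>) * B * \<bar>s - t\<bar>)))" by (intro mult_left_mono) auto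
      then have "\<bar>W i j * x\<^sup>2 - W i j * y\<^sup>2\<bar> \<le> \<bar>W i j\<bar> * ((2 * B) * (2 * ((1 + \<kappa>) * B * \<bar>s - t\<bar>)))"
        by (simp only: abs_mult[symmetric] right_diff_distrib)
      also have "\<dots> = \<bar>W i j\<bar> * (4 * B * ((1 + \<kappa>) * B)) * \<bar>s - t\<bar>" by (simp add: algebra_simps)
      finally show ?thesis unfolding x_def y_def .
    qed
    have "\<bar>\<DD> s - \<DD> t\<bar> = \<bar>\<Sum>i\<in>E. \<Sum>j\<in>E. W i j * (H j s - H i s)\<^sup>2 - W i j * (H j t - H i t)\<^sup>2\<bar> / 2"
      unfolding \<DD>_def by (simp add: sum_subtractf abs_divide flip: diff_divide_distrib)
    also have "\<dots> \<le> \<bar>\<Sum>i\<in>E. \<Sum>j\<in>E. W i j * (H j s - H i s)\<^sup>2 - W i j * (H j t - H i t)\<^sup>2\<bar>" by simp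
    also have "\<dots> \<le> (\<Sum>i\<in>E. \<Sum>j\<in>E. \<bar>W i j\<bar> * (4 * B * ((1 + \<kappa>) * B)) * \<bar>s - t\<bar>)"
      by (intro order.trans[OF sum_abs] sum_mono one)
    also have "\<dots> \<le> K * \<bar>s - t\<bar>" unfolding K_def sum_distrib_right[symmetric] by (intro mult_right_mono) auto
    finally show ?thesis .
  qed
  have \<DD>_lim: "(\<DD> \<longlongrightarrow> 0) at_top"
  proof (rule barbalat[OF _ _ \<DD>0 \<DD>_lip K])
    show "((\<lambda>s. B * \<psi> s - P s) has_real_derivative B * (\<Sum>i\<in>E. r i * e i s) - ((\<Sum>i\<in>E. r i * H i s * e i s) - \<DD> s)) (at s)" for s
      by (intro DERIV_diff DERIV_cmult \<psi>_deriv P_deriv)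
    show "\<DD> s \<le> B * (\<Sum>i\<in>E. r i * e i s) - ((\<Sum>i\<in>E. r i * H i s * e i s) - \<DD> s)" for s
    proof -
      have "(\<Sum>i\<in>E. r i * H i s * e i s) \<le> (\<Sum>i\<in>E. B * (r i * e i s))"
      proof (intro sum_mono)
        fix i assume i: "i \<in> E"
        have "H i s * (r i * e i s) \<le> B * (r i * e i s)" using HB[OF i] re0[OF i] by (intro mult_right_mono) auto
        then show "r i * H i s * e i s \<le> B * (r i * e i s)" by (simp add: mult_ac)
      qed
      then show ?thesis by (simp add: sum_distrib_left)
    qed
    show "B * \<psi> s - P s \<le> B * (a * B) + a * B\<^sup>2" for s
    proof -
      have "B * \<psi> s \<le> B * (a * B)" using \<psi>B[of s] B1 by (intro mult_left_mono) auto
      then show ?thesis using PB[of s] by linarith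
    qed
  qed
  have edge: "((\<lambda>s. H j s - H i s) \<longlongrightarrow> 0) at_top" if ij: "i \<in> E" "j \<in> E" "W i j > 0" for i j
  proof -
    have "((\<lambda>s. W i j * (H j s - H i s)\<^sup>2) \<longlongrightarrow> 0) at_top"
    proof (rule tendsto_sandwich[OF _ _ tendsto_const])
      show "\<forall>\<^sub>F s in at_top. 0 \<le> W i j * (H j s - H i s)\<^sup>2" using term0 ij by simp
      show "\<forall>\<^sub>F s in at_top. W i j * (H j s - H i s)\<^sup>2 \<le> 2 * \<DD> s"
      proof (intro always_eventually allI)
        fix s
        have "W i j * (H j s - H i s)\<^sup>2 \<le> (\<Sum>j\<in>E. W i j * (H j s - H i s)\<^sup>2)"
          by (rule member_le_sum[OF ij(2) _ finE]) (use term0 ij in auto)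
        also have "\<dots> \<le> (\<Sum>i\<in>E. \<Sum>j\<in>E. W i j * (H j s - H i s)\<^sup>2)"
          by (rule member_le_sum[OF ij(1) _ finE]) (use term0 in \<open>auto intro!: sum_nonneg\<close>)
        finally show "W i j * (H j s - H i s)\<^sup>2 \<le> 2 * \<DD> s" by (simp add: \<DD>_def)
      qed
      show "((\<lambda>s. 2 * \<DD> s) \<longlongrightarrow> 0) at_top" using tendsto_mult_left[OF \<DD>_lim, of 2] by simp
    qed
    from tendsto_mult_left[OF this, of "1 / W i j"] have "((\<lambda>s. (H j s - H i s)\<^sup>2) \<longlongrightarrow> 0) at_top" using ij by simp
    from tendsto_real_sqrt[OF this] have "((\<lambda>s. \<bar>H j s - H i s\<bar>) \<longlongrightarrow> 0) at_top" by simp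
    then show ?thesis by (simp add: tendsto_rabs_zero_iff)
  qed
  obtain n where n: "n \<in> E" using neE by blast
  have all: "((\<lambda>s. H j s - H n s) \<longlongrightarrow> 0) at_top" if "j \<in> E" for j
  proof -
    have "{j\<in>E. ((\<lambda>s. H j s - H n s) \<longlongrightarrow> 0) at_top} = E"
    proof (rule irreducible_metzlerD(4)[OF irr])
      show "{j\<in>E. ((\<lambda>s. H j s - H n s) \<longlongrightarrow> 0) at_top} \<noteq> {}" using n by force
      fix i j assume ij: "i \<in> {j\<in>E. ((\<lambda>s. H j s - H n s) \<longlongrightarrow> 0) at_top}" "j \<in> E - {j\<in>E. ((\<lambda>s. H j s - H n s) \<longlongrightarrow> 0) at_top}"
      show "G i j = 0"
      proof (rule ccontr)
        assume "G i j \<noteq> 0"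
        then have "0 < G i j" using offdiag[of i j] ij by force
        then have "0 < W j i" unfolding W_def using r(1) l(1) ij by simp
        then have "((\<lambda>s. H i s - H j s) \<longlongrightarrow> 0) at_top" using edge[of j i] ij by simp
        moreover have "((\<lambda>s. H i s - H n s) \<longlongrightarrow> 0) at_top" using ij by simp
        ultimately have "((\<lambda>s. (H i s - H n s) - (H i s - H j s)) \<longlongrightarrow> 0 - 0) at_top" by (intro tendsto_diff)
        then show False using ij by simp
      qed
    qed auto
    then show ?thesis using that by blast
  qed
  \<comment> \<open>the monotone functional fixes the common limit and makes it positive\<close>
  have \<psi>_mono: "\<psi> s \<le> \<psi> t" if "s \<le> t" for s t
  proof (rule DERIV_nonneg_imp_nondecreasing[OF that])
    fix x show "\<exists>y. (\<psi> has_real_derivative y) (at x) \<and> 0 \<le> y"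
      by (intro exI[of _ "\<Sum>i\<in>E. r i * e i x"] conjI \<psi>_deriv sum_nonneg re0)
  qed
  obtain L where L: "(\<psi> \<longlongrightarrow> L) at_top" "\<And>s. \<psi> s \<le> L"
  proof -
    have "\<exists>L. (\<psi> \<longlongrightarrow> L) at_top \<and> (\<forall>s. \<psi> s \<le> L)"
      by (rule bounded_nondecreasing_tendsto[of \<psi> "a * B"]) (use \<psi>_mono \<psi>B in \<open>auto simp: abs_le_iff\<close>)
    then show ?thesis using that by blast
  qed
  have "0 \<le> \<psi> 0"
  proof -
    have "((\<lambda>s. \<Sum>i\<in>E. r i * (b i * l i) * H i s) \<longlongrightarrow> (\<Sum>i\<in>E. r i * (b i * l i) * 0)) at_bot"
    proof (intro tendsto_sum tendsto_mult_left)
      fix i assume i: "i \<in> E"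
      show "(H i \<longlongrightarrow> 0) at_bot"
      proof (rule tendsto_sandwich[OF _ _ tendsto_const])
        show "\<forall>\<^sub>F s in at_bot. 0 \<le> H i s" using H0[OF i] by simp
        show "\<forall>\<^sub>F s in at_bot. H i s \<le> exp (\<kappa> * s) * (m i / l i)"
        proof (intro always_eventually allI)
          fix s
          have "avg gaussian_kernel i s \<le> m i"
            by (rule avg_le_weight[OF i avg_integrable(1)[OF admissible_gaussian i] gaussian_kernel_bounds(2)])
          then have "exp (\<kappa> * s) * avg gaussian_kernel i s / l i \<le> exp (\<kappa> * s) * m i / l i"
            using l(1)[OF i] by (intro divide_right_mono mult_left_mono) auto
          then show "H i s \<le> exp (\<kappa> * s) * (m i / l i)" by (simp add: H_def)
        qed
        have "filterlim (\<lambda>s. \<kappa> * s) at_bot at_bot"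
          using k by (intro filterlim_tendsto_pos_mult_at_bot[OF tendsto_const _ filterlim_ident])
        then have "((\<lambda>s. exp (\<kappa> * s) * (m i / l i)) \<longlongrightarrow> 0 * (m i / l i)) at_bot"
          by (intro tendsto_mult_right filterlim_compose[OF exp_at_bot])
        then show "((\<lambda>s. exp (\<kappa> * s) * (m i / l i)) \<longlongrightarrow> 0) at_bot" by simp
      qed
    qed
    then have "(\<psi> \<longlongrightarrow> 0) at_bot" unfolding \<psi>_def[abs_def] by simp
    moreover have "\<forall>\<^sub>F s in at_bot. \<psi> s \<le> \<psi> 0"
      by (rule eventually_mono[OF eventually_le_at_bot[of 0]]) (rule \<psi>_mono)
    ultimately show ?thesis by (rule tendsto_upperbound) simp
  qed
  moreover have "\<psi> 0 < \<psi> 1"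
  proof (rule DERIV_pos_imp_increasing[of 0 1 \<psi>])
    fix x :: real
    obtain i where i: "i \<in> E" "0 < c i" using c_pos by blast
    have "0 < r i * e i x" unfolding e_def using avg_gaussian'_pos[OF i] r(1)[OF i(1)] i by simp
    then have "0 < (\<Sum>i\<in>E. r i * e i x)" using re0 i by (intro sum_pos2[OF finE i(1)]) auto
    then show "\<exists>y. (\<psi> has_real_derivative y) (at x) \<and> 0 < y" using \<psi>_deriv by blast
  qed simp
  ultimately have L0: "0 < L" using L(2)[of 1] by linarith
  define \<beta> where "\<beta> = (\<Sum>i\<in>E. r i * (b i * l i))"
  have \<beta>: "0 < \<beta>" using pos unfolding \<beta>_def by (simp add: mult_ac)
  have "\<psi> s - (\<Sum>i\<in>E. r i * (b i * l i) * (H i s - H n s)) = \<beta> * H n s" for s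
    unfolding \<psi>_def \<beta>_def by (simp add: right_diff_distrib sum_subtractf sum_distrib_right)
  moreover have "((\<lambda>s. \<psi> s - (\<Sum>i\<in>E. r i * (b i * l i) * (H i s - H n s))) \<longlongrightarrow> L - (\<Sum>i\<in>E. r i * (b i * l i) * 0)) at_top"
    by (intro tendsto_diff tendsto_sum tendsto_mult_left L all)
  ultimately have "((\<lambda>s. \<beta> * H n s) \<longlongrightarrow> L) at_top" by simp
  from tendsto_mult_left[OF this, of "1 / \<beta>"] have Hn: "(H n \<longlongrightarrow> L / \<beta>) at_top" using \<beta> by simp
  have "((\<lambda>s. \<Sum>i\<in>E. l i * ((H i s - H n s) + H n s)) \<longlongrightarrow> (\<Sum>i\<in>E. l i * (0 + L / \<beta>))) at_top"
    by (intro tendsto_sum tendsto_mult_left tendsto_add all Hn)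
  moreover have "(\<Sum>i\<in>E. l i * ((H i s - H n s) + H n s)) = exp (\<kappa> * s) * (\<Sum>i\<in>E. avg gaussian_kernel i s)" for s
    unfolding sum_distrib_left using l(1) by (intro sum.cong refl) (simp add: H_def less_imp_neq[symmetric])
  moreover have "0 < (\<Sum>i\<in>E. l i * (0 + L / \<beta>))" using l(1) L0 \<beta> finE neE by (intro sum_pos) auto
  ultimately show ?thesis using k by (intro exI[of _ \<kappa>] exI[of _ "\<Sum>i\<in>E. l i * (0 + L / \<beta>)"]) auto
qed

end

section \<open>Stationary laws by time averaging\<close>

locale stationary_chain = jump_chain Q E lam q Z T
  for Q :: "'a measure" and E lam q Z T +
  fixes \<mu> :: "nat \<Rightarrow> real"
  assumes irreducible: "irreducible_metzler E (generator lam q)"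
    and \<mu>_nonneg: "\<And>i. i \<in> E \<Longrightarrow> 0 \<le> \<mu> i" and \<mu>_sum: "(\<Sum>i\<in>E. \<mu> i) = 1"
    and \<mu>_inv: "\<And>j. j \<in> E \<Longrightarrow> (\<Sum>i\<in>E. \<mu> i * generator lam q i j) = 0"
    and marginal: "\<And>t i. 0 \<le> t \<Longrightarrow> i \<in> E \<Longrightarrow> prob {\<omega>\<in>space Q. state t \<omega> = i} = \<mu> i"
begin

lemma \<mu>_pos: "i \<in> E \<Longrightarrow> 0 < \<mu> i"
  using invariant_weights_positive[OF irreducible \<mu>_nonneg \<mu>_sum \<mu>_inv] .

lemma sum_generator:
  assumes "i \<in> E"
  shows "(\<Sum>j\<in>E. generator lam q i j * h j) = lam i * (\<Sum>j\<in>E. q i j * (h j - h i))"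
proof -
  have "(\<Sum>j\<in>E. generator lam q i j * h j) = lam i * (\<Sum>j\<in>E. q i j * h j - (if i = j then h j else 0))"
    unfolding sum_distrib_left by (intro sum.cong) (auto simp: generator_def algebra_simps)
  also have "(\<Sum>j\<in>E. q i j * h j - (if i = j then h j else 0)) = (\<Sum>j\<in>E. q i j * h j) - h i"
    using finE assms by (simp add: sum_subtractf)
  also have "\<dots> = (\<Sum>j\<in>E. q i j * (h j - h i))"
    using q_sum[OF assms] by (simp add: right_diff_distrib sum_subtractf sum_distrib_right[symmetric])
  finally show ?thesis .
qed

lemma generator_row_sum: "i \<in> E \<Longrightarrow> (\<Sum>j\<in>E. generator lam q i j) = 0"
  using sum_generator[of i "\<lambda>_. 1"] by simp

lemma pd_generator_eq:
  "i \<in> E \<Longrightarrow> pd_generator b c h h' i v = (b i * v + c i) * h' i v + (\<Sum>j\<in>E. generator lam q i j * h j v)"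
  unfolding pd_generator_def by (simp add: sum_generator)

lemma tilted_generatorI: "(\<Sum>i\<in>E. b i * \<mu> i) < 0 \<Longrightarrow> tilted_generator E (generator lam q) b \<mu>"
  by unfold_locales (use irreducible generator_row_sum \<mu>_nonneg \<mu>_sum \<mu>_inv in auto)

text \<open>The integral over \<open>[0, t]\<close> of the expected value of an observable.\<close>

definition time_integral :: "(nat \<Rightarrow> real) \<Rightarrow> (nat \<Rightarrow> real) \<Rightarrow> real \<Rightarrow> real \<Rightarrow> (nat \<Rightarrow> real \<Rightarrow> real) \<Rightarrow> real" where
  "time_integral b c u t g = (\<integral>x. g (state (fst x) (snd x)) (pdmp b c u (fst x) (snd x)) * indicator {0..t} (fst x) \<partial>(lborel \<Otimes>\<^sub>M Q))"

definition time_integrable :: "(nat \<Rightarrow> real) \<Rightarrow> (nat \<Rightarrow> real) \<Rightarrow> real \<Rightarrow> real \<Rightarrow> (nat \<Rightarrow> real \<Rightarrow> real) \<Rightarrow> bool" where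
  "time_integrable b c u t g \<longleftrightarrow> integrable (lborel \<Otimes>\<^sub>M Q)
     (\<lambda>x. g (state (fst x) (snd x)) (pdmp b c u (fst x) (snd x)) * indicator {0..t} (fst x))"

lemma borel_lborel_pair: "borel_measurable (borel \<Otimes>\<^sub>M Q) = borel_measurable (lborel \<Otimes>\<^sub>M Q)"
  "measurable (borel \<Otimes>\<^sub>M Q) (count_space UNIV) = measurable (lborel \<Otimes>\<^sub>M Q) (count_space UNIV)"
  by (auto intro!: measurable_cong_sets sets_pair_measure_cong)

lemma observable_measurable:
  fixes g :: "nat \<Rightarrow> real \<Rightarrow> real"
  assumes "\<And>i. i \<in> E \<Longrightarrow> g i \<in> borel_measurable borel"
  shows "(\<lambda>x. g (state (fst x) (snd x)) (pdmp b c u (fst x) (snd x))) \<in> borel_measurable (lborel \<Otimes>\<^sub>M Q)"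
  unfolding borel_lborel_pair(1)[symmetric]
  by (rule measurable_switch[OF assms]) (auto simp: space_pair_measure state_in_E)

lemma integrable_strip:
  fixes t B :: real
  assumes "0 \<le> t"
  shows "integrable (lborel \<Otimes>\<^sub>M Q) (\<lambda>x. B * indicator {0..t} (fst x) :: real)"
    "(\<integral>x. indicator {0..t} (fst x) \<partial>(lborel \<Otimes>\<^sub>M Q)) = t"
proof -
  have e: "emeasure (lborel \<Otimes>\<^sub>M Q) ({0..t} \<times> space Q) = ennreal t"
    using assms by (subst emeasure_pair_measure_Times) (auto simp: emeasure_space_1)
  have s: "{0..t} \<times> space Q \<in> sets (lborel \<Otimes>\<^sub>M Q)" by (intro pair_measureI) auto
  have c: "indicator {0..t} (fst x) = (indicator ({0..t} \<times> space Q) x :: real)" if "x \<in> space (lborel \<Otimes>\<^sub>M Q)" for x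
    using that by (auto simp: space_pair_measure indicator_def)
  have i: "integrable (lborel \<Otimes>\<^sub>M Q) (indicator ({0..t} \<times> space Q) :: _ \<Rightarrow> real)"
    using e s by (intro integrable_real_indicator) (simp_all only: ennreal_less_top infinity_ennreal_def)
  have "integrable (lborel \<Otimes>\<^sub>M Q) (\<lambda>x. indicator {0..t} (fst x) :: real)"
    using i by (subst Bochner_Integration.integrable_cong[OF refl c]) auto
  then show "integrable (lborel \<Otimes>\<^sub>M Q) (\<lambda>x. B * indicator {0..t} (fst x) :: real)" by simp
  have "(\<integral>x. indicator {0..t} (fst x) \<partial>(lborel \<Otimes>\<^sub>M Q)) = (\<integral>x. indicator ({0..t} \<times> space Q) x \<partial>(lborel \<Otimes>\<^sub>M Q) :: real)"
    by (intro Bochner_Integration.integral_cong refl c)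
  also have "\<dots> = measure (lborel \<Otimes>\<^sub>M Q) (({0..t} \<times> space Q) \<inter> space (lborel \<Otimes>\<^sub>M Q))"
    by (rule Bochner_Integration.integral_indicator)
  also have "({0..t} \<times> space Q) \<inter> space (lborel \<Otimes>\<^sub>M Q) = {0..t} \<times> space Q" by (auto simp: space_pair_measure)
  also have "measure (lborel \<Otimes>\<^sub>M Q) ({0..t} \<times> space Q) = t" using e assms by (simp add: measure_def)
  finally show "(\<integral>x. indicator {0..t} (fst x) \<partial>(lborel \<Otimes>\<^sub>M Q)) = t" .
qed

lemma time_integrable_bounded:
  assumes g: "\<And>i. i \<in> E \<Longrightarrow> g i \<in> borel_measurable borel" and B: "\<And>i v. i \<in> E \<Longrightarrow> \<bar>g i v\<bar> \<le> B" and t: "0 \<le> t"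
  shows "time_integrable b c u t g"
  unfolding time_integrable_def
proof (rule Bochner_Integration.integrable_bound[OF integrable_strip(1)[OF t, of B]])
  show "(\<lambda>x. g (state (fst x) (snd x)) (pdmp b c u (fst x) (snd x)) * indicator {0..t} (fst x)) \<in> borel_measurable (lborel \<Otimes>\<^sub>M Q)"
    using observable_measurable[OF g] by measurable
  show "AE x in lborel \<Otimes>\<^sub>M Q. norm (g (state (fst x) (snd x)) (pdmp b c u (fst x) (snd x)) * indicator {0..t} (fst x)) \<le> norm (B * indicator {0..t} (fst x) :: real)"
  proof (rule AE_I2)
    fix x :: "real \<times> 'a" assume "x \<in> space (lborel \<Otimes>\<^sub>M Q)"
    then have "state (fst x) (snd x) \<in> E" by (auto simp: space_pair_measure state_in_E)
    from B[OF this] show "norm (g (state (fst x) (snd x)) (pdmp b c u (fst x) (snd x)) * indicator {0..t} (fst x)) \<le> norm (B * indicator {0..t} (fst x) :: real)"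
      by (auto simp: indicator_def intro: order_trans[OF _ abs_ge_self])
  qed
qed

lemma time_integral_iterated:
  assumes "time_integrable b c u t g"
  shows "time_integral b c u t g = (\<integral>s. (\<integral>\<omega>. g (state s \<omega>) (pdmp b c u s \<omega>) \<partial>Q) * indicator {0..t} s \<partial>lborel)"
proof -
  interpret LQ: pair_sigma_finite lborel Q ..
  have "time_integral b c u t g = (\<integral>s. (\<integral>\<omega>. g (state s \<omega>) (pdmp b c u s \<omega>) * indicator {0..t} s \<partial>Q) \<partial>lborel)"
    unfolding time_integral_def using LQ.integral_fst'[OF assms[unfolded time_integrable_def]] by simp
  then show ?thesis by simp
qed

lemma time_integral_cong:
  assumes "\<And>i v. i \<in> E \<Longrightarrow> f i v = g i v"
  shows "time_integral b c u t f = time_integral b c u t g"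
  unfolding time_integral_def
  by (intro Bochner_Integration.integral_cong refl) (auto simp: space_pair_measure state_in_E assms)

lemma time_integral_mono:
  assumes "time_integrable b c u t f" "time_integrable b c u t g" "\<And>i v. i \<in> E \<Longrightarrow> f i v \<le> g i v"
  shows "time_integral b c u t f \<le> time_integral b c u t g"
  unfolding time_integral_def
  by (rule integral_mono[OF assms(1,2)[unfolded time_integrable_def]])
     (auto simp: space_pair_measure state_in_E intro!: mult_right_mono assms(3))

lemma time_integral_linear:
  assumes "time_integrable b c u t f" "time_integrable b c u t g"
  shows "time_integrable b c u t (\<lambda>i v. x * f i v + y * g i v)"
    and "time_integral b c u t (\<lambda>i v. x * f i v + y * g i v) = x * time_integral b c u t f + y * time_integral b c u t g"
proof -
  have e: "(\<lambda>z. (x * f (state (fst z) (snd z)) (pdmp b c u (fst z) (snd z)) + y * g (state (fst z) (snd z)) (pdmp b c u (fst z) (snd z))) * indicator {0..t} (fst z))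
    = (\<lambda>z. x * (f (state (fst z) (snd z)) (pdmp b c u (fst z) (snd z)) * indicator {0..t} (fst z)) +
       y * (g (state (fst z) (snd z)) (pdmp b c u (fst z) (snd z)) * indicator {0..t} (fst z)))"
    by (simp add: fun_eq_iff algebra_simps)
  note A = assms[unfolded time_integrable_def]
  show "time_integrable b c u t (\<lambda>i v. x * f i v + y * g i v)"
    unfolding time_integrable_def e by (intro Bochner_Integration.integrable_add integrable_mult_right A)
  show "time_integral b c u t (\<lambda>i v. x * f i v + y * g i v) = x * time_integral b c u t f + y * time_integral b c u t g"
    unfolding time_integral_def e
    by (simp only: Bochner_Integration.integral_add[OF integrable_mult_right[OF A(1)] integrable_mult_right[OF A(2)]] integral_mult_right_zero)
qed

lemma time_integral_const: "0 \<le> t \<Longrightarrow> time_integral b c u t (\<lambda>_ _. x) = x * t"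
  unfolding time_integral_def using integrable_strip(2)[of t] by simp

lemma dynkin_time_integral:
  assumes h: "\<And>i v. i \<in> E \<Longrightarrow> (h i has_real_derivative h' i v) (at v)" "\<And>i v. i \<in> E \<Longrightarrow> isCont (h' i) v"
    and t: "0 \<le> t"
  shows "integrable Q (\<lambda>\<omega>. h (state t \<omega>) (pdmp b c u t \<omega>))"
    and "time_integrable b c u t (pd_generator b c h h')"
    and "(\<integral>\<omega>. h (state t \<omega>) (pdmp b c u t \<omega>) \<partial>Q) = (\<integral>\<omega>. h (Z 0 \<omega>) u \<partial>Q) + time_integral b c u t (pd_generator b c h h')"
proof -
  show "integrable Q (\<lambda>\<omega>. h (state t \<omega>) (pdmp b c u t \<omega>))" by (rule dynkin_formula(1)[OF h t])
  show i: "time_integrable b c u t (pd_generator b c h h')"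
    unfolding time_integrable_def using dynkin_formula(2)[OF h t, where b = b and c = c and u = u] by (simp add: split_beta')
  show "(\<integral>\<omega>. h (state t \<omega>) (pdmp b c u t \<omega>) \<partial>Q) = (\<integral>\<omega>. h (Z 0 \<omega>) u \<partial>Q) + time_integral b c u t (pd_generator b c h h')"
    unfolding time_integral_iterated[OF i] by (rule dynkin_formula(3)[OF h t])
qed

lemma time_integral_state:
  assumes "i \<in> E" "0 \<le> t"
  shows "time_integral b c u t (\<lambda>j v. if j = i then 1 else 0) = t * \<mu> i"
proof -
  have "time_integrable b c u t (\<lambda>j v. if j = i then 1 else 0)"
    by (rule time_integrable_bounded[of _ 1]) (use assms in auto)
  note time_integral_iterated[OF this]
  also have "(\<integral>s. (\<integral>\<omega>. (if state s \<omega> = i then 1 else 0) \<partial>Q) * indicator {0..t} s \<partial>lborel) = (\<integral>s. \<mu> i * indicator {0..t} s \<partial>lborel)"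
  proof (intro Bochner_Integration.integral_cong refl)
    fix s
    have "(\<integral>\<omega>. (if state s \<omega> = i then 1 else 0) \<partial>Q) = (\<integral>\<omega>. indicator {\<omega>\<in>space Q. state s \<omega> = i} \<omega> \<partial>Q :: real)"
      by (intro Bochner_Integration.integral_cong refl) (auto simp: indicator_def)
    also have "\<dots> = prob ({\<omega>\<in>space Q. state s \<omega> = i} \<inter> space Q)" by (rule Bochner_Integration.integral_indicator)
    also have "{\<omega>\<in>space Q. state s \<omega> = i} \<inter> space Q = {\<omega>\<in>space Q. state s \<omega> = i}" by auto
    finally have "(\<integral>\<omega>. (if state s \<omega> = i then 1 else 0) \<partial>Q) = prob {\<omega>\<in>space Q. state s \<omega> = i}" .
    then show "(\<integral>\<omega>. (if state s \<omega> = i then 1 else 0) \<partial>Q) * indicator {0..t} s = \<mu> i * indicator {0..t} s"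
      using marginal[OF _ assms(1), of s] by (cases "0 \<le> s") auto
  qed
  also have "\<dots> = t * \<mu> i" using assms by simp
  finally show ?thesis .
qed

text \<open>The law of the value at a uniformly distributed time in \<open>[0, t]\<close>, given that the state lies in \<open>A\<close>.\<close>

definition weight :: "nat set \<Rightarrow> real" where
  "weight A = (\<Sum>i\<in>A. \<mu> i)"

definition occupation :: "(nat \<Rightarrow> real) \<Rightarrow> (nat \<Rightarrow> real) \<Rightarrow> real \<Rightarrow> nat set \<Rightarrow> real \<Rightarrow> real measure" where
  "occupation b c u A t = distr (density (lborel \<Otimes>\<^sub>M Q)
      (\<lambda>x. ennreal ((if state (fst x) (snd x) \<in> A then 1 else 0) * indicator {0..t} (fst x) / (t * weight A))))
    borel (\<lambda>x. pdmp b c u (fst x) (snd x))"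

lemma weight_pos: "A \<subseteq> E \<Longrightarrow> A \<noteq> {} \<Longrightarrow> 0 < weight A"
  unfolding weight_def using \<mu>_pos finite_subset[OF _ finE] by (intro sum_pos) auto

lemma weight_singleton[simp]: "weight {i} = \<mu> i" and weight_E[simp]: "weight E = 1"
  using \<mu>_sum by (simp_all add: weight_def)

lemma occupation_integral:
  assumes A: "A \<subseteq> E" "A \<noteq> {}" and t: "0 < t" and f[measurable]: "f \<in> borel_measurable borel"
  shows "(\<integral>v. f v \<partial>occupation b c u A t) = time_integral b c u t (\<lambda>j v. if j \<in> A then f v else 0) / (t * weight A)"
proof -
  have [measurable]: "(\<lambda>x. pdmp b c u (fst x) (snd x)) \<in> borel_measurable (lborel \<Otimes>\<^sub>M Q)"
    "(\<lambda>x. state (fst x) (snd x)) \<in> measurable (lborel \<Otimes>\<^sub>M Q) (count_space UNIV)"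
    using pdmp_measurable state_measurable unfolding borel_lborel_pair by auto
  have w: "0 < t * weight A" using weight_pos[OF A] t by simp
  have "(\<integral>v. f v \<partial>occupation b c u A t) = (\<integral>x. ((if state (fst x) (snd x) \<in> A then 1 else 0) * indicator {0..t} (fst x) / (t * weight A)) *
     f (pdmp b c u (fst x) (snd x)) \<partial>(lborel \<Otimes>\<^sub>M Q))"
    unfolding occupation_def using w by (subst integral_distr) (auto simp: integral_real_density)
  also have "\<dots> = (\<integral>x. (if state (fst x) (snd x) \<in> A then f (pdmp b c u (fst x) (snd x)) else 0) * indicator {0..t} (fst x) / (t * weight A) \<partial>(lborel \<Otimes>\<^sub>M Q))"
    by (intro Bochner_Integration.integral_cong refl) auto
  finally show ?thesis unfolding time_integral_def by simp
qed

lemma time_integral_sum_states: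
  fixes g :: "nat \<Rightarrow> real \<Rightarrow> real"
  assumes f: "\<And>i. i \<in> E \<Longrightarrow> g i \<in> borel_measurable borel" "\<And>i v. i \<in> E \<Longrightarrow> \<bar>g i v\<bar> \<le> B" and t: "0 \<le> t"
  shows "time_integral b c u t g = (\<Sum>i\<in>E. time_integral b c u t (\<lambda>j v. if j = i then g i v else 0))"
proof -
  have B0: "0 \<le> B" using f(2) E_nonempty by (meson abs_ge_zero all_not_in_conv order_trans)
  have i: "time_integrable b c u t (\<lambda>j v. if j = i then g i v else 0)" if "i \<in> E" for i
    by (rule time_integrable_bounded[of _ B]) (use f that t B0 in auto)
  have "(\<Sum>i\<in>E. time_integral b c u t (\<lambda>j v. if j = i then g i v else 0)) =
    (\<integral>x. (\<Sum>i\<in>E. (if state (fst x) (snd x) = i then g i (pdmp b c u (fst x) (snd x)) else 0) * indicator {0..t} (fst x)) \<partial>(lborel \<Otimes>\<^sub>M Q))"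
    unfolding time_integral_def using i[unfolded time_integrable_def]
    by (subst Bochner_Integration.integral_sum) auto
  also have "\<dots> = time_integral b c u t g"
    unfolding time_integral_def
  proof (intro Bochner_Integration.integral_cong refl)
    fix x :: "real \<times> 'a" assume "x \<in> space (lborel \<Otimes>\<^sub>M Q)"
    then have "state (fst x) (snd x) \<in> E" by (auto simp: space_pair_measure state_in_E)
    then show "(\<Sum>i\<in>E. (if state (fst x) (snd x) = i then g i (pdmp b c u (fst x) (snd x)) else 0) * indicator {0..t} (fst x)) =
      g (state (fst x) (snd x)) (pdmp b c u (fst x) (snd x)) * indicator {0..t} (fst x)"
      unfolding sum_distrib_right[symmetric] using finE by simp
  qed
  finally show ?thesis by simp
qed

lemma occupation_distribution:
  assumes A: "A \<subseteq> E" "A \<noteq> {}" and t: "0 < t"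
  shows "real_distribution (occupation b c u A t)"
proof -
  have [measurable]: "(\<lambda>x. pdmp b c u (fst x) (snd x)) \<in> borel_measurable (lborel \<Otimes>\<^sub>M Q)"
    "(\<lambda>x. state (fst x) (snd x)) \<in> measurable (lborel \<Otimes>\<^sub>M Q) (count_space UNIV)"
    using pdmp_measurable state_measurable unfolding borel_lborel_pair by auto
  have w: "0 < t * weight A" using weight_pos[OF A] t by simp
  define W where "W x = (if state (fst x) (snd x) \<in> A then 1 else 0) * indicator {0..t} (fst x) / (t * weight A)" for x :: "real \<times> 'a"
  have [measurable]: "W \<in> borel_measurable (lborel \<Otimes>\<^sub>M Q)" unfolding W_def by measurable
  have "time_integrable b c u t (\<lambda>j _. if j \<in> A then 1 else 0)"
    by (rule time_integrable_bounded[of _ 1]) (use t in auto)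
  then have "integrable (lborel \<Otimes>\<^sub>M Q) (\<lambda>x. (if state (fst x) (snd x) \<in> A then 1 else 0) * indicator {0..t} (fst x) :: real)"
    unfolding time_integrable_def .
  then have Wi: "integrable (lborel \<Otimes>\<^sub>M Q) W" unfolding W_def by simp
  have W0: "0 \<le> W x" for x unfolding W_def using w by (auto intro!: divide_nonneg_pos)
  have "(\<integral>x. W x \<partial>(lborel \<Otimes>\<^sub>M Q)) = time_integral b c u t (\<lambda>j v. if j \<in> A then 1 else 0) / (t * weight A)"
    unfolding W_def time_integral_def by simp
  also have "time_integral b c u t (\<lambda>j v. if j \<in> A then 1 else 0) = (\<Sum>i\<in>E. time_integral b c u t (\<lambda>j v. if j = i then (if i \<in> A then 1 else 0) else 0))"
    by (rule time_integral_sum_states[of _ 1]) (use t in auto)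
  also have "\<dots> = (\<Sum>i\<in>E. if i \<in> A then t * \<mu> i else 0)"
  proof (intro sum.cong refl)
    fix i assume "i \<in> E"
    then show "time_integral b c u t (\<lambda>j v. if j = i then (if i \<in> A then 1 else 0) else 0) = (if i \<in> A then t * \<mu> i else 0)"
      using time_integral_state[of i t b c u] time_integral_const[of t b c u 0] t by (cases "i \<in> A") (auto cong: if_cong)
  qed
  also have "\<dots> = t * weight A"
    using A finE by (simp add: weight_def sum_distrib_left sum.inter_restrict[symmetric] Int_absorb1)
  finally have "(\<integral>x. W x \<partial>(lborel \<Otimes>\<^sub>M Q)) = (t * weight A) / (t * weight A)" .
  then have W1: "(\<integral>x. W x \<partial>(lborel \<Otimes>\<^sub>M Q)) = 1" using w by (metis divide_self less_irrefl)
  have top: "space (lborel \<Otimes>\<^sub>M Q) \<in> sets (borel \<Otimes>\<^sub>M Q)" using sets.top[of "lborel \<Otimes>\<^sub>M Q"] by simp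
  have "prob_space (density (lborel \<Otimes>\<^sub>M Q) (\<lambda>x. ennreal (W x)))"
  proof
    have "emeasure (density (lborel \<Otimes>\<^sub>M Q) (\<lambda>x. ennreal (W x))) (space (density (lborel \<Otimes>\<^sub>M Q) (\<lambda>x. ennreal (W x)))) = (\<integral>\<^sup>+x. ennreal (W x) \<partial>(lborel \<Otimes>\<^sub>M Q))"
      using top by (subst emeasure_density) (auto intro!: nn_integral_cong)
    also have "\<dots> = 1" using nn_integral_eq_integral[OF Wi] W0 W1 by simp
    finally show "emeasure (density (lborel \<Otimes>\<^sub>M Q) (\<lambda>x. ennreal (W x))) (space (density (lborel \<Otimes>\<^sub>M Q) (\<lambda>x. ennreal (W x)))) = 1" .
  qed
  then have "prob_space (occupation b c u A t)" unfolding occupation_def W_def[symmetric]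
    by (rule prob_space.prob_space_distr) measurable
  then show ?thesis unfolding real_distribution_def real_distribution_axioms_def by (simp add: occupation_def)
qed

lemma occupation_nonneg:
  assumes "\<And>i. i \<in> E \<Longrightarrow> 0 \<le> c i" "0 \<le> u" and A: "A \<subseteq> E" "A \<noteq> {}" "0 < t"
  shows "(\<integral>v. min 1 (max 0 (- v)) \<partial>occupation b c u A t) = 0"
proof -
  have "time_integral b c u t (\<lambda>j v. if j \<in> A then min 1 (max 0 (- v)) else 0) = 0"
    unfolding time_integral_def
  proof (intro integral_eq_zero_AE AE_I2)
    fix x :: "real \<times> 'a" assume x: "x \<in> space (lborel \<Otimes>\<^sub>M Q)"
    have "0 \<le> fst x \<Longrightarrow> 0 \<le> pdmp b c u (fst x) (snd x)"
      by (rule pdmp_nonneg) (use x assms in \<open>auto simp: space_pair_measure\<close>)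
    then show "(if state (fst x) (snd x) \<in> A then min 1 (max 0 (- pdmp b c u (fst x) (snd x))) else 0) * indicator {0..t} (fst x) = 0"
      by (auto simp: indicator_def max_def)
  qed
  then show ?thesis by (subst occupation_integral[OF A]) auto
qed

text \<open>
  The Lyapunov function \<open>r i (1 + v\<^sup>2) powr (p / 2)\<close>, with \<open>p\<close> a small exponent at which the
  tilted generator contracts: its generator is at most \<open>- \<theta> (1 + v\<^sup>2) powr (p / 2) + D\<close>.
\<close>

definition lyapunov :: "real \<Rightarrow> real \<Rightarrow> real" where
  "lyapunov p v = (1 + v\<^sup>2) powr (p / 2)"

lemma one_plus_square_pos: "0 < 1 + v\<^sup>2" for v :: real
  by (simp add: add_pos_nonneg)

lemma lyapunov_deriv: "(lyapunov p has_real_derivative p * v * (1 + v\<^sup>2) powr (p / 2 - 1)) (at v)"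
  unfolding lyapunov_def using one_plus_square_pos[of v]
  by (auto intro!: derivative_eq_intros simp: powr_diff field_simps)

lemma lyapunov_drift:
  assumes p: "0 < p" "p \<le> 1"
  shows "p * v * (1 + v\<^sup>2) powr (p / 2 - 1) * (b * v + c) \<le> p * b * lyapunov p v + p * (\<bar>b\<bar> + \<bar>c\<bar>)"
proof -
  define y where "y = (1 + v\<^sup>2) powr (p / 2 - 1)"
  have y0: "0 \<le> y" by (simp add: y_def)
  have pos: "0 < 1 + v\<^sup>2" by (rule one_plus_square_pos)
  have L: "lyapunov p v = (1 + v\<^sup>2) * y"
  proof -
    have "(1 + v\<^sup>2) * y = (1 + v\<^sup>2) powr 1 * (1 + v\<^sup>2) powr (p / 2 - 1)" using pos by (simp add: y_def)
    also have "\<dots> = lyapunov p v" unfolding powr_add[symmetric] lyapunov_def by simp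
    finally show ?thesis by simp
  qed
  have "y \<le> (1 + v\<^sup>2) powr 0" unfolding y_def using p by (intro powr_mono) auto
  then have y1: "y \<le> 1" using pos by simp
  have yv: "\<bar>v\<bar> * y \<le> 1"
  proof -
    have "\<bar>v\<bar> = (v\<^sup>2) powr (1 / 2)" by (simp add: powr_half_sqrt)
    also have "\<dots> \<le> (1 + v\<^sup>2) powr (1 / 2)" by (intro powr_mono2) auto
    finally have "\<bar>v\<bar> * y \<le> (1 + v\<^sup>2) powr (1 / 2) * y" using y0 by (rule mult_right_mono)
    also have "\<dots> = (1 + v\<^sup>2) powr (1 / 2 + (p / 2 - 1))" unfolding y_def powr_add ..
    also have "\<dots> \<le> (1 + v\<^sup>2) powr 0" using p by (intro powr_mono) auto
    finally show ?thesis using pos by simp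
  qed
  have "p * v * y * (b * v + c) = p * b * lyapunov p v + p * (c * (v * y) - b * y)"
    unfolding L by (simp add: power2_eq_square algebra_simps)
  also have "c * (v * y) - b * y \<le> \<bar>c\<bar> * 1 + \<bar>b\<bar> * 1"
  proof -
    have "\<bar>c * (v * y)\<bar> \<le> \<bar>c\<bar> * 1" using yv y0 unfolding abs_mult by (intro mult_left_mono) auto
    moreover have "\<bar>b * y\<bar> \<le> \<bar>b\<bar> * 1" using y1 y0 unfolding abs_mult by (intro mult_left_mono) auto
    ultimately show ?thesis by linarith
  qed
  then have "p * (c * (v * y) - b * y) \<le> p * (\<bar>b\<bar> + \<bar>c\<bar>)" using p by (intro mult_left_mono) auto
  finally show ?thesis unfolding y_def by simp
qed

lemma occupation_tail_bound:
  assumes drift: "(\<Sum>i\<in>E. b i * \<mu> i) < 0" 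
  shows "\<exists>p K. 0 < p \<and> (\<forall>A t a. A \<subseteq> E \<longrightarrow> A \<noteq> {} \<longrightarrow> 1 \<le> t \<longrightarrow> 0 \<le> a \<longrightarrow>
    measure (occupation b c u A t) {v. a < \<bar>v\<bar>} \<le> K / (weight A * lyapunov p a))"
proof -
  interpret tilted_generator E "generator lam q" b \<mu> by (rule tilted_generatorI[OF drift])
  obtain p r where p: "0 < p" "p \<le> 1" and r: "\<forall>i\<in>E. 0 < r i"
    and contr: "\<forall>i\<in>E. (\<Sum>j\<in>E. generator lam q i j * r j) + p * b i * r i < 0"
    using small_exponent_contracts[of 1] by auto
  define \<theta> where "\<theta> = Min ((\<lambda>i. - ((\<Sum>j\<in>E. generator lam q i j * r j) + p * b i * r i)) ` E)"
  have \<theta>: "0 < \<theta>" unfolding \<theta>_def using contr finE neE by (subst Min_gr_iff) auto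
  have \<theta>_le: "(\<Sum>j\<in>E. generator lam q i j * r j) + p * b i * r i \<le> - \<theta>" if "i \<in> E" for i
  proof -
    have "\<theta> \<le> - ((\<Sum>j\<in>E. generator lam q i j * r j) + p * b i * r i)"
      unfolding \<theta>_def using finE that by (intro Min_le) auto
    then show ?thesis by simp
  qed
  have r_nonneg: "0 \<le> r i" if "i \<in> E" for i by (rule less_imp_le[OF bspec[OF r that]])
  define D where "D = (\<Sum>i\<in>E. r i * (p * (\<bar>b i\<bar> + \<bar>c i\<bar>)))"
  have D_ge: "r i * (p * (\<bar>b i\<bar> + \<bar>c i\<bar>)) \<le> D" if "i \<in> E" for i
    unfolding D_def using r_nonneg p by (intro member_le_sum[OF that _ finE]) auto
  define R where "R = (\<Sum>i\<in>E. r i)"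
  have R: "r i \<le> R" if "i \<in> E" for i
    unfolding R_def using r_nonneg by (intro member_le_sum[OF that _ finE]) auto
  have D0: "0 \<le> D" "0 \<le> R" unfolding D_def R_def using r_nonneg p by (auto intro!: sum_nonneg)
  define h where "h i v = r i * lyapunov p v" for i v
  define h' where "h' i v = r i * (p * v * (1 + v\<^sup>2) powr (p / 2 - 1))" for i v
  have hd: "(h i has_real_derivative h' i v) (at v)" for i v
    unfolding h_def h'_def by (intro DERIV_cmult lyapunov_deriv)
  have hc: "isCont (h' i) v" for i v unfolding h'_def using one_plus_square_pos[of v]
    by (intro continuous_intros) auto
  define L where "L = pd_generator b c h h'"
  have L_le: "L i v \<le> D - \<theta> * lyapunov p v" if i: "i \<in> E" for i v
  proof -
    have "L i v = r i * (p * v * (1 + v\<^sup>2) powr (p / 2 - 1) * (b i * v + c i)) + (\<Sum>j\<in>E. generator lam q i j * r j) * lyapunov p v"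
    proof -
      have "(\<Sum>j\<in>E. generator lam q i j * h j v) = (\<Sum>j\<in>E. generator lam q i j * r j) * lyapunov p v"
        by (simp add: h_def sum_distrib_right mult.assoc)
      then show ?thesis unfolding L_def pd_generator_eq[OF i] by (simp add: h'_def)
    qed
    also have "\<dots> \<le> r i * (p * b i * lyapunov p v + p * (\<bar>b i\<bar> + \<bar>c i\<bar>)) + (\<Sum>j\<in>E. generator lam q i j * r j) * lyapunov p v"
      by (intro add_right_mono mult_left_mono lyapunov_drift p r_nonneg i)
    also have "\<dots> = ((\<Sum>j\<in>E. generator lam q i j * r j) + p * b i * r i) * lyapunov p v + r i * (p * (\<bar>b i\<bar> + \<bar>c i\<bar>))"
      by (simp add: algebra_simps)
    also have "\<dots> \<le> - \<theta> * lyapunov p v + D"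
      using \<theta>_le[OF i] D_ge[OF i] by (intro add_mono mult_right_mono) (auto simp: lyapunov_def)
    finally show ?thesis by simp
  qed
  have lyap_pos: "0 < lyapunov p v" for v unfolding lyapunov_def using one_plus_square_pos[of v] by simp
  define K where "K = (D + R * lyapunov p u) / \<theta>"
  have "measure (occupation b c u A t) {v. a < \<bar>v\<bar>} \<le> K / (weight A * lyapunov p a)"
    if A: "A \<subseteq> E" "A \<noteq> {}" and t: "1 \<le> t" and a: "0 \<le> a" for A t a
  proof -
    interpret O: real_distribution "occupation b c u A t" by (rule occupation_distribution[OF A]) (use t in simp)
    have t0: "0 \<le> t" using t by simp
    define g where "g j v = (if j \<in> A then indicator {v. a < \<bar>v\<bar>} v else 0 :: real)" for j :: nat and v
    have "measure (occupation b c u A t) {v. a < \<bar>v\<bar>} = (\<integral>v. indicator {v. a < \<bar>v\<bar>} v \<partial>occupation b c u A t)"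
      by simp
    also have "\<dots> = time_integral b c u t g / (t * weight A)"
      unfolding g_def using t by (subst occupation_integral[OF A]) auto
    also have "time_integral b c u t g \<le> (D * t + R * lyapunov p u) / (\<theta> * lyapunov p a)"
    proof -
      define x where "x = 1 / (\<theta> * lyapunov p a)"
      have x: "0 < x" unfolding x_def using \<theta> lyap_pos by simp
      have gi: "time_integrable b c u t g"
      proof (rule time_integrable_bounded[of _ 1])
        show "g i \<in> borel_measurable borel" for i
        proof -
          have "g i = (\<lambda>v. if i \<in> A then indicator {v. a < \<bar>v\<bar>} v else 0)" by (rule ext) (simp add: g_def)
          then show ?thesis by simp
        qed
      qed (use t in \<open>auto simp: g_def indicator_def\<close>)
      have Li: "time_integrable b c u t L" unfolding L_def by (rule dynkin_time_integral(2)[OF hd hc t0])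
      have ci: "time_integrable b c u t (\<lambda>_ _. D)" using t by (intro time_integrable_bounded[of _ "\<bar>D\<bar>"]) auto
      have "time_integral b c u t g \<le> time_integral b c u t (\<lambda>i v. x * D + (- x) * L i v)"
      proof (rule time_integral_mono[OF gi time_integral_linear(1)[OF ci Li]])
        fix i v assume i: "i \<in> E"
        have "g i v \<le> lyapunov p v / lyapunov p a"
        proof (cases "a < \<bar>v\<bar>")
          case True
          have "a\<^sup>2 \<le> v\<^sup>2" unfolding abs_le_square_iff[symmetric] using True a by simp
          then have "lyapunov p a \<le> lyapunov p v" unfolding lyapunov_def using p one_plus_square_pos[of a]
            by (intro powr_mono2) auto
          then have "1 \<le> lyapunov p v / lyapunov p a" using lyap_pos[of a] by simp
          moreover have "g i v \<le> 1" by (simp add: g_def indicator_def)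
          ultimately show ?thesis by linarith
        next
          case False
          then show ?thesis using divide_pos_pos[OF lyap_pos[of v] lyap_pos[of a]] by (simp add: g_def)
        qed
        also have "\<dots> = x * (\<theta> * lyapunov p v)" using \<theta> by (simp add: x_def)
        also have "\<dots> \<le> x * (D - L i v)" using L_le[OF i, of v] x by (intro mult_left_mono) auto
        finally show "g i v \<le> x * D + (- x) * L i v" by (simp add: algebra_simps)
      qed
      also have "\<dots> = x * (D * t) - x * time_integral b c u t L"
        using time_integral_linear(2)[OF ci Li, of x "- x"] time_integral_const[of t b c u D] t by simp
      also have "\<dots> \<le> x * (D * t) + x * (R * lyapunov p u)"
      proof -
        have "0 \<le> (\<integral>\<omega>. h (state t \<omega>) (pdmp b c u t \<omega>) \<partial>Q)"
          unfolding h_def by (intro integral_nonneg_AE AE_I2 mult_nonneg_nonneg r_nonneg state_in_E less_imp_le[OF lyap_pos] t0)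
        also have "\<dots> = (\<integral>\<omega>. h (Z 0 \<omega>) u \<partial>Q) + time_integral b c u t L"
          unfolding L_def by (rule dynkin_time_integral(3)[OF hd hc t0])
        also have "(\<integral>\<omega>. h (Z 0 \<omega>) u \<partial>Q) \<le> (\<integral>\<omega>. R * lyapunov p u \<partial>Q)"
        proof (rule integral_mono')
          fix \<omega> assume "\<omega> \<in> space Q"
          then show "h (Z 0 \<omega>) u \<le> R * lyapunov p u"
            unfolding h_def by (intro mult_right_mono R Z_in_E less_imp_le[OF lyap_pos])
          show "0 \<le> R * lyapunov p u" by (intro mult_nonneg_nonneg D0 less_imp_le[OF lyap_pos])
        qed simp
        finally have "- time_integral b c u t L \<le> R * lyapunov p u" using prob_space by simp
        from mult_left_mono[OF this, of x] x show ?thesis by simp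
      qed
      finally show ?thesis by (simp add: x_def add_divide_distrib)
    qed
    also have "(D * t + R * lyapunov p u) / (\<theta> * lyapunov p a) / (t * weight A) \<le> (D * t + R * lyapunov p u * t) / (\<theta> * lyapunov p a) / (t * weight A)"
    proof (intro divide_right_mono add_left_mono)
      have "0 \<le> R * lyapunov p u" using D0 lyap_pos[of u] by simp
      from mult_left_mono[OF t this] show "R * lyapunov p u \<le> R * lyapunov p u * t" by simp
    qed (use t lyap_pos[of a] \<theta> weight_pos[OF A] in auto)
    also have "D * t + R * lyapunov p u * t = (D + R * lyapunov p u) * t" by (simp add: distrib_right)
    also have "(D + R * lyapunov p u) * t / (\<theta> * lyapunov p a) / (t * weight A) = K / (weight A * lyapunov p a)"
      using t by (simp add: K_def)
    finally show ?thesis using weight_pos[OF A] t by (simp add: divide_right_mono)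
  qed
  then have "\<forall>A t a. A \<subseteq> E \<longrightarrow> A \<noteq> {} \<longrightarrow> 1 \<le> t \<longrightarrow> 0 \<le> a \<longrightarrow>
    measure (occupation b c u A t) {v. a < \<bar>v\<bar>} \<le> K / (weight A * lyapunov p a)" by (intro allI impI)
  show ?thesis by (rule exI[of _ p], rule exI[of _ K], rule conjI) fact+
qed

lemma lyapunov_at_top:
  assumes "0 < p"
  shows "filterlim (lyapunov p) at_top at_top"
proof -
  have "filterlim (\<lambda>a::real. a\<^sup>2) at_top at_top" by (rule filterlim_pow_at_top) (auto intro: filterlim_ident)
  then have "filterlim (\<lambda>a::real. 1 + a\<^sup>2) at_top at_top" by (rule filterlim_tendsto_add_at_top[OF tendsto_const])
  then have "filterlim (\<lambda>a::real. ln (1 + a\<^sup>2)) at_top at_top" by (rule filterlim_compose[OF ln_at_top])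
  then have "filterlim (\<lambda>a::real. p / 2 * ln (1 + a\<^sup>2)) at_top at_top"
    by (rule filterlim_tendsto_pos_mult_at_top[OF tendsto_const, rotated]) (use assms in simp)
  then have "filterlim (\<lambda>a::real. exp (p / 2 * ln (1 + a\<^sup>2))) at_top at_top" by (rule filterlim_compose[OF exp_at_top])
  moreover have "lyapunov p = (\<lambda>a. exp (p / 2 * ln (1 + a\<^sup>2)))"
    using one_plus_square_pos by (auto simp: lyapunov_def powr_def fun_eq_iff add_nonneg_eq_0_iff)
  ultimately show ?thesis by simp
qed

lemma occupation_tight:
  assumes drift: "(\<Sum>i\<in>E. b i * \<mu> i) < 0" and A: "A \<subseteq> E" "A \<noteq> {}"
  shows "tight (\<lambda>n. occupation b c u A (real (Suc n)))"
  unfolding tight_def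
proof (intro conjI allI impI)
  show O: "real_distribution (occupation b c u A (real (Suc n)))" for n by (rule occupation_distribution[OF A]) simp
  fix e :: real assume e: "0 < e"
  obtain p K where p: "0 < p" and K: "\<And>t a. 1 \<le> t \<Longrightarrow> 0 \<le> a \<Longrightarrow>
     measure (occupation b c u A t) {v. a < \<bar>v\<bar>} \<le> K / (weight A * lyapunov p a)"
    using occupation_tail_bound[OF drift, of c u] A by meson
  have "filterlim (\<lambda>a. weight A * lyapunov p a) at_top at_top"
    by (rule filterlim_tendsto_pos_mult_at_top[OF tendsto_const weight_pos[OF A] lyapunov_at_top[OF p]])
  then have "((\<lambda>a. K / (weight A * lyapunov p a)) \<longlongrightarrow> 0) at_top"
    by (intro tendsto_divide_0[OF tendsto_const] filterlim_at_top_imp_at_infinity)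
  then have "\<forall>\<^sub>F a in at_top. K / (weight A * lyapunov p a) < e" by (rule order_tendstoD(2)) (rule e)
  moreover have "\<forall>\<^sub>F a in at_top. (0::real) \<le> a" by (rule eventually_ge_at_top)
  ultimately have "\<forall>\<^sub>F a in at_top. K / (weight A * lyapunov p a) < e \<and> 0 \<le> a" by eventually_elim auto
  then obtain a where a: "K / (weight A * lyapunov p a) < e" "0 \<le> a" by (auto simp: eventually_at_top_linorder)
  have S: "{v. a < \<bar>v\<bar>} \<in> sets borel" by (intro borel_open open_Collect_less continuous_intros)
  show "\<exists>x y. x < y \<and> (\<forall>n. 1 - e < measure (occupation b c u A (real (Suc n))) {x<..y})"
  proof (rule exI[of _ "- (a + 1)"], rule exI[of _ "a + 1"], intro conjI allI)
    show "- (a + 1) < a + 1" using a by simp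
    fix n
    define t where "t = real (Suc n)"
    have t: "1 \<le> t" by (simp add: t_def)
    interpret O: real_distribution "occupation b c u A t" unfolding t_def by (rule O)
    have "measure (occupation b c u A t) (UNIV - {v. a < \<bar>v\<bar>}) = 1 - measure (occupation b c u A t) {v. a < \<bar>v\<bar>}"
      using O.prob_compl[of "{v. a < \<bar>v\<bar>}"] S by simp
    also have "\<dots> \<ge> 1 - K / (weight A * lyapunov p a)" using K[OF t a(2)] by simp
    finally have "1 - e < measure (occupation b c u A t) (UNIV - {v. a < \<bar>v\<bar>})" using a by linarith
    also have "\<dots> \<le> measure (occupation b c u A t) {- (a + 1)<..a + 1}"
      by (rule O.finite_measure_mono) auto
    finally show "1 - e < measure (occupation b c u A (real (Suc n))) {- (a + 1)<..a + 1}" unfolding t_def .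
  qed
qed

text \<open>Time averages of a converging function converge to the same limit.\<close>

end

context stationary_chain
begin

lemma time_average_limit:
  fixes f :: "real \<Rightarrow> real"
  assumes f: "\<And>v. isCont f v" "\<And>v. \<bar>f v\<bar> \<le> B" and lim: "((\<lambda>t. \<integral>\<omega>. f (pdmp b c u t \<omega>) \<partial>Q) \<longlongrightarrow> l) at_top"
  shows "(\<lambda>n. \<integral>v. f v \<partial>occupation b c u E (real (Suc n))) \<longlonglongrightarrow> l"
proof -
  define y where "y t = (\<integral>\<omega>. f (pdmp b c u t \<omega>) \<partial>Q)" for t
  have [measurable]: "f \<in> borel_measurable borel" by (rule isCont_borel_measurable[OF f(1)])
  have ym[measurable]: "y \<in> borel_measurable borel"
  proof -
    have "(\<lambda>x. f (pdmp b c u (fst x) (snd x))) \<in> borel_measurable (borel \<Otimes>\<^sub>M Q)" by measurable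
    then show ?thesis unfolding y_def by (intro borel_measurable_lebesgue_integral) (simp add: split_beta')
  qed
  have yB: "\<bar>y t\<bar> \<le> B" for t
  proof -
    have "\<bar>y t\<bar> \<le> (\<integral>\<omega>. \<bar>f (pdmp b c u t \<omega>)\<bar> \<partial>Q)" unfolding y_def by (rule integral_abs_bound)
    also have "\<dots> \<le> (\<integral>\<omega>. B \<partial>Q)" using f(2) order_trans[OF abs_ge_zero f(2)] by (intro integral_mono') auto
    finally show ?thesis using prob_space by simp
  qed
  have eq: "(\<integral>v. f v \<partial>occupation b c u E (real (Suc n))) = (\<integral>s. y (real (Suc n) * s) * indicator {0..1} s \<partial>lborel)" for n
  proof -
    define T where "T = real (Suc n)"
    have T: "0 < T" by (simp add: T_def)
    have "(\<integral>v. f v \<partial>occupation b c u E T) = time_integral b c u T (\<lambda>j v. if j \<in> E then f v else 0) / (T * weight E)"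
      by (rule occupation_integral) (use T E_nonempty in auto)
    also have "time_integral b c u T (\<lambda>j v. if j \<in> E then f v else 0) = time_integral b c u T (\<lambda>_. f)"
      by (rule time_integral_cong) simp
    also have "\<dots> = (\<integral>t. y t * indicator {0..T} t \<partial>lborel)"
      unfolding y_def by (rule time_integral_iterated, rule time_integrable_bounded[of _ B]) (use f T in auto)
    also have "\<dots> = T * (\<integral>s. y (T * s) * indicator {0..T} (T * s) \<partial>lborel)"
      by (subst lborel_integral_real_affine[where c = T and t = 0]) (use T in auto)
    also have "(\<lambda>s. y (T * s) * indicator {0..T} (T * s)) = (\<lambda>s. y (T * s) * indicator {0..1} s)"
      using T by (auto simp: fun_eq_iff indicator_def zero_le_mult_iff)
    finally show ?thesis using T by (simp add: T_def)
  qed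
  have "(\<lambda>n. \<integral>s. y (real (Suc n) * s) * indicator {0..1} s \<partial>lborel) \<longlonglongrightarrow> (\<integral>s. l * indicator {0..1::real} s \<partial>lborel)"
  proof (rule integral_dominated_convergence)
    show "(\<lambda>s::real. l * indicator {0..1} s) \<in> borel_measurable lborel" by measurable
    show "(\<lambda>s. y (real (Suc n) * s) * indicator {0..1} s) \<in> borel_measurable lborel" for n by measurable
    show "AE s in lborel. norm (y (real (Suc n) * s) * indicator {0..1} s) \<le> B * indicator {0..1} s" for n
      using yB by (intro AE_I2) (auto simp: indicator_def)
    have "AE s in lborel. s \<noteq> (0::real)" by (rule AE_lborel_singleton)
    then show "AE s in lborel. (\<lambda>n. y (real (Suc n) * s) * indicator {0..1} s) \<longlonglongrightarrow> l * indicator {0..1} s"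
    proof eventually_elim
      fix s :: real assume "s \<noteq> 0"
      show "(\<lambda>n. y (real (Suc n) * s) * indicator {0..1} s) \<longlonglongrightarrow> l * indicator {0..1} s"
      proof (cases "0 < s")
        case True
        have "filterlim (\<lambda>n. real (Suc n)) at_top sequentially"
          by (intro filterlim_compose[OF filterlim_real_sequentially filterlim_Suc])
        then have "filterlim (\<lambda>n. s * real (Suc n)) at_top sequentially"
          by (rule filterlim_tendsto_pos_mult_at_top[OF tendsto_const True])
        then have "(\<lambda>n. y (s * real (Suc n))) \<longlonglongrightarrow> l"
          by (rule filterlim_compose[OF lim[folded y_def]])
        then show ?thesis by (intro tendsto_mult_right) (simp only: mult.commute)
      next
        case False
        then show ?thesis using \<open>s \<noteq> 0\<close> by (simp add: indicator_def)
      qed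
    qed
    show "integrable lborel (\<lambda>s::real. B * indicator {0..1} s)"
      by (intro integrable_mult_right integrable_real_indicator) (auto simp: emeasure_lborel_Icc_eq)
  qed
  then show ?thesis unfolding eq by simp
qed

lemma weak_conv_m_subseq:
  assumes "weak_conv_m F M" "strict_mono r"
  shows "weak_conv_m (F \<circ> r) M"
  unfolding weak_conv_m_def weak_conv_def
proof (intro allI impI)
  fix x assume "isCont (cdf M) x"
  then have "(\<lambda>n. cdf (F n) x) \<longlonglongrightarrow> cdf M x" using assms(1) by (simp add: weak_conv_m_def weak_conv_def)
  from LIMSEQ_subseq_LIMSEQ[OF this assms(2)] show "(\<lambda>n. cdf ((F \<circ> r) n) x) \<longlonglongrightarrow> cdf M x" by (simp add: o_def)
qed

text \<open>
  Krylov-Bogolyubov: the occupation laws are tight, and along a common subsequence they converge in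
  every state. By Dynkin's formula the time average of the generator is \<open>O (1 / t)\<close>, so the limits
  satisfy the balance equation. If the expectation of an observable converges at all, its limit
  is its integral against the total law \<open>MT\<close>.
\<close>

theorem stationary_law_exists:
  assumes drift: "(\<Sum>i\<in>E. b i * \<mu> i) < 0" and c_nonneg: "\<And>i. i \<in> E \<Longrightarrow> 0 \<le> c i"
    and b_pos: "\<exists>i\<in>E. 0 < b i" and c_pos: "\<exists>i\<in>E. 0 < c i"
  shows "\<exists>M MT. stationary_law E (generator lam q) b \<mu> c M \<and> real_distribution MT \<and>
    (\<forall>f B. (\<forall>v. isCont f v) \<longrightarrow> (\<forall>v. \<bar>f v\<bar> \<le> B) \<longrightarrow> (\<integral>v. f v \<partial>MT) = (\<Sum>i\<in>E. \<mu> i * (\<integral>v. f v \<partial>M i))) \<and>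
    (\<forall>(f :: real \<Rightarrow> real) B l. (\<forall>v. isCont f v) \<longrightarrow> (\<forall>v. \<bar>f v\<bar> \<le> B) \<longrightarrow>
      ((\<lambda>t. \<integral>\<omega>. f (pdmp b c 0 t \<omega>) \<partial>Q) \<longlongrightarrow> l) at_top \<longrightarrow> (\<integral>v. f v \<partial>MT) = l)"
proof -
  define T where "T n = real (Suc n)" for n
  have T: "0 < T n" "1 \<le> T n" for n by (simp_all add: T_def)
  define F where "F io n = occupation b c 0 (case io of None \<Rightarrow> E | Some i \<Rightarrow> {i}) (T n)" for io n
  define J where "J = insert None (Some ` E)"
  have A: "(case io of None \<Rightarrow> E | Some i \<Rightarrow> {i}) \<subseteq> E" "(case io of None \<Rightarrow> E | Some i \<Rightarrow> {i}) \<noteq> {}" if "io \<in> J" for io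
    using that E_nonempty by (auto simp: J_def)
  have tight: "tight (F io)" if "io \<in> J" for io
    unfolding F_def[abs_def] T_def by (rule occupation_tight[OF drift A[OF that]])
  have dist: "real_distribution (F io n)" if "io \<in> J" for io n using tight[OF that] by (simp add: tight_def)
  have "\<exists>s. strict_mono s \<and> (\<forall>io\<in>J. \<exists>M. real_distribution M \<and> weak_conv_m (F io \<circ> s) M)"
  proof (rule common_subsequence)
    show "finite J" unfolding J_def using finE by simp
    fix io and s :: "nat \<Rightarrow> nat" assume "io \<in> J" "strict_mono s"
    from tight_imp_convergent_subsubsequence[OF tight[OF this(1)] this(2)]
    obtain r M where "strict_mono r" "real_distribution M" "weak_conv_m (F io \<circ> s \<circ> r) M" by blast
    then show "\<exists>r. strict_mono r \<and> (\<exists>M. real_distribution M \<and> weak_conv_m (F io \<circ> (s \<circ> r)) M)"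
      unfolding comp_assoc by blast
  next
    fix io and s r :: "nat \<Rightarrow> nat"
    assume "\<exists>M. real_distribution M \<and> weak_conv_m (F io \<circ> s) M" "strict_mono r"
    then show "\<exists>M. real_distribution M \<and> weak_conv_m (F io \<circ> (s \<circ> r)) M"
      using weak_conv_m_subseq[of "F io \<circ> s" _ r] unfolding comp_assoc by blast
  qed
  then obtain s where s: "strict_mono s" "\<forall>io\<in>J. \<exists>M. real_distribution M \<and> weak_conv_m (F io \<circ> s) M" by blast
  then obtain M' where M': "\<forall>io\<in>J. real_distribution (M' io) \<and> weak_conv_m (F io \<circ> s) (M' io)" using bchoice[OF s(2)] by blast
  have conv: "(\<lambda>n. \<integral>v. f v \<partial>F io (s n)) \<longlonglongrightarrow> (\<integral>v. f v \<partial>M' io)"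
    if io: "io \<in> J" and f: "\<And>v. isCont f v" "\<And>v. \<bar>f v\<bar> \<le> B" for io B and f :: "real \<Rightarrow> real"
    using weak_conv_imp_integral_bdd_continuous_conv[of "F io \<circ> s" "M' io" f B] dist[OF io] M' io f by (simp add: o_def)
  have JE: "Some i \<in> J" if "i \<in> E" for i using that by (simp add: J_def)
  have JN: "None \<in> J" by (simp add: J_def)
  define M where "M i = M' (Some i)" for i
  have Md: "real_distribution (M i)" if "i \<in> E" for i using M' JE[OF that] by (simp add: M_def)
  have sT: "(\<lambda>n. x / T (s n)) \<longlonglongrightarrow> 0" for x :: real
  proof -
    have "(\<lambda>n. x * inverse (real (Suc n))) \<longlonglongrightarrow> x * 0" by (intro tendsto_mult_left LIMSEQ_inverse_real_of_nat)
    then have "(\<lambda>n. x / T n) \<longlonglongrightarrow> 0" by (simp add: T_def divide_inverse)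
    from LIMSEQ_subseq_LIMSEQ[OF this s(1)] show ?thesis by (simp add: o_def)
  qed
  \<comment> \<open>time integrals decompose over the states\<close>
  have split: "time_integral b c 0 (T n) g / T n = (\<Sum>k\<in>E. \<mu> k * (\<integral>v. g k v \<partial>F (Some k) n))"
    if g: "\<And>k v. k \<in> E \<Longrightarrow> isCont (g k) v" "\<And>k v. k \<in> E \<Longrightarrow> \<bar>g k v\<bar> \<le> B" for g :: "nat \<Rightarrow> real \<Rightarrow> real" and B n
  proof -
    have gm: "g k \<in> borel_measurable borel" if "k \<in> E" for k by (rule isCont_borel_measurable[OF g(1)[OF that]])
    have one: "time_integral b c 0 (T n) (\<lambda>j v. if j = k then g k v else 0) / T n = \<mu> k * (\<integral>v. g k v \<partial>F (Some k) n)" if "k \<in> E" for k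
    proof -
      have "(\<integral>v. g k v \<partial>F (Some k) n) = time_integral b c 0 (T n) (\<lambda>j v. if j = k then g k v else 0) / (T n * \<mu> k)"
        unfolding F_def using occupation_integral[of "{k}" "T n" "g k" b c 0] that gm T by simp
      then show ?thesis using \<mu>_pos[OF that] by simp
    qed
    have "time_integral b c 0 (T n) g = (\<Sum>k\<in>E. time_integral b c 0 (T n) (\<lambda>j v. if j = k then g k v else 0))"
      by (rule time_integral_sum_states[OF gm g(2)]) (use T[of n] in auto)
    then show ?thesis by (simp add: sum_divide_distrib one)
  qed
  have law: "stationary_law E (generator lam q) b \<mu> c M"
    unfolding stationary_law_def stationary_law_axioms_def
  proof (intro conjI allI impI)
    show "tilted_generator E (generator lam q) b \<mu>" by (rule tilted_generatorI[OF drift])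
    show "\<exists>i\<in>E. 0 < b i" "\<exists>i\<in>E. 0 < c i" by fact+
    fix i assume i: "i \<in> E"
    show "0 \<le> c i" by (rule c_nonneg[OF i])
    show "real_distribution (M i)" by (rule Md[OF i])
    interpret Mi: real_distribution "M i" by (rule Md[OF i])
    show "AE v in M i. 0 \<le> v"
    proof -
      define f where "f v = min 1 (max 0 (- v))" for v :: real
      have f: "isCont f v" "\<bar>f v\<bar> \<le> 1" "0 \<le> f v" for v unfolding f_def by (auto intro!: continuous_intros)
      have [measurable]: "f \<in> borel_measurable borel" by (rule isCont_borel_measurable[OF f(1)])
      have "(\<integral>v. f v \<partial>F (Some i) n) = 0" for n unfolding F_def f_def using i T c_nonneg by (intro occupation_nonneg) auto
      then have "(\<integral>v. f v \<partial>M i) = 0" using conv[OF JE[OF i] f(1,2)] unfolding M_def by (simp add: LIMSEQ_const_iff)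
      moreover have "integrable (M i) f" by (rule Mi.integrable_const_bound[of _ 1]) (use f(2) in \<open>auto intro!: AE_I2\<close>)
      ultimately have "AE v in M i. f v = 0" using integral_nonneg_eq_0_iff_AE[of "M i" f] f(3) by simp
      then show ?thesis by eventually_elim (auto simp: f_def min_def max_def split: if_splits)
    qed
    fix f f' :: "real \<Rightarrow> real" and B
    assume f: "\<forall>v. (f has_real_derivative f' v) (at v)" "\<forall>v. isCont f' v" "\<forall>v. \<bar>f v\<bar> \<le> B" "\<forall>v. (1 + \<bar>v\<bar>) * \<bar>f' v\<bar> \<le> B"
    have fc: "isCont f v" for v using f(1) DERIV_isCont by blast
    define h where "h j v = (if j = i then f v else 0)" for j v
    define h' where "h' j v = (if j = i then f' v else 0)" for j v
    define L where "L = pd_generator b c h h'"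
    define gen where "gen = generator lam q"
    have hd: "(h j has_real_derivative h' j v) (at v)" for j v
      unfolding h_def h'_def using f(1) by (cases "j = i") auto
    have hc: "isCont (h' j) v" for j v unfolding h'_def using f(2) by (cases "j = i") auto
    have L_eq: "L k v = (if k = i then (b k * v + c k) * f' v else 0) + gen k i * f v" if "k \<in> E" for k v
    proof -
      have "(\<Sum>j\<in>E. generator lam q k j * h j v) = (\<Sum>j\<in>E. if j = i then gen k j * f v else 0)"
        by (intro sum.cong) (auto simp: h_def gen_def)
      then show ?thesis unfolding L_def pd_generator_eq[OF that] using finE i by (simp add: h'_def)
    qed
    have Lc: "isCont (L k) v" if "k \<in> E" for k v
      unfolding L_def by (rule pd_generator_isCont[OF hd hc that])
    have g1B: "\<bar>(b k * v + c k) * f' v\<bar> \<le> (\<bar>b k\<bar> + \<bar>c k\<bar>) * B" for k v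
    proof -
      have "\<bar>b k * v + c k\<bar> \<le> \<bar>b k\<bar> * \<bar>v\<bar> + \<bar>c k\<bar>" by (rule order.trans[OF abs_triangle_ineq]) (simp add: abs_mult)
      also have "\<dots> \<le> (\<bar>b k\<bar> + \<bar>c k\<bar>) * (1 + \<bar>v\<bar>)" by (simp add: algebra_simps)
      finally have "\<bar>b k * v + c k\<bar> * \<bar>f' v\<bar> \<le> ((\<bar>b k\<bar> + \<bar>c k\<bar>) * (1 + \<bar>v\<bar>)) * \<bar>f' v\<bar>" by (rule mult_right_mono) simp
      also have "\<dots> \<le> (\<bar>b k\<bar> + \<bar>c k\<bar>) * B" unfolding mult.assoc using f(4) by (intro mult_left_mono) auto
      finally show ?thesis by (simp add: abs_mult)
    qed
    have B0: "0 \<le> B" using f(3) order_trans[OF abs_ge_zero] by blast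
    define B' where "B' = (\<Sum>k\<in>E. (\<bar>b k\<bar> + \<bar>c k\<bar>) * B + \<bar>gen k i\<bar> * B)"
    have LB: "\<bar>L k v\<bar> \<le> B'" if k: "k \<in> E" for k v
    proof -
      have "\<bar>L k v\<bar> \<le> (\<bar>b k\<bar> + \<bar>c k\<bar>) * B + \<bar>gen k i\<bar> * B"
        unfolding L_eq[OF k] using g1B[of k v] f(3) B0
        by (intro order.trans[OF abs_triangle_ineq] add_mono) (auto simp: abs_mult intro!: mult_left_mono)
      also have "\<dots> \<le> B'" unfolding B'_def using B0 by (intro member_le_sum[OF k _ finE]) auto
      finally show ?thesis .
    qed
    have "(\<lambda>n. \<Sum>k\<in>E. \<mu> k * (\<integral>v. L k v \<partial>F (Some k) (s n))) \<longlonglongrightarrow> (\<Sum>k\<in>E. \<mu> k * (\<integral>v. L k v \<partial>M k))"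
      unfolding M_def by (intro tendsto_sum tendsto_mult_left conv[OF JE _ LB] Lc)
    moreover have "(\<lambda>n. \<Sum>k\<in>E. \<mu> k * (\<integral>v. L k v \<partial>F (Some k) (s n))) \<longlonglongrightarrow> 0"
    proof (rule Lim_null_comparison[OF always_eventually sT[of "2 * B"]], intro allI)
      fix n
      let ?t = "T (s n)"
      have hB: "\<bar>h j v\<bar> \<le> B" for j v using f(3) B0 by (simp add: h_def)
      have mean: "\<bar>\<integral>\<omega>. g \<omega> \<partial>Q\<bar> \<le> B" if "\<And>\<omega>. \<bar>g \<omega>\<bar> \<le> B" for g :: "'a \<Rightarrow> real"
      proof -
        have "\<bar>\<integral>\<omega>. g \<omega> \<partial>Q\<bar> \<le> (\<integral>\<omega>. \<bar>g \<omega>\<bar> \<partial>Q)" by (rule integral_abs_bound)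
        also have "\<dots> \<le> (\<integral>\<omega>. B \<partial>Q)" using that B0 by (intro integral_mono') auto
        finally show ?thesis using prob_space by simp
      qed
      have "(\<integral>\<omega>. h (state ?t \<omega>) (pdmp b c 0 ?t \<omega>) \<partial>Q) = (\<integral>\<omega>. h (Z 0 \<omega>) 0 \<partial>Q) + time_integral b c 0 ?t L"
        unfolding L_def by (rule dynkin_time_integral(3)[OF hd hc less_imp_le[OF T(1)]])
      moreover have "\<bar>\<integral>\<omega>. h (state ?t \<omega>) (pdmp b c 0 ?t \<omega>) \<partial>Q\<bar> \<le> B" "\<bar>\<integral>\<omega>. h (Z 0 \<omega>) 0 \<partial>Q\<bar> \<le> B"
        by (rule mean, rule hB)+
      ultimately have "\<bar>time_integral b c 0 ?t L\<bar> \<le> 2 * B" by linarith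
      then have bound: "\<bar>time_integral b c 0 ?t L\<bar> / ?t \<le> 2 * B / ?t" by (rule divide_right_mono[OF _ less_imp_le[OF T(1)]])
      have e: "(\<Sum>k\<in>E. \<mu> k * (\<integral>v. L k v \<partial>F (Some k) (s n))) = time_integral b c 0 ?t L / ?t"
        by (rule split[symmetric, of L B']) (erule Lc, erule LB)
      show "norm (\<Sum>k\<in>E. \<mu> k * (\<integral>v. L k v \<partial>F (Some k) (s n))) \<le> 2 * B / ?t"
        unfolding e real_norm_def abs_divide abs_of_pos[OF T(1)] by (rule bound)
    qed
    ultimately have balance: "(\<Sum>k\<in>E. \<mu> k * (\<integral>v. L k v \<partial>M k)) = 0" by (rule LIMSEQ_unique)
    have terms: "\<mu> k * (\<integral>v. L k v \<partial>M k) = (if k = i then \<mu> i * (\<integral>v. (b i * v + c i) * f' v \<partial>M i) else 0) + \<mu> k * gen k i * (\<integral>v. f v \<partial>M k)" if k: "k \<in> E" for k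
    proof -
      interpret Mk: real_distribution "M k" by (rule Md[OF k])
      have [measurable]: "f \<in> borel_measurable borel" "f' \<in> borel_measurable borel"
        using isCont_borel_measurable[of f] isCont_borel_measurable[of f'] fc f(2) by blast+
      have i1: "integrable (M k) f" by (rule Mk.integrable_const_bound[of _ B]) (use f(3) in auto)
      have i2: "integrable (M k) (\<lambda>v. (b k * v + c k) * f' v)" by (rule Mk.integrable_const_bound[of _ "(\<bar>b k\<bar> + \<bar>c k\<bar>) * B"]) (use g1B in auto)
      have e1: "(\<integral>v. L k v \<partial>M k) = (\<integral>v. (if k = i then (b k * v + c k) * f' v else 0) + gen k i * f v \<partial>M k)"
        by (rule Bochner_Integration.integral_cong) (simp_all only: L_eq[OF k])
      show ?thesis
      proof (cases "k = i")
        case True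
        have e2: "(\<integral>v. L k v \<partial>M k) = (\<integral>v. (b k * v + c k) * f' v \<partial>M k) + gen k i * (\<integral>v. f v \<partial>M k)"
          unfolding e1 using True i1 i2 by simp
        show ?thesis unfolding e2 using True by (simp add: distrib_left)
      next
        case False
        have e2: "(\<integral>v. L k v \<partial>M k) = gen k i * (\<integral>v. f v \<partial>M k)" unfolding e1 using False by simp
        show ?thesis unfolding e2 using False by simp
      qed
    qed
    have "(\<Sum>k\<in>E. (if k = i then \<mu> i * (\<integral>v. (b i * v + c i) * f' v \<partial>M i) else 0) + \<mu> k * gen k i * (\<integral>v. f v \<partial>M k)) =
        (\<Sum>k\<in>E. \<mu> k * (\<integral>v. L k v \<partial>M k))"
      by (rule sum.cong[OF refl terms[symmetric]])
    also note balance
    finally have "(\<Sum>k\<in>E. if k = i then \<mu> i * (\<integral>v. (b i * v + c i) * f' v \<partial>M i) else 0) +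
        (\<Sum>k\<in>E. \<mu> k * gen k i * (\<integral>v. f v \<partial>M k)) = 0"
      by (simp only: sum.distrib)
    then show "\<mu> i * (\<integral>v. (b i * v + c i) * f' v \<partial>M i) + (\<Sum>j\<in>E. \<mu> j * generator lam q j i * (\<integral>v. f v \<partial>M j)) = 0"
      by (simp only: sum.delta[OF finE] i if_True gen_def)
  qed
  have total: "real_distribution (M' None)" using M' JN by simp
  have mixture: "(\<integral>v. f v \<partial>M' None) = (\<Sum>i\<in>E. \<mu> i * (\<integral>v. f v \<partial>M i))"
    if f: "\<forall>v. isCont f v" "\<forall>v. \<bar>f v\<bar> \<le> B" for f :: "real \<Rightarrow> real" and B
  proof -
    have [measurable]: "f \<in> borel_measurable borel" using f isCont_borel_measurable by auto
    have "(\<integral>v. f v \<partial>F None n) = (\<Sum>k\<in>E. \<mu> k * (\<integral>v. f v \<partial>F (Some k) n))" for n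
    proof -
      have "(\<integral>v. f v \<partial>F None n) = time_integral b c 0 (T n) (\<lambda>j v. if j \<in> E then f v else 0) / T n"
        unfolding F_def using occupation_integral[of E "T n" f b c 0] E_nonempty T by simp
      also have "time_integral b c 0 (T n) (\<lambda>j v. if j \<in> E then f v else 0) = time_integral b c 0 (T n) (\<lambda>_. f)"
        by (rule time_integral_cong) simp
      finally show ?thesis using split[of "\<lambda>_. f" B n] f by simp
    qed
    moreover have "(\<lambda>n. \<integral>v. f v \<partial>F None (s n)) \<longlonglongrightarrow> (\<integral>v. f v \<partial>M' None)" by (rule conv[OF JN]) (use f in auto)
    moreover have "(\<lambda>n. \<Sum>k\<in>E. \<mu> k * (\<integral>v. f v \<partial>F (Some k) (s n))) \<longlonglongrightarrow> (\<Sum>k\<in>E. \<mu> k * (\<integral>v. f v \<partial>M k))"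
      unfolding M_def by (intro tendsto_sum tendsto_mult_left conv[OF JE, of _ f B]) (use f in auto)
    ultimately show ?thesis using LIMSEQ_unique by force
  qed
  have limit: "(\<integral>v. f v \<partial>M' None) = l"
    if f: "\<forall>v. isCont f v" "\<forall>v. \<bar>f v\<bar> \<le> B" and lim: "((\<lambda>t. \<integral>\<omega>. f (pdmp b c 0 t \<omega>) \<partial>Q) \<longlongrightarrow> l) at_top"
    for f :: "real \<Rightarrow> real" and B l
  proof -
    have "(\<lambda>n. \<integral>v. f v \<partial>F None n) \<longlonglongrightarrow> l"
      unfolding F_def T_def using time_average_limit[of f B b c 0 l] lim f by simp
    from LIMSEQ_subseq_LIMSEQ[OF this s(1)] have "(\<lambda>n. \<integral>v. f v \<partial>F None (s n)) \<longlonglongrightarrow> l" by (simp add: o_def)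
    moreover have "(\<lambda>n. \<integral>v. f v \<partial>F None (s n)) \<longlonglongrightarrow> (\<integral>v. f v \<partial>M' None)" by (rule conv[OF JN]) (use f in auto)
    ultimately show ?thesis using LIMSEQ_unique by blast
  qed
  show ?thesis
  proof (rule exI, rule exI, intro conjI)
    show "stationary_law E (generator lam q) b \<mu> c M" by (rule law)
    show "real_distribution (M' None)" by (rule total)
    show "\<forall>f B. (\<forall>v. isCont f v) \<longrightarrow> (\<forall>v. \<bar>f v\<bar> \<le> B) \<longrightarrow> (\<integral>v. f v \<partial>M' None) = (\<Sum>i\<in>E. \<mu> i * (\<integral>v. f v \<partial>M i))"
      by (intro allI impI, rule mixture)
    show "\<forall>(f :: real \<Rightarrow> real) B l. (\<forall>v. isCont f v) \<longrightarrow> (\<forall>v. \<bar>f v\<bar> \<le> B) \<longrightarrow>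
      ((\<lambda>t. \<integral>\<omega>. f (pdmp b c 0 t \<omega>) \<partial>Q) \<longlongrightarrow> l) at_top \<longrightarrow> (\<integral>v. f v \<partial>M' None) = l"
      by (intro allI impI, rule limit)
  qed
qed

end

section \<open>Linear diffusions with additive noise between two jumps\<close>

lemma exp_difference_quotient:
  assumes "0 < x"
  shows "(\<lambda>m. (exp (a * (x / real (Suc m))) - 1) / (x / real (Suc m))) \<longlonglongrightarrow> a"
proof -
  have "((\<lambda>h. exp (a * h)) has_real_derivative a) (at 0)" by (auto intro!: derivative_eq_intros)
  then have "((\<lambda>h. (exp (a * h) - 1) / h) \<longlongrightarrow> a) (at 0)" by (simp add: has_field_derivative_iff)
  moreover have "filterlim (\<lambda>m. x / real (Suc m)) (at 0) sequentially"
    unfolding filterlim_at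
  proof
    have "(\<lambda>m. x * inverse (real (Suc m))) \<longlonglongrightarrow> x * 0" by (intro tendsto_mult_left LIMSEQ_inverse_real_of_nat)
    then show "(\<lambda>m. x / real (Suc m)) \<longlonglongrightarrow> 0" by (simp add: divide_inverse)
    show "\<forall>\<^sub>F m in sequentially. x / real (Suc m) \<in> UNIV \<and> x / real (Suc m) \<noteq> 0" using assms by (intro always_eventually) simp
  qed
  ultimately show ?thesis by (rule filterlim_compose)
qed

text \<open>
  Variation of constants without stochastic calculus: the solution is the limit of explicit
  weighted sums of increments of the driving path. The defect of one time step of length \<open>h\<close>
  is \<open>o(h)\<close> because the solution is uniformly continuous.
\<close>

lemma exponential_euler_limit:
  fixes y w :: "real \<Rightarrow> real"
  assumes st: "s < t" and cont: "continuous_on {s..t} y"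
    and eq: "\<And>p r. s \<le> p \<Longrightarrow> p \<le> r \<Longrightarrow> r \<le> t \<Longrightarrow> y r - y p = a * (LINT v:{p..r}|lborel. y v) + c * (w r - w p)"
  defines "g \<equiv> \<lambda>m k. s + real k * ((t - s) / real (Suc m))"
  shows "(\<lambda>m. y s * exp (a * (t - s)) + (\<Sum>k<Suc m. c * exp (a * (t - g m (Suc k))) * (w (g m (Suc k)) - w (g m k)))) \<longlonglongrightarrow> y t"
    (is "?S \<longlonglongrightarrow> _")
proof -
  define h where "h m = (t - s) / real (Suc m)" for m
  have h: "0 < h m" for m using st by (simp add: h_def)
  have g_h: "g m k = s + real k * h m" for m k by (simp add: g_def h_def)
  have Sm: "real (Suc m) * h m = t - s" for m by (simp add: h_def)
  have g_in: "s \<le> g m k" "g m k \<le> t" if "k \<le> Suc m" for m k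
  proof -
    show "s \<le> g m k" using h[of m] by (simp add: g_h)
    have "real k * h m \<le> real (Suc m) * h m" using that h[of m] by (intro mult_right_mono) auto
    then show "g m k \<le> t" unfolding Sm by (simp add: g_h)
  qed
  have g_Suc: "g m (Suc k) = g m k + h m" for m k by (simp add: g_h distrib_right)
  have g0: "g m 0 = s" and gS: "g m (Suc m) = t" for m using Sm[of m] by (simp_all add: g_h del: of_nat_Suc)
  obtain B where B: "\<And>r. r \<in> {s..t} \<Longrightarrow> \<bar>y r\<bar> \<le> B"
  proof -
    have "bounded (y ` {s..t})" by (rule compact_imp_bounded[OF compact_continuous_image[OF cont compact_Icc]])
    then show thesis using that unfolding bounded_iff by (metis imageI real_norm_def)
  qed
  have B0: "0 \<le> B" using B[of s] st by (meson abs_ge_zero atLeastAtMost_iff less_imp_le order.refl order_trans)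
  define \<rho> where "\<rho> m = \<bar>(exp (a * h m) - 1) / h m - a\<bar>" for m
  have \<rho>: "\<rho> \<longlonglongrightarrow> 0"
  proof -
    have "(\<lambda>m. (exp (a * h m) - 1) / h m - a) \<longlonglongrightarrow> a - a"
      unfolding h_def by (intro tendsto_diff exp_difference_quotient tendsto_const) (use st in simp)
    then have "(\<lambda>m. (exp (a * h m) - 1) / h m - a) \<longlonglongrightarrow> 0" by simp
    from tendsto_rabs_zero[OF this] show ?thesis by (simp add: \<rho>_def[abs_def])
  qed
  define K where "K = exp (\<bar>a\<bar> * (t - s))"
  have K: "0 < K" by (simp add: K_def)
  have step: "\<bar>y (g m (Suc k)) - exp (a * h m) * y (g m k) - c * (w (g m (Suc k)) - w (g m k))\<bar> \<le> h m * (\<bar>a\<bar> * e + B * \<rho> m)"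
    if e: "0 \<le> e" "\<And>p r. p \<in> {s..t} \<Longrightarrow> r \<in> {s..t} \<Longrightarrow> \<bar>p - r\<bar> \<le> h m \<Longrightarrow> \<bar>y p - y r\<bar> \<le> e" and k: "k < Suc m" for m k e
  proof -
    let ?p = "g m k" and ?r = "g m (Suc k)"
    have pr: "s \<le> ?p" "?p \<le> ?r" "?r \<le> t" using g_in[of k m] g_in[of "Suc k" m] k h[of m] by (auto simp: g_Suc)
    have yi: "set_integrable lborel {?p..?r} y"
      by (rule borel_integrable_atLeastAtMost', rule continuous_on_subset[OF cont]) (use pr in auto)
    have ci: "set_integrable lborel {?p..?r} (\<lambda>_. x)" for x :: real
      by (rule borel_integrable_atLeastAtMost') simp
    have cI: "(LINT v:{?p..?r}|lborel. x) = h m * x" for x :: real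
      using pr by (simp add: set_lebesgue_integral_def g_Suc)
    have "\<bar>(LINT v:{?p..?r}|lborel. y v) - h m * y ?p\<bar> = \<bar>LINT v:{?p..?r}|lborel. y v - y ?p\<bar>"
      unfolding set_integral_diff(2)[OF yi ci] cI ..
    also have "\<dots> \<le> (LINT v:{?p..?r}|lborel. \<bar>y v - y ?p\<bar>)"
      using set_integral_norm_bound[OF set_integral_diff(1)[OF yi ci[of "y ?p"]]] by simp
    also have "\<dots> \<le> (LINT v:{?p..?r}|lborel. e)"
    proof (rule set_integral_mono)
      show "set_integrable lborel {?p..?r} (\<lambda>v. \<bar>y v - y ?p\<bar>)" by (rule set_integrable_abs[OF set_integral_diff(1)[OF yi ci]])
      fix v assume v: "v \<in> {?p..?r}"
      show "\<bar>y v - y ?p\<bar> \<le> e" by (rule e(2)) (use v pr in \<open>auto simp: g_Suc\<close>)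
    qed (rule ci)
    finally have I: "\<bar>(LINT v:{?p..?r}|lborel. y v) - h m * y ?p\<bar> \<le> h m * e" unfolding cI .
    have "y ?r - exp (a * h m) * y ?p - c * (w ?r - w ?p) =
        a * ((LINT v:{?p..?r}|lborel. y v) - h m * y ?p) - h m * ((exp (a * h m) - 1) / h m - a) * y ?p"
      using eq[OF pr] h[of m] by (simp add: field_simps)
    also have "\<bar>\<dots>\<bar> \<le> \<bar>a\<bar> * \<bar>(LINT v:{?p..?r}|lborel. y v) - h m * y ?p\<bar> + h m * \<rho> m * \<bar>y ?p\<bar>"
    proof (rule order.trans[OF abs_triangle_ineq4])
      show "\<bar>a * ((LINT v:{?p..?r}|lborel. y v) - h m * y ?p)\<bar> + \<bar>h m * ((exp (a * h m) - 1) / h m - a) * y ?p\<bar>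
          \<le> \<bar>a\<bar> * \<bar>(LINT v:{?p..?r}|lborel. y v) - h m * y ?p\<bar> + h m * \<rho> m * \<bar>y ?p\<bar>"
        unfolding \<rho>_def abs_mult abs_of_pos[OF h] by (rule order.refl)
    qed
    also have "\<dots> \<le> \<bar>a\<bar> * (h m * e) + h m * \<rho> m * B"
      using h[of m] pr by (intro add_mono mult_left_mono I B mult_nonneg_nonneg) (auto simp: \<rho>_def)
    also have "\<dots> = h m * (\<bar>a\<bar> * e + B * \<rho> m)" by (simp add: algebra_simps)
    finally show ?thesis .
  qed
  have total: "\<bar>y t - ?S m\<bar> \<le> K * (t - s) * (\<bar>a\<bar> * e + B * \<rho> m)"
    if e: "0 \<le> e" "\<And>p r. p \<in> {s..t} \<Longrightarrow> r \<in> {s..t} \<Longrightarrow> \<bar>p - r\<bar> \<le> h m \<Longrightarrow> \<bar>y p - y r\<bar> \<le> e" for m e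
  proof -
    define D where "D k = exp (a * (t - g m k)) * y (g m k)" for k
    have "y t - y s * exp (a * (t - s)) = (\<Sum>k<Suc m. D (Suc k) - D k)"
      unfolding sum_lessThan_telescope by (simp add: D_def g0 gS mult.commute)
    moreover have "D (Suc k) - D k = exp (a * (t - g m (Suc k))) * (y (g m (Suc k)) - exp (a * h m) * y (g m k))" for k
      by (simp add: D_def g_Suc right_diff_distrib exp_add[symmetric] mult.assoc[symmetric] algebra_simps)
    ultimately have defect: "y t - ?S m = (\<Sum>k<Suc m. exp (a * (t - g m (Suc k))) *
        (y (g m (Suc k)) - exp (a * h m) * y (g m k) - c * (w (g m (Suc k)) - w (g m k))))"
      by (simp only: right_diff_distrib sum_subtractf diff_diff_eq[symmetric] mult.assoc mult.left_commute[of c])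
    have "\<bar>y t - ?S m\<bar> \<le> (\<Sum>k<Suc m. K * (h m * (\<bar>a\<bar> * e + B * \<rho> m)))"
      unfolding defect
    proof (rule sum_abs[THEN order.trans], rule sum_mono)
      fix k assume k: "k \<in> {..<Suc m}"
      have "a * (t - g m (Suc k)) \<le> \<bar>a\<bar> * (t - s)" using g_in[of "Suc k" m] k by (intro mult_mono) auto
      then have weight: "exp (a * (t - g m (Suc k))) \<le> K" by (simp add: K_def)
      have k': "k < Suc m" using k by simp
      show "\<bar>exp (a * (t - g m (Suc k))) * (y (g m (Suc k)) - exp (a * h m) * y (g m k) - c * (w (g m (Suc k)) - w (g m k)))\<bar>
          \<le> K * (h m * (\<bar>a\<bar> * e + B * \<rho> m))"
        unfolding abs_mult abs_exp_cancel by (rule mult_mono[OF weight step[OF e k'] less_imp_le[OF K] abs_ge_zero])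
    qed
    also have "\<dots> = K * (real (Suc m) * h m) * (\<bar>a\<bar> * e + B * \<rho> m)"
      by (simp only: sum_constant card_lessThan mult_ac)
    finally show ?thesis unfolding Sm .
  qed
  show ?thesis
  proof (rule LIMSEQ_I)
    fix e :: real assume e: "0 < e"
    define e' where "e' = e / (2 * (K * (t - s) * \<bar>a\<bar> + 1))"
    have den: "0 < 2 * (K * (t - s) * \<bar>a\<bar> + 1)" using K st by (intro mult_pos_pos add_nonneg_pos) auto
    have e': "0 < e'" unfolding e'_def using e den by simp
    have "K * (t - s) * \<bar>a\<bar> * e' \<le> (K * (t - s) * \<bar>a\<bar> + 1) * e'" using e' by (intro mult_right_mono) auto
    also have "\<dots> = e / 2" using den unfolding e'_def by (simp add: field_simps)
    finally have half: "K * (t - s) * (\<bar>a\<bar> * e') \<le> e / 2" by (simp add: mult.assoc)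
    obtain d where d: "0 < d" "\<And>p r. p \<in> {s..t} \<Longrightarrow> r \<in> {s..t} \<Longrightarrow> dist r p < d \<Longrightarrow> dist (y r) (y p) < e'"
      using compact_uniformly_continuous[OF cont compact_Icc] e' unfolding uniformly_continuous_on_def by meson
    have hlim: "h \<longlonglongrightarrow> 0"
    proof -
      have "(\<lambda>m. (t - s) * inverse (real (Suc m))) \<longlonglongrightarrow> (t - s) * 0" by (intro tendsto_mult_left LIMSEQ_inverse_real_of_nat)
      then show ?thesis by (simp add: h_def[abs_def] divide_inverse)
    qed
    have "(\<lambda>m. K * (t - s) * (B * \<rho> m)) \<longlonglongrightarrow> K * (t - s) * (B * 0)" by (intro tendsto_mult_left \<rho>)
    then have "\<forall>\<^sub>F m in sequentially. K * (t - s) * (B * \<rho> m) < e / 2" by (rule order_tendstoD(2)) (use e in simp)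
    moreover have "\<forall>\<^sub>F m in sequentially. h m < d" by (rule order_tendstoD(2)[OF hlim d(1)])
    ultimately have "\<forall>\<^sub>F m in sequentially. norm (?S m - y t) < e"
    proof eventually_elim
      case (elim m)
      have "\<bar>y t - ?S m\<bar> \<le> K * (t - s) * (\<bar>a\<bar> * e' + B * \<rho> m)"
      proof (rule total)
        fix p r assume "p \<in> {s..t}" "r \<in> {s..t}" "\<bar>p - r\<bar> \<le> h m"
        with d(2)[of r p] elim(2) show "\<bar>y p - y r\<bar> \<le> e'" by (simp add: dist_real_def)
      qed (use e' in simp)
      also have "\<dots> < e" unfolding distrib_left using half elim(1) by linarith
      finally show ?case unfolding real_norm_def by (subst abs_minus_commute)
    qed
    then show "\<exists>no. \<forall>n\<ge>no. norm (?S n - y t) < e" by (simp add: eventually_sequentially)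
  qed
qed

locale brownian = prob_space M for M :: "'b measure" +
  fixes F :: "real \<Rightarrow> 'b measure" and W :: "real \<Rightarrow> 'b \<Rightarrow> real"
  assumes filtration: "filtration_on M F" and brownian: "standard_brownian_motion M F W"
begin

lemma filtration_subalgebra: "0 \<le> t \<Longrightarrow> subalgebra M (F t)"
  and filtration_mono: "0 \<le> s \<Longrightarrow> s \<le> t \<Longrightarrow> subalgebra (F t) (F s)"
  using filtration by (simp_all add: filtration_on_def)

lemma measurable_filtration_mono: "0 \<le> s \<Longrightarrow> s \<le> t \<Longrightarrow> f \<in> borel_measurable (F s) \<Longrightarrow> f \<in> borel_measurable (F t)"
  using measurable_from_subalg[OF filtration_mono] .

lemma measurable_filtration: "0 \<le> s \<Longrightarrow> f \<in> borel_measurable (F s) \<Longrightarrow> f \<in> borel_measurable M"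
  using measurable_from_subalg[OF filtration_subalgebra] .

lemma W_adapted: "0 \<le> s \<Longrightarrow> s \<le> t \<Longrightarrow> W s \<in> borel_measurable (F t)"
  using brownian by (intro measurable_filtration_mono[of s t]) (auto simp: standard_brownian_motion_def)

lemma char_distr: "f \<in> borel_measurable M \<Longrightarrow> char (distr M borel f) u = (CLINT x|M. iexp (u * f x))"
  by (simp add: char_def integral_distr)

lemma char_increment:
  assumes st: "0 \<le> s" "s < t"
  shows "char (distr M borel (\<lambda>\<theta>. \<alpha> * (W t \<theta> - W s \<theta>))) u = exp (- (u\<^sup>2 * \<alpha>\<^sup>2 * (t - s)) / 2)"
proof -
  define h where "h = sqrt (t - s)"
  have h: "0 < h" "h\<^sup>2 = t - s" using st by (simp_all add: h_def)
  have [measurable]: "W t \<in> borel_measurable M" "W s \<in> borel_measurable M"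
    using measurable_filtration[OF _ W_adapted, of t t] measurable_filtration[OF _ W_adapted, of s s] st by auto
  have "distributed M lborel (\<lambda>\<theta>. W t \<theta> - W s \<theta>) (normal_density 0 h)"
    using brownian st unfolding standard_brownian_motion_def h_def by blast
  then have "distributed M lborel (\<lambda>\<theta>. (W t \<theta> - W s \<theta> - 0) / h) std_normal_density"
    by (subst (asm) normal_standard_normal_convert[OF h(1)])
  then have "distr M lborel (\<lambda>\<theta>. (W t \<theta> - W s \<theta>) / h) = std_normal_distribution" by (simp add: distributed_def)
  moreover have "distr M lborel (\<lambda>\<theta>. (W t \<theta> - W s \<theta>) / h) = distr M borel (\<lambda>\<theta>. (W t \<theta> - W s \<theta>) / h)"
    by (rule distr_cong) auto
  ultimately have N: "distr M borel (\<lambda>\<theta>. (W t \<theta> - W s \<theta>) / h) = std_normal_distribution" by simp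
  have "char (distr M borel (\<lambda>\<theta>. \<alpha> * (W t \<theta> - W s \<theta>))) u = (CLINT \<theta>|M. iexp ((u * \<alpha> * h) * ((W t \<theta> - W s \<theta>) / h)))"
    using h by (simp add: char_distr mult.assoc)
  also have "\<dots> = char std_normal_distribution (u * \<alpha> * h)" unfolding N[symmetric] by (rule char_distr[symmetric]) simp
  finally show ?thesis unfolding char_std_normal_distribution using h by (simp add: power_mult_distrib)
qed

lemma char_add_increment:
  assumes st: "0 \<le> s" "s < t" and R: "R \<in> borel_measurable (F s)"
  shows "char (distr M borel (\<lambda>\<theta>. R \<theta> + \<alpha> * (W t \<theta> - W s \<theta>))) u =
    char (distr M borel R) u * exp (- (u\<^sup>2 * \<alpha>\<^sup>2 * (t - s)) / 2)"
proof -
  let ?D = "\<lambda>\<theta>. W t \<theta> - W s \<theta>"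
  have [measurable]: "W t \<in> borel_measurable M" "W s \<in> borel_measurable M" and RM[measurable]: "R \<in> borel_measurable M"
    using measurable_filtration[OF _ W_adapted, of t t] measurable_filtration[OF _ W_adapted, of s s] measurable_filtration[OF st(1) R] st by auto
  have ind: "indep_set (sets (F s)) (sets (vimage_algebra (space M) ?D borel))"
    using brownian st unfolding standard_brownian_motion_def by blast
  have "indep_var borel R borel (\<lambda>\<theta>. \<alpha> * ?D \<theta>)"
    unfolding indep_var_eq
  proof (intro conjI)
    have sp: "space (F s) = space M" using filtration_subalgebra[OF st(1)] by (simp add: subalgebra_def)
    have "sigma_sets (space M) {R -` A \<inter> space M |A. A \<in> sets borel} \<subseteq> sets (F s)"
      unfolding sp[symmetric] using measurable_sets[OF R] by (intro sets.sigma_sets_subset) auto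
    moreover have "sigma_sets (space M) {(\<lambda>\<theta>. \<alpha> * ?D \<theta>) -` A \<inter> space M |A. A \<in> sets borel} \<subseteq> sets (vimage_algebra (space M) ?D borel)"
    proof -
      have "(\<lambda>\<theta>. \<alpha> * ?D \<theta>) \<in> borel_measurable (vimage_algebra (space M) ?D borel)"
        by (intro borel_measurable_times borel_measurable_const measurable_vimage_algebra1) auto
      from measurable_sets[OF this] have "{(\<lambda>\<theta>. \<alpha> * ?D \<theta>) -` A \<inter> space M |A. A \<in> sets borel} \<subseteq> sets (vimage_algebra (space M) ?D borel)"
        by auto
      from sets.sigma_sets_subset[OF this] show ?thesis by simp
    qed
    ultimately show "indep_set (sigma_sets (space M) {R -` A \<inter> space M |A. A \<in> sets borel})
        (sigma_sets (space M) {(\<lambda>\<theta>. \<alpha> * ?D \<theta>) -` A \<inter> space M |A. A \<in> sets borel})"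
      using ind unfolding indep_set_def by (elim indep_sets_mono_sets) (auto split: bool.split)
  qed auto
  from char_distr_add[OF this] show ?thesis unfolding char_increment[OF st] .
qed

text \<open>
  Increments over consecutive intervals are added one at a time, each independent of what
  precedes it.
\<close>

lemma char_add_increments:
  assumes s: "0 \<le> s" and h: "0 < h" and R: "R \<in> borel_measurable (F s)"
  shows "(\<lambda>\<theta>. R \<theta> + (\<Sum>k<n. \<alpha> k * (W (s + real (Suc k) * h) \<theta> - W (s + real k * h) \<theta>))) \<in> borel_measurable (F (s + real n * h))
    \<and> char (distr M borel (\<lambda>\<theta>. R \<theta> + (\<Sum>k<n. \<alpha> k * (W (s + real (Suc k) * h) \<theta> - W (s + real k * h) \<theta>)))) u =
      char (distr M borel R) u * exp (- (u\<^sup>2 * (\<Sum>k<n. (\<alpha> k)\<^sup>2 * h)) / 2)"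
proof (induction n)
  case 0
  then show ?case using R by simp
next
  case (Suc n)
  let ?p = "s + real n * h" and ?r = "s + real (Suc n) * h"
  let ?R = "\<lambda>\<theta>. R \<theta> + (\<Sum>k<n. \<alpha> k * (W (s + real (Suc k) * h) \<theta> - W (s + real k * h) \<theta>))"
  have pr: "0 \<le> ?p" "?p < ?r" using s h by (auto simp: algebra_simps)
  have R': "?R \<in> borel_measurable (F ?p)" and IH: "char (distr M borel ?R) u = char (distr M borel R) u * exp (- (u\<^sup>2 * (\<Sum>k<n. (\<alpha> k)\<^sup>2 * h)) / 2)"
    using Suc.IH by blast+
  have eq: "(\<lambda>\<theta>. R \<theta> + (\<Sum>k<Suc n. \<alpha> k * (W (s + real (Suc k) * h) \<theta> - W (s + real k * h) \<theta>))) =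
      (\<lambda>\<theta>. ?R \<theta> + \<alpha> n * (W ?r \<theta> - W ?p \<theta>))" by (simp add: add.assoc del: of_nat_Suc)
  have "(\<lambda>\<theta>. ?R \<theta> + \<alpha> n * (W ?r \<theta> - W ?p \<theta>)) \<in> borel_measurable (F ?r)"
    by (rule borel_measurable_add[OF measurable_filtration_mono[OF pr(1) less_imp_le[OF pr(2)] R']],
        rule borel_measurable_times[OF borel_measurable_const], rule borel_measurable_diff)
      (rule W_adapted[OF less_imp_le[OF order.strict_trans1[OF pr]] order.refl] W_adapted[OF pr(1) less_imp_le[OF pr(2)]])+
  moreover have "char (distr M borel (\<lambda>\<theta>. ?R \<theta> + \<alpha> n * (W ?r \<theta> - W ?p \<theta>))) u =
      char (distr M borel R) u * exp (- (u\<^sup>2 * (\<Sum>k<Suc n. (\<alpha> k)\<^sup>2 * h)) / 2)"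
  proof -
    have "- (u\<^sup>2 * (\<Sum>k<n. (\<alpha> k)\<^sup>2 * h)) / 2 + - (u\<^sup>2 * (\<alpha> n)\<^sup>2 * (?r - ?p)) / 2 = - (u\<^sup>2 * (\<Sum>k<Suc n. (\<alpha> k)\<^sup>2 * h)) / 2"
      by (simp add: algebra_simps add_divide_distrib)
    then show ?thesis unfolding char_add_increment[OF pr R'] IH mult.assoc exp_add[symmetric] of_real_mult[symmetric] by simp
  qed
  ultimately show ?case unfolding eq by blast
qed

text \<open>
  Between two jumps the solution is an Ornstein-Uhlenbeck process: its characteristic function
  is that of the initial value, contracted by the linear flow, times a Gaussian factor whose
  variance solves \<open>v' = 2 a v + c\<^sup>2\<close>.
\<close>

lemma ornstein_uhlenbeck_char:
  assumes s: "0 \<le> s" "s < t" and ys: "ys \<in> borel_measurable (F s)" and yt[measurable]: "yt \<in> borel_measurable M"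
    and path: "AE \<theta> in M. \<exists>y. continuous_on {s..t} y \<and> y s = ys \<theta> \<and> y t = yt \<theta> \<and>
      (\<forall>p r. s \<le> p \<longrightarrow> p \<le> r \<longrightarrow> r \<le> t \<longrightarrow> y r - y p = a * (LINT v:{p..r}|lborel. y v) + c * (W r \<theta> - W p \<theta>))"
  shows "char (distr M borel yt) u = char (distr M borel ys) (u * exp (a * (t - s))) * exp (- (u\<^sup>2 * linear_flow (2 * a) (c\<^sup>2) (t - s) 0) / 2)"
proof -
  define h where "h m = (t - s) / real (Suc m)" for m
  have h: "0 < h m" for m using s by (simp add: h_def)
  have Sm: "real (Suc m) * h m = t - s" for m by (simp add: h_def)
  define \<alpha> where "\<alpha> m k = c * exp (a * (t - (s + real (Suc k) * h m)))" for m k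
  define S where "S m \<theta> = ys \<theta> * exp (a * (t - s)) + (\<Sum>k<Suc m. \<alpha> m k * (W (s + real (Suc k) * h m) \<theta> - W (s + real k * h m) \<theta>))" for m \<theta>
  have y': "(\<lambda>\<theta>. ys \<theta> * exp (a * (t - s))) \<in> borel_measurable (F s)" using ys by (intro borel_measurable_times borel_measurable_const)
  have inc: "S m \<in> borel_measurable (F (s + real (Suc m) * h m)) \<and>
      char (distr M borel (S m)) u = char (distr M borel (\<lambda>\<theta>. ys \<theta> * exp (a * (t - s)))) u * exp (- (u\<^sup>2 * (\<Sum>k<Suc m. (\<alpha> m k)\<^sup>2 * h m)) / 2)" for m
    unfolding S_def[abs_def] by (rule char_add_increments[OF s(1) h y'])
  have S_meas[measurable]: "S m \<in> borel_measurable M" for m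
  proof -
    have "S m \<in> borel_measurable (F (s + (t - s)))" using inc[of m] unfolding Sm by blast
    then show ?thesis by (rule measurable_filtration[rotated]) (use s in simp)
  qed
  have char_S: "char (distr M borel (S m)) u = char (distr M borel ys) (u * exp (a * (t - s))) * exp (- (u\<^sup>2 * (\<Sum>k<Suc m. (\<alpha> m k)\<^sup>2 * h m)) / 2)" for m
  proof -
    have "char (distr M borel (\<lambda>\<theta>. ys \<theta> * exp (a * (t - s)))) u = char (distr M borel ys) (u * exp (a * (t - s)))"
      using measurable_filtration[OF s(1) ys] measurable_filtration[OF s(1) y'] by (simp add: char_distr mult_ac)
    then show ?thesis using inc[of m] by (simp only:)
  qed
  have var: "(\<lambda>m. \<Sum>k<Suc m. (\<alpha> m k)\<^sup>2 * h m) \<longlonglongrightarrow> linear_flow (2 * a) (c\<^sup>2) (t - s) 0"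
  proof -
    have "(\<Sum>k<Suc m. (\<alpha> m k)\<^sup>2 * h m) = c\<^sup>2 * (h m * (\<Sum>k<Suc m. exp (2 * a * h m) ^ k))" for m
    proof -
      have "(\<Sum>k<Suc m. (\<alpha> m k)\<^sup>2 * h m) = (\<Sum>k<Suc m. c\<^sup>2 * (h m * exp (2 * a * h m) ^ (Suc m - Suc k)))"
      proof (rule sum.cong[OF refl])
        fix k assume "k \<in> {..<Suc m}"
        then have k: "real (Suc m - Suc k) = real (Suc m) - real (Suc k)" by (subst of_nat_diff) auto
        have "t - (s + real (Suc k) * h m) = real (Suc m - Suc k) * h m" unfolding k left_diff_distrib Sm by simp
        then show "(\<alpha> m k)\<^sup>2 * h m = c\<^sup>2 * (h m * exp (2 * a * h m) ^ (Suc m - Suc k))"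
          unfolding \<alpha>_def power_mult_distrib exp_of_nat_mult[symmetric] exp_double[symmetric] by (simp add: mult_ac)
      qed
      also have "\<dots> = (\<Sum>k<Suc m. c\<^sup>2 * (h m * exp (2 * a * h m) ^ k))" by (rule sum.nat_diff_reindex)
      finally show ?thesis by (simp only: sum_distrib_left)
    qed
    moreover have "(\<lambda>m. h m * (\<Sum>k<Suc m. exp (2 * a * h m) ^ k)) \<longlonglongrightarrow> (if 2 * a = 0 then t - s else (exp (2 * a * (t - s)) - 1) / (2 * a))"
    proof (cases "a = 0")
      case True
      then show ?thesis using Sm by (simp add: mult.commute del: of_nat_Suc)
    next
      case False
      have "h m * (\<Sum>k<Suc m. exp (2 * a * h m) ^ k) = (exp (2 * a * (t - s)) - 1) / ((exp (2 * a * h m) - 1) / h m)" for m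
      proof -
        have "exp (2 * a * h m) \<noteq> 1" using False h[of m] by simp
        then have "(\<Sum>k<Suc m. exp (2 * a * h m) ^ k) = (exp (2 * a * h m) ^ Suc m - 1) / (exp (2 * a * h m) - 1)"
          by (rule geometric_sum)
        also have "exp (2 * a * h m) ^ Suc m = exp (2 * a * (t - s))"
          unfolding exp_of_nat_mult[symmetric] Sm[of m, symmetric] by (simp add: mult_ac)
        finally show ?thesis by simp
      qed
      moreover have "(\<lambda>m. (exp (2 * a * (t - s)) - 1) / ((exp (2 * a * h m) - 1) / h m)) \<longlonglongrightarrow> (exp (2 * a * (t - s)) - 1) / (2 * a)"
        unfolding h_def by (intro tendsto_divide tendsto_const exp_difference_quotient) (use s False in auto)
      ultimately show ?thesis using False by simp
    qed
    ultimately show ?thesis unfolding linear_flow_def by (simp add: tendsto_mult_left)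
  qed
  have "(\<lambda>m. char (distr M borel (S m)) u) \<longlonglongrightarrow> char (distr M borel ys) (u * exp (a * (t - s))) * exp (- (u\<^sup>2 * linear_flow (2 * a) (c\<^sup>2) (t - s) 0) / 2)"
    unfolding char_S by (intro tendsto_mult tendsto_const tendsto_of_real tendsto_exp tendsto_divide tendsto_minus var) simp
  moreover have "(\<lambda>m. char (distr M borel (S m)) u) \<longlonglongrightarrow> char (distr M borel yt) u"
    unfolding char_distr[OF S_meas] char_distr[OF yt]
  proof (rule integral_dominated_convergence[where w = "\<lambda>_. 1"])
    show "AE \<theta> in M. (\<lambda>m. iexp (u * S m \<theta>)) \<longlonglongrightarrow> iexp (u * yt \<theta>)"
      using path
    proof eventually_elim
      case (elim \<theta>)
      then obtain y where y: "continuous_on {s..t} y" "y s = ys \<theta>" "y t = yt \<theta>"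
        and eq: "\<And>p r. s \<le> p \<Longrightarrow> p \<le> r \<Longrightarrow> r \<le> t \<Longrightarrow> y r - y p = a * (LINT v:{p..r}|lborel. y v) + c * (W r \<theta> - W p \<theta>)" by blast
      have "(\<lambda>m. S m \<theta>) \<longlonglongrightarrow> yt \<theta>"
        using exponential_euler_limit[OF s(2) y(1) eq] unfolding S_def \<alpha>_def h_def y(2,3) .
      then show ?case by (intro tendsto_intros)
    qed
  qed auto
  ultimately show ?thesis using LIMSEQ_unique by metis
qed

end

section \<open>The characteristic function along a frozen path of states\<close>

lemma partition_nonneg:
  fixes \<tau> :: "nat \<Rightarrow> real"
  assumes "\<tau> 0 = 0" "\<And>k. \<tau> k \<le> \<tau> (Suc k)"
  shows "0 \<le> \<tau> n"
proof (induction n)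
  case (Suc n)
  then show ?case using assms(2)[of n] by linarith
qed (simp add: assms(1))

text \<open>
  The value of a step integral does not depend on the partition: the sum over the natural
  partition \<open>\<tau>\<close>, stopped at \<open>u\<close>, has the right increment on every interval on which the integrand
  is constant.
\<close>

lemma has_step_integral_increment:
  fixes f w :: "real \<Rightarrow> real" and \<tau> :: "nat \<Rightarrow> real"
  assumes \<tau>: "\<tau> 0 = 0" "\<And>k. \<tau> k \<le> \<tau> (Suc k)" "r \<le> \<tau> K"
    and pieces: "\<And>k u. \<tau> k \<le> u \<Longrightarrow> u < \<tau> (Suc k) \<Longrightarrow> f u = f (\<tau> k)"
    and pr: "0 \<le> p" "p \<le> r" "\<And>u. p \<le> u \<Longrightarrow> u < r \<Longrightarrow> f u = f p"
    and I: "has_step_integral f w p Ip" "has_step_integral f w r Ir"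
  shows "Ir - Ip = f p * (w r - w p)"
proof -
  define \<Delta> where "\<Delta> k u = w (min (\<tau> (Suc k)) u) - w (min (\<tau> k) u)" for k u
  define J where "J u = (\<Sum>k<K. f (\<tau> k) * \<Delta> k u)" for u
  have \<Delta>_sum: "(\<Sum>k<K. \<Delta> k u) = w u - w 0" if "0 \<le> u" "u \<le> \<tau> K" for u
    unfolding \<Delta>_def using sum_lessThan_telescope[of "\<lambda>k. w (min (\<tau> k) u)" K] that \<tau>(1) by (simp add: min_absorb1 min_absorb2)
  have J_increment: "J y - J x = f x * (w y - w x)"
    if xy: "0 \<le> x" "x \<le> y" "y \<le> \<tau> K" and const: "\<And>u. x \<le> u \<Longrightarrow> u < y \<Longrightarrow> f u = f x" for x y
  proof -
    have summand: "f (\<tau> k) * (\<Delta> k y - \<Delta> k x) = f x * (\<Delta> k y - \<Delta> k x)" for k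
    proof (cases "max (\<tau> k) x < min (\<tau> (Suc k)) y")
      case True
      then have "f (max (\<tau> k) x) = f (\<tau> k)" "f (max (\<tau> k) x) = f x"
        using pieces[of k "max (\<tau> k) x"] const[of "max (\<tau> k) x"] by auto
      then show ?thesis by simp
    next
      case False
      then consider "\<tau> (Suc k) \<le> x" | "y \<le> \<tau> k" | "\<tau> k = \<tau> (Suc k)" | "x = y"
        using \<tau>(2)[of k] xy by linarith
      then have "\<Delta> k y = \<Delta> k x"
      proof cases
        case 1
        then show ?thesis using xy \<tau>(2)[of k] by (simp add: \<Delta>_def min_absorb1)
      next
        case 2
        then show ?thesis using xy \<tau>(2)[of k] by (simp add: \<Delta>_def min_absorb2)
      qed (simp_all add: \<Delta>_def)
      then show ?thesis by simp
    qed
    have "J y - J x = (\<Sum>k<K. f x * (\<Delta> k y - \<Delta> k x))"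
      by (simp only: J_def sum_subtractf[symmetric] right_diff_distrib[symmetric] summand)
    also have "\<dots> = f x * (w y - w x)"
      using xy unfolding sum_distrib_left[symmetric] sum_subtractf by (simp add: \<Delta>_sum)
    finally show ?thesis .
  qed
  have "I = J t" if I: "has_step_integral f w t I" and t: "t \<le> \<tau> K" for I t
  proof -
    obtain n s where s: "s 0 = 0" "s n = t" "\<And>k. k < n \<Longrightarrow> s k \<le> s (Suc k)"
      and const: "\<And>k u. k < n \<Longrightarrow> s k \<le> u \<Longrightarrow> u < s (Suc k) \<Longrightarrow> f u = f (s k)"
      and I_eq: "I = (\<Sum>k<n. f (s k) * (w (s (Suc k)) - w (s k)))"
      using I unfolding has_step_integral_def by blast
    have nonneg: "k \<le> n \<Longrightarrow> 0 \<le> s k" for k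
    proof (induction k)
      case (Suc k)
      then show ?case using s(3)[of k] by simp
    qed (simp add: s(1))
    have le: "s k \<le> t" if "k \<le> n" for k
      using that
    proof (induction rule: inc_induct)
      case (step k)
      then show ?case using s(3)[of k] by simp
    qed (simp add: s(2))
    have "I = (\<Sum>k<n. J (s (Suc k)) - J (s k))"
      unfolding I_eq
    proof (rule sum.cong[OF refl])
      fix k assume "k \<in> {..<n}"
      then have k: "k < n" by simp
      show "f (s k) * (w (s (Suc k)) - w (s k)) = J (s (Suc k)) - J (s k)"
        by (rule J_increment[OF nonneg[OF less_imp_le[OF k]] s(3)[OF k] order.trans[OF le[OF Suc_leI[OF k]] t] const[OF k], symmetric])
    qed
    also have "\<dots> = J t - J 0" using sum_lessThan_telescope[of "\<lambda>k. J (s k)" n] s by simp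
    also have "J 0 = 0"
    proof -
      have "0 \<le> \<tau> k" for k by (rule partition_nonneg[OF \<tau>(1,2)])
      then show ?thesis unfolding J_def \<Delta>_def by (simp add: min_absorb2)
    qed
    finally show ?thesis by simp
  qed
  from this[OF I(1)] this[OF I(2)] J_increment[OF pr(1,2) \<tau>(3) pr(3)] show ?thesis using pr(2) \<tau>(3) by simp
qed

lemma linear_flow_split: "linear_flow b c s v = v * exp (b * s) + linear_flow b c s 0"
  by (simp add: linear_flow_def)

context brownian
begin

lemma path_increment:
  fixes y :: "real \<Rightarrow> real"
  assumes \<tau>: "\<tau> 0 = 0" "\<And>n. \<tau> n < \<tau> (Suc n)"
    and X: "\<And>n t. \<tau> n \<le> t \<Longrightarrow> t < \<tau> (Suc n) \<Longrightarrow> X t = z n"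
    and cont: "continuous_on {0..} y"
    and sde: "\<And>t. 0 \<le> t \<Longrightarrow> set_integrable lborel {0..t} (\<lambda>s. a (X s) * y s)"
      "\<And>t. 0 \<le> t \<Longrightarrow> has_step_integral (\<lambda>s. \<sigma> (X s)) w t (y t - init - (LINT s:{0..t}|lborel. a (X s) * y s))"
    and pr: "\<tau> n \<le> p" "p \<le> r" "r \<le> \<tau> (Suc n)"
  shows "y r - y p = a (z n) * (LINT v:{p..r}|lborel. y v) + \<sigma> (z n) * (w r - w p)"
proof -
  have "0 \<le> \<tau> n" by (rule partition_nonneg[where \<tau> = \<tau>, OF \<tau>(1) less_imp_le[OF \<tau>(2)]])
  then have p0: "0 \<le> p" "0 \<le> r" using pr by auto
  define g where "g s = a (X s) * y s" for s
  have gi: "set_integrable lborel {0..t} g" if "0 \<le> t" for t using sde(1)[OF that] by (simp add: g_def[abs_def])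
  have gpr: "set_integrable lborel {p<..r} g" by (rule set_integrable_subset[OF gi[OF p0(2)]]) (use p0 in auto)
  have yi: "set_integrable lborel {p..r} y"
    by (rule borel_integrable_atLeastAtMost', rule continuous_on_subset[OF cont]) (use p0 in auto)
  have "(LINT v:{0..r}|lborel. g v) = (LINT v:{0..p} \<union> {p<..r}|lborel. g v)"
    using p0 pr by (intro arg_cong[where f = "\<lambda>A. set_lebesgue_integral lborel A g"]) auto
  also have "\<dots> = (LINT v:{0..p}|lborel. g v) + (LINT v:{p<..r}|lborel. g v)"
    by (rule set_integral_Un[OF _ gi[OF p0(1)] gpr]) auto
  also have "(LINT v:{p<..r}|lborel. g v) = (LINT v:{p..r}|lborel. a (z n) * y v)"
    unfolding set_lebesgue_integral_def
  proof (rule integral_cong_AE)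
    show "(\<lambda>v. indicator {p<..r} v *\<^sub>R g v) \<in> borel_measurable lborel"
      using gpr unfolding set_integrable_def by (rule borel_measurable_integrable)
    show "(\<lambda>v. indicator {p..r} v *\<^sub>R (a (z n) * y v)) \<in> borel_measurable lborel"
      using set_integrable_mult_right[OF yi, of "a (z n)"] unfolding set_integrable_def by (rule borel_measurable_integrable)
    have "AE v in lborel. v \<noteq> p" "AE v in lborel. v \<noteq> r" by (rule AE_lborel_singleton)+
    then show "AE v in lborel. indicator {p<..r} v *\<^sub>R g v = indicator {p..r} v *\<^sub>R (a (z n) * y v)"
    proof eventually_elim
      case (elim v)
      have "X v = z n" if "p < v" "v < r" by (rule X) (use that pr in auto)
      then show ?case using elim by (auto simp: indicator_def g_def)
    qed
  qed
  finally have drift: "(LINT v:{0..r}|lborel. g v) = (LINT v:{0..p}|lborel. g v) + a (z n) * (LINT v:{p..r}|lborel. y v)" by simp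
  have "(y r - init - (LINT v:{0..r}|lborel. g v)) - (y p - init - (LINT v:{0..p}|lborel. g v)) = \<sigma> (X p) * (w r - w p)"
  proof (rule has_step_integral_increment[where \<tau> = \<tau> and K = "Suc n" and f = "\<lambda>s. \<sigma> (X s)"])
    show "has_step_integral (\<lambda>s. \<sigma> (X s)) w p (y p - init - (LINT v:{0..p}|lborel. g v))"
      "has_step_integral (\<lambda>s. \<sigma> (X s)) w r (y r - init - (LINT v:{0..r}|lborel. g v))"
      using sde(2) p0 by (simp_all add: g_def[abs_def])
    show "\<sigma> (X u) = \<sigma> (X (\<tau> k))" if "\<tau> k \<le> u" "u < \<tau> (Suc k)" for k u using X[OF that] X[of k "\<tau> k"] \<tau>(2)[of k] by simp
    show "\<sigma> (X u) = \<sigma> (X p)" if "p \<le> u" "u < r" for u using X[of n u] X[of n p] that pr by simp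
  qed (use \<tau>(1) less_imp_le[OF \<tau>(2)] p0 pr in auto)
  moreover have "\<sigma> (X p) * (w r - w p) = \<sigma> (z n) * (w r - w p)"
    using X[of n p] pr by (cases "p = r") auto
  ultimately show ?thesis using drift by linarith
qed

text \<open>
  Iterating over the jumps: for a frozen path of states the solution is the sum of a contracted
  copy of its initial value and an independent centred Gaussian variable.
\<close>

lemma frozen_path_char:
  assumes \<tau>: "\<tau> 0 = 0" "\<And>n. \<tau> n < \<tau> (Suc n)"
    and X: "\<And>n t. \<tau> n \<le> t \<Longrightarrow> t < \<tau> (Suc n) \<Longrightarrow> X t = z n"
    and Y: "\<And>t. 0 \<le> t \<Longrightarrow> Y t \<in> borel_measurable (F t)" and Y0: "Y0 \<in> borel_measurable (F 0)"
    and sde: "AE \<theta> in M. continuous_on {0..} (\<lambda>t. Y t \<theta>) \<and> Y 0 \<theta> = Y0 \<theta> \<and>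
      (\<forall>t\<ge>0. set_integrable lborel {0..t} (\<lambda>s. a (X s) * Y s \<theta>) \<and>
        has_step_integral (\<lambda>s. \<sigma> (X s)) (\<lambda>s. W s \<theta>) t (Y t \<theta> - Y0 \<theta> - (LINT s:{0..t}|lborel. a (X s) * Y s \<theta>)))"
    and A: "A 0 = 0" "\<And>n. A (Suc n) = linear_flow 0 (a (z n)) (\<tau> (Suc n) - \<tau> n) (A n)"
    and V: "V 0 = 0" "\<And>n. V (Suc n) = linear_flow (2 * a (z n)) ((\<sigma> (z n))\<^sup>2) (\<tau> (Suc n) - \<tau> n) (V n)"
    and t: "\<tau> n \<le> t" "t \<le> \<tau> (Suc n)"
  shows "char (distr M borel (Y t)) u = char (distr M borel Y0) (u * exp (linear_flow 0 (a (z n)) (t - \<tau> n) (A n))) *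
    exp (- (u\<^sup>2 * linear_flow (2 * a (z n)) ((\<sigma> (z n))\<^sup>2) (t - \<tau> n) (V n)) / 2)"
proof -
  have \<tau>0: "0 \<le> \<tau> n" for n by (rule partition_nonneg[where \<tau> = \<tau>, OF \<tau>(1) less_imp_le[OF \<tau>(2)]])
  have step: "char (distr M borel (Y t)) u = char (distr M borel (Y (\<tau> n))) (u * exp (a (z n) * (t - \<tau> n))) *
      exp (- (u\<^sup>2 * linear_flow (2 * a (z n)) ((\<sigma> (z n))\<^sup>2) (t - \<tau> n) 0) / 2)"
    if t: "\<tau> n \<le> t" "t \<le> \<tau> (Suc n)" for n t u
  proof (cases "\<tau> n = t")
    case True
    then show ?thesis by simp
  next
    case False
    then have lt: "\<tau> n < t" using t by simp
    show ?thesis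
    proof (rule ornstein_uhlenbeck_char[OF \<tau>0 lt Y[OF \<tau>0]])
      show "Y t \<in> borel_measurable M" using measurable_filtration[OF _ Y, of t] \<tau>0[of n] t by simp
      show "AE \<theta> in M. \<exists>y. continuous_on {\<tau> n..t} y \<and> y (\<tau> n) = Y (\<tau> n) \<theta> \<and> y t = Y t \<theta> \<and>
          (\<forall>p r. \<tau> n \<le> p \<longrightarrow> p \<le> r \<longrightarrow> r \<le> t \<longrightarrow> y r - y p = a (z n) * (LINT v:{p..r}|lborel. y v) + \<sigma> (z n) * (W r \<theta> - W p \<theta>))"
        using sde
      proof eventually_elim
        case (elim \<theta>)
        show ?case
        proof (rule exI[of _ "\<lambda>t. Y t \<theta>"], intro conjI allI impI refl)
          show "continuous_on {\<tau> n..t} (\<lambda>t. Y t \<theta>)"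
            by (rule continuous_on_subset[OF conjunct1[OF elim]]) (use \<tau>0[of n] in auto)
          have c: "continuous_on {0..} (\<lambda>t. Y t \<theta>)" using elim by (rule conjunct1)
          have si: "set_integrable lborel {0..t} (\<lambda>s. a (X s) * Y s \<theta>)" if "0 \<le> t" for t using elim that by blast
          have hs: "has_step_integral (\<lambda>s. \<sigma> (X s)) (\<lambda>s. W s \<theta>) t (Y t \<theta> - Y0 \<theta> - (LINT s:{0..t}|lborel. a (X s) * Y s \<theta>))"
            if "0 \<le> t" for t using elim that by blast
          fix p r assume pr: "\<tau> n \<le> p" "p \<le> r" "r \<le> t"
          show "Y r \<theta> - Y p \<theta> = a (z n) * (LINT v:{p..r}|lborel. Y v \<theta>) + \<sigma> (z n) * (W r \<theta> - W p \<theta>)"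
            by (rule path_increment[where X = X and \<tau> = \<tau> and init = "Y0 \<theta>" and y = "\<lambda>t. Y t \<theta>" and w = "\<lambda>s. W s \<theta>" and z = z,
                OF \<tau> X c si hs pr(1,2) order.trans[OF pr(3) t(2)]])
        qed
      qed
    qed
  qed
  have combine: "char (distr M borel (Y t)) u = char (distr M borel Y0) (u * exp (linear_flow 0 (a (z n)) (t - \<tau> n) (A n))) *
      exp (- (u\<^sup>2 * linear_flow (2 * a (z n)) ((\<sigma> (z n))\<^sup>2) (t - \<tau> n) (V n)) / 2)"
    if t: "\<tau> n \<le> t" "t \<le> \<tau> (Suc n)"
      and IH: "\<And>u. char (distr M borel (Y (\<tau> n))) u = char (distr M borel Y0) (u * exp (A n)) * exp (- (u\<^sup>2 * V n) / 2)" for n t u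
  proof -
    let ?e = "exp (a (z n) * (t - \<tau> n))" and ?l = "linear_flow (2 * a (z n)) ((\<sigma> (z n))\<^sup>2) (t - \<tau> n)"
    have e1: "u * ?e * exp (A n) = u * exp (linear_flow 0 (a (z n)) (t - \<tau> n) (A n))"
      by (simp add: linear_flow_def exp_add mult_ac)
    have sq: "exp (2 * a (z n) * (t - \<tau> n)) = ?e\<^sup>2" by (simp only: exp_double[symmetric] mult.assoc)
    have "- (u\<^sup>2 * E * x) / 2 + - (u\<^sup>2 * y) / 2 = - (u\<^sup>2 * (x * E + y)) / 2" for x y E :: real
      by (simp add: field_simps)
    then have e2: "- ((u * ?e)\<^sup>2 * V n) / 2 + - (u\<^sup>2 * ?l 0) / 2 = - (u\<^sup>2 * ?l (V n)) / 2"
      by (simp only: linear_flow_split[of _ _ _ "V n"] power_mult_distrib sq)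
    define X1 where "X1 = - ((u * ?e)\<^sup>2 * V n) / 2"
    define X2 where "X2 = - (u\<^sup>2 * ?l 0) / 2"
    have "char (distr M borel (Y t)) u = char (distr M borel Y0) (u * ?e * exp (A n)) * exp X1 * exp X2"
      unfolding step[OF t] IH X1_def X2_def ..
    also have "\<dots> = char (distr M borel Y0) (u * ?e * exp (A n)) * complex_of_real (exp X1 * exp X2)"
      unfolding of_real_mult by (rule mult.assoc)
    also have "exp X1 * exp X2 = exp (- (u\<^sup>2 * ?l (V n)) / 2)"
      unfolding exp_add[symmetric] X1_def X2_def e2 ..
    finally show ?thesis unfolding e1 .
  qed
  have at_jump: "char (distr M borel (Y (\<tau> n))) u = char (distr M borel Y0) (u * exp (A n)) * exp (- (u\<^sup>2 * V n) / 2)" for n u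
  proof (induction n arbitrary: u)
    case 0
    have m: "Y 0 \<in> borel_measurable M" "Y0 \<in> borel_measurable M"
      by (rule measurable_filtration[OF order.refl Y[OF order.refl]], rule measurable_filtration[OF order.refl Y0])
    have "char (distr M borel (Y 0)) u = char (distr M borel Y0) u"
      unfolding char_distr[OF m(1)] char_distr[OF m(2)]
      proof (rule integral_cong_AE)
        show "AE \<theta> in M. iexp (u * Y 0 \<theta>) = iexp (u * Y0 \<theta>)" using sde by eventually_elim simp
      qed (use m in measurable)
    then show ?case by (simp add: \<tau> A V)
  next
    case (Suc n)
    have "char (distr M borel (Y (\<tau> (Suc n)))) u = char (distr M borel Y0) (u * exp (linear_flow 0 (a (z n)) (\<tau> (Suc n) - \<tau> n) (A n))) *
      exp (- (u\<^sup>2 * linear_flow (2 * a (z n)) ((\<sigma> (z n))\<^sup>2) (\<tau> (Suc n) - \<tau> n) (V n)) / 2)"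
      by (rule combine[OF _ _ Suc.IH]) (use \<tau>(2)[of n] in auto)
    then show ?case unfolding A(2) V(2) .
  qed
  show ?thesis by (rule combine[OF t at_jump])
qed

end

section \<open>The initial value is forgotten\<close>

context jump_chain
begin

lemma pdmp_translation_drift:
  assumes w: "\<omega> \<in> space Q" and t: "0 \<le> t"
  shows "pdmp (\<lambda>_. 0) (\<lambda>i. a i + d) u t \<omega> = pdmp (\<lambda>_. 0) a u t \<omega> + d * t"
proof -
  have "jump_value (\<lambda>_. 0) (\<lambda>i. a i + d) u n \<omega> = jump_value (\<lambda>_. 0) a u n \<omega> + d * jump_time n \<omega>" for n
    by (induction n) (simp_all add: linear_flow_def jump_time_Suc algebra_simps)
  then show ?thesis unfolding pdmp_def by (simp add: linear_flow_def algebra_simps)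
qed

lemma integrable_exp_pdmp:
  assumes t: "0 \<le> t"
  shows "integrable Q (\<lambda>\<omega>. exp (p * pdmp b c u t \<omega>))"
proof (rule integrable_const_bound)
  show "AE \<omega> in Q. norm (exp (p * pdmp b c u t \<omega>)) \<le> exp (\<bar>p\<bar> * value_bound b c (value_bound b c u t) t)"
  proof (rule AE_I2)
    fix \<omega> assume w: "\<omega> \<in> space Q"
    have "p * pdmp b c u t \<omega> \<le> \<bar>p * pdmp b c u t \<omega>\<bar>" by (rule abs_ge_self)
    also have "\<dots> \<le> \<bar>p\<bar> * value_bound b c (value_bound b c u t) t"
      unfolding abs_mult by (intro mult_left_mono pdmp_bound[OF w t order.refl]) simp
    finally show "norm (exp (p * pdmp b c u t \<omega>)) \<le> exp (\<bar>p\<bar> * value_bound b c (value_bound b c u t) t)" by simp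
  qed
qed simp

end

context stationary_chain
begin

text \<open>
  A small exponential moment of the accumulated rate decays: some room is left below drift \<open>0\<close>,
  and with the rates raised by that amount the exponential moment is still bounded, by the
  supersolution that exists for small exponents.
\<close>

lemma accumulated_rate_decay:
  assumes drift: "(\<Sum>i\<in>E. a i * \<mu> i) < 0"
  shows "\<exists>p C d. 0 < p \<and> 0 < d \<and> (\<forall>t\<ge>0. (\<integral>\<omega>. exp (p * pdmp (\<lambda>_. 0) a 0 t \<omega>) \<partial>Q) \<le> C * exp (- d * t))"
proof -
  define d where "d = - (\<Sum>i\<in>E. a i * \<mu> i) / 2"
  have d: "0 < d" using drift by (simp add: d_def)
  have "(\<Sum>i\<in>E. (a i + d) * \<mu> i) = (\<Sum>i\<in>E. a i * \<mu> i) + d"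
    using \<mu>_sum by (simp add: distrib_right sum.distrib sum_distrib_left[symmetric])
  then have drift': "(\<Sum>i\<in>E. (a i + d) * \<mu> i) < 0" using drift by (simp add: d_def)
  interpret tilted_generator E "generator lam q" "\<lambda>i. a i + d" \<mu> by (rule tilted_generatorI[OF drift'])
  obtain p r where p: "0 < p" and r: "\<forall>i\<in>E. 0 < r i"
    and contr: "\<forall>i\<in>E. (\<Sum>j\<in>E. generator lam q i j * r j) + p * (a i + d) * r i < 0"
    using small_exponent_contracts[of 1] by auto
  define x where "x = Min (r ` E)"
  define R where "R = Max (r ` E)"
  have x: "0 < x" unfolding x_def using r finE neE by (subst Min_gr_iff) auto
  have x_le: "x \<le> r i" and R_ge: "r i \<le> R" if "i \<in> E" for i
    unfolding x_def R_def using finE that by auto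
  define h where "h i v = r i * exp (p * v)" for i v
  define h' where "h' i v = r i * (p * exp (p * v))" for i v
  have h: "(h i has_real_derivative h' i v) (at v)" "isCont (h' i) v" for i v
    unfolding h_def h'_def by (auto intro!: derivative_eq_intros continuous_intros)
  define L where "L = pd_generator (\<lambda>_. 0) (\<lambda>i. a i + d) h h'"
  have L: "L i v \<le> 0" if i: "i \<in> E" for i v
  proof -
    have "(\<Sum>j\<in>E. generator lam q i j * h j v) = (\<Sum>j\<in>E. generator lam q i j * r j) * exp (p * v)"
      by (simp add: h_def sum_distrib_right mult.assoc)
    then have "L i v = ((\<Sum>j\<in>E. generator lam q i j * r j) + p * (a i + d) * r i) * exp (p * v)"
      unfolding L_def pd_generator_eq[OF i] by (simp add: h'_def algebra_simps)
    also have "\<dots> \<le> 0" using bspec[OF contr i] by (intro mult_nonpos_nonneg) auto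
    finally show ?thesis .
  qed
  have "(\<integral>\<omega>. exp (p * pdmp (\<lambda>_. 0) a 0 t \<omega>) \<partial>Q) \<le> R / x * exp (- (p * d) * t)" if t: "0 \<le> t" for t
  proof -
    let ?A = "pdmp (\<lambda>_. 0) (\<lambda>i. a i + d) 0 t"
    have hi: "integrable Q (\<lambda>\<omega>. h (state t \<omega>) (?A \<omega>))" by (rule dynkin_time_integral(1)[OF h t])
    have "x * (\<integral>\<omega>. exp (p * ?A \<omega>) \<partial>Q) = (\<integral>\<omega>. x * exp (p * ?A \<omega>) \<partial>Q)" by simp
    also have "\<dots> \<le> (\<integral>\<omega>. h (state t \<omega>) (?A \<omega>) \<partial>Q)"
    proof (rule integral_mono[OF integrable_mult_right[OF integrable_exp_pdmp[OF t]] hi])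
      fix \<omega> assume "\<omega> \<in> space Q"
      then show "x * exp (p * ?A \<omega>) \<le> h (state t \<omega>) (?A \<omega>)"
        unfolding h_def by (intro mult_right_mono x_le state_in_E) auto
    qed
    also have "\<dots> = (\<integral>\<omega>. h (Z 0 \<omega>) 0 \<partial>Q) + time_integral (\<lambda>_. 0) (\<lambda>i. a i + d) 0 t L"
      unfolding L_def by (rule dynkin_time_integral(3)[OF h t])
    also have "time_integral (\<lambda>_. 0) (\<lambda>i. a i + d) 0 t L \<le> 0"
    proof -
      have "time_integral (\<lambda>_. 0) (\<lambda>i. a i + d) 0 t L \<le> time_integral (\<lambda>_. 0) (\<lambda>i. a i + d) 0 t (\<lambda>_ _. 0)"
      proof (rule time_integral_mono)
        show "time_integrable (\<lambda>_. 0) (\<lambda>i. a i + d) 0 t L" unfolding L_def by (rule dynkin_time_integral(2)[OF h t])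
        show "time_integrable (\<lambda>_. 0) (\<lambda>i. a i + d) 0 t (\<lambda>_ _. 0)" by (rule time_integrable_bounded[of _ 0]) (use t in auto)
      qed (rule L)
      then show ?thesis by (simp add: time_integral_def)
    qed
    also have "(\<integral>\<omega>. h (Z 0 \<omega>) 0 \<partial>Q) \<le> (\<integral>\<omega>. R \<partial>Q)"
    proof (rule integral_mono')
      fix \<omega> assume w: "\<omega> \<in> space Q"
      show "h (Z 0 \<omega>) 0 \<le> R" using R_ge[OF Z_in_E[OF w]] by (simp add: h_def)
      show "0 \<le> R" using R_ge[OF Z_in_E[OF w, of 0]] x_le[OF Z_in_E[OF w, of 0]] x by linarith
    qed simp
    finally have "x * (\<integral>\<omega>. exp (p * ?A \<omega>) \<partial>Q) \<le> R" using prob_space by simp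
    then have bound: "(\<integral>\<omega>. exp (p * ?A \<omega>) \<partial>Q) \<le> R / x" using x by (simp add: pos_le_divide_eq mult.commute)
    have "(\<integral>\<omega>. exp (p * pdmp (\<lambda>_. 0) a 0 t \<omega>) \<partial>Q) = (\<integral>\<omega>. exp (p * ?A \<omega>) * exp (- (p * d) * t) \<partial>Q)"
    proof (rule Bochner_Integration.integral_cong[OF refl])
      fix \<omega> assume w: "\<omega> \<in> space Q"
      show "exp (p * pdmp (\<lambda>_. 0) a 0 t \<omega>) = exp (p * ?A \<omega>) * exp (- (p * d) * t)"
        unfolding pdmp_translation_drift[OF w t] exp_add[symmetric] by (simp add: algebra_simps)
    qed
    also have "\<dots> = (\<integral>\<omega>. exp (p * ?A \<omega>) \<partial>Q) * exp (- (p * d) * t)" by simp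
    also have "\<dots> \<le> R / x * exp (- (p * d) * t)" by (intro mult_right_mono bound) simp
    finally show ?thesis .
  qed
  then have decay: "\<forall>t\<ge>0. (\<integral>\<omega>. exp (p * pdmp (\<lambda>_. 0) a 0 t \<omega>) \<partial>Q) \<le> R / x * exp (- (p * d) * t)" by simp
  show ?thesis
    by (rule exI[of _ p], rule exI[of _ "R / x"], rule exI[of _ "p * d"], intro conjI)
      (rule p mult_pos_pos[OF p d] decay)+
qed

text \<open>
  With \<open>\<phi>\<close> the characteristic function of the initial value, this says that the starting point
  disappears from the limit law. Away from \<open>0\<close> the integrand is at most \<open>2\<close>, hence dominated by a
  small power of its argument, whose mean decays.
\<close>

lemma contracted_initial_value_vanishes:
  fixes \<phi> :: "real \<Rightarrow> complex"
  assumes drift: "(\<Sum>i\<in>E. a i * \<mu> i) < 0"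
    and \<phi>: "isCont \<phi> 0" "\<phi> 0 = 1" "\<And>x. norm (\<phi> x) \<le> 1" and \<phi>_meas[measurable]: "\<phi> \<in> borel_measurable borel"
  shows "((\<lambda>t. \<integral>\<omega>. norm (\<phi> (u * exp (pdmp (\<lambda>_. 0) a 0 t \<omega>)) - 1) \<partial>Q) \<longlongrightarrow> 0) at_top"
proof (rule tendstoI)
  fix e :: real assume e: "0 < e"
  obtain p C d where p: "0 < p" and d: "0 < d"
    and decay: "\<And>t. 0 \<le> t \<Longrightarrow> (\<integral>\<omega>. exp (p * pdmp (\<lambda>_. 0) a 0 t \<omega>) \<partial>Q) \<le> C * exp (- d * t)"
    using accumulated_rate_decay[OF drift] by meson
  have "\<exists>s>0. \<forall>x. dist x 0 < s \<longrightarrow> dist (\<phi> x) (\<phi> 0) < e / 2"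
    using \<phi>(1) half_gt_zero[OF e] unfolding continuous_at_eps_delta by blast
  then obtain s where s: "0 < s" and near: "\<And>x. \<bar>x\<bar> < s \<Longrightarrow> norm (\<phi> x - 1) < e / 2"
    by (auto simp: dist_norm \<phi>(2))
  define K where "K = 2 * (\<bar>u\<bar> / s) powr p"
  have K: "0 \<le> K" by (simp add: K_def)
  have bound: "norm (\<phi> (u * exp A) - 1) \<le> e / 2 + K * exp (p * A)" for A
  proof (cases "\<bar>u * exp A\<bar> < s")
    case True
    then show ?thesis using near[OF True] K by (simp add: add_increasing2 less_imp_le)
  next
    case False
    then have "1 \<le> (\<bar>u\<bar> * exp A / s) powr p" using s p by (intro ge_one_powr_ge_zero) (auto simp: abs_mult)
    also have "\<dots> = (\<bar>u\<bar> / s) powr p * exp (p * A)"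
      using s by (subst times_divide_eq_left[symmetric], subst powr_mult) (auto simp: powr_def)
    finally have "2 \<le> K * exp (p * A)" by (simp add: K_def)
    moreover have "norm (\<phi> (u * exp A) - 1) \<le> 2"
      using norm_triangle_ineq4[of "\<phi> (u * exp A)" 1] \<phi>(3)[of "u * exp A"] by simp
    ultimately show ?thesis using e by linarith
  qed
  have "filterlim (\<lambda>t. d * t) at_top at_top" by (rule filterlim_tendsto_pos_mult_at_top[OF tendsto_const d filterlim_ident])
  then have "((\<lambda>t. exp (- (d * t))) \<longlongrightarrow> 0) at_top"
    by (intro filterlim_compose[OF exp_at_bot] filterlim_compose[OF filterlim_uminus_at_bot_at_top])
  then have "((\<lambda>t. K * (C * exp (- (d * t)))) \<longlongrightarrow> K * (C * 0)) at_top" by (intro tendsto_mult_left)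
  then have "((\<lambda>t. K * (C * exp (- (d * t)))) \<longlongrightarrow> 0) at_top" by simp
  then have "\<forall>\<^sub>F t in at_top. K * (C * exp (- (d * t))) < e / 2" by (rule order_tendstoD(2)) (use e in simp)
  moreover have "\<forall>\<^sub>F t in at_top. (0::real) \<le> t" by (rule eventually_ge_at_top)
  ultimately show "\<forall>\<^sub>F t in at_top. dist (\<integral>\<omega>. norm (\<phi> (u * exp (pdmp (\<lambda>_. 0) a 0 t \<omega>)) - 1) \<partial>Q) 0 < e"
  proof eventually_elim
    case (elim t)
    let ?A = "pdmp (\<lambda>_. 0) a 0 t"
    have i: "integrable Q (\<lambda>\<omega>. e / 2 + K * exp (p * ?A \<omega>))"
      by (intro Bochner_Integration.integrable_add integrable_mult_right integrable_exp_pdmp elim) simp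
    have "(\<integral>\<omega>. norm (\<phi> (u * exp (?A \<omega>)) - 1) \<partial>Q) \<le> (\<integral>\<omega>. e / 2 + K * exp (p * ?A \<omega>) \<partial>Q)"
    proof (rule integral_mono')
      fix \<omega>
      show "norm (\<phi> (u * exp (?A \<omega>)) - 1) \<le> e / 2 + K * exp (p * ?A \<omega>)" by (rule bound)
      show "0 \<le> e / 2 + K * exp (p * ?A \<omega>)" using e K by simp
    qed (rule i)
    also have "\<dots> = e / 2 + K * (\<integral>\<omega>. exp (p * ?A \<omega>) \<partial>Q)"
      using integrable_exp_pdmp[OF elim(2)] prob_space by simp
    also have "\<dots> \<le> e / 2 + K * (C * exp (- (d * t)))" using decay[OF elim(2)] K by (intro add_left_mono mult_left_mono) auto
    also have "\<dots> < e" using elim(1) by simp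
    finally have "(\<integral>\<omega>. norm (\<phi> (u * exp (?A \<omega>)) - 1) \<partial>Q) < e" .
    moreover have "0 \<le> (\<integral>\<omega>. norm (\<phi> (u * exp (?A \<omega>)) - 1) \<partial>Q)" by simp
    ultimately show ?case by (simp add: dist_real_def)
  qed
qed

end

section \<open>Identification of the limit law\<close>

context stationary_chain
begin

text \<open>
  The recursions for the accumulated rate and for the variance along a frozen path are those of the
  piecewise linear processes with coefficients \<open>(0, a)\<close> and \<open>(2 a, \<sigma>\<^sup>2)\<close>.
\<close>

lemma conditional_char:
  assumes brownian: "brownian Q' F W"
    and X: "\<And>\<omega> n t. \<omega> \<in> space Q \<Longrightarrow> jump_time n \<omega> \<le> t \<Longrightarrow> t < jump_time (Suc n) \<omega> \<Longrightarrow> X t \<omega> = Z n \<omega>"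
    and Y0: "Y0 \<in> borel_measurable (F 0)"
    and Y: "switching_diffusion Q Q' F X W a \<sigma> Y0 Y"
    and w: "\<omega> \<in> space Q" and t: "0 \<le> t"
  shows "char (distr Q' borel (\<lambda>\<theta>. Y t (\<omega>, \<theta>))) u =
    char (distr Q' borel Y0) (u * exp (pdmp (\<lambda>_. 0) a 0 t \<omega>)) *
    exp (- (u\<^sup>2 * pdmp (\<lambda>i. 2 * a i) (\<lambda>i. (\<sigma> i)\<^sup>2) 0 t \<omega>) / 2)"
proof -
  interpret B: brownian Q' F W by (rule brownian)
  have Ym: "(\<lambda>\<theta>. Y t (\<omega>, \<theta>)) \<in> borel_measurable (F t)" if "0 \<le> t" for t
    using Y w that unfolding switching_diffusion_def by blast
  have sde: "AE \<theta> in Q'. continuous_on {0..} (\<lambda>t. Y t (\<omega>, \<theta>)) \<and> Y 0 (\<omega>, \<theta>) = Y0 \<theta> \<and>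
      (\<forall>t\<ge>0. set_integrable lborel {0..t} (\<lambda>s. a (X s \<omega>) * Y s (\<omega>, \<theta>)) \<and>
        has_step_integral (\<lambda>s. \<sigma> (X s \<omega>)) (\<lambda>s. W s \<theta>) t (Y t (\<omega>, \<theta>) - Y0 \<theta> - (LINT s:{0..t}|lborel. a (X s \<omega>) * Y s (\<omega>, \<theta>))))"
    using Y w unfolding switching_diffusion_def by blast
  have holding: "T n \<omega> = jump_time (Suc n) \<omega> - jump_time n \<omega>" for n by (simp add: jump_time_Suc)
  show ?thesis
    unfolding pdmp_def state_def
    by (rule B.frozen_path_char[where \<tau> = "\<lambda>n. jump_time n \<omega>" and X = "\<lambda>t. X t \<omega>" and z = "\<lambda>n. Z n \<omega>" and Y = "\<lambda>t \<theta>. Y t (\<omega>, \<theta>)"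
          and A = "\<lambda>n. jump_value (\<lambda>_. 0) a 0 n \<omega>" and V = "\<lambda>n. jump_value (\<lambda>i. 2 * a i) (\<lambda>i. (\<sigma> i)\<^sup>2) 0 n \<omega>",
          OF jump_time_0 jump_time_less_Suc[OF w] X[OF w] Ym Y0 sde jump_value.simps(1) _ jump_value.simps(1) _
            jump_count_bounds(1)[OF w t] less_imp_le[OF jump_count_bounds(2)[OF w t]]])
      (simp_all only: jump_value.simps holding)
qed

text \<open>
  Averaging the conditional characteristic function over the switching path and discarding the
  contribution of the initial value. The maximum with \<open>0\<close> does not change the variance; it makes the
  observable bounded on the whole line.
\<close>

lemma limit_char:
  assumes Q': "prob_space Q'" and brownian: "brownian Q' F W"
    and X: "\<And>\<omega> n t. \<omega> \<in> space Q \<Longrightarrow> jump_time n \<omega> \<le> t \<Longrightarrow> t < jump_time (Suc n) \<omega> \<Longrightarrow> X t \<omega> = Z n \<omega>"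
    and Y0: "Y0 \<in> borel_measurable (F 0)"
    and Y: "switching_diffusion Q Q' F X W a \<sigma> Y0 Y"
    and drift: "(\<Sum>i\<in>E. a i * \<mu> i) < 0"
    and \<nu>: "limit_distribution (Q \<Otimes>\<^sub>M Q') Y \<nu>"
  shows "((\<lambda>t. complex_of_real (\<integral>\<omega>. exp (- (u\<^sup>2 * max (pdmp (\<lambda>i. 2 * a i) (\<lambda>i. (\<sigma> i)\<^sup>2) 0 t \<omega>) 0) / 2) \<partial>Q)) \<longlongrightarrow> char \<nu> u) at_top"
proof -
  interpret B: brownian Q' F W by (rule brownian)
  interpret P: pair_prob_space Q Q' ..
  have Ym: "Y t \<in> borel_measurable (Q \<Otimes>\<^sub>M Q')" if "0 \<le> t" for t
    using Y that unfolding switching_diffusion_def by blast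
  have Y0m[measurable]: "Y0 \<in> borel_measurable Q'" by (rule B.measurable_filtration[OF order.refl Y0])
  interpret D0: real_distribution "distr Q' borel Y0" by (rule B.real_distribution_distr) simp
  define \<phi> where "\<phi> = char (distr Q' borel Y0)"
  have \<phi>: "isCont \<phi> 0" "\<phi> 0 = 1" "norm (\<phi> x) \<le> 1" for x
    unfolding \<phi>_def using D0.isCont_char D0.char_zero D0.cmod_char_le_1 by auto
  have \<phi>_meas[measurable]: "\<phi> \<in> borel_measurable borel" unfolding \<phi>_def by (rule D0.char_measurable)
  define A where "A = pdmp (\<lambda>_. 0) a 0"
  define V where "V = pdmp (\<lambda>i. 2 * a i) (\<lambda>i. (\<sigma> i)\<^sup>2) 0"
  have [measurable]: "A t \<in> borel_measurable Q" "V t \<in> borel_measurable Q" for t by (simp_all add: A_def V_def)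
  define g where "g t \<omega> = exp (- (u\<^sup>2 * max (V t \<omega>) 0) / 2)" for t \<omega>
  have g: "0 \<le> g t \<omega>" "g t \<omega> \<le> 1" for t \<omega> by (simp_all add: g_def)
  have [measurable]: "g t \<in> borel_measurable Q" for t unfolding g_def[abs_def] by measurable
  have gi: "integrable Q (\<lambda>\<omega>. complex_of_real (g t \<omega>))" for t
    by (rule integrable_const_bound[of _ 1]) (use g in auto)
  have fubini: "char (distr (Q \<Otimes>\<^sub>M Q') borel (Y t)) u = (\<integral>\<omega>. \<phi> (u * exp (A t \<omega>)) * g t \<omega> \<partial>Q)" if t: "0 \<le> t" for t
  proof -
    have [measurable]: "Y t \<in> borel_measurable (Q \<Otimes>\<^sub>M Q')" by (rule Ym[OF t])
    have "char (distr (Q \<Otimes>\<^sub>M Q') borel (Y t)) u = (\<integral>x. iexp (u * Y t x) \<partial>(Q \<Otimes>\<^sub>M Q'))"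
      by (simp add: char_def integral_distr)
    also have "\<dots> = (\<integral>\<omega>. (\<integral>\<theta>. iexp (u * Y t (\<omega>, \<theta>)) \<partial>Q') \<partial>Q)"
      by (rule P.integral_fst'[symmetric], rule P.integrable_const_bound[of _ 1]) auto
    also have "\<dots> = (\<integral>\<omega>. \<phi> (u * exp (A t \<omega>)) * g t \<omega> \<partial>Q)"
    proof (rule Bochner_Integration.integral_cong[OF refl])
      fix \<omega> assume w: "\<omega> \<in> space Q"
      have "0 \<le> V t \<omega>" unfolding V_def by (rule pdmp_nonneg[OF w _ _ t]) auto
      then have g_eq: "g t \<omega> = exp (- (u\<^sup>2 * V t \<omega>) / 2)" by (simp add: g_def max_absorb1)
      have "(\<integral>\<theta>. iexp (u * Y t (\<omega>, \<theta>)) \<partial>Q') = char (distr Q' borel (\<lambda>\<theta>. Y t (\<omega>, \<theta>))) u"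
        by (rule B.char_distr[symmetric]) (use w in measurable)
      also have "\<dots> = \<phi> (u * exp (A t \<omega>)) * g t \<omega>"
        unfolding \<phi>_def A_def g_eq V_def by (rule conditional_char[OF brownian X Y0 Y w t])
      finally show "(\<integral>\<theta>. iexp (u * Y t (\<omega>, \<theta>)) \<partial>Q') = \<phi> (u * exp (A t \<omega>)) * g t \<omega>" .
    qed
    finally show ?thesis .
  qed
  have law: "((\<lambda>t. char (distr (Q \<Otimes>\<^sub>M Q') borel (Y t)) u) \<longlongrightarrow> char \<nu> u) at_top"
  proof (rule tendsto_at_topI_sequentially)
    fix s :: "nat \<Rightarrow> real" assume s: "filterlim s at_top sequentially"
    define s' where "s' n = max 0 (s n)" for n
    have ev: "\<forall>\<^sub>F n in sequentially. s' n = s n"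
      using filterlim_at_top[THEN iffD1, OF s, rule_format, of 0] by eventually_elim (simp add: s'_def)
    have s': "\<forall>n. 0 \<le> s' n" by (simp add: s'_def)
    have "filterlim s' at_top sequentially" using s ev by (subst filterlim_cong[OF refl refl ev])
    then have conv: "weak_conv_m (\<lambda>n. distr (Q \<Otimes>\<^sub>M Q') borel (Y (s' n))) \<nu>" and rd: "real_distribution \<nu>"
      using \<nu> s' unfolding limit_distribution_def by blast+
    have "(\<lambda>n. char (distr (Q \<Otimes>\<^sub>M Q') borel (Y (s' n))) u) \<longlonglongrightarrow> char \<nu> u"
      by (rule levy_continuity1[OF _ rd conv], rule P.real_distribution_distr) (simp add: Ym s')
    moreover have "\<forall>\<^sub>F n in sequentially. char (distr (Q \<Otimes>\<^sub>M Q') borel (Y (s' n))) u = char (distr (Q \<Otimes>\<^sub>M Q') borel (Y (s n))) u"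
      using ev by eventually_elim simp
    ultimately show "(\<lambda>n. char (distr (Q \<Otimes>\<^sub>M Q') borel (Y (s n))) u) \<longlonglongrightarrow> char \<nu> u" by (rule Lim_transform_eventually)
  qed
  have close: "((\<lambda>t. \<integral>\<omega>. norm (\<phi> (u * exp (A t \<omega>)) - 1) \<partial>Q) \<longlongrightarrow> 0) at_top"
    unfolding A_def by (rule contracted_initial_value_vanishes[OF drift \<phi> \<phi>_meas])
  have "((\<lambda>t. char (distr (Q \<Otimes>\<^sub>M Q') borel (Y t)) u - (\<integral>\<omega>. complex_of_real (g t \<omega>) \<partial>Q)) \<longlongrightarrow> 0) at_top"
  proof (rule Lim_null_comparison[OF _ close])
    show "\<forall>\<^sub>F t in at_top. norm (char (distr (Q \<Otimes>\<^sub>M Q') borel (Y t)) u - (\<integral>\<omega>. complex_of_real (g t \<omega>) \<partial>Q)) \<le>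
        (\<integral>\<omega>. norm (\<phi> (u * exp (A t \<omega>)) - 1) \<partial>Q)"
      using eventually_ge_at_top[of "0::real"]
    proof eventually_elim
      case (elim t)
      have \<phi>i: "integrable Q (\<lambda>\<omega>. \<phi> (u * exp (A t \<omega>)))" by (rule integrable_const_bound[of _ 1]) (use \<phi> in auto)
      have fi: "integrable Q (\<lambda>\<omega>. \<phi> (u * exp (A t \<omega>)) * complex_of_real (g t \<omega>))"
        by (rule integrable_const_bound[of _ 1]) (use \<phi>(3) g in \<open>auto simp: norm_mult intro!: mult_le_one\<close>)
      have "char (distr (Q \<Otimes>\<^sub>M Q') borel (Y t)) u - (\<integral>\<omega>. complex_of_real (g t \<omega>) \<partial>Q) =
          (\<integral>\<omega>. \<phi> (u * exp (A t \<omega>)) * complex_of_real (g t \<omega>) - complex_of_real (g t \<omega>) \<partial>Q)"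
        unfolding fubini[OF elim] by (rule Bochner_Integration.integral_diff[OF fi gi, symmetric])
      also have "norm \<dots> \<le> (\<integral>\<omega>. norm (\<phi> (u * exp (A t \<omega>)) - 1) \<partial>Q)"
      proof (rule order.trans[OF integral_norm_bound], rule integral_mono)
        show "integrable Q (\<lambda>\<omega>. norm (\<phi> (u * exp (A t \<omega>)) * complex_of_real (g t \<omega>) - complex_of_real (g t \<omega>)))"
          by (intro integrable_norm Bochner_Integration.integrable_diff fi gi)
        show "integrable Q (\<lambda>\<omega>. norm (\<phi> (u * exp (A t \<omega>)) - 1))"
          by (intro integrable_norm Bochner_Integration.integrable_diff \<phi>i) simp
        fix \<omega>
        have "\<phi> (u * exp (A t \<omega>)) * complex_of_real (g t \<omega>) - complex_of_real (g t \<omega>) = (\<phi> (u * exp (A t \<omega>)) - 1) * complex_of_real (g t \<omega>)"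
          by (simp add: left_diff_distrib)
        then have "norm (\<phi> (u * exp (A t \<omega>)) * complex_of_real (g t \<omega>) - complex_of_real (g t \<omega>)) = norm (\<phi> (u * exp (A t \<omega>)) - 1) * g t \<omega>"
          using g(1) by (simp add: norm_mult)
        also have "\<dots> \<le> norm (\<phi> (u * exp (A t \<omega>)) - 1) * 1" by (intro mult_left_mono g(2)) simp
        finally show "norm (\<phi> (u * exp (A t \<omega>)) * complex_of_real (g t \<omega>) - complex_of_real (g t \<omega>)) \<le> norm (\<phi> (u * exp (A t \<omega>)) - 1)" by simp
      qed
      finally show ?case .
    qed
  qed
  from tendsto_diff[OF law this] have "((\<lambda>t. \<integral>\<omega>. complex_of_real (g t \<omega>) \<partial>Q) \<longlongrightarrow> char \<nu> u) at_top" by simp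
  then show ?thesis unfolding g_def V_def integral_complex_of_real .
qed

end

text \<open>
  A law with this characteristic function is that of a standard Gaussian variable multiplied by
  the square root of an independent random variance.
\<close>

lemma gaussian_mixture_tails:
  assumes MT: "real_distribution MT" and \<nu>: "real_distribution \<nu>"
    and char: "\<And>u. char \<nu> u = complex_of_real (\<integral>v. exp (- (u\<^sup>2 * max v 0) / 2) \<partial>MT)" and t: "0 < t"
  shows "measure \<nu> {t<..} = (\<integral>v. gaussian_kernel (v / t\<^sup>2) \<partial>MT)"
    and "measure \<nu> {..<- t} = (\<integral>v. gaussian_kernel (v / t\<^sup>2) \<partial>MT)"
proof -
  interpret MT: real_distribution MT by (rule MT)
  interpret \<nu>: real_distribution \<nu> by (rule \<nu>)
  interpret N: prob_space std_normal_distribution by (rule prob_space_std_normal)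
  let ?N = "std_normal_distribution"
  interpret P: pair_prob_space MT ?N ..
  define S where "S x = sqrt (max (fst x) 0) * snd x" for x :: "real \<times> real"
  have sets: "sets (MT \<Otimes>\<^sub>M ?N) = sets (borel \<Otimes>\<^sub>M borel)" by (intro sets_pair_measure_cong) auto
  have "S \<in> borel_measurable (borel \<Otimes>\<^sub>M borel)" unfolding S_def[abs_def] by measurable
  then have S[measurable]: "S \<in> borel_measurable (MT \<Otimes>\<^sub>M ?N)" using measurable_cong_sets[OF sets refl] by blast
  interpret D: real_distribution "distr (MT \<Otimes>\<^sub>M ?N) borel S" by (rule P.real_distribution_distr) simp
  have "char (distr (MT \<Otimes>\<^sub>M ?N) borel S) u = char \<nu> u" for u
  proof -
    have "char (distr (MT \<Otimes>\<^sub>M ?N) borel S) u = (\<integral>x. iexp (u * S x) \<partial>(MT \<Otimes>\<^sub>M ?N))"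
      by (simp add: char_def integral_distr)
    also have "\<dots> = (\<integral>v. (\<integral>z. iexp (u * S (v, z)) \<partial>?N) \<partial>MT)"
      by (rule P.integral_fst'[symmetric], rule P.integrable_const_bound[of _ 1]) auto
    also have "(\<lambda>v. \<integral>z. iexp (u * S (v, z)) \<partial>?N) = (\<lambda>v. complex_of_real (exp (- (u\<^sup>2 * max v 0) / 2)))"
    proof (rule ext)
      fix v :: real
      have "(\<integral>z. iexp (u * S (v, z)) \<partial>?N) = char ?N (u * sqrt (max v 0))" by (simp add: char_def S_def mult.assoc)
      also have "\<dots> = complex_of_real (exp (- (u\<^sup>2 * max v 0) / 2))"
        unfolding char_std_normal_distribution by (simp add: power_mult_distrib)
      finally show "(\<integral>z. iexp (u * S (v, z)) \<partial>?N) = complex_of_real (exp (- (u\<^sup>2 * max v 0) / 2))" .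
    qed
    finally show ?thesis unfolding char integral_complex_of_real .
  qed
  then have \<nu>_eq: "\<nu> = distr (MT \<Otimes>\<^sub>M ?N) borel S"
    by (intro Levy_uniqueness[OF \<nu> D.real_distribution_axioms] ext) simp
  have right: "measure \<nu> {t<..} = (\<integral>v. gaussian_kernel (v / t\<^sup>2) \<partial>MT)"
  proof -
    have "measure \<nu> {t<..} = (\<integral>x. indicator {t<..} (S x) \<partial>(MT \<Otimes>\<^sub>M ?N))"
    proof -
      have "measure \<nu> {t<..} = (\<integral>y. indicator {t<..} y \<partial>distr (MT \<Otimes>\<^sub>M ?N) borel S)" unfolding \<nu>_eq[symmetric] by simp
      also have "\<dots> = (\<integral>x. indicator {t<..} (S x) \<partial>(MT \<Otimes>\<^sub>M ?N))" by (rule integral_distr) auto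
      finally show ?thesis .
    qed
    also have "\<dots> = (\<integral>v. (\<integral>z. indicator {t<..} (S (v, z)) \<partial>?N) \<partial>MT)"
      by (rule P.integral_fst'[symmetric], rule P.integrable_const_bound[of _ 1]) (auto simp: indicator_def)
    also have "(\<lambda>v. \<integral>z. indicator {t<..} (S (v, z)) \<partial>?N) = (\<lambda>v. gaussian_kernel (v / t\<^sup>2))"
    proof (rule ext)
      fix v :: real
      show "(\<integral>z. indicator {t<..} (S (v, z)) \<partial>?N) = gaussian_kernel (v / t\<^sup>2)"
      proof (cases "0 < v")
        case True
        have "1 / sqrt (v / t\<^sup>2) = t / sqrt v" using t True by (simp add: real_sqrt_divide)
        moreover have "indicator {t<..} (S (v, z)) = (indicator {t / sqrt v<..} z :: real)" for z
          using True by (simp add: S_def indicator_def pos_divide_less_eq mult.commute)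
        moreover have "\<not> v / t\<^sup>2 \<le> 0" using True t by (simp add: not_le)
        ultimately show ?thesis by (simp add: gaussian_kernel_def gaussian_tail_def del: divide_le_0_iff)
      next
        case False
        then have "v / t\<^sup>2 \<le> 0" using t by (simp add: divide_le_0_iff)
        moreover have "indicator {t<..} (S (v, z)) = (0 :: real)" for z using False t by (simp add: S_def max_absorb2)
        ultimately show ?thesis by (simp add: gaussian_kernel_def)
      qed
    qed
    finally show ?thesis .
  qed
  then show "measure \<nu> {t<..} = (\<integral>v. gaussian_kernel (v / t\<^sup>2) \<partial>MT)" .
  \<comment> \<open>the characteristic function is even, so the law is symmetric\<close>
  interpret R: real_distribution "distr \<nu> borel uminus" by (rule \<nu>.real_distribution_distr) simp
  have "char (distr \<nu> borel uminus) u = char \<nu> u" for u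
  proof -
    have "char (distr \<nu> borel uminus) u = char \<nu> (- u)" by (simp add: char_def integral_distr)
    then show ?thesis by (simp add: char)
  qed
  then have "distr \<nu> borel uminus = \<nu>" by (intro Levy_uniqueness[OF R.real_distribution_axioms \<nu>] ext) simp
  then have "measure \<nu> {..<- t} = measure (distr \<nu> borel uminus) {..<- t}" by simp
  also have "\<dots> = measure \<nu> {t<..}"
    by (subst measure_distr) (auto intro!: arg_cong[where f = "measure \<nu>"])
  finally show "measure \<nu> {..<- t} = (\<integral>v. gaussian_kernel (v / t\<^sup>2) \<partial>MT)" unfolding right .
qed

text \<open>
  No power of \<open>q\<close> leads out of a set of states that is closed under single jumps.
\<close>

lemma irreducible_generator:
  assumes fin: "finite E" "E \<noteq> {}" and lam: "\<And>i. i \<in> E \<Longrightarrow> 0 < lam i"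
    and q: "stochastic_kernel E q" "irreducible_kernel E q"
  shows "irreducible_metzler E (generator lam q)"
  unfolding irreducible_metzler_def
proof (intro conjI allI impI ballI)
  show "finite E" "E \<noteq> {}" by fact+
  have q0: "0 \<le> q i j" if "i \<in> E" "j \<in> E" for i j using q(1) that by (simp add: stochastic_kernel_def)
  show "0 \<le> generator lam q i j" if "i \<in> E" "j \<in> E" "i \<noteq> j" for i j
    using lam[OF that(1)] q0[OF that(1,2)] that(3) by (simp add: generator_def)
  fix I assume I: "I \<subseteq> E" "I \<noteq> {}" "\<forall>i\<in>I. \<forall>j\<in>E - I. generator lam q i j = 0"
  have zero: "kernel_power E q n i j = 0" if "i \<in> I" "j \<in> E - I" for n i j
    using that(1)
  proof (induction n arbitrary: i)
    case 0
    then have "i \<noteq> j" using that(2) by blast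
    then show ?case by simp
  next
    case (Suc n)
    have "q i k * kernel_power E q n k j = 0" if k: "k \<in> E" for k
    proof (cases "k \<in> I")
      case True
      then show ?thesis using Suc.IH by simp
    next
      case False
      have "generator lam q i k = 0" using I(3) Suc.prems k False by blast
      moreover have "i \<noteq> k" "i \<in> E" using Suc.prems False I(1) by blast+
      ultimately show ?thesis using lam[of i] by (simp add: generator_def)
    qed
    then show ?case by (simp only: kernel_power.simps sum.neutral_const cong: sum.cong)
  qed
  have "E \<subseteq> I"
  proof
    fix j assume j: "j \<in> E"
    obtain i where i: "i \<in> I" "i \<in> E" using I(1,2) by blast
    obtain n where n: "0 < kernel_power E q n i j" using q(2) i(2) j unfolding irreducible_kernel_def by blast
    show "j \<in> I"
    proof (rule ccontr)
      assume "j \<notin> I"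
      then show False using zero[OF i(1), of j n] j n by simp
    qed
  qed
  then show "I = E" using I(1) by (intro subset_antisym)
qed

section \<open>The tails of the stationary distribution\<close>

theorem theorem2:
  fixes N :: nat
    and Q :: "'a measure" and Q' :: "'b measure"
    and F :: "real \<Rightarrow> 'b measure"
    and lam a \<sigma> \<mu> :: "nat \<Rightarrow> real"
    and q :: "nat \<Rightarrow> nat \<Rightarrow> real"
    and X :: "real \<Rightarrow> 'a \<Rightarrow> nat"
    and W :: "real \<Rightarrow> 'b \<Rightarrow> real"
    and Y0 :: "'b \<Rightarrow> real"
    and Y :: "real \<Rightarrow> 'a \<times> 'b \<Rightarrow> real"
    and \<nu> :: "real measure"
  assumes "N > 1"
    and "prob_space Q" and "prob_space Q'"
    and "\<And>i. i \<in> {1..N} \<Longrightarrow> lam i > 0"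
    and "stochastic_kernel {1..N} q"
    and "irreducible_kernel {1..N} q"
    and "\<And>i. i \<in> {1..N} \<Longrightarrow> q i i = 0"
    and "markov_jump_process Q {1..N} lam q X"
    and "invariant_probability {1..N} lam q \<mu>"
    and "stationary_with_law Q {1..N} X \<mu>"
    and "filtration_on Q' F"
    and "standard_brownian_motion Q' F W"
    and "Y0 \<in> borel_measurable (F 0)"
    and "switching_diffusion Q Q' F X W a \<sigma> Y0 Y"
    and "(\<Sum>i\<in>{1..N}. a i * \<mu> i) < 0"
    and "limit_distribution (Q \<Otimes>\<^sub>M Q') Y \<nu>"
    and "\<exists>i\<in>{1..N}. \<sigma> i \<noteq> 0"
    and "\<exists>i\<in>{1..N}. a i > 0"
  shows "\<exists>\<kappa> L :: real. \<kappa> > 0 \<and> L > 0 \<and>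
    ((\<lambda>t. t powr \<kappa> * measure \<nu> {t<..}) \<longlongrightarrow> L) at_top \<and>
    ((\<lambda>t. t powr \<kappa> * measure \<nu> {..<-t}) \<longlongrightarrow> L) at_top"
proof -
  define E where "E = {1..N}"
  have finE: "finite E" and neE: "E \<noteq> {}" using assms(1) by (auto simp: E_def)
  obtain Z :: "nat \<Rightarrow> 'a \<Rightarrow> nat" and T :: "nat \<Rightarrow> 'a \<Rightarrow> real" where
    chain: "(\<forall>n. Z n \<in> measurable Q (count_space E)) \<and> (\<forall>n. T n \<in> borel_measurable Q) \<and>
      (\<forall>\<omega>\<in>space Q. (\<forall>n. 0 < T n \<omega>) \<and> filterlim (\<lambda>n. \<Sum>k<n. T k \<omega>) at_top sequentially \<and>
        (\<forall>n t. (\<Sum>k<n. T k \<omega>) \<le> t \<and> t < (\<Sum>k<Suc n. T k \<omega>) \<longrightarrow> X t \<omega> = Z n \<omega>)) \<and>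
      (\<forall>n (z :: nat \<Rightarrow> nat) (s :: nat \<Rightarrow> real). (\<forall>k\<le>n. z k \<in> E \<and> 0 \<le> s k) \<longrightarrow>
        measure Q {\<omega>\<in>space Q. \<forall>k\<le>n. Z k \<omega> = z k \<and> s k < T k \<omega>} =
        measure Q {\<omega>\<in>space Q. Z 0 \<omega> = z 0} * (\<Prod>k<n. q (z k) (z (Suc k))) * (\<Prod>k\<le>n. exp (- lam (z k) * s k)))"
    using assms(8) unfolding markov_jump_process_def E_def[symmetric] by (elim exE) (rule that)
  note Z = spec[OF conjunct1[OF chain]] and T = spec[OF conjunct1[OF conjunct2[OF chain]]]
    and path = bspec[OF conjunct1[OF conjunct2[OF conjunct2[OF chain]]]]
    and joint = mp[OF spec[OF spec[OF spec[OF conjunct2[OF conjunct2[OF conjunct2[OF chain]]]]]]]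
  have jump_chain: "jump_chain Q E lam q Z T"
  proof (rule jump_chain.intro[OF assms(2)], rule jump_chain_axioms.intro)
    show "0 < lam i" if "i \<in> E" for i using assms(4) that unfolding E_def .
    show "0 \<le> q i j" if "i \<in> E" "j \<in> E" for i j using assms(5) that unfolding stochastic_kernel_def E_def by blast
    show "(\<Sum>j\<in>E. q i j) = 1" if "i \<in> E" for i using assms(5) that unfolding stochastic_kernel_def E_def by blast
    show "0 < T n \<omega>" if "\<omega> \<in> space Q" for n \<omega> using path[OF that] by blast
    show "filterlim (\<lambda>n. \<Sum>k<n. T k \<omega>) at_top sequentially" if "\<omega> \<in> space Q" for \<omega> using path[OF that] by blast
    show "finite E" by (rule finE)
    show "Z n \<in> measurable Q (count_space E)" for n by (rule Z)
    show "T n \<in> borel_measurable Q" for n by (rule T)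
    show "measure Q {\<omega>\<in>space Q. \<forall>k\<le>n. Z k \<omega> = z k \<and> s k < T k \<omega>} =
        measure Q {\<omega>\<in>space Q. Z 0 \<omega> = z 0} * (\<Prod>k<n. q (z k) (z (Suc k))) * (\<Prod>k\<le>n. exp (- lam (z k) * s k))"
      if "\<forall>k\<le>n. z k \<in> E \<and> 0 \<le> s k" for n z s by (rule joint[OF that])
  qed
  interpret J: jump_chain Q E lam q Z T by (rule jump_chain)
  have X: "X t \<omega> = Z n \<omega>" if "\<omega> \<in> space Q" "J.jump_time n \<omega> \<le> t" "t < J.jump_time (Suc n) \<omega>" for \<omega> n t
    using path[OF that(1)] that(2,3) unfolding J.jump_time_def by blast
  have state: "J.state t \<omega> = X t \<omega>" if "\<omega> \<in> space Q" "0 \<le> t" for t \<omega>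
    unfolding J.state_def using X[OF that(1) J.jump_count_bounds[OF that]] by simp
  interpret S: stationary_chain Q E lam q Z T \<mu>
  proof (rule stationary_chain.intro[OF jump_chain], rule stationary_chain_axioms.intro)
    show "irreducible_metzler E (generator lam q)"
      by (rule irreducible_generator[OF finE neE]) (use assms(4,5,6) in \<open>simp_all add: E_def\<close>)
    show "0 \<le> \<mu> i" if "i \<in> E" for i using assms(9) that unfolding invariant_probability_def E_def by blast
    show "(\<Sum>i\<in>E. \<mu> i) = 1" using assms(9) unfolding invariant_probability_def E_def by blast
    show "(\<Sum>i\<in>E. \<mu> i * generator lam q i j) = 0" if "j \<in> E" for j
      using assms(9) that unfolding invariant_probability_def E_def by blast
    fix t :: real and i assume t: "0 \<le> t" and i: "i \<in> E"
    have "{\<omega> \<in> space Q. J.state t \<omega> = i} = {\<omega> \<in> space Q. X t \<omega> = i}" using state[OF _ t] by auto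
    then show "measure Q {\<omega> \<in> space Q. J.state t \<omega> = i} = \<mu> i"
      using assms(10) t i unfolding stationary_with_law_def E_def by simp
  qed
  have brownian: "brownian Q' F W"
    by (rule brownian.intro[OF assms(3)], rule brownian_axioms.intro) fact+
  define b where "b i = 2 * a i" for i
  define c where "c i = (\<sigma> i)\<^sup>2" for i
  have drift: "(\<Sum>i\<in>E. a i * \<mu> i) < 0" using assms(15) by (simp add: E_def)
  have "(\<Sum>i\<in>E. b i * \<mu> i) = 2 * (\<Sum>i\<in>E. a i * \<mu> i)" by (simp add: b_def sum_distrib_left mult.assoc)
  then have drift': "(\<Sum>i\<in>E. b i * \<mu> i) < 0" using drift by simp
  have c0: "0 \<le> c i" for i by (simp add: c_def)
  have pos: "\<exists>i\<in>E. 0 < b i" "\<exists>i\<in>E. 0 < c i" using assms(17,18) by (simp_all add: b_def c_def E_def)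
  obtain M MT where mixed: "stationary_law E (generator lam q) b \<mu> c M \<and> real_distribution MT \<and>
    (\<forall>f B. (\<forall>v. isCont f v) \<longrightarrow> (\<forall>v. \<bar>f v\<bar> \<le> B) \<longrightarrow> (\<integral>v. f v \<partial>MT) = (\<Sum>i\<in>E. \<mu> i * (\<integral>v. f v \<partial>M i))) \<and>
    (\<forall>(f :: real \<Rightarrow> real) B l. (\<forall>v. isCont f v) \<longrightarrow> (\<forall>v. \<bar>f v\<bar> \<le> B) \<longrightarrow>
      ((\<lambda>t. \<integral>\<omega>. f (J.pdmp b c 0 t \<omega>) \<partial>Q) \<longlongrightarrow> l) at_top \<longrightarrow> (\<integral>v. f v \<partial>MT) = l)"
    using S.stationary_law_exists[OF drift' c0 pos] by (elim exE) (rule that)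
  note law = conjunct1[OF mixed] and MT = conjunct1[OF conjunct2[OF mixed]]
  have mixture: "(\<integral>v. f v \<partial>MT) = (\<Sum>i\<in>E. \<mu> i * (\<integral>v. f v \<partial>M i))"
    if "\<And>v. isCont f v" "\<And>v. \<bar>f v\<bar> \<le> B" for f B
    by (rule mp[OF mp[OF spec[OF spec[OF conjunct1[OF conjunct2[OF conjunct2[OF mixed]]]]] allI[OF that(1)]] allI[OF that(2)]])
  have limit: "(\<integral>v. f v \<partial>MT) = l"
    if "\<And>v. isCont f v" "\<And>v. \<bar>f v\<bar> \<le> B" "((\<lambda>t. \<integral>\<omega>. f (J.pdmp b c 0 t \<omega>) \<partial>Q) \<longlongrightarrow> l) at_top"
    for f :: "real \<Rightarrow> real" and B l
    by (rule mp[OF mp[OF mp[OF spec[OF spec[OF spec[OF conjunct2[OF conjunct2[OF conjunct2[OF mixed]]]]]] allI[OF that(1)]] allI[OF that(2)]] that(3)])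
  interpret SL: stationary_law E "generator lam q" b \<mu> c M by (rule law)
  have \<nu>: "real_distribution \<nu>" using assms(16) by (simp add: limit_distribution_def)
  have char: "char \<nu> u = complex_of_real (\<integral>v. exp (- (u\<^sup>2 * max v 0) / 2) \<partial>MT)" for u
  proof -
    let ?f = "\<lambda>v::real. exp (- (u\<^sup>2 * max v 0) / 2)"
    have L: "((\<lambda>t. complex_of_real (\<integral>\<omega>. ?f (J.pdmp b c 0 t \<omega>) \<partial>Q)) \<longlongrightarrow> char \<nu> u) at_top"
      unfolding b_def[abs_def] c_def[abs_def]
      by (rule S.limit_char[OF assms(3) brownian X assms(13,14) drift assms(16)])
    from tendsto_Re[OF this] have R: "((\<lambda>t. \<integral>\<omega>. ?f (J.pdmp b c 0 t \<omega>) \<partial>Q) \<longlongrightarrow> Re (char \<nu> u)) at_top" by simp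
    have "(\<integral>v. ?f v \<partial>MT) = Re (char \<nu> u)"
      by (rule limit[of ?f 1, OF _ _ R]) (auto intro!: continuous_intros)
    moreover have "complex_of_real (Re (char \<nu> u)) = char \<nu> u"
      by (rule tendsto_unique[OF trivial_limit_at_top_linorder tendsto_of_real[OF R] L])
    ultimately show ?thesis by simp
  qed
  obtain \<kappa> L where \<kappa>: "0 < \<kappa>" and L: "0 < L"
    and tail: "((\<lambda>s. exp (\<kappa> * s) * (\<Sum>i\<in>E. SL.avg gaussian_kernel i s)) \<longlongrightarrow> L) at_top"
    using SL.gaussian_average_tail by blast
  have average: "(\<integral>v. gaussian_kernel (v / t\<^sup>2) \<partial>MT) = (\<Sum>i\<in>E. SL.avg gaussian_kernel i (2 * ln t))" if t: "0 < t" for t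
  proof -
    have "exp (- (2 * ln t)) = 1 / t\<^sup>2" using t by (simp add: exp_minus exp_double inverse_eq_divide)
    moreover have "(\<integral>v. gaussian_kernel (v / t\<^sup>2) \<partial>MT) = (\<Sum>i\<in>E. \<mu> i * (\<integral>v. gaussian_kernel (v / t\<^sup>2) \<partial>M i))"
    proof (rule mixture)
      show "isCont (\<lambda>v. gaussian_kernel (v / t\<^sup>2)) v" for v
        by (rule isCont_o2[OF _ DERIV_isCont[OF gaussian_kernel_deriv]]) (use t in \<open>auto intro!: continuous_intros\<close>)
      show "\<bar>gaussian_kernel (v / t\<^sup>2)\<bar> \<le> 1" for v using gaussian_kernel_bounds by simp
    qed
    ultimately show ?thesis by (simp add: SL.avg_def)
  qed
  have "filterlim (\<lambda>t::real. 2 * ln t) at_top at_top"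
    by (rule filterlim_tendsto_pos_mult_at_top[OF tendsto_const _ ln_at_top]) simp
  from filterlim_compose[OF tail this]
  have lim: "((\<lambda>t. exp (\<kappa> * (2 * ln t)) * (\<Sum>i\<in>E. SL.avg gaussian_kernel i (2 * ln t))) \<longlongrightarrow> L) at_top" .
  have ev: "\<forall>\<^sub>F t in at_top. (0::real) < t" by (rule eventually_gt_at_top)
  have scale: "exp (\<kappa> * (2 * ln t)) = t powr (2 * \<kappa>)" if "0 < t" for t using that by (simp add: powr_def)
  have "((\<lambda>t. t powr (2 * \<kappa>) * measure \<nu> {t<..}) \<longlongrightarrow> L) at_top"
  proof (rule Lim_transform_eventually[OF lim])
    show "\<forall>\<^sub>F t in at_top. exp (\<kappa> * (2 * ln t)) * (\<Sum>i\<in>E. SL.avg gaussian_kernel i (2 * ln t)) = t powr (2 * \<kappa>) * measure \<nu> {t<..}"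
      using ev by eventually_elim (simp only: gaussian_mixture_tails[OF MT \<nu> char] average scale)
  qed
  moreover have "((\<lambda>t. t powr (2 * \<kappa>) * measure \<nu> {..<-t}) \<longlongrightarrow> L) at_top"
  proof (rule Lim_transform_eventually[OF lim])
    show "\<forall>\<^sub>F t in at_top. exp (\<kappa> * (2 * ln t)) * (\<Sum>i\<in>E. SL.avg gaussian_kernel i (2 * ln t)) = t powr (2 * \<kappa>) * measure \<nu> {..<-t}"
      using ev by eventually_elim (simp only: gaussian_mixture_tails[OF MT \<nu> char] average scale)
  qed
  moreover have "0 < 2 * \<kappa>" using \<kappa> by simp
  ultimately show ?thesis using L by blast
qed

end
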